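(* Let $D$ be the unit disc, $K\subset D^2$ a compact set with $0\in K$, and $u$ a plurisubharmonic function on $D^2$ that is bounded on $D^2\setminus K$ (i.e. $u\in\mathcal{PSH}\cap L^\infty(D^2\setminus K)$). If $u(|z|,w)=u(z,w)$ for all $(z,w)\in D^2$ and $\nu(u,0)=0$, then $(dd^cu)^2(\{0\})=0$. *)

theory Defs
  imports "HOL-Analysis.Analysis"
begin

type_synonym c2 = "complex \<times> complex"

definition bidisc :: "c2 set" where
  "bidisc = ball (0::complex) 1 \<times> ball (0::complex) 1"

definition cmul :: "complex \<Rightarrow> c2 \<Rightarrow> c2" where
  "cmul c p = (c * fst p, c * snd p)"

definition usc_on :: "c2 set \<Rightarrow> (c2 \<Rightarrow> ereal) \<Rightarrow> bool" where
  "usc_on S u \<longleftrightarrow> (\<forall>x\<in>S. \<forall>c. u x < c \<longrightarrow> (\<forall>\<^sub>F y in at x within S. u y < c))"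

text \<open>Mean value over the unit circle of g (an extended-real valued function bounded
  above on the circle): (1/2pi) * integral of g(e^{i theta}) d theta, with values in [-inf, inf).\<close>
definition circ_mean :: "(complex \<Rightarrow> ereal) \<Rightarrow> ereal" where
  "circ_mean g = ereal (1 / (2 * pi)) *
     (enn2ereal (\<integral>\<^sup>+ \<theta>\<in>{0..2*pi}. e2ennreal (g (cis \<theta>)) \<partial>lborel)
      - enn2ereal (\<integral>\<^sup>+ \<theta>\<in>{0..2*pi}. e2ennreal (- g (cis \<theta>)) \<partial>lborel))"

definition psh :: "c2 set \<Rightarrow> (c2 \<Rightarrow> ereal) \<Rightarrow> bool" where
  "psh \<Omega> u \<longleftrightarrow> open \<Omega> \<and> usc_on \<Omega> u \<and> (\<forall>x\<in>\<Omega>. u x < \<infinity>) \<and> (\<exists>x\<in>\<Omega>. u x \<noteq> -\<infinity>) \<and>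
     (\<forall>a b. (\<forall>\<zeta>. cmod \<zeta> \<le> 1 \<longrightarrow> a + cmul \<zeta> b \<in> \<Omega>) \<longrightarrow>
        u a \<le> circ_mean (\<lambda>\<zeta>. u (a + cmul \<zeta> b)))"

definition lelong :: "(c2 \<Rightarrow> ereal) \<Rightarrow> c2 \<Rightarrow> ereal" where
  "lelong u a = Liminf (at a) (\<lambda>p. u p / ereal (ln (norm (p - a))))"

definition pd :: "c2 \<Rightarrow> (c2 \<Rightarrow> real) \<Rightarrow> c2 \<Rightarrow> real" where
  "pd e f x = deriv (\<lambda>t. f (x + t *\<^sub>R e)) 0"

definition dx1 :: c2 where "dx1 = (1, 0)"
definition dy1 :: c2 where "dy1 = (\<i>, 0)"
definition dx2 :: c2 where "dx2 = (0, 1)"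
definition dy2 :: c2 where "dy2 = (0, \<i>)"

text \<open>Density (w.r.t. Lebesgue measure on C^2 = R^4) of (dd^c f)^2 for f of class C^2,
  with dd^c = (i/pi) d d-bar: (dd^c f)^2 = (8/pi^2) det(d^2 f/dz_j d conj(z_k)) dV.\<close>
definition MA_density :: "(c2 \<Rightarrow> real) \<Rightarrow> c2 \<Rightarrow> real" where
  "MA_density f x =
     (let h11 = (pd dx1 (pd dx1 f) x + pd dy1 (pd dy1 f) x) / 4;
          h22 = (pd dx2 (pd dx2 f) x + pd dy2 (pd dy2 f) x) / 4;
          re12 = (pd dx1 (pd dx2 f) x + pd dy1 (pd dy2 f) x) / 4;
          im12 = (pd dx1 (pd dy2 f) x - pd dy1 (pd dx2 f) x) / 4
      in (8 / pi\<^sup>2) * (h11 * h22 - (re12\<^sup>2 + im12\<^sup>2)))"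

definition rho0 :: "c2 \<Rightarrow> real" where
  "rho0 p = (if norm p < 1 then exp (- 1 / (1 - (norm p)\<^sup>2)) else 0)"

definition rho :: "c2 \<Rightarrow> real" where
  "rho p = rho0 p / (\<integral>q. rho0 q \<partial>lborel)"

definition moll :: "(c2 \<Rightarrow> real) \<Rightarrow> real \<Rightarrow> c2 \<Rightarrow> real" where
  "moll v \<epsilon> x = (\<integral>y. v (x - \<epsilon> *\<^sub>R y) * rho y \<partial>lborel)"

definition test_fun :: "c2 set \<Rightarrow> (c2 \<Rightarrow> real) \<Rightarrow> bool" where
  "test_fun \<Omega> \<phi> \<longleftrightarrow> continuous_on UNIV \<phi> \<and> compact (closure {x. \<phi> x \<noteq> 0})
      \<and> closure {x. \<phi> x \<noteq> 0} \<subseteq> \<Omega>"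

definition radon_on :: "c2 set \<Rightarrow> c2 measure \<Rightarrow> bool" where
  "radon_on \<Omega> \<mu> \<longleftrightarrow> sets \<mu> = sets borel \<and> emeasure \<mu> (- \<Omega>) = 0 \<and>
      (\<forall>C. compact C \<and> C \<subseteq> \<Omega> \<longrightarrow> emeasure \<mu> C < \<infinity>)"

text \<open>Bedford--Taylor: for a bounded psh function v on Omega, (dd^c v)^2 is the weak limit
  of (dd^c v_eps)^2 as eps -> 0+.\<close>
definition is_MA_bdd :: "c2 set \<Rightarrow> (c2 \<Rightarrow> real) \<Rightarrow> c2 measure \<Rightarrow> bool" where
  "is_MA_bdd \<Omega> v \<mu> \<longleftrightarrow> radon_on \<Omega> \<mu> \<and>
     (\<forall>\<phi>. test_fun \<Omega> \<phi> \<longrightarrow>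
        ((\<lambda>\<epsilon>. \<integral>x. \<phi> x * MA_density (moll v \<epsilon>) x \<partial>lborel) \<longlongrightarrow> (\<integral>x. \<phi> x \<partial>\<mu>))
          (at_right 0))"

text \<open>Demailly: for u psh on Omega and locally bounded outside a compact subset,
  (dd^c u)^2 is the weak limit of (dd^c max(u,-j))^2 as j -> infinity.\<close>
definition is_MA :: "c2 set \<Rightarrow> (c2 \<Rightarrow> ereal) \<Rightarrow> c2 measure \<Rightarrow> bool" where
  "is_MA \<Omega> u \<mu> \<longleftrightarrow> radon_on \<Omega> \<mu> \<and>
     (\<exists>\<mu>s. (\<forall>j::nat. is_MA_bdd \<Omega> (\<lambda>p. real_of_ereal (max (u p) (ereal (- real j)))) (\<mu>s j)) \<and>
       (\<forall>\<phi>. test_fun \<Omega> \<phi> \<longrightarrow>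
          (\<lambda>j. \<integral>x. \<phi> x \<partial>(\<mu>s j)) \<longlonglongrightarrow> (\<integral>x. \<phi> x \<partial>\<mu>)))"

end

theory Submission
  imports Defs
begin

text \<open>
  Write t = log |z|. By rotation invariance u is convex and increasing in t, and integration by parts
  turns the mass of (dd^c u)^2 against a test function eta(z) chi(w) into the flux, integral of
  chi u_t dd^c u(t, .) over {t = const}, up to an error controlled by u(t, .) - u(-inf, .).
  Since u is bounded for |z| near 1, we have u >= A t - C and u_t <= -u/|t|; hence it suffices that
  the integral of -u(t, .) against dd^c u(t, .) near 0 is small compared with |t|.

  Put f = u(t, .). The composition U(w) = u(f(w)/A, w) (first argument on the log scale) is
  subharmonic because u increases in t, and convexity in t gives f^2 <= A |t| (-U).
  The symmetry of the Green kernel exchanges the roles in the integral of -U against dd^c f, and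
  leaves at most A |t| times the mass of dd^c U near 0. This mass is small: where f/A >= log tau
  we have U >= u(tau, .), which is controlled by the vanishing Lelong number, and the remaining set
  is negligible because f is a logarithmic potential of bounded mass.

  The argument is run for mollifications of max(u, -j), with constants independent of the
  regularisation.
\<close>

section \<open>Differential calculus and integration by parts\<close>

text \<open>Vanishing Lelong number at 0 does not control the slice u(0, .): for max(log |w|,
  -sqrt(-log |z|)) that slice is log |w|, whose Laplacian charges 0. So the mass of dd^c f near 0
  need not become small as t tends to -infinity, and -f may be of order |t| just where this mass
  sits. U repairs this: it evaluates u at the level log a + f/A, and where f is not very negative
  this level lies above the fixed level log tau at which the Lelong number gives information. The
  square in f^2 <= A |t| (-U) lets Young's inequality trade -f for -U at the cost of a small
  multiple of |t|. The order of choices is forced: a tolerance, one point p near 0 with u(p) >=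
  epsilon log |p|, the radius r in w, x = |z|, the truncation j, and last the mollification. Hence
  the constants may depend on radii and on the bounds of u from above and off K, but not on V.
  Circle means and Green's formula are replaced by averages with a smooth compactly supported
  weight, so that integrations by parts take place on the whole plane and leave no boundary
  terms.\<close>

text \<open>Uniqueness of translation-invariant measures, normalised on the unit ball, which T preserves.\<close>

lemma lborel_distr_isometry:
  fixes T :: "'a::euclidean_space \<Rightarrow> 'a"
  assumes lin: "linear T" and iso: "\<And>x. norm (T x) = norm x"
  shows "distr lborel borel T = lborel"
proof -
  have inj: "inj T"
    using linear_inj_iff_eq_0[OF lin] iso by (metis norm_eq_zero)
  have surj: "surj T" using linear_inj_imp_surj[OF lin inj] .
  obtain T' where T': "linear T'" "\<And>x. T (T' x) = x"
    using linear_surjective_right_inverse[OF lin surj] by (auto simp: fun_eq_iff)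
  have mT: "T \<in> borel_measurable borel"
    by (intro borel_measurable_continuous_onI linear_continuous_on linear_conv_bounded_linear[THEN iffD1] lin)
  have tr: "(\<integral>\<^sup>+x. h (x + c) \<partial>lborel) = (\<integral>\<^sup>+x. h x \<partial>lborel)" if "h \<in> borel_measurable borel" for h :: "'a \<Rightarrow> ennreal" and c
  proof -
    have "(\<integral>\<^sup>+x. h x \<partial>lborel) = (\<integral>\<^sup>+x. h x \<partial>distr lborel borel ((+) c))" by (simp only: lborel_distr_plus)
    also have "\<dots> = (\<integral>\<^sup>+x. h (c + x) \<partial>lborel)" using that by (subst nn_integral_distr) auto
    finally show ?thesis by (simp add: add.commute)
  qed
  define B where "B = ball (0::'a) 1"
  have eq: "(\<integral>\<^sup>+x. f (T x) \<partial>lborel) = (\<integral>\<^sup>+x. f x \<partial>lborel)" if f[measurable]: "f \<in> borel_measurable borel" for f :: "'a \<Rightarrow> ennreal"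
  proof -
    note mT[measurable]
    have B[measurable]: "B \<in> sets borel" by (simp add: B_def)
    \<comment> \<open>Tonelli for \<open>f (T z)\<close> against the indicator of the unit ball
      around \<open>T z\<close>: integrating in \<open>y\<close> first gives the left side. Shifting
      \<open>z\<close> by \<open>T' y\<close> turns the integrand into \<open>f (y + T z)\<close> on
      \<open>B\<close>, since \<open>T\<close> preserves the norm, and then \<open>y\<close> can be
      integrated alone.\<close>
    have "(\<integral>\<^sup>+x. f (T x) \<partial>lborel) * emeasure lborel B = (\<integral>\<^sup>+z. f (T z) * (\<integral>\<^sup>+y. indicator B y \<partial>lborel) \<partial>lborel)"
      by (subst nn_integral_multc) (auto)
    also have "\<dots> = (\<integral>\<^sup>+z. f (T z) * (\<integral>\<^sup>+y. indicator B (y + (- T z)) \<partial>lborel) \<partial>lborel)"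
      by (subst tr[of "indicator B"]) auto
    also have "\<dots> = (\<integral>\<^sup>+z. (\<integral>\<^sup>+y. f (T z) * indicator B (y + (- T z)) \<partial>lborel) \<partial>lborel)"
      by (subst nn_integral_cmult) (auto)
    also have "\<dots> = (\<integral>\<^sup>+y. (\<integral>\<^sup>+z. f (T z) * indicator B (y + (- T z)) \<partial>lborel) \<partial>lborel)"
      by (subst lborel_pair.Fubini') (auto simp: case_prod_beta')
    also have "\<dots> = (\<integral>\<^sup>+y. (\<integral>\<^sup>+z. f (T (z + T' y)) * indicator B (y + (- T (z + T' y))) \<partial>lborel) \<partial>lborel)"
      by (subst tr) auto
    also have "\<dots> = (\<integral>\<^sup>+y. (\<integral>\<^sup>+z. f (y + T z) * indicator B z \<partial>lborel) \<partial>lborel)"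
      by (intro nn_integral_cong) (auto simp: linear_add[OF lin] T' B_def iso indicator_def add.commute)
    also have "\<dots> = (\<integral>\<^sup>+z. (\<integral>\<^sup>+y. f (y + T z) * indicator B z \<partial>lborel) \<partial>lborel)"
      by (subst lborel_pair.Fubini') (auto simp: case_prod_beta')
    also have "\<dots> = (\<integral>\<^sup>+z. (\<integral>\<^sup>+y. f y \<partial>lborel) * indicator B z \<partial>lborel)"
      by (subst nn_integral_multc) (auto simp: tr)
    also have "\<dots> = (\<integral>\<^sup>+y. f y \<partial>lborel) * emeasure lborel B"
      by (subst nn_integral_cmult) auto
    finally have e: "(\<integral>\<^sup>+x. f (T x) \<partial>lborel) * emeasure lborel B = (\<integral>\<^sup>+y. f y \<partial>lborel) * emeasure lborel B" .
    have "emeasure lborel B \<noteq> \<infinity>" unfolding B_def by (metis emeasure_lborel_ball_finite infinity_ennreal_def less_irrefl)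
    moreover have "emeasure lborel B \<noteq> 0"
      unfolding B_def using content_ball_pos[of 1 "0::'a"] by (auto simp: measure_def)
    ultimately show ?thesis using e
      by (metis ennreal_mult_cancel_left infinity_ennreal_def mult.commute)
  qed
  show ?thesis
  proof (rule measure_eqI)
    fix A assume "A \<in> sets (distr lborel borel T)"
    then have A[measurable]: "A \<in> sets borel" by simp
    have "emeasure (distr lborel borel T) A = (\<integral>\<^sup>+x. indicator A x \<partial>distr lborel borel T)"
      by simp
    also have "\<dots> = (\<integral>\<^sup>+x. indicator A (T x) \<partial>lborel)"
      by (rule nn_integral_distr) (use mT in auto)
    also have "\<dots> = emeasure lborel A" by (subst eq) auto
    finally show "emeasure (distr lborel borel T) A = emeasure lborel A" .
  qed simp
qed

lemma
  fixes T :: "'a::euclidean_space \<Rightarrow> 'a"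
  assumes lin: "linear T" and iso: "\<And>x. norm (T x) = norm x"
  shows nn_integral_isometry: "f \<in> borel_measurable borel \<Longrightarrow> (\<integral>\<^sup>+x. f (T x) \<partial>lborel) = (\<integral>\<^sup>+x. f x \<partial>lborel)"
    and integral_isometry: "g \<in> borel_measurable borel \<Longrightarrow> (\<integral>x. g (T x) \<partial>lborel) = (\<integral>x. (g x :: real) \<partial>lborel)"
proof -
  have mT: "T \<in> lborel \<rightarrow>\<^sub>M borel"
    unfolding measurable_lborel2
    by (intro borel_measurable_continuous_onI linear_continuous_on linear_conv_bounded_linear[THEN iffD1] lin)
  show "(\<integral>\<^sup>+x. f (T x) \<partial>lborel) = (\<integral>\<^sup>+x. f x \<partial>lborel)" if "f \<in> borel_measurable borel"
    using nn_integral_distr[OF mT, of f] that lborel_distr_isometry[OF assms] by simp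
  show "(\<integral>x. g (T x) \<partial>lborel) = (\<integral>x. (g x :: real) \<partial>lborel)" if "g \<in> borel_measurable borel"
    using integral_distr[OF mT, of g] that lborel_distr_isometry[OF assms] by simp
qed

lemma
  fixes c :: "'a::euclidean_space"
  shows nn_integral_translate: "f \<in> borel_measurable borel \<Longrightarrow> (\<integral>\<^sup>+x. f (x + c) \<partial>lborel) = (\<integral>\<^sup>+x. f x \<partial>lborel)"
    and integral_translate: "g \<in> borel_measurable borel \<Longrightarrow> (\<integral>x. g (x + c) \<partial>lborel) = (\<integral>x. (g x :: real) \<partial>lborel)"
proof -
  have mT: "(+) c \<in> lborel \<rightarrow>\<^sub>M borel" by simp
  show "(\<integral>\<^sup>+x. f (x + c) \<partial>lborel) = (\<integral>\<^sup>+x. f x \<partial>lborel)" if "f \<in> borel_measurable borel"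
    using nn_integral_distr[OF mT, of f] that by (simp add: lborel_distr_plus add.commute)
  show "(\<integral>x. g (x + c) \<partial>lborel) = (\<integral>x. (g x :: real) \<partial>lborel)" if "g \<in> borel_measurable borel"
    using integral_distr[OF mT, of g] that by (simp add: lborel_distr_plus add.commute)
qed

section \<open>Compact support and iterated directional differentiability\<close>

definition csupp :: "('a::euclidean_space \<Rightarrow> real) \<Rightarrow> bool" where
  "csupp f \<longleftrightarrow> (\<exists>r. \<forall>x. norm x > r \<longrightarrow> f x = 0)"

lemma csupp_mult1: "csupp f \<Longrightarrow> csupp (\<lambda>x. f x * g x)"
  and csupp_mult2: "csupp f \<Longrightarrow> csupp (\<lambda>x. g x * f x)"
  unfolding csupp_def by (metis mult_zero_left, metis mult_zero_right)

lemma csupp_add: "csupp f \<Longrightarrow> csupp g \<Longrightarrow> csupp (\<lambda>x. f x + g x)"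
  unfolding csupp_def
  by (metis add.right_neutral linorder_not_le order.trans less_le_not_le linorder_le_cases)

lemma csupp_integrable:
  fixes f :: "'a::euclidean_space \<Rightarrow> real"
  assumes "continuous_on UNIV f" "csupp f"
  shows "integrable lborel f"
proof -
  obtain r where r: "\<And>x. norm x > r \<Longrightarrow> f x = 0" using assms(2) by (auto simp: csupp_def)
  have "integrable lborel (\<lambda>x. indicator (cball 0 r) x *\<^sub>R f x)"
    by (intro borel_integrable_compact) (auto intro: continuous_on_subset[OF assms(1)])
  also have "(\<lambda>x. indicator (cball 0 r) x *\<^sub>R f x) = f"
    using r by (auto simp: indicator_def fun_eq_iff not_le)
  finally show ?thesis .
qed

lemma csupp_bounded:
  fixes f :: "'a::euclidean_space \<Rightarrow> real"
  assumes "continuous_on UNIV f" "csupp f"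
  obtains M where "M \<ge> 0" "\<And>x. \<bar>f x\<bar> \<le> M"
proof -
  obtain r where r: "\<And>x. norm x > r \<Longrightarrow> f x = 0" using assms(2) by (auto simp: csupp_def)
  have "compact (f ` cball 0 r)"
    by (intro compact_continuous_image) (auto intro: continuous_on_subset[OF assms(1)])
  then obtain M where M: "\<And>x. x \<in> cball 0 r \<Longrightarrow> \<bar>f x\<bar> \<le> M"
    by (metis bounded_iff compact_imp_bounded imageI real_norm_def)
  show thesis
    by (rule that[of "max M 0"], simp) (metis M abs_zero linorder_not_le max.coboundedI1 max.coboundedI2 mem_cball_0 order_refl r)
qed

text \<open>As a Frechet derivative it is linear in \<open>e\<close> wherever the function is
  differentiable. The one-dimensional \<open>pd\<close> agrees with it on \<open>Ck (Suc n)\<close>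
  functions (\<open>pd_eq_dr\<close>).\<close>

definition dr :: "'a::real_normed_vector \<Rightarrow> ('a \<Rightarrow> real) \<Rightarrow> 'a \<Rightarrow> real" where
  "dr e f x = frechet_derivative f (at x) e"

text \<open>Total differentiability together with the same condition on every directional
  derivative, instead of multilinear higher derivatives. Closure properties then follow by induction
  on the order from explicit first derivatives (\<open>Ck_SucI\<close>).\<close>

primrec Ck :: "nat \<Rightarrow> ('a::real_normed_vector \<Rightarrow> real) \<Rightarrow> bool" where
  "Ck 0 f = continuous_on UNIV f"
| "Ck (Suc n) f = ((\<forall>x. f differentiable (at x)) \<and> (\<forall>e. Ck n (dr e f)))"

lemma dr_eqI: "(f has_derivative D) (at x) \<Longrightarrow> dr e f x = D e"
  unfolding dr_def using frechet_derivative_at by metis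

lemma dr_eqI': "(\<And>x. (f has_derivative (\<lambda>e. D e x)) (at x)) \<Longrightarrow> dr e f = D e"
  by (rule ext) (rule dr_eqI)

lemma Ck_derivative: "Ck (Suc n) f \<Longrightarrow> (f has_derivative (\<lambda>e. dr e f x)) (at x)"
  unfolding dr_def by (metis Ck.simps(2) frechet_derivative_works eta_contract_eq)

lemma Ck_SucI:
  assumes "\<And>x. (f has_derivative (\<lambda>e. D e x)) (at x)" "\<And>e. Ck n (D e)"
  shows "Ck (Suc n) f"
  using dr_eqI'[of f D, OF assms(1)] assms by (auto simp: differentiable_def)

lemma Ck_cont: "Ck n f \<Longrightarrow> continuous_on UNIV f"
  by (cases n) (auto intro!: differentiable_imp_continuous_on simp: differentiable_on_def)

lemma Ck_dr: "Ck (Suc n) f \<Longrightarrow> Ck n (dr e f)" by simp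

lemma Ck_SucD: "Ck (Suc n) f \<Longrightarrow> Ck n f"
proof (induction n arbitrary: f)
  case 0 then show ?case using Ck_cont[of "Suc 0" f] by simp
next
  case (Suc n) then show ?case by (metis Ck.simps(2))
qed

lemma Ck_const: "Ck n (\<lambda>x. c)"
proof (induction n arbitrary: c)
  case (Suc n) show ?case by (rule Ck_SucI[where D="\<lambda>e x. 0"]) (use Suc in auto)
qed simp

lemma Ck_linear: assumes "bounded_linear L" shows "Ck n L"
proof (cases n)
  case 0 then show ?thesis using assms by (simp add: linear_continuous_on)
next
  case (Suc m)
  have "Ck (Suc m) L"
    by (rule Ck_SucI[where D="\<lambda>e x. L e"]) (auto intro: bounded_linear.has_derivative[OF assms has_derivative_ident, simplified] Ck_const assms bounded_linear_imp_has_derivative)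
  then show ?thesis using Suc by simp
qed

lemma Ck_add: "Ck n f \<Longrightarrow> Ck n g \<Longrightarrow> Ck n (\<lambda>x. f x + g x)"
proof (induction n arbitrary: f g)
  case (Suc n)
  show ?case
    by (rule Ck_SucI[where D="\<lambda>e x. dr e f x + dr e g x"])
       (auto intro!: derivative_intros Ck_derivative[of n] Suc simp del: Ck.simps intro: Ck_dr)
qed (auto intro: continuous_intros)

lemma Ck_mult: "Ck n f \<Longrightarrow> Ck n g \<Longrightarrow> Ck n (\<lambda>x. f x * g x)"
proof (induction n arbitrary: f g)
  case (Suc n)
  show ?case
    by (rule Ck_SucI[where D="\<lambda>e x. f x * dr e g x + dr e f x * g x"])
       (auto intro!: has_derivative_mult Ck_derivative[of n] Suc Ck_add Suc.IH[of _ g] Suc.IH[of f] simp del: Ck.simps intro: Ck_dr Ck_SucD)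
qed (auto intro: continuous_intros)

lemma Ck_cmult: "Ck n f \<Longrightarrow> Ck n (\<lambda>x. c * f x)" by (intro Ck_mult Ck_const)

lemma Ck_minus: "Ck n f \<Longrightarrow> Ck n (\<lambda>x. - f x)" using Ck_cmult[of n f "-1"] by simp

lemma Ck_diff: "Ck n f \<Longrightarrow> Ck n g \<Longrightarrow> Ck n (\<lambda>x. f x - g x)"
  using Ck_add[of n f "\<lambda>x. - g x"] Ck_minus[of n g] by simp

lemma Ck_affine:
  assumes L: "bounded_linear L"
  shows "Ck n f \<Longrightarrow> Ck n (\<lambda>x. f (a + L x))"
proof (induction n arbitrary: f)
  case 0
  have "continuous_on UNIV (\<lambda>x. a + L x)" by (intro continuous_intros linear_continuous_on L)
  from continuous_on_compose2[OF _ this, of UNIV f] 0 show ?case by simp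
next
  case (Suc n)
  have "((\<lambda>x. a + L x) has_derivative L) (at x)" for x
    by (auto intro!: derivative_eq_intros bounded_linear_imp_has_derivative L)
  from diff_chain_at[OF this Ck_derivative[OF Suc.prems]]
  show ?case
    by (intro Ck_SucI[where D="\<lambda>e x. dr (L e) f (a + L x)"]) (auto intro!: Suc.IH simp: o_def Ck_dr[OF Suc.prems] simp del: Ck.simps)
qed

lemma dr_affine:
  assumes L: "bounded_linear L" and "Ck (Suc n) f"
  shows "dr e (\<lambda>x. f (a + L x)) x = dr (L e) f (a + L x)"
proof -
  have "((\<lambda>x. a + L x) has_derivative L) (at x)" for x
    by (auto intro!: derivative_eq_intros bounded_linear_imp_has_derivative L)
  from diff_chain_at[OF this Ck_derivative[OF assms(2)]]
  show ?thesis by (intro dr_eqI) (auto simp: o_def)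
qed

lemma Ck_exp: "Ck n f \<Longrightarrow> Ck n (\<lambda>x. exp (f x))"
proof (induction n arbitrary: f)
  case (Suc n)
  show ?case
    by (rule Ck_SucI[where D="\<lambda>e x. exp (f x) * dr e f x"])
       (auto intro!: derivative_eq_intros Ck_derivative[of n] Suc Ck_mult simp del: Ck.simps intro: Ck_dr Ck_SucD)
qed (auto intro: continuous_intros)

lemma Ck_inverse: "Ck n f \<Longrightarrow> (\<And>x. f x \<noteq> 0) \<Longrightarrow> Ck n (\<lambda>x. inverse (f x))"
proof (induction n arbitrary: f)
  case (Suc n)
  show ?case
    by (rule Ck_SucI[where D="\<lambda>e x. - (inverse (f x) * dr e f x * inverse (f x))"])
       (auto intro!: Deriv.has_derivative_inverse Ck_derivative[of n] Suc Ck_mult Ck_minus simp del: Ck.simps intro: Ck_dr Ck_SucD)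
qed (auto intro: continuous_intros)

lemma dr_mult: "Ck (Suc n) f \<Longrightarrow> Ck (Suc n) g \<Longrightarrow> dr e (\<lambda>x. f x * g x) x = f x * dr e g x + dr e f x * g x"
  by (rule dr_eqI) (auto intro!: has_derivative_mult Ck_derivative simp del: Ck.simps)

lemma dr_add_dir: "Ck (Suc n) f \<Longrightarrow> dr (e + e') f x = dr e f x + dr e' f x"
  and dr_scale_dir: "Ck (Suc n) f \<Longrightarrow> dr (c *\<^sub>R e) f x = c * dr e f x"
  using linear_add[OF has_derivative_linear[OF Ck_derivative, of n f x]]
    linear_cmul[OF has_derivative_linear[OF Ck_derivative, of n f x]]
  by (simp_all del: Ck.simps)

lemma dr_line:
  assumes "Ck (Suc n) f"
  shows "((\<lambda>t. f (x + t *\<^sub>R e)) has_real_derivative dr e f (x + t *\<^sub>R e)) (at t)"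
proof -
  have "((\<lambda>t. x + t *\<^sub>R e) has_derivative (\<lambda>h. h *\<^sub>R e)) (at t)"
    by (auto intro!: derivative_eq_intros)
  from diff_chain_at[OF this Ck_derivative[OF assms]]
  show ?thesis using dr_scale_dir[OF assms] by (simp add: o_def has_field_derivative_def mult_commute_abs)
qed

lemma dr_mvt:
  assumes f: "Ck (Suc n) f" and t: "t > 0"
  obtains \<xi> where "0 < \<xi>" "\<xi> < t" "f (x + t *\<^sub>R e) - f x = t * dr e f (x + \<xi> *\<^sub>R e)"
proof -
  have "\<exists>z>0. z < t \<and> f (x + t *\<^sub>R e) - f (x + 0 *\<^sub>R e) = (t - 0) * dr e f (x + z *\<^sub>R e)"
    by (rule MVT2[OF t]) (rule dr_line[OF f])
  then show thesis using that by auto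
qed

lemma csupp_dr:
  fixes f :: "'a::euclidean_space \<Rightarrow> real"
  assumes "csupp f" shows "csupp (dr e f)"
proof -
  obtain r where r: "\<And>x. norm x > r \<Longrightarrow> f x = 0" using assms(1) by (auto simp: csupp_def)
  have "dr e f x = 0" if "norm x > r" for x
  proof (rule dr_eqI)
    have op: "open {x::'a. norm x > r}" by (intro open_Collect_less continuous_intros)
    show "(f has_derivative (\<lambda>x. 0)) (at x)"
      by (rule has_derivative_transform_within_open[OF _ op, where f="\<lambda>x. 0"]) (use that r in auto)
  qed
  then show ?thesis by (auto simp: csupp_def)
qed

section \<open>Integration by parts and symmetry of second derivatives\<close>

text \<open>Difference quotients along \<open>e\<close> have integral 0 by translation invariance.
  They converge to the derivative and are dominated by a bound of the derivative on a fixed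
  ball.\<close>

lemma integral_dr_zero:
  fixes f :: "'a::euclidean_space \<Rightarrow> real"
  assumes f: "Ck (Suc 0) f" and c: "csupp f"
  shows "(\<integral>x. dr e f x \<partial>lborel) = 0"
proof -
  have cf: "continuous_on UNIV f" by (rule Ck_cont[OF f])
  have cd: "continuous_on UNIV (dr e f)" by (rule Ck_cont[OF Ck_dr[OF f]])
  obtain M where M: "M \<ge> 0" "\<And>x. \<bar>dr e f x\<bar> \<le> M" using csupp_bounded[OF cd csupp_dr[OF c]] by blast
  obtain r where r: "\<And>x. norm x > r \<Longrightarrow> f x = 0" using c by (auto simp: csupp_def)
  define s where "s n = 1 / real (Suc n)" for n
  define D where "D n x = (f (x + s n *\<^sub>R e) - f x) / s n" for n x
  have s: "s n > 0" "s n \<le> 1" for n by (auto simp: s_def)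
  have s0: "s \<longlonglongrightarrow> 0" unfolding s_def by (rule LIMSEQ_Suc[OF lim_const_over_n])
  have mf: "f \<in> borel_measurable borel" using cf by (rule borel_measurable_continuous_onI)
  have int: "integrable lborel f" by (rule csupp_integrable[OF cf c])
  have int': "integrable lborel (\<lambda>x. f (x + y))" for y
    by (rule csupp_integrable) (auto intro!: continuous_on_compose2[OF cf] continuous_intros simp: csupp_def
        intro!: exI[of _ "r + norm y"] r elim!: order.strict_trans1[rotated] 
        | smt (verit) norm_triangle_ineq2 norm_triangle_ineq4 add_diff_cancel)+
  have z: "(\<integral>x. D n x \<partial>lborel) = 0" for n
    unfolding D_def using int int' integral_translate[OF mf] by simp
  have bd: "\<bar>D n x\<bar> \<le> M * indicator (cball 0 (r + norm e)) x" for n x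
  proof (cases "norm x \<le> r + norm e")
    case True
    obtain t where "f (x + s n *\<^sub>R e) - f x = s n * dr e f (x + t *\<^sub>R e)"
      using dr_mvt[OF f s(1)] by metis
    then have "D n x = dr e f (x + t *\<^sub>R e)" using s(1)[of n] by (simp add: D_def)
    then show ?thesis using True M by simp
  next
    case False
    have "norm (s n *\<^sub>R e) \<le> norm e" using s[of n] by (simp add: mult_left_le_one_le)
    then have "norm (x + s n *\<^sub>R e) > r" using False norm_diff_ineq[of x "s n *\<^sub>R e"] by linarith
    moreover have "norm x > r" using False norm_ge_zero[of e] by linarith
    ultimately show ?thesis by (simp add: D_def r False)
  qed
  have lim: "(\<lambda>n. D n x) \<longlonglongrightarrow> dr e f x" for x
  proof -
    have "((\<lambda>h. (f (x + (0 + h) *\<^sub>R e) - f (x + 0 *\<^sub>R e)) / h) \<longlongrightarrow> dr e f (x + 0 *\<^sub>R e)) (at 0)"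
      using dr_line[OF f, of x e 0] unfolding DERIV_def .
    then have "((\<lambda>h. (f (x + h *\<^sub>R e) - f x) / h) \<longlongrightarrow> dr e f x) (at 0)" by simp
    moreover have "filterlim s (at 0) sequentially"
      using s0 s(1) by (auto simp: filterlim_at eventually_sequentially less_imp_neq[symmetric])
    ultimately show ?thesis unfolding D_def by (rule filterlim_compose)
  qed
  have "(\<lambda>n. \<integral>x. D n x \<partial>lborel) \<longlonglongrightarrow> (\<integral>x. dr e f x \<partial>lborel)"
  proof (rule integral_dominated_convergence[where w="\<lambda>x. M * indicator (cball 0 (r + norm e)) x"])
    show "dr e f \<in> borel_measurable lborel" using cd by (simp add: borel_measurable_continuous_onI)
    show "D n \<in> borel_measurable lborel" for n
      unfolding D_def using int int' by (intro borel_measurable_divide borel_measurable_diff) auto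
    show "integrable lborel (\<lambda>x. M * indicator (cball 0 (r + norm e)) x)"
      using emeasure_bounded_finite[of "cball 0 (r + norm e)"] by (intro integrable_mult_right integrable_real_indicator) auto
  qed (use lim bd in auto)
  then have "(\<lambda>n. 0) \<longlonglongrightarrow> (\<integral>x. dr e f x \<partial>lborel)" by (simp only: z)
  from LIMSEQ_unique[OF this tendsto_const] show ?thesis by simp
qed

lemma integral_by_parts:
  fixes f g :: "'a::euclidean_space \<Rightarrow> real"
  assumes f: "Ck (Suc 0) f" and g: "Ck (Suc 0) g" and c: "csupp f"
  shows "(\<integral>x. f x * dr e g x \<partial>lborel) = - (\<integral>x. dr e f x * g x \<partial>lborel)"
proof -
  have "0 = (\<integral>x. dr e (\<lambda>x. f x * g x) x \<partial>lborel)"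
    by (rule integral_dr_zero[symmetric]) (auto intro: Ck_mult f g csupp_mult1 c simp del: Ck.simps)
  also have "\<dots> = (\<integral>x. f x * dr e g x + dr e f x * g x \<partial>lborel)"
    by (simp add: dr_mult[OF f g])
  also have "\<dots> = (\<integral>x. f x * dr e g x \<partial>lborel) + (\<integral>x. dr e f x * g x \<partial>lborel)"
    by (intro Bochner_Integration.integral_add csupp_integrable csupp_mult1 c csupp_dr continuous_intros Ck_cont[OF f]
        Ck_cont[OF g] Ck_cont[OF Ck_dr[OF f]] Ck_cont[OF Ck_dr[OF g]])
  finally show ?thesis by simp
qed

text \<open>The second difference of \<open>f\<close> over the parallelogram spanned by
  \<open>t u\<close> and \<open>t v\<close> is symmetric in \<open>u\<close> and \<open>v\<close>.
  Two mean value theorems turn it into \<open>t * t\<close> times either mixed derivative at a point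
  that tends to \<open>x\<close>.\<close>

lemma dr_commute:
  assumes f: "Ck (Suc (Suc n)) f"
  shows "dr u (dr v f) x = dr v (dr u f) x"
proof -
  define S where "S t = f (x + t *\<^sub>R u + t *\<^sub>R v) - f (x + t *\<^sub>R u) - f (x + t *\<^sub>R v) + f x" for t
  have *: "\<exists>\<xi> \<eta>. \<bar>\<xi>\<bar> < t \<and> \<bar>\<eta>\<bar> < t \<and>
       f (x + t *\<^sub>R u + t *\<^sub>R v) - f (x + t *\<^sub>R u) - f (x + t *\<^sub>R v) + f x = t * t * dr v (dr u f) (x + \<xi> *\<^sub>R u + \<eta> *\<^sub>R v)"
    if t0: "t > 0" for t u v
  proof -
    have f1: "Ck (Suc n) f" using Ck_SucD[OF f] .
    define p where "p s = f ((x + t *\<^sub>R v) + s *\<^sub>R u) - f (x + s *\<^sub>R u)" for s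
    have "(p has_real_derivative (dr u f ((x + t *\<^sub>R v) + s *\<^sub>R u) - dr u f (x + s *\<^sub>R u))) (at s)" for s
      unfolding p_def by (intro DERIV_diff dr_line[OF f1])
    then have "\<exists>\<xi>>0. \<xi> < t \<and> p t - p 0 = (t - 0) * (dr u f ((x + t *\<^sub>R v) + \<xi> *\<^sub>R u) - dr u f (x + \<xi> *\<^sub>R u))"
      by (intro MVT2[OF t0])
    then obtain \<xi> where \<xi>: "0 < \<xi>" "\<xi> < t" "p t - p 0 = (t - 0) * (dr u f ((x + t *\<^sub>R v) + \<xi> *\<^sub>R u) - dr u f (x + \<xi> *\<^sub>R u))"
      by auto
    obtain \<eta> where \<eta>: "0 < \<eta>" "\<eta> < t" "dr u f ((x + \<xi> *\<^sub>R u) + t *\<^sub>R v) - dr u f (x + \<xi> *\<^sub>R u)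
        = t * dr v (dr u f) ((x + \<xi> *\<^sub>R u) + \<eta> *\<^sub>R v)"
      using dr_mvt[OF Ck_dr[OF f] t0] by metis
    have "p t - p 0 = t * (t * dr v (dr u f) ((x + \<xi> *\<^sub>R u) + \<eta> *\<^sub>R v))"
      using \<xi>(3) \<eta>(3) by (simp add: ac_simps)
    then show ?thesis using \<xi> \<eta>
      by (intro exI[of _ \<xi>] exI[of _ \<eta>]) (simp add: p_def ac_simps)
  qed
  have lim: "((\<lambda>t. S t / (t * t)) \<longlongrightarrow> dr v (dr u f) x) (at_right 0)"
    if S: "\<And>t. t > 0 \<Longrightarrow> \<exists>\<xi> \<eta>. \<bar>\<xi>\<bar> < t \<and> \<bar>\<eta>\<bar> < t \<and> S t = t * t * dr v (dr u f) (x + \<xi> *\<^sub>R u + \<eta> *\<^sub>R v)" for u v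
  proof -
    obtain a b where ab: "\<And>t. t > 0 \<Longrightarrow> \<bar>a t\<bar> < t \<and> \<bar>b t\<bar> < t \<and> S t = t * t * dr v (dr u f) (x + a t *\<^sub>R u + b t *\<^sub>R v)"
      using S by metis
    have a0: "(a \<longlongrightarrow> 0) (at_right 0)" and b0: "(b \<longlongrightarrow> 0) (at_right (0::real))"
      by (rule Lim_null_comparison[where g="\<lambda>t. t"], use ab in \<open>auto simp: eventually_at_right_less eventually_at_right_field less_imp_le intro!: exI[of _ 1]\<close>)+
    have "((\<lambda>t. x + a t *\<^sub>R u + b t *\<^sub>R v) \<longlongrightarrow> x + 0 *\<^sub>R u + 0 *\<^sub>R v) (at_right 0)"
      by (intro tendsto_intros a0 b0)
    then have "((\<lambda>t. x + a t *\<^sub>R u + b t *\<^sub>R v) \<longlongrightarrow> x) (at_right 0)" by simp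
    moreover have "isCont (dr v (dr u f)) x"
      using Ck_cont[OF Ck_dr[OF Ck_dr[OF f]]] by (simp add: continuous_on_eq_continuous_at)
    ultimately have "((\<lambda>t. dr v (dr u f) (x + a t *\<^sub>R u + b t *\<^sub>R v)) \<longlongrightarrow> dr v (dr u f) x) (at_right 0)"
      using isCont_tendsto_compose by blast
    moreover have "\<forall>\<^sub>F t in at_right 0. dr v (dr u f) (x + a t *\<^sub>R u + b t *\<^sub>R v) = S t / (t * t)"
      using ab by (auto simp: eventually_at_right_field intro!: exI[of _ 1])
    ultimately show ?thesis by (rule Lim_transform_eventually)
  qed
  have "((\<lambda>t. S t / (t * t)) \<longlongrightarrow> dr v (dr u f) x) (at_right 0)"
    by (rule lim) (use * in \<open>auto simp: S_def\<close>)
  moreover have "((\<lambda>t. S t / (t * t)) \<longlongrightarrow> dr u (dr v f) x) (at_right 0)"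
    by (rule lim) (use *[of _ v u] in \<open>auto simp: S_def algebra_simps\<close>)
  ultimately show ?thesis by (metis tendsto_unique trivial_limit_at_right_real)
qed

section \<open>Flat exponentials, the source of all cutoff functions\<close>

text \<open>The powers of \<open>inverse s\<close> close the family under differentiation up to
  linear combinations, so that \<open>Ck_flat_exp\<close> is one induction on the order for all
  \<open>m\<close> together.\<close>

definition flat_exp :: "nat \<Rightarrow> real \<Rightarrow> real" where
  "flat_exp m s = (if s > 0 then exp (- inverse s) * inverse s ^ m else 0)"

lemma flat_exp_nonneg: "flat_exp m s \<ge> 0" by (simp add: flat_exp_def)

text \<open>The single term of index \<open>m + 2\<close> of the exponential series at
  \<open>inverse s\<close> leaves a factor \<open>s\<^sup>2\<close>, enough for the derivative at 0
  to vanish. The case \<open>m = 2\<close> also gives the constant of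
  \<open>chi'_le\<close>.\<close>

lemma flat_exp_le: assumes "s > 0" shows "flat_exp m s \<le> fact (m + 2) * s\<^sup>2"
proof -
  let ?x = "inverse s"
  have "(\<Sum>k\<in>{m+2}. ?x ^ k /\<^sub>R fact k) \<le> exp ?x"
    unfolding exp_def by (rule sum_le_suminf[OF summable_exp_generic]) (use assms in auto)
  then have "?x ^ (m + 2) / fact (m + 2) \<le> exp ?x" by (simp only: sum.insert_if sum.empty add_0_right if_False finite.emptyI empty_iff) (simp only: divide_inverse real_scaleR_def mult.commute)
  then have "?x ^ (m + 2) \<le> fact (m + 2) * exp ?x" by (subst (asm) pos_divide_le_eq) (simp_all only: fact_gt_zero mult.commute)
  then have "exp (- ?x) * ?x ^ (m + 2) \<le> exp (- ?x) * (fact (m + 2) * exp ?x)"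
    by (rule mult_left_mono) simp
  also have "\<dots> = fact (m + 2)" by (simp add: exp_minus)
  finally have "exp (- ?x) * ?x ^ m * ?x\<^sup>2 * s\<^sup>2 \<le> fact (m + 2) * s\<^sup>2"
    by (intro mult_right_mono) (auto simp: power_add power2_eq_square ac_simps)
  moreover have "?x\<^sup>2 * s\<^sup>2 = 1" using assms by (simp add: power_mult_distrib[symmetric])
  ultimately show ?thesis using assms by (simp add: flat_exp_def mult.assoc)
qed

lemma flat_exp_deriv: "(flat_exp m has_real_derivative (flat_exp (m + 2) s - m * flat_exp (m + 1) s)) (at s)"
proof -
  consider "s > 0" | "s < 0" | "s = 0" by linarith
  then show ?thesis
  proof cases
    case 1
    have e: "m * inverse s ^ (m - 1) * (- (inverse s)\<^sup>2) = - m * inverse s ^ (m + 1)"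
      by (cases m) (simp_all add: power2_eq_square algebra_simps)
    have "((\<lambda>s. exp (- inverse s) * inverse s ^ m) has_real_derivative 
       (exp (- inverse s) * (inverse s)\<^sup>2) * inverse s ^ m + (m * inverse s ^ (m - 1) * (- (inverse s)\<^sup>2)) * exp (- inverse s)) (at s)"
      using 1 by (auto intro!: derivative_eq_intros simp: power2_eq_square)
    then have "((\<lambda>s. exp (- inverse s) * inverse s ^ m) has_real_derivative (flat_exp (m + 2) s - m * flat_exp (m + 1) s)) (at s)"
      unfolding e using 1 by (simp add: flat_exp_def power_add power2_eq_square mult.commute mult.left_commute)
    moreover have "\<forall>\<^sub>F t in nhds s. exp (- inverse t) * inverse t ^ m = flat_exp m t"
      using eventually_nhds_in_open[of "{0<..}" s] 1 by (auto simp: flat_exp_def elim: eventually_mono)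
    ultimately show ?thesis
      by (simp add: DERIV_cong_ev[OF refl _ refl, of "\<lambda>s. exp (- inverse s) * inverse s ^ m" "flat_exp m"])
  next
    case 2
    have ev: "\<forall>\<^sub>F t in nhds s. flat_exp m t = 0"
      using eventually_nhds_in_open[of "{..<0}" s] 2 by (auto simp: flat_exp_def elim: eventually_mono)
    show ?thesis using 2 by (subst DERIV_cong_ev[OF refl ev refl]) (simp add: flat_exp_def)
  next
    case 3
    have "\<bar>flat_exp m h / h\<bar> \<le> fact (m + 2) * \<bar>h\<bar>" for h
    proof (cases "h > 0")
      case True
      have "\<bar>flat_exp m h / h\<bar> = flat_exp m h / h" using True flat_exp_nonneg by simp
      also have "\<dots> \<le> fact (m + 2) * h\<^sup>2 / h" using True flat_exp_le by (intro divide_right_mono) auto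
      also have "\<dots> = fact (m + 2) * \<bar>h\<bar>" using True by (simp add: power2_eq_square)
      finally show ?thesis .
    next
      case False
      then have "\<bar>flat_exp m h / h\<bar> = 0" by (simp add: flat_exp_def)
      moreover have "0 \<le> fact (m + 2) * \<bar>h\<bar>" by (rule mult_nonneg_nonneg) auto
      ultimately show ?thesis by linarith
    qed
    then have "\<forall>\<^sub>F h in at 0. norm (flat_exp m h / h) \<le> fact (m + 2) * \<bar>h\<bar>" by (simp del: fact_Suc)
    then have "((\<lambda>h. flat_exp m h / h) \<longlongrightarrow> 0) (at 0)"
      by (rule Lim_null_comparison) (intro tendsto_mult_right_zero tendsto_rabs_zero tendsto_ident_at)
    then show ?thesis using 3 by (simp add: DERIV_def flat_exp_def)
  qed
qed

lemma Ck_flat_exp: "Ck n g \<Longrightarrow> Ck n (\<lambda>x. flat_exp m (g x))"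
proof (induction n arbitrary: m)
  case 0
  have "continuous_on UNIV (flat_exp m)"
    using flat_exp_deriv by (meson DERIV_continuous continuous_at_imp_continuous_on)
  then show ?case using 0 by (auto intro: continuous_on_compose2[of UNIV "flat_exp m" _ g])
next
  case (Suc n)
  have "((\<lambda>x. flat_exp m (g x)) has_derivative (\<lambda>e. (flat_exp (m + 2) (g x) - m * flat_exp (m + 1) (g x)) * dr e g x)) (at x)" for x
    using has_derivative_compose[OF Ck_derivative[OF Suc.prems, of x] has_field_derivative_imp_has_derivative[OF flat_exp_deriv, of m "g x"]]
    by simp
  then show ?case
    by (rule Ck_SucI[where D="\<lambda>e x. (flat_exp (m + 2) (g x) - m * flat_exp (m + 1) (g x)) * dr e g x"])
      (intro Ck_mult Ck_diff Ck_const Suc.IH Ck_SucD[OF Suc.prems] Ck_dr[OF Suc.prems])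
qed

section \<open>Smooth radial averages in the plane\<close>

definition lap :: "(complex \<Rightarrow> real) \<Rightarrow> complex \<Rightarrow> real" where
  "lap f w = dr 1 (dr 1 f) w + dr \<i> (dr \<i> f) w"

lemma Ck_lap_cont: assumes "Ck (Suc (Suc 0)) f" shows "continuous_on UNIV (lap f)"
  unfolding lap_def by (intro continuous_intros Ck_cont[OF Ck_dr[OF Ck_dr[OF assms]]])

lemma Ck_Re: "Ck n Re" and Ck_Im: "Ck n Im"
  by (auto intro: Ck_linear bounded_linear_Re bounded_linear_Im)

lemma dr_complex: assumes "Ck (Suc n) f" shows "dr \<zeta> f x = Re \<zeta> * dr 1 f x + Im \<zeta> * dr \<i> f x"
proof -
  have "\<zeta> = Re \<zeta> *\<^sub>R 1 + Im \<zeta> *\<^sub>R \<i>" by (simp add: complex_eq_iff)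
  then show ?thesis by (metis dr_add_dir[OF assms] dr_scale_dir[OF assms])
qed

definition sqn :: "complex \<Rightarrow> real" where "sqn z = (cmod z)\<^sup>2"

lemma sqn_alt: "sqn = (\<lambda>z. Re z * Re z + Im z * Im z)"
  by (auto simp: fun_eq_iff sqn_def cmod_power2) (simp add: power2_eq_square)

lemma Ck_sqn: "Ck n sqn" unfolding sqn_alt by (intro Ck_add Ck_mult Ck_Re Ck_Im)

lemma sqn_has_derivative: "(sqn has_derivative (\<lambda>e. 2 * (Re e * Re z + Im e * Im z))) (at z)"
  unfolding sqn_alt by (auto intro!: derivative_eq_intros)

lemma flat_exp_pos: "s > 0 \<Longrightarrow> flat_exp m s > 0" and flat_exp_0: "s \<le> 0 \<Longrightarrow> flat_exp m s = 0"
  by (auto simp: flat_exp_def)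

lemma nn_integral_affine_complex:
  assumes [measurable]: "g \<in> borel_measurable borel" and s: "s > 0"
  shows "(\<integral>\<^sup>+z. g (w + s *\<^sub>R z) \<partial>lborel) = ennreal (1 / s\<^sup>2) * (\<integral>\<^sup>+x. g (x::complex) \<partial>lborel)"
proof -
  have "(\<integral>\<^sup>+x. g x \<partial>lborel) = (\<integral>\<^sup>+x. g x \<partial>density (distr lborel borel (\<lambda>x. w + s *\<^sub>R x)) (\<lambda>_. \<bar>s\<bar> ^ DIM(complex)))"
    using lborel_affine[of s w] s by simp
  also have "\<dots> = (\<integral>\<^sup>+x. ennreal (s\<^sup>2) * g x \<partial>distr lborel borel (\<lambda>x. w + s *\<^sub>R x))"
    using s by (subst nn_integral_density) auto
  also have "\<dots> = (\<integral>\<^sup>+x. ennreal (s\<^sup>2) * g (w + s *\<^sub>R x) \<partial>lborel)"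
    by (subst nn_integral_distr) auto
  also have "\<dots> = ennreal (s\<^sup>2) * (\<integral>\<^sup>+x. g (w + s *\<^sub>R x) \<partial>lborel)"
    by (subst nn_integral_cmult) auto
  finally have "ennreal (1 / s\<^sup>2) * (\<integral>\<^sup>+x. g x \<partial>lborel) = (ennreal (1/s\<^sup>2) * ennreal (s\<^sup>2)) * (\<integral>\<^sup>+x. g (w + s *\<^sub>R x) \<partial>lborel)"
    by (simp add: mult.assoc)
  also have "ennreal (1/s\<^sup>2) * ennreal (s\<^sup>2) = 1" using s by (simp add: ennreal_mult[symmetric])
  finally show ?thesis by simp
qed

lemma nn_integral_inverse_Icc:
  assumes "0 < s" "s \<le> S"
  shows "(\<integral>\<^sup>+\<sigma>. ennreal (1 / \<sigma>) * indicator {s..S} \<sigma> \<partial>lborel) = ennreal (ln (S / s))"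
proof -
  have "(\<integral>\<^sup>+\<sigma>. ennreal (1 / \<sigma>) * indicator {s..S} \<sigma> \<partial>lborel) = ennreal (ln S - ln s)"
  proof (rule nn_integral_FTC_Icc)
    fix x assume "x \<in> {s..S}"
    then have "x > 0" using assms by auto
    then show "(ln has_real_derivative 1 / x) (at x)" "0 \<le> 1 / x"
      using DERIV_ln_divide by auto
  qed (use assms in auto)
  then show ?thesis using assms by (simp add: ln_div)
qed

lemma ball_sets_borel[measurable]: "ball (a::complex) r \<in> sets borel" by simp

lemma ball_indicator_borel[measurable]: "(indicator (ball (a::complex) r) :: _ \<Rightarrow> ennreal) \<in> borel_measurable borel" by simp

definition lap_mass :: "(complex \<Rightarrow> real) \<Rightarrow> complex set \<Rightarrow> ennreal" where
  "lap_mass f E = (\<integral>\<^sup>+x. ennreal (lap f x) * indicator E x \<partial>lborel)"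

lemma lap_mass_mono: "E \<subseteq> F \<Longrightarrow> lap_mass f E \<le> lap_mass f F"
  unfolding lap_mass_def by (intro nn_integral_mono mult_left_mono) (auto simp: indicator_def)

text \<open>The radial weights satisfy z beta(z) = - grad Psi(z), and beta lives on the annulus
  kappa < |z|^2 < 1: averages at a suitable scale only see the region where u is known to be bounded.\<close>

locale kern = fixes \<kappa> :: real assumes k0: "0 < \<kappa>" and k1: "\<kappa> < 1"
begin

text \<open>\<open>Psi0\<close> is the usual smooth step in |z|^2, equal to 1 up to \<kappa> and to
  0 from 1 on, and \<open>beta0\<close> is -2 times its derivative in |z|^2. In polar coordinates
  \<open>cc\<close> is 2 pi, the constant of the logarithmic kernel; after division
  \<open>beta\<close> has total weight 1 and \<open>Psi\<close> the plateau
  \<open>1 / cc\<close>.\<close>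

definition den where "den z = flat_exp 0 (1 - sqn z) + flat_exp 0 (sqn z - \<kappa>)"
definition Psi0 where "Psi0 z = flat_exp 0 (1 - sqn z) * inverse (den z)"
definition beta0 where "beta0 z = 2 * (flat_exp 2 (1 - sqn z) * flat_exp 0 (sqn z - \<kappa>) + flat_exp 0 (1 - sqn z) * flat_exp 2 (sqn z - \<kappa>)) * (inverse (den z) * inverse (den z))"
definition cc where "cc = (\<integral>z. beta0 z \<partial>lborel)"
definition Psi where "Psi z = Psi0 z / cc"
definition beta where "beta z = beta0 z / cc"

lemma den_pos: "den z > 0"
proof (cases "sqn z < 1")
  case True then show ?thesis unfolding den_def by (intro add_pos_nonneg flat_exp_pos flat_exp_nonneg) auto
next
  case False then show ?thesis unfolding den_def using k1 by (intro add_nonneg_pos flat_exp_pos flat_exp_nonneg) auto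
qed

lemma Ck_den: "Ck n den"
  unfolding den_def[abs_def] by (intro Ck_add Ck_flat_exp Ck_diff Ck_const Ck_sqn)

lemma Ck_Psi0: "Ck n Psi0"
  unfolding Psi0_def[abs_def] by (intro Ck_mult Ck_inverse Ck_den Ck_flat_exp Ck_diff Ck_const Ck_sqn) (use den_pos in \<open>auto simp: less_imp_neq[symmetric]\<close>)

lemma Ck_beta0: "Ck n beta0"
  unfolding beta0_def[abs_def] by (intro Ck_mult Ck_add Ck_inverse Ck_den Ck_flat_exp Ck_diff Ck_const Ck_sqn) (use den_pos in \<open>auto simp: less_imp_neq[symmetric]\<close>)

lemma dr_Psi0: "dr e Psi0 z = - (Re e * Re z + Im e * Im z) * beta0 z"
proof -
  let ?D = "\<lambda>e. 2 * (Re e * Re z + Im e * Im z)"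
  define A B A2 B2 where "A = flat_exp 0 (1 - sqn z)" and "B = flat_exp 0 (sqn z - \<kappa>)" and "A2 = flat_exp 2 (1 - sqn z)" and "B2 = flat_exp 2 (sqn z - \<kappa>)"
  have b: "(flat_exp 0 has_real_derivative flat_exp 2 s) (at s)" for s using flat_exp_deriv[of 0 s] by (simp add: numeral_2_eq_2)
  have a: "((\<lambda>z. flat_exp 0 (1 - sqn z)) has_derivative (\<lambda>e. - (A2 * ?D e))) (at z)"
    using has_derivative_compose[OF has_derivative_diff[OF has_derivative_const sqn_has_derivative] has_field_derivative_imp_has_derivative[OF b], of 1 z]
    by (auto simp: A2_def algebra_simps elim: has_derivative_eq_rhs)
  have a': "((\<lambda>z. flat_exp 0 (sqn z - \<kappa>)) has_derivative (\<lambda>e. B2 * ?D e)) (at z)"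
    using has_derivative_compose[OF has_derivative_diff[OF sqn_has_derivative has_derivative_const] has_field_derivative_imp_has_derivative[OF b]]
    by (simp add: B2_def)
  have d: "(den has_derivative (\<lambda>e. - (A2 * ?D e) + B2 * ?D e)) (at z)"
    unfolding den_def[abs_def] by (intro has_derivative_add a a')
  have den: "den z \<noteq> 0" using den_pos[of z] by simp
  have "dr e Psi0 z = A * (- (inverse (den z) * (- (A2 * ?D e) + B2 * ?D e) * inverse (den z))) + (- (A2 * ?D e)) * inverse (den z)"
    unfolding Psi0_def[abs_def] A_def by (rule dr_eqI) (intro has_derivative_mult a Deriv.has_derivative_inverse d den)
  also have "\<dots> = (A * (A2 * ?D e - B2 * ?D e) - A2 * ?D e * den z) * (inverse (den z) * inverse (den z))"
    using den by (simp add: algebra_simps)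
  also have "den z = A + B" by (simp add: den_def A_def B_def)
  also have "A * (A2 * ?D e - B2 * ?D e) - A2 * ?D e * (A + B) = - ?D e * (A2 * B + A * B2)" by algebra
  finally have "dr e Psi0 z = - ?D e * (A2 * B + A * B2) * (inverse (den z) * inverse (den z))"
    using \<open>den z = A + B\<close> by simp
  moreover have "- (2 * a) * b * c = - a * (2 * b * c)" for a b c :: real by simp
  ultimately show ?thesis unfolding beta0_def A_def[symmetric] B_def[symmetric] A2_def[symmetric] B2_def[symmetric]
    by (simp only:)
qed

lemma beta0_nonneg: "beta0 z \<ge> 0" unfolding beta0_def
  by (intro mult_nonneg_nonneg add_nonneg_nonneg flat_exp_nonneg) (use den_pos[of z] in auto)

lemma beta0_supp: "beta0 z \<noteq> 0 \<Longrightarrow> \<kappa> < sqn z \<and> sqn z < 1"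
  by (rule ccontr) (auto simp: beta0_def flat_exp_0 not_less de_Morgan_conj)

lemma sqn_less_1: "sqn z < 1 \<longleftrightarrow> cmod z < 1" unfolding sqn_def
  by (metis abs_norm_cancel abs_square_less_1)

lemma beta0_zero: "cmod z \<ge> 1 \<Longrightarrow> beta0 z = 0"
  using beta0_supp sqn_less_1 by (meson not_le)

lemma csupp_beta0: "csupp beta0" unfolding csupp_def by (rule exI[of _ 1]) (auto intro: beta0_zero)

lemma cc_pos: "cc > 0"
proof -
  let ?z = "complex_of_real (sqrt ((\<kappa> + 1) / 2))"
  have sq: "sqn ?z = (\<kappa> + 1) / 2" using k0 by (simp add: sqn_def)
  have pos: "beta0 ?z > 0" unfolding beta0_def sq using den_pos[of ?z] k0 k1
    by (intro mult_pos_pos add_pos_pos flat_exp_pos) (auto simp: field_simps)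
  have cont: "continuous_on UNIV beta0" by (rule Ck_cont[OF Ck_beta0])
  have "open {z. beta0 z > beta0 ?z / 2}" by (intro open_Collect_less continuous_intros cont)
  then obtain d where d: "d > 0" "ball ?z d \<subseteq> {z. beta0 z > beta0 ?z / 2}"
    using pos by (metis (mono_tags, lifting) mem_Collect_eq half_gt_zero_iff less_add_same_cancel1 field_sum_of_halves openE)
  have "0 < beta0 ?z / 2 * measure lborel (ball ?z d)"
    using pos content_ball_pos[OF d(1)] by simp
  also have "\<dots> = (\<integral>z. beta0 ?z / 2 * indicator (ball ?z d) z \<partial>lborel)" by simp
  also have "\<dots> \<le> cc" unfolding cc_def
  proof (rule integral_mono)
    show "integrable lborel (\<lambda>z. beta0 ?z / 2 * indicator (ball ?z d) z)"
      using emeasure_lborel_ball_finite[of ?z d] by (intro integrable_mult_right integrable_real_indicator) auto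
    show "integrable lborel beta0" by (rule csupp_integrable[OF cont csupp_beta0])
    show "beta0 ?z / 2 * indicator (ball ?z d) z \<le> beta0 z" for z
      using d(2) beta0_nonneg[of z] by (cases "z \<in> ball ?z d") auto
  qed
  finally show ?thesis .
qed

lemma Ck_Psi: "Ck n Psi" and Ck_beta: "Ck n beta"
  using Ck_cmult[OF Ck_Psi0, of _ "1/cc"] Ck_cmult[OF Ck_beta0, of _ "1/cc"] by (simp_all add: Psi_def[abs_def] beta_def[abs_def])

lemma cont_Psi: "continuous_on UNIV Psi" and cont_beta: "continuous_on UNIV beta"
  by (rule Ck_cont[OF Ck_Psi] Ck_cont[OF Ck_beta])+

lemma dr_Psi: "dr e Psi z = - (Re e * Re z + Im e * Im z) * beta z"
proof -
  have "dr e (\<lambda>z. (1 / cc) * Psi0 z) z = (1/cc) * dr e Psi0 z"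
    by (rule dr_eqI) (intro has_derivative_mult_right Ck_derivative[OF Ck_Psi0])
  then show ?thesis by (simp add: Psi_def[abs_def] dr_Psi0 beta_def)
qed

lemma beta_nonneg: "beta z \<ge> 0" using beta0_nonneg cc_pos by (simp add: beta_def)
lemma beta_supp: "beta z \<noteq> 0 \<Longrightarrow> \<kappa> < sqn z \<and> cmod z < 1" using beta0_supp sqn_less_1 by (auto simp: beta_def)
lemma beta_zero: "cmod z \<ge> 1 \<Longrightarrow> beta z = 0" using beta_supp by fastforce
lemma csupp_beta: "csupp beta" unfolding csupp_def by (rule exI[of _ 1]) (auto intro: beta_zero)
lemma beta_int: "(\<integral>z. beta z \<partial>lborel) = 1" using cc_pos by (simp add: beta_def[abs_def] cc_def[symmetric])
lemma Psi_nonneg: "Psi z \<ge> 0" using den_pos[of z] flat_exp_nonneg cc_pos by (simp add: Psi_def Psi0_def)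
lemma Psi_zero: "cmod z \<ge> 1 \<Longrightarrow> Psi z = 0"
  using sqn_less_1[of z] by (simp add: Psi_def Psi0_def flat_exp_0 not_less)
lemma csupp_Psi: "csupp Psi" unfolding csupp_def by (rule exI[of _ 1]) (auto intro: Psi_zero)
lemma Psi_in: "sqn z \<le> \<kappa> \<Longrightarrow> Psi z = 1 / cc"
  using den_pos[of z] by (simp add: Psi_def Psi0_def den_def flat_exp_0)
lemma Psi_le: "Psi z \<le> 1 / cc"
proof -
  have "Psi0 z \<le> 1" using den_pos[of z] flat_exp_nonneg[of 0 "sqn z - \<kappa>"] by (simp add: Psi0_def den_def field_simps)
  then show ?thesis using cc_pos by (simp add: Psi_def divide_right_mono)
qed
lemma Psi_even: "Psi (- z) = Psi z" by (simp add: Psi_def Psi0_def den_def sqn_def)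

lemma meas_Psi[measurable]: "Psi \<in> borel_measurable borel" and meas_beta[measurable]: "beta \<in> borel_measurable borel"
  by (simp_all add: borel_measurable_continuous_onI cont_Psi cont_beta)

section \<open>Averages, excess over a function, and Laplacian mass\<close>

text \<open>The substitute for the mean over the circle of radius \<open>s\<close>: radial, of total
  weight 1, and seeing only points whose distance from \<open>w\<close> lies between sqrt \<kappa>
  times \<open>s\<close> and \<open>s\<close>.\<close>

definition T :: "real \<Rightarrow> (complex \<Rightarrow> real) \<Rightarrow> complex \<Rightarrow> real" where
  "T s f w = (\<integral>z. f (w + s *\<^sub>R z) * beta z \<partial>lborel)"

lemma T_0: "T 0 f w = f w" by (simp add: T_def beta_int)

lemma cont_shift: "continuous_on UNIV f \<Longrightarrow> continuous_on UNIV (\<lambda>z. f (w + s *\<^sub>R (z::complex)))"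
  by (auto intro!: continuous_on_compose2[of UNIV f] continuous_intros)

lemma T_integrable: "continuous_on UNIV f \<Longrightarrow> integrable lborel (\<lambda>z. f (w + s *\<^sub>R z) * beta z)"
  by (intro csupp_integrable csupp_mult2 csupp_beta continuous_intros cont_beta cont_shift) auto

lemma T_mono:
  assumes "continuous_on UNIV f" "continuous_on UNIV g"
    and "\<And>z. \<kappa> < sqn z \<Longrightarrow> cmod z < 1 \<Longrightarrow> f (w + s *\<^sub>R z) \<le> g (w + s *\<^sub>R z)"
  shows "T s f w \<le> T s g w"
  unfolding T_def
proof (rule integral_mono[OF T_integrable T_integrable])
  show "f (w + s *\<^sub>R z) * beta z \<le> g (w + s *\<^sub>R z) * beta z" for z
    using assms(3)[of z] beta_supp[of z] beta_nonneg[of z] by (cases "beta z = 0") (auto intro: mult_right_mono)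
qed (use assms in auto)

lemma T_const: "T s (\<lambda>_. c) w = c" by (simp add: T_def beta_int)

text \<open>Since z beta(z) = - grad Psi(z), an integration by parts in each real coordinate moves
  the gradient from \<open>Psi\<close> to the first derivatives of \<open>f\<close>; the chain rule
  supplies the factor \<sigma>.\<close>

lemma inner_formula:
  assumes f: "Ck (Suc (Suc 0)) f"
  shows "(\<integral>z. dr z f (w + \<sigma> *\<^sub>R z) * beta z \<partial>lborel) = \<sigma> * (\<integral>z. lap f (w + \<sigma> *\<^sub>R z) * Psi z \<partial>lborel)"
proof -
  have f1: "Ck (Suc 0) f" using Ck_SucD[OF f] .
  have bl: "bounded_linear (\<lambda>z::complex. \<sigma> *\<^sub>R z)" by (rule bounded_linear_scaleR_right)
  define F where "F e z = dr e f (w + \<sigma> *\<^sub>R z)" for e z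
  have F: "Ck (Suc 0) (F e)" for e unfolding F_def by (rule Ck_affine[OF bl Ck_dr[OF f]])
  have dF: "dr e (F e) z = \<sigma> * dr e (dr e f) (w + \<sigma> *\<^sub>R z)" for e z
    unfolding F_def by (subst dr_affine[OF bl Ck_dr[OF f]]) (rule dr_scale_dir[OF Ck_dr[OF f]])
  have ibp: "(\<integral>z. F e z * (Re e * Re z + Im e * Im z) * beta z \<partial>lborel) = (\<integral>z. \<sigma> * dr e (dr e f) (w + \<sigma> *\<^sub>R z) * Psi z \<partial>lborel)" for e
    using integral_by_parts[OF Ck_Psi F csupp_Psi, of e e] by (simp add: dr_Psi dF algebra_simps Bochner_Integration.integral_minus[symmetric] del: Bochner_Integration.integral_minus)
  have int1: "integrable lborel (\<lambda>z. F e z * (Re e * Re z + Im e * Im z) * beta z)" for e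
    by (intro csupp_integrable csupp_mult2 csupp_beta continuous_intros cont_beta Ck_cont[OF F])
  have int2: "integrable lborel (\<lambda>z. \<sigma> * dr e (dr e f) (w + \<sigma> *\<^sub>R z) * Psi z)" for e
    by (intro csupp_integrable csupp_mult2 csupp_Psi continuous_intros cont_Psi cont_shift Ck_cont[OF Ck_dr[OF Ck_dr[OF f]]])
  have "(\<integral>z. dr z f (w + \<sigma> *\<^sub>R z) * beta z \<partial>lborel)
     = (\<integral>z. F 1 z * (Re 1 * Re z + Im 1 * Im z) * beta z + F \<i> z * (Re \<i> * Re z + Im \<i> * Im z) * beta z \<partial>lborel)"
    by (subst dr_complex[OF f1]) (simp add: F_def algebra_simps)
  also have "\<dots> = (\<integral>z. \<sigma> * dr 1 (dr 1 f) (w + \<sigma> *\<^sub>R z) * Psi z \<partial>lborel) + (\<integral>z. \<sigma> * dr \<i> (dr \<i> f) (w + \<sigma> *\<^sub>R z) * Psi z \<partial>lborel)"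
    by (subst Bochner_Integration.integral_add[OF int1 int1]) (simp only: ibp)
  also have "\<dots> = (\<integral>z. \<sigma> * (lap f (w + \<sigma> *\<^sub>R z) * Psi z) \<partial>lborel)"
    by (subst Bochner_Integration.integral_add[OF int2 int2, symmetric]) (simp add: lap_def algebra_simps)
  finally show ?thesis by simp
qed

lemma joint_integrable:
  assumes "continuous_on UNIV (\<lambda>p::real \<times> complex. g (fst p) (snd p))" "\<And>\<sigma> z. cmod z \<ge> 1 \<Longrightarrow> g \<sigma> z = 0"
  shows "integrable (lborel \<Otimes>\<^sub>M lborel) (\<lambda>(\<sigma>, z). indicator {s..S} \<sigma> * (g \<sigma> z :: real))"
proof -
  have "integrable lborel (\<lambda>p. indicator ({s..S} \<times> cball 0 1) p *\<^sub>R (g (fst p) (snd p)))"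
    by (intro borel_integrable_compact compact_Times) (auto intro: continuous_on_subset[OF assms(1)])
  also have "(\<lambda>p. indicator ({s..S} \<times> cball 0 1) p *\<^sub>R (g (fst p) (snd p))) = (\<lambda>(\<sigma>, z). indicator {s..S} \<sigma> * g \<sigma> z)"
    using assms(2) by (force simp: fun_eq_iff indicator_def)
  finally show ?thesis by (simp only: lborel_prod)
qed

text \<open>Plays the role of Green's representation formula; s = 0 is allowed since T 0 f = f.\<close>

lemma T_formula:
  assumes f: "Ck (Suc (Suc 0)) f" and s: "s \<le> S"
  shows "T S f w - T s f w = (\<integral>\<sigma>. indicator {s..S} \<sigma> * (\<sigma> * (\<integral>z. lap f (w + \<sigma> *\<^sub>R z) * Psi z \<partial>lborel)) \<partial>lborel)"
proof -
  have f1: "Ck (Suc 0) f" using Ck_SucD[OF f] .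
  have cf: "continuous_on UNIV f" by (rule Ck_cont[OF f])
  have cd: "continuous_on UNIV (dr e f)" for e by (rule Ck_cont[OF Ck_dr[OF f]])
  have ftc: "f (w + S *\<^sub>R z) - f (w + s *\<^sub>R z) = (\<integral>\<sigma>. indicator {s..S} \<sigma> * dr z f (w + \<sigma> *\<^sub>R z) \<partial>lborel)" for z
  proof -
    have "isCont (\<lambda>\<sigma>. dr z f (w + \<sigma> *\<^sub>R z)) x" for x
      using continuous_on_compose2[OF cd, of UNIV "\<lambda>\<sigma>. w + \<sigma> *\<^sub>R z"] 
      by (auto simp: continuous_on_eq_continuous_at intro!: continuous_intros)
    then show ?thesis
      using integral_FTC_Icc_real[OF s, of "\<lambda>\<sigma>. f (w + \<sigma> *\<^sub>R z)" "\<lambda>\<sigma>. dr z f (w + \<sigma> *\<^sub>R z)"] dr_line[OF f1]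
      by (simp add: mult.commute)
  qed
  have J: "integrable (lborel \<Otimes>\<^sub>M lborel) (\<lambda>(\<sigma>, z). indicator {s..S} \<sigma> * (dr z f (w + \<sigma> *\<^sub>R z) * beta z))"
  proof (rule joint_integrable)
    have c: "continuous_on UNIV (\<lambda>p::real\<times>complex. dr e f (w + fst p *\<^sub>R snd p))" for e
      by (rule continuous_on_compose2[OF cd]) (auto intro!: continuous_intros)
    show "continuous_on UNIV (\<lambda>p::real\<times>complex. dr (snd p) f (w + fst p *\<^sub>R snd p) * beta (snd p))"
      unfolding dr_complex[OF f1, of "snd _"]
      by (intro continuous_intros c continuous_on_compose2[OF cont_beta]) auto
  qed (simp add: beta_zero)
  have "T S f w - T s f w = (\<integral>z. (f (w + S *\<^sub>R z) - f (w + s *\<^sub>R z)) * beta z \<partial>lborel)"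
    unfolding T_def by (subst Bochner_Integration.integral_diff[OF T_integrable T_integrable, symmetric]) (auto simp: cf left_diff_distrib)
  also have "\<dots> = (\<integral>z. (\<integral>\<sigma>. indicator {s..S} \<sigma> * (dr z f (w + \<sigma> *\<^sub>R z) * beta z) \<partial>lborel) \<partial>lborel)"
    by (simp add: ftc mult.assoc[symmetric])
  also have "\<dots> = (\<integral>\<sigma>. (\<integral>z. indicator {s..S} \<sigma> * (dr z f (w + \<sigma> *\<^sub>R z) * beta z) \<partial>lborel) \<partial>lborel)"
    using lborel_pair.Fubini_integral[OF J] by simp
  also have "\<dots> = (\<integral>\<sigma>. indicator {s..S} \<sigma> * (\<sigma> * (\<integral>z. lap f (w + \<sigma> *\<^sub>R z) * Psi z \<partial>lborel)) \<partial>lborel)"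
    using inner_formula[OF f, of w] by simp
  finally show ?thesis .
qed

text \<open>A nonnegative Laplacian on the ball of radius \<open>S\<close> makes the integrand of
  \<open>T_formula\<close> nonnegative, because \<open>Psi\<close> vanishes off the unit disc. The
  \<open>ennreal\<close> form is the one to which Tonelli applies without further integrability
  conditions.\<close>

lemma T_nn:
  assumes f: "Ck (Suc (Suc 0)) f" and s: "0 \<le> s" "s \<le> S" and pos: "\<And>x. dist w x < S \<Longrightarrow> lap f x \<ge> 0"
  shows "T s f w \<le> T S f w" (is ?A)
    and "ennreal (T S f w - T s f w) = (\<integral>\<^sup>+\<sigma>. indicator {s..S} \<sigma> * (\<integral>\<^sup>+z. ennreal (\<sigma> * Psi z) * ennreal (lap f (w + \<sigma> *\<^sub>R z)) \<partial>lborel) \<partial>lborel)" (is ?B)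
proof -
  note cl = Ck_lap_cont[OF f]
  have nn: "0 \<le> \<sigma> * (Psi z * lap f (w + \<sigma> *\<^sub>R z))" if "0 \<le> \<sigma>" "\<sigma> \<le> S" for \<sigma> z
  proof (cases "cmod z < 1 \<and> \<sigma> > 0")
    case True
    then have "\<sigma> * cmod z < \<sigma> * 1" by (intro mult_strict_left_mono) auto
    then have "\<sigma> * cmod z < S" using that by linarith
    then have "lap f (w + \<sigma> *\<^sub>R z) \<ge> 0" using that by (intro pos) (simp add: dist_norm)
    then show ?thesis using Psi_nonneg that by simp
  qed (use Psi_zero[of z] that in \<open>auto simp: not_less\<close>)
  define I where "I \<sigma> = \<sigma> * (\<integral>z. lap f (w + \<sigma> *\<^sub>R z) * Psi z \<partial>lborel)" for \<sigma>
  have intz: "integrable lborel (\<lambda>z. \<sigma> * (Psi z * lap f (w + \<sigma> *\<^sub>R z)))" for \<sigma>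
    by (intro csupp_integrable csupp_mult2[OF csupp_mult1[OF csupp_Psi]] continuous_intros cont_Psi cont_shift cl)
  have I: "I \<sigma> = (\<integral>z. \<sigma> * (Psi z * lap f (w + \<sigma> *\<^sub>R z)) \<partial>lborel)" for \<sigma>
    by (simp add: I_def mult.commute)
  have Inn: "I \<sigma> \<ge> 0" if "0 \<le> \<sigma>" "\<sigma> \<le> S" for \<sigma>
    unfolding I by (rule Bochner_Integration.integral_nonneg) (rule nn[OF that])
  have form: "T S f w - T s f w = (\<integral>\<sigma>. indicator {s..S} \<sigma> * I \<sigma> \<partial>lborel)"
    unfolding I_def by (rule T_formula[OF f s(2)])
  have "0 \<le> (\<integral>\<sigma>. indicator {s..S} \<sigma> * I \<sigma> \<partial>lborel)"
    by (rule Bochner_Integration.integral_nonneg) (use Inn s in \<open>auto simp: indicator_def\<close>)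
  then show ?A using form by linarith
  have J: "integrable (lborel \<Otimes>\<^sub>M lborel) (\<lambda>(\<sigma>, z). indicator {s..S} \<sigma> * (\<sigma> * (Psi z * lap f (w + \<sigma> *\<^sub>R z))))"
  proof (rule joint_integrable)
    have c: "continuous_on UNIV (\<lambda>p::real\<times>complex. lap f (w + fst p *\<^sub>R snd p))"
      by (rule continuous_on_compose2[OF cl]) (auto intro!: continuous_intros)
    show "continuous_on UNIV (\<lambda>p::real\<times>complex. fst p * (Psi (snd p) * lap f (w + fst p *\<^sub>R snd p)))"
      by (intro continuous_intros c continuous_on_compose2[OF cont_Psi]) auto
  qed (simp add: Psi_zero)
  have "integrable lborel (\<lambda>\<sigma>. indicator {s..S} \<sigma> * I \<sigma>)"
    using lborel_pair.integrable_fst[OF J] by (simp add: I)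
  then have "ennreal (T S f w - T s f w) = (\<integral>\<^sup>+\<sigma>. ennreal (indicator {s..S} \<sigma> * I \<sigma>) \<partial>lborel)"
    unfolding form by (intro nn_integral_eq_integral[symmetric]) (use Inn s in \<open>auto simp: indicator_def\<close>)
  also have "\<dots> = (\<integral>\<^sup>+\<sigma>. indicator {s..S} \<sigma> * (\<integral>\<^sup>+z. ennreal (\<sigma> * Psi z) * ennreal (lap f (w + \<sigma> *\<^sub>R z)) \<partial>lborel) \<partial>lborel)"
  proof (rule nn_integral_cong)
    fix \<sigma> :: real
    show "ennreal (indicator {s..S} \<sigma> * I \<sigma>) = indicator {s..S} \<sigma> * (\<integral>\<^sup>+z. ennreal (\<sigma> * Psi z) * ennreal (lap f (w + \<sigma> *\<^sub>R z)) \<partial>lborel)"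
    proof (cases "\<sigma> \<in> {s..S}")
      case True
      then have \<sigma>: "0 \<le> \<sigma>" "\<sigma> \<le> S" using s by auto
      have "ennreal (I \<sigma>) = (\<integral>\<^sup>+z. ennreal (\<sigma> * (Psi z * lap f (w + \<sigma> *\<^sub>R z))) \<partial>lborel)"
        unfolding I by (rule nn_integral_eq_integral[symmetric, OF intz]) (use nn[OF \<sigma>] in auto)
      also have "\<dots> = (\<integral>\<^sup>+z. ennreal (\<sigma> * Psi z) * ennreal (lap f (w + \<sigma> *\<^sub>R z)) \<partial>lborel)"
        using \<sigma> Psi_nonneg by (intro nn_integral_cong) (simp add: ennreal_mult'[symmetric] mult.assoc)
      finally show ?thesis using True by simp
    qed simp
  qed
  finally show ?B .
qed

context
  fixes f :: "complex \<Rightarrow> real" assumes f: "Ck (Suc (Suc 0)) f"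
begin

lemma meas_lap[measurable]: "lap f \<in> borel_measurable borel"
  by (simp add: borel_measurable_continuous_onI Ck_lap_cont[OF f])

lemma scale_ball:
  assumes "0 < \<sigma>" "0 < r"
  shows "(\<integral>\<^sup>+z. ennreal (lap f (w + \<sigma> *\<^sub>R z)) * indicator (ball 0 r) z \<partial>lborel) = ennreal (1 / \<sigma>\<^sup>2) * lap_mass f (ball w (\<sigma> * r))"
proof -
  have "(\<integral>\<^sup>+z. ennreal (lap f (w + \<sigma> *\<^sub>R z)) * indicator (ball 0 r) z \<partial>lborel)
    = (\<integral>\<^sup>+z. (\<lambda>x. ennreal (lap f x) * indicator (ball w (\<sigma> * r)) x) (w + \<sigma> *\<^sub>R z) \<partial>lborel)"
    using assms by (intro nn_integral_cong) (auto simp: indicator_def dist_norm)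
  also have "\<dots> = ennreal (1 / \<sigma>\<^sup>2) * lap_mass f (ball w (\<sigma> * r))"
    unfolding lap_mass_def by (rule nn_integral_affine_complex) (measurable, use assms in auto)
  finally show ?thesis .
qed

text \<open>\<open>Psi\<close> equals \<open>1 / cc\<close> on the disc of radius sqrt \<kappa>, so
  at each scale \<sigma> >= \<open>s\<close> the inner integral is at least the mass of the small
  ball divided by \<open>cc * \<sigma>\<close>; integrating \<open>1 / \<sigma>\<close> gives the
  logarithm. This converts bounds for means into bounds for mass.\<close>

lemma mass_lower:
  assumes s: "0 < s" "s \<le> S" and pos: "\<And>x. dist w x < S \<Longrightarrow> lap f x \<ge> 0"
  shows "lap_mass f (ball w (sqrt \<kappa> * s)) * ennreal (ln (S / s) / cc) \<le> ennreal (T S f w - T s f w)"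
proof -
  let ?M = "lap_mass f (ball w (sqrt \<kappa> * s))"
  have "?M * ennreal (ln (S / s) / cc) = ?M * ennreal (1 / cc) * (\<integral>\<^sup>+\<sigma>. ennreal (1 / \<sigma>) * indicator {s..S} \<sigma> \<partial>lborel)"
    using cc_pos s by (subst nn_integral_inverse_Icc[OF s]) (simp add: mult.assoc ennreal_mult'[symmetric])
  also have "\<dots> = (\<integral>\<^sup>+\<sigma>. indicator {s..S} \<sigma> * (?M * ennreal (1 / cc) * ennreal (1 / \<sigma>)) \<partial>lborel)"
    by (subst nn_integral_cmult[symmetric]) (auto simp: ac_simps)
  also have "\<dots> \<le> (\<integral>\<^sup>+\<sigma>. indicator {s..S} \<sigma> * (\<integral>\<^sup>+z. ennreal (\<sigma> * Psi z) * ennreal (lap f (w + \<sigma> *\<^sub>R z)) \<partial>lborel) \<partial>lborel)"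
  proof (intro nn_integral_mono)
    fix \<sigma>
    show "indicator {s..S} \<sigma> * (?M * ennreal (1 / cc) * ennreal (1 / \<sigma>)) \<le> indicator {s..S} \<sigma> * (\<integral>\<^sup>+z. ennreal (\<sigma> * Psi z) * ennreal (lap f (w + \<sigma> *\<^sub>R z)) \<partial>lborel)"
    proof (cases "\<sigma> \<in> {s..S}")
      case True
      then have \<sigma>: "0 < \<sigma>" "s \<le> \<sigma>" using s by auto
      have "?M * ennreal (1 / cc) * ennreal (1 / \<sigma>) \<le> lap_mass f (ball w (\<sigma> * sqrt \<kappa>)) * ennreal (1 / cc) * ennreal (1 / \<sigma>)"
        using \<sigma> k0 by (intro mult_right_mono lap_mass_mono subset_ball) (auto simp: mult.commute mult_left_mono)
      also have "\<dots> = ennreal (\<sigma> / cc) * (ennreal (1 / \<sigma>\<^sup>2) * lap_mass f (ball w (\<sigma> * sqrt \<kappa>)))"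
      proof -
        have "ennreal (\<sigma> / cc) * ennreal (1 / \<sigma>\<^sup>2) = ennreal (1 / cc) * ennreal (1 / \<sigma>)"
          using \<sigma> cc_pos by (simp add: ennreal_mult[symmetric] power2_eq_square)
        then show ?thesis by (metis mult.assoc mult.commute)
      qed
      also have "\<dots> = ennreal (\<sigma> / cc) * (\<integral>\<^sup>+z. ennreal (lap f (w + \<sigma> *\<^sub>R z)) * indicator (ball 0 (sqrt \<kappa>)) z \<partial>lborel)"
        using \<sigma> k0 by (subst scale_ball) auto
      also have "\<dots> = (\<integral>\<^sup>+z. ennreal (\<sigma> / cc) * (ennreal (lap f (w + \<sigma> *\<^sub>R z)) * indicator (ball 0 (sqrt \<kappa>)) z) \<partial>lborel)"
        by (subst nn_integral_cmult) measurable
      also have "\<dots> \<le> (\<integral>\<^sup>+z. ennreal (\<sigma> * Psi z) * ennreal (lap f (w + \<sigma> *\<^sub>R z)) \<partial>lborel)"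
      proof (intro nn_integral_mono)
        fix z
        show "ennreal (\<sigma> / cc) * (ennreal (lap f (w + \<sigma> *\<^sub>R z)) * indicator (ball 0 (sqrt \<kappa>)) z) \<le> ennreal (\<sigma> * Psi z) * ennreal (lap f (w + \<sigma> *\<^sub>R z))"
        proof (cases "cmod z < sqrt \<kappa>")
          case True
          then have "sqn z \<le> \<kappa>" unfolding sqn_def using real_le_rsqrt real_sqrt_le_iff k0
            by (smt (verit) norm_ge_zero power2_le_imp_le real_sqrt_pow2 power_mono)
          then show ?thesis by (simp add: Psi_in True)
        qed simp
      qed
      finally show ?thesis using True by simp
    qed simp
  qed
  also have "\<dots> = ennreal (T S f w - T s f w)"
    using T_nn(2)[OF f _ s(2) pos] s(1) by simp
  finally show ?thesis .
qed

text \<open>The converse device: \<open>Psi\<close> is at most \<open>1 / cc\<close> and lives on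
  the unit disc, so as the scale shrinks the mean falls at most logarithmically, with the mass as
  slope.\<close>

lemma mass_upper:
  assumes s: "0 < s" "s \<le> S" and pos: "\<And>x. dist w x < S \<Longrightarrow> lap f x \<ge> 0"
  shows "ennreal (T S f w - T s f w) \<le> lap_mass f (ball w S) * ennreal (ln (S / s) / cc)"
proof -
  let ?M = "lap_mass f (ball w S)"
  have "ennreal (T S f w - T s f w) = (\<integral>\<^sup>+\<sigma>. indicator {s..S} \<sigma> * (\<integral>\<^sup>+z. ennreal (\<sigma> * Psi z) * ennreal (lap f (w + \<sigma> *\<^sub>R z)) \<partial>lborel) \<partial>lborel)"
    using T_nn(2)[OF f _ s(2) pos] s(1) by simp
  also have "\<dots> \<le> (\<integral>\<^sup>+\<sigma>. indicator {s..S} \<sigma> * (?M * ennreal (1 / cc) * ennreal (1 / \<sigma>)) \<partial>lborel)"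
  proof (intro nn_integral_mono)
    fix \<sigma>
    show "indicator {s..S} \<sigma> * (\<integral>\<^sup>+z. ennreal (\<sigma> * Psi z) * ennreal (lap f (w + \<sigma> *\<^sub>R z)) \<partial>lborel) \<le> indicator {s..S} \<sigma> * (?M * ennreal (1 / cc) * ennreal (1 / \<sigma>))"
    proof (cases "\<sigma> \<in> {s..S}")
      case True
      then have \<sigma>: "0 < \<sigma>" "\<sigma> \<le> S" using s by auto
      have "(\<integral>\<^sup>+z. ennreal (\<sigma> * Psi z) * ennreal (lap f (w + \<sigma> *\<^sub>R z)) \<partial>lborel)
        \<le> (\<integral>\<^sup>+z. ennreal (\<sigma> / cc) * (ennreal (lap f (w + \<sigma> *\<^sub>R z)) * indicator (ball 0 1) z) \<partial>lborel)"
      proof (intro nn_integral_mono)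
        fix z
        show "ennreal (\<sigma> * Psi z) * ennreal (lap f (w + \<sigma> *\<^sub>R z)) \<le> ennreal (\<sigma> / cc) * (ennreal (lap f (w + \<sigma> *\<^sub>R z)) * indicator (ball 0 1) z)"
        proof (cases "cmod z < 1")
          case True
          have "\<sigma> * Psi z \<le> \<sigma> / cc" using mult_left_mono[OF Psi_le, of \<sigma> z] \<sigma> by simp
          then show ?thesis using True by (auto intro!: mult_right_mono ennreal_leI)
        qed (simp add: Psi_zero)
      qed
      also have "\<dots> = ennreal (\<sigma> / cc) * (ennreal (1 / \<sigma>\<^sup>2) * lap_mass f (ball w (\<sigma> * 1)))"
        by (subst nn_integral_cmult, measurable) (simp only: scale_ball[OF \<sigma>(1) zero_less_one])
      also have "\<dots> = lap_mass f (ball w \<sigma>) * ennreal (1 / cc) * ennreal (1 / \<sigma>)"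
      proof -
        have "ennreal (\<sigma> / cc) * ennreal (1 / \<sigma>\<^sup>2) = ennreal (1 / cc) * ennreal (1 / \<sigma>)"
          using \<sigma> cc_pos by (simp add: ennreal_mult[symmetric] power2_eq_square)
        then show ?thesis by (metis mult.assoc mult.commute mult_1_right)
      qed
      also have "\<dots> \<le> ?M * ennreal (1 / cc) * ennreal (1 / \<sigma>)"
        using \<sigma> by (intro mult_right_mono lap_mass_mono subset_ball) auto
      finally show ?thesis using True by simp
    qed simp
  qed
  also have "\<dots> = ?M * ennreal (1 / cc) * (\<integral>\<^sup>+\<sigma>. ennreal (1 / \<sigma>) * indicator {s..S} \<sigma> \<partial>lborel)"
    by (subst nn_integral_cmult[symmetric]) (auto simp: ac_simps)
  also have "\<dots> = ?M * ennreal (ln (S / s) / cc)"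
    using cc_pos s by (subst nn_integral_inverse_Icc[OF s]) (simp add: mult.assoc ennreal_mult'[symmetric])
  finally show ?thesis .
qed

text \<open>Integrating the representation over \<open>w\<close> first merely translates the
  Laplacian by at most \<open>s\<close>, so only the mass of the larger ball is seen; what remains
  is the integral of \<sigma> over \<open>{0..s}\<close>, bounded by s^2. It quantifies that
  \<open>f\<close> lies far below its means only on a small set.\<close>

lemma integral_excess:
  assumes s: "0 \<le> s" "0 < r" and pos: "\<And>x. dist a x < r + s \<Longrightarrow> lap f x \<ge> 0"
  shows "(\<integral>\<^sup>+w. ennreal (T s f w - f w) * indicator (ball a r) w \<partial>lborel) \<le> lap_mass f (ball a (r + s)) * ennreal (s\<^sup>2 * (\<integral>z. Psi z \<partial>lborel))"
proof -
  let ?M = "lap_mass f (ball a (r + s))"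
  have shift: "(\<integral>\<^sup>+w. ennreal (lap f (w + \<sigma> *\<^sub>R z)) * indicator (ball a r) w \<partial>lborel) \<le> ?M"
    if "0 \<le> \<sigma>" "\<sigma> \<le> s" "cmod z \<le> 1" for \<sigma> z
  proof -
    have "dist a (w + \<sigma> *\<^sub>R z) < r + s" if "dist a w < r" for w
    proof -
      have "\<sigma> * cmod z \<le> s" using \<open>0 \<le> \<sigma>\<close> \<open>\<sigma> \<le> s\<close> \<open>cmod z \<le> 1\<close>
        by (metis mult_left_le order_trans)
      moreover have "dist w (w + \<sigma> *\<^sub>R z) = \<sigma> * cmod z" using \<open>0 \<le> \<sigma>\<close> by (simp add: dist_norm)
      ultimately show ?thesis using that dist_triangle[of a "w + \<sigma> *\<^sub>R z" w] by linarith
    qed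
    then have "(\<integral>\<^sup>+w. ennreal (lap f (w + \<sigma> *\<^sub>R z)) * indicator (ball a r) w \<partial>lborel)
      \<le> (\<integral>\<^sup>+w. (\<lambda>x. ennreal (lap f x) * indicator (ball a (r + s)) x) (w + \<sigma> *\<^sub>R z) \<partial>lborel)"
      by (intro nn_integral_mono) (auto simp: indicator_def)
    also have "\<dots> = ?M" unfolding lap_mass_def by (rule nn_integral_translate) measurable
    finally show ?thesis .
  qed
  have "(\<integral>\<^sup>+w. ennreal (T s f w - f w) * indicator (ball a r) w \<partial>lborel)
    \<le> (\<integral>\<^sup>+w. (\<integral>\<^sup>+\<sigma>. (\<integral>\<^sup>+z. indicator {0..s} \<sigma> * ennreal (\<sigma> * Psi z) * (ennreal (lap f (w + \<sigma> *\<^sub>R z)) * indicator (ball a r) w) \<partial>lborel) \<partial>lborel) \<partial>lborel)"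
  proof (intro nn_integral_mono)
    fix w
    show "ennreal (T s f w - f w) * indicator (ball a r) w \<le> (\<integral>\<^sup>+\<sigma>. (\<integral>\<^sup>+z. indicator {0..s} \<sigma> * ennreal (\<sigma> * Psi z) * (ennreal (lap f (w + \<sigma> *\<^sub>R z)) * indicator (ball a r) w) \<partial>lborel) \<partial>lborel)"
    proof (cases "w \<in> ball a r")
      case True
      have p: "lap f x \<ge> 0" if "dist w x < s" for x
        using True that dist_triangle[of a x w] by (intro pos) auto
      have "ennreal (T s f w - f w) = (\<integral>\<^sup>+\<sigma>. indicator {0..s} \<sigma> * (\<integral>\<^sup>+z. ennreal (\<sigma> * Psi z) * ennreal (lap f (w + \<sigma> *\<^sub>R z)) \<partial>lborel) \<partial>lborel)"
        using T_nn(2)[OF f order_refl s(1) p] by (simp add: T_0)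
      also have "\<dots> = (\<integral>\<^sup>+\<sigma>. (\<integral>\<^sup>+z. indicator {0..s} \<sigma> * (ennreal (\<sigma> * Psi z) * ennreal (lap f (w + \<sigma> *\<^sub>R z))) \<partial>lborel) \<partial>lborel)"
        by (subst nn_integral_cmult) measurable
      finally show ?thesis using True by (simp add: mult.assoc)
    qed simp
  qed
  also have "\<dots> = (\<integral>\<^sup>+\<sigma>. (\<integral>\<^sup>+z. (\<integral>\<^sup>+w. indicator {0..s} \<sigma> * ennreal (\<sigma> * Psi z) * (ennreal (lap f (w + \<sigma> *\<^sub>R z)) * indicator (ball a r) w) \<partial>lborel) \<partial>lborel) \<partial>lborel)"
    by (subst lborel_pair.Fubini', measurable) (rule nn_integral_cong, rule lborel_pair.Fubini', measurable)
  also have "\<dots> = (\<integral>\<^sup>+\<sigma>. (\<integral>\<^sup>+z. indicator {0..s} \<sigma> * ennreal (\<sigma> * Psi z) * (\<integral>\<^sup>+w. ennreal (lap f (w + \<sigma> *\<^sub>R z)) * indicator (ball a r) w \<partial>lborel) \<partial>lborel) \<partial>lborel)"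
    by (subst nn_integral_cmult) measurable
  also have "\<dots> \<le> (\<integral>\<^sup>+\<sigma>. (\<integral>\<^sup>+z. (indicator {0..s} \<sigma> * ennreal s) * (ennreal (Psi z) * ?M) \<partial>lborel) \<partial>lborel)"
  proof (intro nn_integral_mono)
    fix \<sigma> :: real and z
    show "indicator {0..s} \<sigma> * ennreal (\<sigma> * Psi z) * (\<integral>\<^sup>+w. ennreal (lap f (w + \<sigma> *\<^sub>R z)) * indicator (ball a r) w \<partial>lborel) \<le> (indicator {0..s} \<sigma> * ennreal s) * (ennreal (Psi z) * ?M)"
    proof (cases "\<sigma> \<in> {0..s} \<and> cmod z < 1")
      case True
      then have "ennreal (\<sigma> * Psi z) \<le> ennreal s * ennreal (Psi z)"
        using s Psi_nonneg[of z] by (auto simp: ennreal_mult'[symmetric] intro!: ennreal_leI mult_right_mono)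
      then have "ennreal (\<sigma> * Psi z) * (\<integral>\<^sup>+w. ennreal (lap f (w + \<sigma> *\<^sub>R z)) * indicator (ball a r) w \<partial>lborel) \<le> (ennreal s * ennreal (Psi z)) * ?M"
        by (rule mult_mono) (use shift[of \<sigma> z] True in auto)
      then show ?thesis using True by (simp add: mult.assoc)
    qed (auto simp: Psi_zero)
  qed
  also have "\<dots> = ?M * ennreal (s\<^sup>2 * (\<integral>z. Psi z \<partial>lborel))"
  proof -
    have "(\<integral>\<^sup>+z. ennreal (Psi z) * ?M \<partial>lborel) = ennreal (\<integral>z. Psi z \<partial>lborel) * ?M"
      by (subst nn_integral_multc, measurable)
         (subst nn_integral_eq_integral[OF csupp_integrable[OF cont_Psi csupp_Psi]], auto simp: Psi_nonneg)
    then have "(\<integral>\<^sup>+\<sigma>. (\<integral>\<^sup>+z. (indicator {0..s} \<sigma> * ennreal s) * (ennreal (Psi z) * ?M) \<partial>lborel) \<partial>lborel)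
      = (\<integral>\<^sup>+\<sigma>. indicator {0..s} \<sigma> * (ennreal s * (ennreal (\<integral>z. Psi z \<partial>lborel) * ?M)) \<partial>lborel)"
      by (subst nn_integral_cmult) (auto simp: mult.assoc)
    also have "\<dots> = ennreal s * (ennreal s * (ennreal (\<integral>z. Psi z \<partial>lborel) * ?M))"
      using s by (subst nn_integral_multc) auto
    finally show ?thesis using s Psi_nonneg
      by (simp add: power2_eq_square ennreal_mult' mult.assoc mult.commute mult.left_commute)
  qed
  finally show ?thesis .
qed

text \<open>The previous bound at scale \<rho>, weighted by \<open>beta\<close>. Only the ratio
  \<open>s / \<rho>\<close> enters the factor, so for \<rho> = \<open>s\<close>, as in
  \<open>lap_mass_U\<close>, it does not depend on the scale.\<close>

lemma T_excess:
  assumes s: "0 \<le> s" "0 < \<rho>" and pos: "\<And>x. dist a x < \<rho> + s \<Longrightarrow> lap f x \<ge> 0" and B: "\<And>z. beta z \<le> B"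
  shows "(\<integral>\<^sup>+z. ennreal (beta z) * ennreal (T s f (a + \<rho> *\<^sub>R z) - f (a + \<rho> *\<^sub>R z)) \<partial>lborel)
    \<le> ennreal (B * (s\<^sup>2 / \<rho>\<^sup>2) * (\<integral>z. Psi z \<partial>lborel)) * lap_mass f (ball a (\<rho> + s))"
proof -
  have B0: "B \<ge> 0" using B[of 0] beta_nonneg[of 0] by linarith
  have [measurable]: "f \<in> borel_measurable borel"
    using Ck_cont[OF f] by (simp add: borel_measurable_continuous_onI)
  have "(\<lambda>w. \<integral>z. f (w + s *\<^sub>R z) * beta z \<partial>lborel) \<in> borel_measurable borel"
    by measurable
  then have [measurable]: "T s f \<in> borel_measurable borel"
    by (simp add: T_def[abs_def])
  have "(\<integral>\<^sup>+z. ennreal (beta z) * ennreal (T s f (a + \<rho> *\<^sub>R z) - f (a + \<rho> *\<^sub>R z)) \<partial>lborel)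
    \<le> (\<integral>\<^sup>+z. ennreal B * (\<lambda>x. ennreal (T s f x - f x) * indicator (ball a \<rho>) x) (a + \<rho> *\<^sub>R z) \<partial>lborel)"
  proof (intro nn_integral_mono)
    fix z
    show "ennreal (beta z) * ennreal (T s f (a + \<rho> *\<^sub>R z) - f (a + \<rho> *\<^sub>R z)) \<le> ennreal B * (\<lambda>x. ennreal (T s f x - f x) * indicator (ball a \<rho>) x) (a + \<rho> *\<^sub>R z)"
      using s B beta_zero[of z] by (cases "cmod z < 1") (auto simp: dist_norm intro!: mult_right_mono ennreal_leI)
  qed
  also have "\<dots> = ennreal B * (ennreal (1 / \<rho>\<^sup>2) * (\<integral>\<^sup>+w. ennreal (T s f w - f w) * indicator (ball a \<rho>) w \<partial>lborel))"
    by (subst nn_integral_cmult, measurable) (subst nn_integral_affine_complex, measurable, use s in auto)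
  also have "\<dots> \<le> ennreal B * (ennreal (1 / \<rho>\<^sup>2) * (lap_mass f (ball a (\<rho> + s)) * ennreal (s\<^sup>2 * (\<integral>z. Psi z \<partial>lborel))))"
    by (intro mult_left_mono integral_excess s pos) auto
  also have "\<dots> = ennreal (B * (s\<^sup>2 / \<rho>\<^sup>2) * (\<integral>z. Psi z \<partial>lborel)) * lap_mass f (ball a (\<rho> + s))"
  proof -
    have "B * (s\<^sup>2 / \<rho>\<^sup>2) * (\<integral>z. Psi z \<partial>lborel) = B * ((1 / \<rho>\<^sup>2) * (s\<^sup>2 * (\<integral>z. Psi z \<partial>lborel)))" by simp
    moreover have "ennreal (B * ((1 / \<rho>\<^sup>2) * (s\<^sup>2 * (\<integral>z. Psi z \<partial>lborel)))) = ennreal B * (ennreal (1 / \<rho>\<^sup>2) * ennreal (s\<^sup>2 * (\<integral>z. Psi z \<partial>lborel)))"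
      using B0 by (simp only: ennreal_mult' zero_le_power2 zero_le_divide_1_iff)
    ultimately show ?thesis by (simp only: mult.assoc) (simp only: mult.commute mult.left_commute)
  qed
  finally show ?thesis .
qed

end

declare meas_lap[measurable del]

text \<open>After expansion by \<open>T_nn\<close>, either side integrates one Laplacian against the
  other at displacement \<open>\<sigma> *\<^sub>R z\<close>, with weight
  \<open>\<sigma> * Psi z\<close>. Translation by the displacement exchanges \<open>f\<close> and
  \<open>U\<close>, evenness of \<open>Psi\<close> restores its sign, and the ball grows by
  \<open>d\<close> because the displacement is at most \<open>d\<close>. This stands for the
  symmetry of the Green kernel.\<close>

lemma symmetry_ineq:
  assumes f: "Ck (Suc (Suc 0)) f" and U: "Ck (Suc (Suc 0)) U" and rd: "0 < r" "0 < d"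
    and pf: "\<And>x. dist a x < r + 2 * d \<Longrightarrow> lap f x \<ge> 0" and pU: "\<And>x. dist a x < r + 2 * d \<Longrightarrow> lap U x \<ge> 0"
  shows "(\<integral>\<^sup>+w. ennreal (lap f w) * ennreal (T d U w - U w) * indicator (ball a r) w \<partial>lborel)
    \<le> (\<integral>\<^sup>+y. ennreal (lap U y) * ennreal (T d f y - f y) * indicator (ball a (r + d)) y \<partial>lborel)"
proof -
  note meas_lap[OF f, measurable] meas_lap[OF U, measurable]
  have ball: "dist a y < r + d" "dist a (y - \<sigma> *\<^sub>R z) < r + 2 * d" if "dist a (y - \<sigma> *\<^sub>R z) < r" "0 \<le> \<sigma>" "\<sigma> \<le> d" "cmod z < 1" for y z \<sigma>
  proof -
    have "\<sigma> * cmod z \<le> d" using that by (metis less_imp_le mult_left_le order_trans)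
    moreover have "dist (y - \<sigma> *\<^sub>R z) y = \<sigma> * cmod z" using that by (simp add: dist_norm)
    ultimately show "dist a y < r + d" using that dist_triangle[of a y "y - \<sigma> *\<^sub>R z"] by linarith
    show "dist a (y - \<sigma> *\<^sub>R z) < r + 2 * d" using that rd by linarith
  qed
  have expand: "ennreal (lap g w) * ennreal (T d h w - h w) * indicator (ball a q) w =
     (\<integral>\<^sup>+\<sigma>. (\<integral>\<^sup>+z. indicator {0..d} \<sigma> * ennreal (\<sigma> * Psi z) * (ennreal (lap g w) * ennreal (lap h (w + \<sigma> *\<^sub>R z)) * indicator (ball a q) w) \<partial>lborel) \<partial>lborel)"
    if h: "Ck (Suc (Suc 0)) h" and ph: "\<And>x. dist a x < r + 2 * d \<Longrightarrow> lap h x \<ge> 0" and q: "q \<le> r + d" for g h w q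
  proof (cases "w \<in> ball a q")
    case True
    note meas_lap[OF h, measurable]
    have p: "lap h x \<ge> 0" if "dist w x < d" for x
      using True that dist_triangle[of a x w] q by (intro ph) auto
    have "ennreal (lap g w) * ennreal (T d h w - h w) = ennreal (lap g w) * (\<integral>\<^sup>+\<sigma>. indicator {0..d} \<sigma> * (\<integral>\<^sup>+z. ennreal (\<sigma> * Psi z) * ennreal (lap h (w + \<sigma> *\<^sub>R z)) \<partial>lborel) \<partial>lborel)"
      using T_nn(2)[OF h order_refl _ p] rd by (simp add: T_0)
    also have "\<dots> = (\<integral>\<^sup>+\<sigma>. ennreal (lap g w) * (indicator {0..d} \<sigma> * (\<integral>\<^sup>+z. ennreal (\<sigma> * Psi z) * ennreal (lap h (w + \<sigma> *\<^sub>R z)) \<partial>lborel)) \<partial>lborel)"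
      by (rule nn_integral_cmult[symmetric]) measurable
    also have "\<dots> = (\<integral>\<^sup>+\<sigma>. (\<integral>\<^sup>+z. (ennreal (lap g w) * indicator {0..d} \<sigma>) * (ennreal (\<sigma> * Psi z) * ennreal (lap h (w + \<sigma> *\<^sub>R z))) \<partial>lborel) \<partial>lborel)"
      by (rule nn_integral_cong, subst nn_integral_cmult) (measurable, simp add: mult.assoc)
    finally show ?thesis using True by (simp add: ac_simps)
  qed simp
  have "(\<integral>\<^sup>+w. ennreal (lap f w) * ennreal (T d U w - U w) * indicator (ball a r) w \<partial>lborel)
    = (\<integral>\<^sup>+w. (\<integral>\<^sup>+\<sigma>. (\<integral>\<^sup>+z. indicator {0..d} \<sigma> * ennreal (\<sigma> * Psi z) * (ennreal (lap f w) * ennreal (lap U (w + \<sigma> *\<^sub>R z)) * indicator (ball a r) w) \<partial>lborel) \<partial>lborel) \<partial>lborel)"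
    by (intro nn_integral_cong expand U pU) (use rd in auto)
  also have "\<dots> = (\<integral>\<^sup>+\<sigma>. (\<integral>\<^sup>+z. (\<integral>\<^sup>+w. indicator {0..d} \<sigma> * ennreal (\<sigma> * Psi z) * (ennreal (lap f w) * ennreal (lap U (w + \<sigma> *\<^sub>R z)) * indicator (ball a r) w) \<partial>lborel) \<partial>lborel) \<partial>lborel)"
    by (subst lborel_pair.Fubini', measurable) (rule nn_integral_cong, rule lborel_pair.Fubini', measurable)
  also have "\<dots> \<le> (\<integral>\<^sup>+\<sigma>. (\<integral>\<^sup>+z. (\<integral>\<^sup>+y. indicator {0..d} \<sigma> * ennreal (\<sigma> * Psi z) * (ennreal (lap U y) * ennreal (lap f (y - \<sigma> *\<^sub>R z)) * indicator (ball a (r + d)) y) \<partial>lborel) \<partial>lborel) \<partial>lborel)"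
  proof (rule nn_integral_mono, rule nn_integral_mono)
    fix \<sigma> :: real and z
    have "(\<integral>\<^sup>+w. indicator {0..d} \<sigma> * ennreal (\<sigma> * Psi z) * (ennreal (lap f w) * ennreal (lap U (w + \<sigma> *\<^sub>R z)) * indicator (ball a r) w) \<partial>lborel)
      = (\<integral>\<^sup>+w. (\<lambda>y. indicator {0..d} \<sigma> * ennreal (\<sigma> * Psi z) * (ennreal (lap f (y - \<sigma> *\<^sub>R z)) * ennreal (lap U y) * indicator (ball a r) (y - \<sigma> *\<^sub>R z))) (w + \<sigma> *\<^sub>R z) \<partial>lborel)"
      by simp
    also have "\<dots> = (\<integral>\<^sup>+y. indicator {0..d} \<sigma> * ennreal (\<sigma> * Psi z) * (ennreal (lap f (y - \<sigma> *\<^sub>R z)) * ennreal (lap U y) * indicator (ball a r) (y - \<sigma> *\<^sub>R z)) \<partial>lborel)"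
      by (rule nn_integral_translate) measurable
    also have "\<dots> \<le> (\<integral>\<^sup>+y. indicator {0..d} \<sigma> * ennreal (\<sigma> * Psi z) * (ennreal (lap U y) * ennreal (lap f (y - \<sigma> *\<^sub>R z)) * indicator (ball a (r + d)) y) \<partial>lborel)"
    proof (intro nn_integral_mono)
      fix y
      show "indicator {0..d} \<sigma> * ennreal (\<sigma> * Psi z) * (ennreal (lap f (y - \<sigma> *\<^sub>R z)) * ennreal (lap U y) * indicator (ball a r) (y - \<sigma> *\<^sub>R z))
        \<le> indicator {0..d} \<sigma> * ennreal (\<sigma> * Psi z) * (ennreal (lap U y) * ennreal (lap f (y - \<sigma> *\<^sub>R z)) * indicator (ball a (r + d)) y)"
        using ball(1)[of y \<sigma> z] by (cases "\<sigma> \<in> {0..d} \<and> cmod z < 1") (auto simp: indicator_def Psi_zero mult.commute)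
    qed
    finally show "(\<integral>\<^sup>+w. indicator {0..d} \<sigma> * ennreal (\<sigma> * Psi z) * (ennreal (lap f w) * ennreal (lap U (w + \<sigma> *\<^sub>R z)) * indicator (ball a r) w) \<partial>lborel)
      \<le> (\<integral>\<^sup>+y. indicator {0..d} \<sigma> * ennreal (\<sigma> * Psi z) * (ennreal (lap U y) * ennreal (lap f (y - \<sigma> *\<^sub>R z)) * indicator (ball a (r + d)) y) \<partial>lborel)" .
  qed
  also have "\<dots> = (\<integral>\<^sup>+\<sigma>. (\<integral>\<^sup>+z. (\<lambda>z. (\<integral>\<^sup>+y. indicator {0..d} \<sigma> * ennreal (\<sigma> * Psi z) * (ennreal (lap U y) * ennreal (lap f (y + \<sigma> *\<^sub>R z)) * indicator (ball a (r + d)) y) \<partial>lborel)) (- z) \<partial>lborel) \<partial>lborel)"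
    by (simp add: Psi_even)
  also have "\<dots> = (\<integral>\<^sup>+\<sigma>. (\<integral>\<^sup>+z. (\<integral>\<^sup>+y. indicator {0..d} \<sigma> * ennreal (\<sigma> * Psi z) * (ennreal (lap U y) * ennreal (lap f (y + \<sigma> *\<^sub>R z)) * indicator (ball a (r + d)) y) \<partial>lborel) \<partial>lborel) \<partial>lborel)"
    by (intro nn_integral_cong nn_integral_isometry) (auto simp: linear_uminus[unfolded uminus_apply] intro!: linearI) 
  also have "\<dots> = (\<integral>\<^sup>+y. (\<integral>\<^sup>+\<sigma>. (\<integral>\<^sup>+z. indicator {0..d} \<sigma> * ennreal (\<sigma> * Psi z) * (ennreal (lap U y) * ennreal (lap f (y + \<sigma> *\<^sub>R z)) * indicator (ball a (r + d)) y) \<partial>lborel) \<partial>lborel) \<partial>lborel)"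
    by (subst lborel_pair.Fubini'[symmetric], measurable) (rule nn_integral_cong, rule lborel_pair.Fubini'[symmetric], measurable)
  also have "\<dots> = (\<integral>\<^sup>+y. ennreal (lap U y) * ennreal (T d f y - f y) * indicator (ball a (r + d)) y \<partial>lborel)"
    by (intro nn_integral_cong expand[symmetric] f pf) (use rd in auto)
  finally show ?thesis .
qed

text \<open>If the Laplacian were negative at \<open>w\<close>, then \<open>g = - f\<close> would
  have positive Laplacian near \<open>w\<close>. There \<open>mass_lower\<close> makes the mean of
  \<open>g\<close> strictly increasing in the scale and above \<open>g w\<close>, while the
  hypothesis puts the mean of \<open>g\<close> below \<open>g w\<close>; so the mass of a small ball
  would vanish.\<close>

lemma lap_nonneg_if_submean:
  assumes f: "Ck (Suc (Suc 0)) f" and d: "d > 0" and sm: "\<And>s. 0 < s \<Longrightarrow> s < d \<Longrightarrow> f w \<le> T s f w"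
  shows "lap f w \<ge> 0"
proof (rule ccontr)
  assume neg: "\<not> lap f w \<ge> 0"
  define g where "g x = - f x" for x
  have g: "Ck (Suc (Suc 0)) g" unfolding g_def by (rule Ck_minus[OF f])
  have dr_neg: "dr e (\<lambda>x. - h x) x = - dr e h x" if "Ck (Suc n) h" for e h n and x :: complex
    by (rule dr_eqI) (intro has_derivative_minus Ck_derivative[OF that])
  have lg: "lap g x = - lap f x" for x
  proof -
    have "dr e g = (\<lambda>x. - dr e f x)" for e unfolding g_def by (rule ext) (rule dr_neg[OF Ck_SucD[OF f]])
    then show ?thesis unfolding lap_def by (simp add: dr_neg[OF Ck_dr[OF f]])
  qed
  have cl: "continuous_on UNIV (lap g)" by (rule Ck_lap_cont[OF g])
  have "open {x. lap g x > 0}" by (intro open_Collect_less continuous_intros cl)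
  moreover have "w \<in> {x. lap g x > 0}" using neg lg by simp
  ultimately obtain r where r: "r > 0" "ball w r \<subseteq> {x. lap g x > 0}" using open_contains_ball by blast
  define S where "S = min r d / 2"
  have S: "0 < S" "S < r" "S < d" using r(1) d by (auto simp: S_def min_def)
  define s where "s = S / 2"
  have s: "0 < s" "s < S" using S by (auto simp: s_def)
  have p: "lap g x \<ge> 0" if "dist w x < S" for x
    using r(2) that S by (force simp: subset_eq less_imp_le)
  have neg': "T t g w = - T t f w" for t unfolding T_def g_def by simp
  have "lap_mass g (ball w (sqrt \<kappa> * s)) * ennreal (ln (S / s) / cc) \<le> ennreal (T S g w - T s g w)"
    by (rule mass_lower[OF g s(1) less_imp_le[OF s(2)] p])
  moreover have "T S g w \<le> g w" using sm[of S] S neg'[of S] by (simp add: g_def)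
  moreover have "g w \<le> T s g w"
    using T_nn(1)[OF g order_refl, of s w] s S p by (simp add: T_0)
  ultimately have z: "lap_mass g (ball w (sqrt \<kappa> * s)) * ennreal (ln (S / s) / cc) = 0" by (simp add: ennreal_neg)
  have "ln (S / s) / cc > 0" using s S cc_pos by (simp add: s_def)
  then have "lap_mass g (ball w (sqrt \<kappa> * s)) = 0" using z by (simp add: ennreal_eq_0_iff)
  then have "AE x in lborel. ennreal (lap g x) * indicator (ball w (sqrt \<kappa> * s)) x = 0"
    unfolding lap_mass_def by (subst (asm) nn_integral_0_iff_AE) (use meas_lap[OF g] in \<open>measurable\<close>)
  moreover have "\<And>x. x \<in> ball w (sqrt \<kappa> * s) \<longrightarrow> lap g x > 0"
  proof
    fix x assume that: "x \<in> ball w (sqrt \<kappa> * s)"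
    have "sqrt \<kappa> * s \<le> s" using k0 k1 s mult_left_le_one_le[of s "sqrt \<kappa>"] by simp
    moreover have "dist w x < sqrt \<kappa> * s" using that by simp
    ultimately have "dist w x < r" using s S by linarith
    then show "lap g x > 0" using r(2) by (force simp: subset_eq)
  qed
  ultimately have "AE x in lborel. x \<notin> ball w (sqrt \<kappa> * s)"
    by (elim AE_mp) (intro AE_I2, force simp: ennreal_eq_0_iff indicator_def not_le)
  then have "emeasure lborel (ball w (sqrt \<kappa> * s)) = 0"
    by (subst (asm) AE_iff_measurable[OF _ refl]) (auto simp: ball_def)
  then show False using content_ball_pos[of "sqrt \<kappa> * s" w] s k0 by (simp add: measure_def)
qed

end

section \<open>Rotation-invariant smooth plurisubharmonic functions\<close>

lemma has_derivative_graph: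
  fixes V :: "c2 \<Rightarrow> real"
  assumes V: "Ck (Suc n) V" and Z: "Ck (Suc n) Z"
  shows "((\<lambda>w. V (complex_of_real (Z w), w)) has_derivative
     (\<lambda>e. dr dx1 V (complex_of_real (Z w), w) * dr e Z w + dr (0, e) V (complex_of_real (Z w), w))) (at w)"
proof -
  have "((\<lambda>w. (complex_of_real (Z w), w)) has_derivative (\<lambda>e. (complex_of_real (dr e Z w), e))) (at w)"
    by (intro has_derivative_Pair has_derivative_ident has_derivative_of_real Ck_derivative[OF Z])
  from diff_chain_at[OF this Ck_derivative[OF V]]
  have D: "((\<lambda>w. V (complex_of_real (Z w), w)) has_derivative (\<lambda>e. dr (complex_of_real (dr e Z w), e) V (complex_of_real (Z w), w))) (at w)"
    by (simp add: o_def)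
  have "(complex_of_real r, e) = r *\<^sub>R dx1 + (0, e)" for r and e :: complex by (simp add: dx1_def scaleR_conv_of_real)
  then show ?thesis using D by (simp add: dr_add_dir[OF V] dr_scale_dir[OF V] mult.commute)
qed

lemma Ck_graph:
  fixes V :: "c2 \<Rightarrow> real"
  shows "Ck n V \<Longrightarrow> Ck n Z \<Longrightarrow> Ck n (\<lambda>w. V (complex_of_real (Z w), w))"
proof (induction n arbitrary: V)
  case 0
  then show ?case
    by (auto intro!: continuous_on_compose2[of UNIV V] continuous_intros)
next
  case (Suc n)
  show ?case
    by (rule Ck_SucI[OF has_derivative_graph[OF Suc.prems]])
      (intro Ck_add Ck_mult Suc.IH Ck_SucD[OF Suc.prems(2)] Ck_dr[OF Suc.prems(1)] Ck_dr[OF Suc.prems(2)])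
qed

text \<open>The model for V is a mollification of max(u, -j) minus an upper bound of u.\<close>

locale smooth_inv =
  fixes V :: "c2 \<Rightarrow> real" and a b C :: real
  assumes smooth: "\<And>n. Ck n V"
    and rot: "\<And>\<theta> z w. V (cis \<theta> * z, w) = V (z, w)"
    and nonpos: "\<And>p. V p \<le> 0"
    and a0: "0 < a" and ab: "a < b" and C0: "0 \<le> C"
    and psh: "\<And>p B. cmod (fst p) < b \<Longrightarrow> cmod (snd p) < b \<Longrightarrow>
        dr B (dr B V) p + dr (cmul \<i> B) (dr (cmul \<i> B) V) p \<ge> 0"
    and low1: "\<And>z w. a \<le> cmod z \<Longrightarrow> cmod z < b \<Longrightarrow> cmod w < b \<Longrightarrow> V (z, w) \<ge> - C"
    and low2: "\<And>z w. a \<le> cmod w \<Longrightarrow> cmod w < b \<Longrightarrow> cmod z < b \<Longrightarrow> V (z, w) \<ge> - C"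
begin

section \<open>Polar coordinates in the first variable\<close>

abbreviation "X \<equiv> dr dx1 V"
abbreviation "Y \<equiv> dr dy1 V"

lemma smX: "Ck n (dr e V)" using Ck_dr[OF smooth[of "Suc n"]] .
lemma smXX: "Ck n (dr e (dr e' V))" using Ck_dr[OF smX[of "Suc n"]] .

lemmas dV = Ck_derivative[OF smooth[of "Suc 0"]]
lemmas dX = Ck_derivative[OF smX[of "Suc 0"]]

lemma slice_smooth: "Ck n (\<lambda>w. V (z, w))"
proof -
  have "bounded_linear (\<lambda>w::complex. (0::complex, w))" by (intro bounded_linear_Pair bounded_linear_zero bounded_linear_ident)
  from Ck_affine[OF this smooth[of n], of "(z, 0)"] show ?thesis by simp
qed

lemma slice_dr:
  assumes G: "Ck (Suc n) G"
  shows "dr e (\<lambda>w. G (z::complex, w)) (w::complex) = dr (0, e) G (z, w)"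
proof -
  have "bounded_linear (\<lambda>w::complex. (0::complex, w))" by (intro bounded_linear_Pair bounded_linear_zero bounded_linear_ident)
  from dr_affine[OF this G, of e "(z, 0)"] show ?thesis by simp
qed

lemma slice_lap: "lap (\<lambda>w. V (z, w)) w = dr dx2 (dr dx2 V) (z, w) + dr dy2 (dr dy2 V) (z, w)"
proof -
  have "dr e (\<lambda>w. V (z, w)) = (\<lambda>w. dr (0, e) V (z, w))" for e
    by (rule ext) (rule slice_dr[OF smooth[of "Suc 0"]])
  then show ?thesis unfolding lap_def by (simp add: slice_dr[OF smX[of "Suc 0"]] dx2_def dy2_def)
qed

lemma slice_lap_nonneg: "cmod z < b \<Longrightarrow> cmod w < b \<Longrightarrow> lap (\<lambda>w. V (z, w)) w \<ge> 0"
  using psh[of "(z, w)" dx2] by (simp add: slice_lap cmul_def dx2_def dy2_def)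

text \<open>This is the derivative of \<open>V\<close> in t = ln |z|. In this form it is defined and
  continuous also at z = 0, where it vanishes.\<close>

definition E :: "c2 \<Rightarrow> real" where "E p = dr (fst p, 0) V p"

lemma E_alt: "E p = Re (fst p) * X p + Im (fst p) * Y p"
proof -
  have e: "(fst p, 0) = Re (fst p) *\<^sub>R dx1 + Im (fst p) *\<^sub>R dy1"
    by (auto simp: dx1_def dy1_def complex_eq_iff)
  show ?thesis unfolding E_def by (subst e) (simp only: dr_add_dir[OF smooth[of "Suc 0"]] dr_scale_dir[OF smooth[of "Suc 0"]])
qed

lemma V_polar: "V (z, w) = V (complex_of_real (cmod z), w)"
  using rot[of "Arg z" "complex_of_real (cmod z)" w]
  by (metis mult.commute rcis_cmod_Arg rcis_def)

lemma E_polar: "E (z, w) = E (complex_of_real (cmod z), w)"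
proof -
  have D: "((\<lambda>s. V ((1 + complex_of_real s) * z, w)) has_real_derivative E (z, w)) (at 0)" for z
  proof -
    have "(\<lambda>s. V ((1 + complex_of_real s) * z, w)) = (\<lambda>s. V ((z, w) + s *\<^sub>R (z, 0)))"
      by (auto simp: algebra_simps scaleR_conv_of_real)
    then show ?thesis using dr_line[OF smooth[of "Suc 0"], of "(z, w)" "(z, 0)" 0] by (simp add: E_def)
  qed
  have eq: "V ((1 + complex_of_real s) * z, w) = V ((1 + complex_of_real s) * complex_of_real (cmod z), w)" for s
  proof -
    have "cmod ((1 + complex_of_real s) * z) = cmod ((1 + complex_of_real s) * complex_of_real (cmod z))"
      by (simp add: norm_mult)
    then show ?thesis by (metis V_polar)
  qed
  show ?thesis using D[of z] D[of "complex_of_real (cmod z)"] unfolding eq by (rule DERIV_unique)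
qed

text \<open>\<open>(\<i> * z, 0)\<close> is the velocity of the rotation, along which
  \<open>V\<close> is constant.\<close>

lemma rot_id: "Im (fst p) * X p = Re (fst p) * Y p"
proof -
  obtain z w where p: "p = (z, w)" by force
  have "((\<lambda>\<theta>. (cis \<theta> * z, w)) has_derivative (\<lambda>h. h *\<^sub>R (\<i> * z, 0))) (at 0)"
  proof -
    have "((\<lambda>\<theta>. (cos \<theta> *\<^sub>R z + sin \<theta> *\<^sub>R (\<i> * z), w)) has_derivative (\<lambda>h. h *\<^sub>R (\<i> * z, 0))) (at 0)"
      by (auto intro!: derivative_eq_intros has_derivative_Pair)
    moreover have "(\<lambda>\<theta>. (cos \<theta> *\<^sub>R z + sin \<theta> *\<^sub>R (\<i> * z), w)) = (\<lambda>\<theta>. (cis \<theta> * z, w))"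
      by (auto simp: fun_eq_iff complex_eq_iff)
    ultimately show ?thesis by simp
  qed
  from diff_chain_at[OF this] dV[of p]
  have "((\<lambda>\<theta>. V (cis \<theta> * z, w)) has_derivative (\<lambda>h. dr (h *\<^sub>R (\<i> * z, 0)) V p)) (at 0)"
    by (simp add: o_def p)
  moreover have "((\<lambda>\<theta>. V (cis \<theta> * z, w)) has_derivative (\<lambda>h. 0)) (at 0)" by (simp add: rot)
  ultimately have "(\<lambda>h. dr (h *\<^sub>R (\<i> * z, 0)) V p) = (\<lambda>h. 0)" by (rule has_derivative_unique)
  then have "dr (1 *\<^sub>R (\<i> * z, 0)) V p = 0" by metis
  then have z: "dr (\<i> * z, 0) V p = 0" by simp
  have e: "(\<i> * z, 0) = (- Im z) *\<^sub>R dx1 + Re z *\<^sub>R dy1"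
    by (auto simp: dx1_def dy1_def complex_eq_iff)
  have "dr (\<i> * z, 0) V p = - Im z * X p + Re z * Y p"
    by (subst e) (simp only: dr_add_dir[OF smooth[of "Suc 0"]] dr_scale_dir[OF smooth[of "Suc 0"]])
  then show ?thesis using z p by simp
qed

text \<open>The derivative of \<open>rot_id\<close>. At points with real first coordinate it
  determines derivatives of \<open>Y\<close>: the angular one equals \<open>X / x\<close>
  (\<open>Y_y\<close>) and those in the directions of \<open>w\<close> vanish (\<open>Y_b\<close>),
  for x not 0.\<close>

lemma rot_id_deriv:
  "Im (fst e) * X p + Im (fst p) * dr e X p = Re (fst e) * Y p + Re (fst p) * dr e Y p"
proof -
  have fi: "((\<lambda>p. Im (fst p)) has_derivative (\<lambda>e. Im (fst e))) (at p)"
    and fr: "((\<lambda>p. Re (fst p)) has_derivative (\<lambda>e. Re (fst e))) (at p)" for p :: c2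
    by (auto intro!: derivative_eq_intros)
  have "((\<lambda>p. Im (fst p) * X p) has_derivative (\<lambda>e. Im (fst p) * dr e X p + Im (fst e) * X p)) (at p)"
    by (intro has_derivative_mult fi dX)
  moreover have "((\<lambda>p. Im (fst p) * X p) has_derivative (\<lambda>e. Re (fst p) * dr e Y p + Re (fst e) * Y p)) (at p)"
    unfolding rot_id by (intro has_derivative_mult fr dX)
  ultimately have "(\<lambda>e. Im (fst p) * dr e X p + Im (fst e) * X p) = (\<lambda>e. Re (fst p) * dr e Y p + Re (fst e) * Y p)"
    by (rule has_derivative_unique)
  from fun_cong[OF this, of e] show ?thesis by simp
qed

context
  fixes x :: real and w :: complex
begin

lemma Y_y: "x * dr dy1 Y (complex_of_real x, w) = X (complex_of_real x, w)"
  using rot_id_deriv[of dy1 "(complex_of_real x, w)"] by (simp add: dy1_def)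

lemma Y_b: "x \<noteq> 0 \<Longrightarrow> dr (0, e) Y (complex_of_real x, w) = 0"
  using rot_id_deriv[of "(0, e)" "(complex_of_real x, w)"] by simp

lemma E_real: "E (complex_of_real x, w) = x * X (complex_of_real x, w)"
  by (simp add: E_alt)

lemma X_deriv: "((\<lambda>x. G (complex_of_real x, w)) has_real_derivative dr dx1 G (complex_of_real x, w)) (at x)"
  if G: "Ck (Suc n) G"
proof -
  have "(\<lambda>x. G (complex_of_real x, w)) = (\<lambda>x. G ((0, w) + x *\<^sub>R dx1))"
    by (simp add: dx1_def scaleR_conv_of_real)
  then show ?thesis using dr_line[OF G, of "(0, w)" dx1 x] by (simp add: dx1_def scaleR_conv_of_real)
qed

end

text \<open>The polar form of the Laplacian in \<open>z\<close>: by \<open>Y_y\<close> the term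
  \<open>X\<close> of the product rule is \<open>x\<close> times the second derivative in the
  direction \<open>dy1\<close>. Together with \<open>psh\<close> it yields convexity of
  \<open>V\<close> in ln x, stated as \<open>E_mono\<close>.\<close>

lemma E_deriv: "((\<lambda>x. E (complex_of_real x, w)) has_real_derivative
    x * (dr dx1 X (complex_of_real x, w) + dr dy1 Y (complex_of_real x, w))) (at x)"
proof -
  have "((\<lambda>x. x * X (complex_of_real x, w)) has_real_derivative (1 * X (complex_of_real x, w) + dr dx1 X (complex_of_real x, w) * x)) (at x)"
    by (intro DERIV_mult X_deriv[OF smX[of "Suc 0"]] DERIV_ident)
  then show ?thesis by (simp add: E_real Y_y[symmetric] algebra_simps)
qed

lemma E_mono: assumes "0 \<le> x" "x \<le> y" "y < b" "cmod w < b"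
  shows "E (complex_of_real x, w) \<le> E (complex_of_real y, w)"
proof (rule DERIV_nonneg_imp_nondecreasing[OF assms(2)])
  fix t assume t: "x \<le> t" "t \<le> y"
  have "dr dx1 X (complex_of_real t, w) + dr dy1 Y (complex_of_real t, w) \<ge> 0"
    using psh[of "(complex_of_real t, w)" dx1] t assms by (simp add: cmul_def dx1_def dy1_def)
  then show "\<exists>y. ((\<lambda>x. E (complex_of_real x, w)) has_real_derivative y) (at t) \<and> 0 \<le> y"
    using E_deriv t assms by (intro exI conjI[OF E_deriv]) auto
qed

lemma E_nonneg: "cmod z < b \<Longrightarrow> cmod w < b \<Longrightarrow> E (z, w) \<ge> 0"
  using E_mono[of 0 "cmod z" w] E_polar[of z w] E_real[of 0 w] by simp

lemma V_mono: assumes "0 \<le> x" "x \<le> y" "y < b" "cmod w < b"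
  shows "V (complex_of_real x, w) \<le> V (complex_of_real y, w)"
proof (cases "x = y")
  case False
  then have xy: "x < y" using assms by simp
  have "\<exists>z>x. z < y \<and> V (complex_of_real y, w) - V (complex_of_real x, w) = (y - x) * X (complex_of_real z, w)"
    by (rule MVT2[OF xy]) (rule X_deriv[OF smooth[of "Suc 0"]])
  then obtain z where z: "z > x" "z < y" "V (complex_of_real y, w) - V (complex_of_real x, w) = (y - x) * X (complex_of_real z, w)" by auto
  have "z > 0" using z assms by linarith
  moreover have "0 \<le> z * X (complex_of_real z, w)" using E_nonneg[of "complex_of_real z" w] z assms E_real by simp
  ultimately have "X (complex_of_real z, w) \<ge> 0" by (simp add: zero_le_mult_iff)
  then have "(y - x) * X (complex_of_real z, w) \<ge> 0" using xy by simp
  then show ?thesis using z(3) by linarith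
qed simp

text \<open>Tangent inequalities at the two endpoints for a convex function of ln x: the derivative
  of \<open>V - c * ln t\<close> is \<open>(E - c) / t\<close>, and its sign is known when
  \<open>c\<close> is the slope at an endpoint.\<close>

lemma V_log: assumes "0 < x" "x \<le> y" "y < b" "cmod w < b"
  shows "E (complex_of_real x, w) * ln (y / x) \<le> V (complex_of_real y, w) - V (complex_of_real x, w)"
    and "V (complex_of_real y, w) - V (complex_of_real x, w) \<le> E (complex_of_real y, w) * ln (y / x)"
proof -
  have D: "((\<lambda>t. V (complex_of_real t, w) - c * ln t) has_real_derivative (E (complex_of_real t, w) - c) / t) (at t)" if "t > 0" for t c
    using that E_real by (auto intro!: derivative_eq_intros X_deriv[OF smooth[of "Suc 0"]] simp: diff_divide_distrib)
  have "V (complex_of_real x, w) - E (complex_of_real x, w) * ln x \<le> V (complex_of_real y, w) - E (complex_of_real x, w) * ln y"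
  proof (rule DERIV_nonneg_imp_nondecreasing[OF assms(2)])
    fix t assume t: "x \<le> t" "t \<le> y"
    have "0 \<le> (E (complex_of_real t, w) - E (complex_of_real x, w)) / t"
      using E_mono[of x t w] t assms by (intro divide_nonneg_pos) auto
    then show "\<exists>y. ((\<lambda>t. V (complex_of_real t, w) - E (complex_of_real x, w) * ln t) has_real_derivative y) (at t) \<and> 0 \<le> y"
      using D[of t "E (complex_of_real x, w)"] t assms by (intro exI conjI) auto
  qed
  then show "E (complex_of_real x, w) * ln (y / x) \<le> V (complex_of_real y, w) - V (complex_of_real x, w)"
    using assms by (simp add: ln_div algebra_simps)
  have "V (complex_of_real x, w) - E (complex_of_real y, w) * ln x \<ge> V (complex_of_real y, w) - E (complex_of_real y, w) * ln y"
  proof (rule DERIV_nonpos_imp_nonincreasing[OF assms(2)])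
    fix t assume t: "x \<le> t" "t \<le> y"
    have "(E (complex_of_real t, w) - E (complex_of_real y, w)) / t \<le> 0"
      using E_mono[of t y w] t assms by (intro divide_nonpos_pos) auto
    then show "\<exists>z. ((\<lambda>t. V (complex_of_real t, w) - E (complex_of_real y, w) * ln t) has_real_derivative z) (at t) \<and> z \<le> 0"
      using D[of t "E (complex_of_real y, w)"] t assms by (intro exI conjI) auto
  qed
  then show "V (complex_of_real y, w) - V (complex_of_real x, w) \<le> E (complex_of_real y, w) * ln (y / x)"
    using assms by (simp add: ln_div algebra_simps)
qed

text \<open>The chord inequality in the logarithmic variable for \<open>x\<close>, \<open>y\<close>
  and \<open>a\<close>, with the nonpositive value at \<open>a\<close> dropped. At
  \<open>y = Zf x w\<close> it becomes the bound f^2 <= A |t| (-U).\<close>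

lemma V_convex: assumes "0 < x" "x \<le> y" "y \<le> a" "x < a" "cmod w < b"
  shows "V (complex_of_real y, w) \<le> ln (a / y) / ln (a / x) * V (complex_of_real x, w)"
proof -
  let ?v = "\<lambda>x. V (complex_of_real x, w)" and ?l = "ln (a / y)" and ?k = "ln (y / x)"
  have l: "?l \<ge> 0" "?k \<ge> 0" "ln (a / x) > 0" and s: "ln (a / x) = ?l + ?k" using assms by (auto simp: ln_div)
  have "(?v y - ?v x) * ?l \<le> (E (complex_of_real y, w) * ?k) * ?l"
    using V_log(2)[of x y w] assms ab l by (intro mult_right_mono) auto
  also have "\<dots> = (E (complex_of_real y, w) * ?l) * ?k" by simp
  also have "\<dots> \<le> (?v a - ?v y) * ?k"
    using V_log(1)[of y a w] assms ab l by (intro mult_right_mono) auto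
  also have "\<dots> \<le> (- ?v y) * ?k" using nonpos l by (intro mult_right_mono) auto
  finally have "?v y * ln (a / x) \<le> ?l * ?v x" unfolding s by (simp add: algebra_simps)
  then show ?thesis using l by (simp add: field_simps)
qed

section \<open>Growth bounds and the subharmonic composition\<close>

text \<open>\<open>A0\<close> bounds the slope \<open>E\<close> for |z| <= \<open>a\<close>: from
  \<open>a\<close> to \<open>(a + b) / 2\<close> the function rises by at most \<open>C\<close>. In
  \<open>A\<close> the summand \<open>C\<close> absorbs the value at \<open>a\<close>, as only ln (a
  / x) >= 1 is considered, and 1 makes it positive.\<close>

definition "A0 = C / ln ((a + b) / (2 * a))"
definition "A = A0 + C + 1"

lemma A0_nonneg: "A0 \<ge> 0" unfolding A0_def using a0 ab C0 by (intro divide_nonneg_nonneg ln_ge_zero) (auto simp: field_simps)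
lemma A_pos: "A > 0" using A0_nonneg C0 by (simp add: A_def)

lemma E_le: assumes "cmod z \<le> a" "cmod w < b" shows "E (z, w) \<le> A0"
proof -
  let ?y = "(a + b) / 2"
  have l: "ln (?y / a) > 0" using a0 ab by (simp add: field_simps)
  have "E (complex_of_real a, w) * ln (?y / a) \<le> V (complex_of_real ?y, w) - V (complex_of_real a, w)"
    using a0 ab assms by (intro V_log) auto
  also have "\<dots> \<le> C" using nonpos low1[of "complex_of_real a" w] a0 ab assms
    by (smt (verit) norm_of_real)
  finally have "E (complex_of_real a, w) \<le> A0" unfolding A0_def using l by (simp add: field_simps)
  moreover have "E (z, w) \<le> E (complex_of_real a, w)"
    unfolding E_polar[of z w] using assms ab by (intro E_mono) auto
  ultimately show ?thesis by simp
qed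

lemma V_lower: assumes "0 < x" "ln (a / x) \<ge> 1" "cmod w < b"
  shows "V (complex_of_real x, w) \<ge> - A * ln (a / x)"
proof -
  have "a / x > 1"
  proof (rule ccontr)
    assume "\<not> a / x > 1"
    then have "ln (a / x) \<le> 0" using assms a0 by (subst ln_le_zero_iff) auto
    then show False using assms by simp
  qed
  then have xa: "x < a" using assms by (simp add: field_simps)
  have "V (complex_of_real a, w) - V (complex_of_real x, w) \<le> E (complex_of_real a, w) * ln (a / x)"
    using assms xa ab by (intro V_log) auto
  also have "\<dots> \<le> A0 * ln (a / x)" using E_le[of "complex_of_real a" w] assms a0 xa by (intro mult_right_mono) auto
  finally have "V (complex_of_real x, w) \<ge> - C - A0 * ln (a / x)"
    using low1[of "complex_of_real a" w] a0 ab assms by auto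
  moreover have "C * 1 \<le> C * ln (a / x)" using C0 assms by (intro mult_left_mono)
  ultimately show ?thesis using assms unfolding A_def by (simp add: algebra_simps)
qed

text \<open>U is V composed with t = log a + V(x, w)/A in the logarithmic first variable.\<close>

definition Zf :: "real \<Rightarrow> complex \<Rightarrow> real" where "Zf x w = a * exp (V (complex_of_real x, w) / A)"
definition U :: "real \<Rightarrow> complex \<Rightarrow> real" where "U x w = V (complex_of_real (Zf x w), w)"

lemma Zf_pos: "Zf x w > 0" and Zf_le: "Zf x w \<le> a"
  using a0 nonpos A_pos by (auto simp: Zf_def divide_nonpos_pos)

lemma Zf_smooth: "Ck n (Zf x)"
proof -
  have "Ck n (\<lambda>w. a * exp ((1 / A) * V (complex_of_real x, w)))"
    by (intro Ck_cmult Ck_exp slice_smooth)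
  then show ?thesis by (simp add: Zf_def[abs_def])
qed

lemma U_smooth: "Ck n (U x)" unfolding U_def[abs_def] by (intro Ck_graph smooth Zf_smooth)

lemma U_nonpos: "U x w \<le> 0" by (simp add: U_def nonpos)

text \<open>\<open>psh\<close> in the direction (s + i t, 1) at a point with real first coordinate.
  There \<open>Y_b\<close> removes the derivatives of \<open>Y\<close> along \<open>w\<close>, and
  the terms in \<open>dr dy1 X\<close> coming from \<open>B\<close> and from
  \<open>cmul \<i> B\<close> cancel.\<close>

lemma psh_real: assumes x: "0 < x" "x < b" and w: "cmod w < b"
  shows "0 \<le> (s\<^sup>2 + t\<^sup>2) * (dr dx1 X (complex_of_real x, w) + dr dy1 Y (complex_of_real x, w))
    + 2 * s * dr dx2 X (complex_of_real x, w) - 2 * t * dr dy2 X (complex_of_real x, w)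
    + (dr dx2 (dr dx2 V) (complex_of_real x, w) + dr dy2 (dr dy2 V) (complex_of_real x, w))"
proof -
  let ?p = "(complex_of_real x, w)"
  define B where "B = s *\<^sub>R dx1 + t *\<^sub>R dy1 + dx2"
  have iB: "cmul \<i> B = (- t) *\<^sub>R dx1 + s *\<^sub>R dy1 + dy2"
    by (auto simp: B_def cmul_def dx1_def dy1_def dx2_def dy2_def complex_eq_iff)
  have two: "dr (s *\<^sub>R dx1 + t *\<^sub>R dy1 + q) (dr (s *\<^sub>R dx1 + t *\<^sub>R dy1 + q) V) ?p
    = s\<^sup>2 * dr dx1 X ?p + t\<^sup>2 * dr dy1 Y ?p + dr q (dr q V) ?p + 2 * s * t * dr dy1 X ?p + 2 * s * dr q X ?p + 2 * t * dr q Y ?p" for s t q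
  proof -
    have 1: "dr (s *\<^sub>R dx1 + t *\<^sub>R dy1 + q) G p = s * dr dx1 G p + t * dr dy1 G p + dr q G p" if "Ck (Suc 0) G" for G p
      by (simp add: dr_add_dir[OF that] dr_scale_dir[OF that])
    have 2: "dr (s *\<^sub>R dx1 + t *\<^sub>R dy1 + q) V = (\<lambda>p. s * X p + t * Y p + dr q V p)"
      by (rule ext) (rule 1[OF smooth])
    have 3: "dr e (\<lambda>p. s * X p + t * Y p + dr q V p) ?p = s * dr e X ?p + t * dr e Y ?p + dr e (dr q V) ?p" for e
      by (rule dr_eqI) (intro has_derivative_add has_derivative_mult_right dX)
    have c: "dr dx1 Y ?p = dr dy1 X ?p" "dr dx1 (dr q V) ?p = dr q X ?p" "dr dy1 (dr q V) ?p = dr q Y ?p"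
      by (rule dr_commute[OF smooth[of "Suc (Suc 0)"]])+
    show ?thesis unfolding 2 3 1[OF smX] c by (simp add: algebra_simps power2_eq_square)
  qed
  have "dr dx2 Y ?p = 0" "dr dy2 Y ?p = 0" using Y_b[of x _ w] x by (auto simp: dx2_def dy2_def)
  then show ?thesis
    using psh[of ?p B] x w two[of s t dx2] two[of "- t" s dy2]
    unfolding iB[symmetric] B_def[symmetric] by (simp add: iB algebra_simps)
qed

text \<open>The Laplacian splits into the form of \<open>psh_real\<close> at the point (Z w, w),
  with \<open>s = dr 1 Z w\<close> and \<open>t = - dr \<i> Z w\<close>, plus \<open>X\<close> times
  \<open>Z w / A * lap f w\<close>; the second part is nonnegative because \<open>V\<close>
  increases in |z|. The exponential in \<open>Zf\<close> is essential: its Laplacian contains |grad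
  Z|^2 / Z, which multiplied by \<open>X = Z * dr dy1 Y\<close> supplies the angular part of the
  form.\<close>

lemma U_lap_nonneg: assumes x: "0 < x" "x < b" and w: "cmod w < b" shows "lap (U x) w \<ge> 0"
proof -
  define f where "f w = V (complex_of_real x, w)" for w
  define Z where "Z = Zf x"
  have f: "Ck n f" for n unfolding f_def by (rule slice_smooth)
  have Z: "Ck n Z" for n unfolding Z_def by (rule Zf_smooth)
  have lf: "lap f w \<ge> 0" unfolding f_def using x w by (intro slice_lap_nonneg) auto
  have Zalt: "Z w = a * exp (f w / A)" for w by (simp add: Z_def Zf_def f_def)
  have dZ: "dr e Z = (\<lambda>w. (1 / A) * (Z w * dr e f w))" for e
  proof
    fix w
    have "((\<lambda>w. a * exp ((1 / A) * f w)) has_derivative (\<lambda>e. a * (exp ((1 / A) * f w) * ((1 / A) * dr e f w)))) (at w)"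
      by (intro has_derivative_mult_right has_derivative_compose[OF has_derivative_mult_right[OF Ck_derivative[OF f], of "1/A" w] has_field_derivative_imp_has_derivative[OF DERIV_exp]])
    then have "(Z has_derivative (\<lambda>e. (1 / A) * (Z w * dr e f w))) (at w)"
      by (simp add: Zalt[abs_def] algebra_simps)
    then show "dr e Z w = (1 / A) * (Z w * dr e f w)" by (rule dr_eqI)
  qed
  have ddZ: "dr e (dr e Z) w = (dr e Z w)\<^sup>2 / Z w + Z w / A * dr e (dr e f) w" for e
  proof -
    have "dr e (dr e Z) w = dr e (\<lambda>w. (1 / A) * (Z w * dr e f w)) w" by (simp only: dZ[of e])
    also have "\<dots> = (1 / A) * (Z w * dr e (dr e f) w + dr e Z w * dr e f w)"
      by (rule dr_eqI) (intro has_derivative_mult_right has_derivative_mult Ck_derivative[OF Z] Ck_derivative[OF Ck_dr[OF f]])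
    also have "\<dots> = (dr e Z w)\<^sup>2 / Z w + Z w / A * dr e (dr e f) w"
      using Zf_pos[of x w] A_pos by (simp add: dZ Z_def[symmetric] power2_eq_square field_simps)
    finally show ?thesis .
  qed
  let ?g = "\<lambda>w. (complex_of_real (Z w), w)"
  have U: "U x = (\<lambda>w. V (?g w))" by (simp add: U_def[abs_def] Z_def)
  have D: "dr e (\<lambda>w. G (?g w)) w = dr dx1 G (?g w) * dr e Z w + dr (0, e) G (?g w)" if "Ck (Suc 0) G" for G e w
    by (rule dr_eqI) (rule has_derivative_graph[OF that Z])
  have dU: "dr e (U x) = (\<lambda>w. X (?g w) * dr e Z w + dr (0, e) V (?g w))" for e
    unfolding U by (rule ext) (rule D[OF smooth])
  have ddU: "dr e (dr e (U x)) w = dr dx1 X (?g w) * (dr e Z w)\<^sup>2 + 2 * dr e Z w * dr (0, e) X (?g w)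
     + X (?g w) * dr e (dr e Z) w + dr (0, e) (dr (0, e) V) (?g w)" for e
  proof -
    have "dr e (dr e (U x)) w = (X (?g w) * dr e (dr e Z) w + (dr dx1 X (?g w) * dr e Z w + dr (0, e) X (?g w)) * dr e Z w)
      + (dr dx1 (dr (0, e) V) (?g w) * dr e Z w + dr (0, e) (dr (0, e) V) (?g w))"
      unfolding dU by (rule dr_eqI) (intro has_derivative_add has_derivative_mult has_derivative_graph[OF smX Z] Ck_derivative[OF Ck_dr[OF Z]])
    moreover have "dr dx1 (dr (0, e) V) (?g w) = dr (0, e) X (?g w)" by (rule dr_commute[OF smooth[of "Suc (Suc 0)"]])
    ultimately show ?thesis by (simp add: algebra_simps power2_eq_square)
  qed
  have Z0: "0 < Z w" "Z w < b" using Zf_pos[of x w] Zf_le[of x w] ab by (auto simp: Z_def)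
  have Xnn: "X (?g w) \<ge> 0"
    using E_nonneg[of "complex_of_real (Z w)" w] Z0 w by (simp add: E_real zero_le_mult_iff)
  have XZ: "X (?g w) = Z w * dr dy1 Y (?g w)" using Y_y[of "Z w" w] by simp
  have "lap (U x) w = ((dr 1 Z w)\<^sup>2 + (- dr \<i> Z w)\<^sup>2) * (dr dx1 X (?g w) + dr dy1 Y (?g w))
    + 2 * dr 1 Z w * dr dx2 X (?g w) - 2 * (- dr \<i> Z w) * dr dy2 X (?g w)
    + (dr dx2 (dr dx2 V) (?g w) + dr dy2 (dr dy2 V) (?g w)) + X (?g w) * (Z w / A * lap f w)"
    unfolding lap_def ddU ddZ using Z0(1)
    by (simp add: XZ dx2_def dy2_def field_simps) (simp add: add_divide_distrib)
  also have "\<dots> \<ge> 0" using Xnn lf Z0 A_pos by (rule_tac add_nonneg_nonneg[OF psh_real[OF Z0 w]]) auto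
  finally show ?thesis .
qed

end

section \<open>The flux estimate\<close>

text \<open>Chosen so that sqrt kap turns the scale \<open>a + 4 * dl\<close> into
  \<open>a + 3 * dl\<close>, and so that at scale \<open>a + 2 * dl\<close> the annulus around a
  point with |w| <= \<open>dl\<close> stays in |w| >= \<open>a\<close>. It depends on
  \<open>a\<close> and \<open>b\<close> alone, so interpretations for different \<open>V\<close>
  share \<open>beta\<close>, \<open>Psi\<close> and \<open>cc\<close>.\<close>

definition kap :: "real \<Rightarrow> real \<Rightarrow> real" where
  "kap a b = ((a + 3 * ((b - a) / 8)) / (a + 4 * ((b - a) / 8)))\<^sup>2"

context smooth_inv
begin

definition "dl = (b - a) / 8"

lemma dl_pos: "dl > 0" and bd: "a + 8 * dl \<le> b" using ab by (auto simp: dl_def) argo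

lemma sqrt_kap: "sqrt (kap a b) = (a + 3 * dl) / (a + 4 * dl)"
  using a0 dl_pos bd by (simp add: kap_def dl_def[symmetric])

end

sublocale smooth_inv \<subseteq> kern "kap a b"
proof
  have q: "(a + 3 * dl) / (a + 4 * dl) > 0" "(a + 3 * dl) / (a + 4 * dl) < 1"
    using a0 dl_pos bd by (auto simp: field_simps)
  have k: "kap a b = ((a + 3 * dl) / (a + 4 * dl))\<^sup>2" by (simp only: kap_def dl_def)
  show "0 < kap a b" unfolding k by (rule zero_less_power[OF q(1)])
  show "kap a b < 1" unfolding k using q by (intro power_less_one_iff[THEN iffD2]) auto
qed

context smooth_inv
begin

section \<open>Uniform bounds for slices\<close>

text \<open>\<open>m\<close> will bound the Laplacian mass of every slice
  (\<open>lap_mass_slice\<close>), and \<open>L s\<close> minus the mean of a slice at scale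
  \<open>s\<close> (\<open>T_lower\<close>). Like \<open>A\<close>, they depend only on
  \<open>a\<close>, \<open>b\<close> and \<open>C\<close>.\<close>

definition "s0 = a + 2 * dl"
definition "m = C * cc / ln ((a + 5 * dl) / (a + 4 * dl))"
definition "L s = C + m / cc * ln (s0 / s)"
definition "PP = (\<integral>z. Psi z \<partial>lborel)"

lemma m_nonneg: "m \<ge> 0"
  unfolding m_def using C0 cc_pos a0 dl_pos bd by (intro divide_nonneg_nonneg mult_nonneg_nonneg ln_ge_zero) (auto simp: field_simps)

lemma PP_nonneg: "PP \<ge> 0" unfolding PP_def by (rule Bochner_Integration.integral_nonneg) (rule Psi_nonneg)

lemma sqn_kap: "kap a b < sqn z \<Longrightarrow> sqrt (kap a b) < cmod z"
  unfolding sqn_def using real_sqrt_less_iff[of "kap a b" "(cmod z)\<^sup>2"] by simp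

lemma cont_slice: "continuous_on UNIV (\<lambda>w. V (z, w))" by (rule Ck_cont[OF slice_smooth])

lemma T_slice_nonpos: "T s (\<lambda>w. V (z, w)) w \<le> 0"
proof -
  have "T s (\<lambda>w. V (z, w)) w \<le> T s (\<lambda>_. 0) w"
    by (intro T_mono cont_slice continuous_on_const nonpos)
  then show ?thesis by (simp add: T_const)
qed

text \<open>All points seen by \<open>beta\<close> at scale \<open>s\<close> lie in the shell where
  \<open>low2\<close> applies. Hence the bound holds over every \<open>z\<close> with |z| <
  \<open>b\<close>, also where slices have no uniform lower bound near the origin.\<close>

lemma T_annulus:
  assumes z: "cmod z < b" and w: "cmod w \<le> r" and s: "0 < s" "sqrt (kap a b) * s - r \<ge> a" "s + r \<le> b"
  shows "T s (\<lambda>w. V (z, w)) w \<ge> - C"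
proof -
  have "T s (\<lambda>_. - C) w \<le> T s (\<lambda>w. V (z, w)) w"
  proof (intro T_mono cont_slice continuous_on_const)
    fix \<zeta> assume \<zeta>: "kap a b < sqn \<zeta>" "cmod \<zeta> < 1"
    have "s * sqrt (kap a b) < s * cmod \<zeta>" using s sqn_kap[OF \<zeta>(1)] by (intro mult_strict_left_mono) auto
    moreover have "s * cmod \<zeta> < s * 1" using s \<zeta> by (intro mult_strict_left_mono) auto
    moreover have "cmod (s *\<^sub>R \<zeta>) = s * cmod \<zeta>" using s by simp
    moreover note norm_triangle_ineq[of w "s *\<^sub>R \<zeta>"] norm_diff_ineq[of "s *\<^sub>R \<zeta>" w]
    moreover have "cmod (s *\<^sub>R \<zeta> + w) = cmod (w + s *\<^sub>R \<zeta>)" "s * sqrt (kap a b) = sqrt (kap a b) * s" by (auto simp: add.commute)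
    ultimately have "a \<le> cmod (w + s *\<^sub>R \<zeta>)" "cmod (w + s *\<^sub>R \<zeta>) < b"
      using s w by linarith+
    then show "- C \<le> V (z, w + s *\<^sub>R \<zeta>)" using z by (intro low2) auto
  qed
  then show ?thesis by (simp add: T_const)
qed

lemma T_s0: assumes "cmod z < b" "cmod w \<le> dl" shows "T s0 (\<lambda>w. V (z, w)) w \<ge> - C"
proof (rule T_annulus[OF assms])
  have "(a + dl) * (a + 4 * dl) \<le> (a + 3 * dl) * s0" using dl_pos bd by (simp add: s0_def algebra_simps)
  then have "a + dl \<le> (a + 3 * dl) * s0 / (a + 4 * dl)" using a0 dl_pos bd by (simp add: field_simps)
  then show "a \<le> sqrt (kap a b) * s0 - dl" by (simp add: sqrt_kap)
qed (use a0 dl_pos bd in \<open>auto simp: s0_def\<close>)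

text \<open>\<open>mass_lower\<close> between the scales \<open>a + 4 * dl\<close> and
  \<open>a + 5 * dl\<close>: the mean at the smaller scale is at least \<open>- C\<close>, the one
  at the larger scale at most 0.\<close>

lemma lap_mass_slice: assumes z: "cmod z < b" shows "lap_mass (\<lambda>w. V (z, w)) (ball 0 (a + 3 * dl)) \<le> ennreal m"
proof -
  let ?f = "\<lambda>w. V (z, w)" and ?s = "a + 4 * dl" and ?S = "a + 5 * dl"
  have sk: "sqrt (kap a b) * ?s = a + 3 * dl" using a0 dl_pos bd by (simp add: sqrt_kap)
  have l: "ln (?S / ?s) / cc > 0" using a0 dl_pos bd cc_pos by simp
  have "lap_mass ?f (ball 0 (a + 3 * dl)) * ennreal (ln (?S / ?s) / cc) \<le> ennreal (T ?S ?f 0 - T ?s ?f 0)"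
    unfolding sk[symmetric]
    by (rule mass_lower[OF slice_smooth]) (use a0 dl_pos bd z in \<open>auto intro!: slice_lap_nonneg \<close>)
  also have "\<dots> \<le> ennreal C"
  proof (rule ennreal_leI)
    have "T ?s ?f 0 \<ge> - C" using z by (rule T_annulus[where r=0]) (use a0 dl_pos bd sk in \<open>auto \<close>)
    then show "T ?S ?f 0 - T ?s ?f 0 \<le> C" using T_slice_nonpos[of ?S z 0] by linarith
  qed
  also have "ennreal C = ennreal m * ennreal (ln (?S / ?s) / cc)"
    using l m_nonneg cc_pos a0 dl_pos bd by (subst ennreal_mult[symmetric]) (auto simp: m_def less_imp_le)
  finally have "ennreal (ln (?S / ?s) / cc) * lap_mass ?f (ball 0 (a + 3 * dl)) \<le> ennreal (ln (?S / ?s) / cc) * ennreal m"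
    by (simp only: mult.commute)
  then show ?thesis using l by (subst (asm) ennreal_mult_le_mult_iff) auto
qed

lemma lap_mass_slice_sub: "cmod z < b \<Longrightarrow> ball w r \<subseteq> ball 0 (a + 3 * dl) \<Longrightarrow> lap_mass (\<lambda>w. V (z, w)) (ball w r) \<le> ennreal m"
  using lap_mass_slice lap_mass_mono order_trans by blast

text \<open>\<open>mass_upper\<close> from scale \<open>s0\<close>, where the mean is at least
  \<open>- C\<close>, down to \<open>s\<close>, with the mass bounded by \<open>m\<close>. The
  logarithmic growth in 1 / s is what allows a small power of |p| as scale in
  \<open>flux_small\<close>.\<close>

lemma T_lower:
  assumes z: "cmod z < b" and w: "cmod w \<le> dl" and s: "0 < s" "s \<le> s0"
  shows "- T s (\<lambda>w. V (z, w)) w \<le> L s"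
proof -
  let ?f = "\<lambda>w. V (z, w)"
  have sub: "ball w s0 \<subseteq> ball 0 (a + 3 * dl)"
    using w by (intro ball_subset_ball_iff[THEN iffD2]) (auto simp: s0_def dist_norm)
  have "ennreal (T s0 ?f w - T s ?f w) \<le> lap_mass ?f (ball w s0) * ennreal (ln (s0 / s) / cc)"
  proof (rule mass_upper[OF slice_smooth s])
    fix x assume "dist w x < s0"
    then have "x \<in> ball 0 (a + 3 * dl)" using sub by auto
    then show "0 \<le> lap ?f x" using z dl_pos bd by (intro slice_lap_nonneg) auto
  qed
  also have "\<dots> \<le> ennreal m * ennreal (ln (s0 / s) / cc)"
    by (intro mult_right_mono lap_mass_slice_sub z sub) auto
  also have "\<dots> = ennreal (m * (ln (s0 / s) / cc))"
    using s cc_pos m_nonneg by (subst ennreal_mult) (auto simp: divide_nonneg_pos)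
  finally have "T s0 ?f w - T s ?f w \<le> m * (ln (s0 / s) / cc)"
    using s cc_pos m_nonneg by (subst (asm) ennreal_le_iff) auto
  then show ?thesis using T_s0[OF z w] by (simp add: L_def)
qed

text \<open>Below \<open>C\<close> plus the excess of the mean at scale \<open>s0\<close> there is
  nothing left of \<open>- V\<close>, and \<open>integral_excess\<close> bounds the excess. The
  bound is uniform in \<open>z\<close>, in the truncation and in the mollification; at z = 0 it
  permits the limit in j.\<close>

lemma slice_L1:
  assumes z: "cmod z < b"
  shows "(\<integral>\<^sup>+w. ennreal (- V (z, w)) * indicator (ball 0 dl) w \<partial>lborel) \<le> ennreal (C * measure lborel (ball (0::complex) dl) + m * (s0\<^sup>2 * PP))"
proof -
  let ?f = "\<lambda>w. V (z, w)"
  have s0: "0 < s0" using a0 dl_pos bd by (simp add: s0_def)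
  have "(\<integral>\<^sup>+w. ennreal (- V (z, w)) * indicator (ball 0 dl) w \<partial>lborel)
    \<le> (\<integral>\<^sup>+w. ennreal C * indicator (ball 0 dl) w + ennreal (T s0 ?f w - ?f w) * indicator (ball 0 dl) w \<partial>lborel)"
  proof (rule nn_integral_mono)
    fix w
    have "ennreal (- V (z, w)) \<le> ennreal C + ennreal (T s0 ?f w - ?f w)" if "cmod w < dl"
    proof -
      have "ennreal (- V (z, w)) \<le> ennreal (C + max 0 (T s0 ?f w - ?f w))"
        using T_s0[OF z, of w] that by (intro ennreal_leI) linarith
      also have "\<dots> = ennreal C + ennreal (T s0 ?f w - ?f w)"
        using C0 by (subst ennreal_plus) (auto simp: max_def ennreal_neg)
      finally show ?thesis .
    qed
    then show "ennreal (- V (z, w)) * indicator (ball 0 dl) w \<le> ennreal C * indicator (ball 0 dl) w + ennreal (T s0 ?f w - ?f w) * indicator (ball 0 dl) w"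
      by (auto simp: indicator_def)
  qed
  also have "\<dots> = ennreal C * emeasure lborel (ball (0::complex) dl) + (\<integral>\<^sup>+w. ennreal (T s0 ?f w - ?f w) * indicator (ball 0 dl) w \<partial>lborel)"
  proof -
    have [measurable]: "?f \<in> borel_measurable borel" using cont_slice by (simp add: borel_measurable_continuous_onI)
    have "(\<lambda>w. \<integral>\<zeta>. ?f (w + s0 *\<^sub>R \<zeta>) * beta \<zeta> \<partial>lborel) \<in> borel_measurable borel" by measurable
    then have [measurable]: "T s0 ?f \<in> borel_measurable borel" by (simp add: T_def[abs_def])
    show ?thesis by (subst nn_integral_add) (auto simp: nn_integral_cmult)
  qed
  also have "\<dots> \<le> ennreal C * emeasure lborel (ball (0::complex) dl) + lap_mass ?f (ball 0 (dl + s0)) * ennreal (s0\<^sup>2 * PP)"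
    unfolding PP_def
    by (intro add_left_mono integral_excess[OF slice_smooth]) (use dl_pos bd s0 z in \<open>auto intro!: slice_lap_nonneg simp: s0_def\<close>)
  also have "\<dots> \<le> ennreal C * emeasure lborel (ball (0::complex) dl) + ennreal m * ennreal (s0\<^sup>2 * PP)"
    by (intro add_left_mono mult_right_mono lap_mass_slice_sub z) (auto simp: s0_def)
  also have "\<dots> = ennreal (C * measure lborel (ball (0::complex) dl) + m * (s0\<^sup>2 * PP))"
  proof -
    have "emeasure lborel (ball (0::complex) dl) = ennreal (measure lborel (ball (0::complex) dl))"
      by (rule emeasure_eq_ennreal_measure) (use emeasure_lborel_ball_finite in \<open>auto simp: less_top[symmetric]\<close>)
    then show ?thesis using C0 m_nonneg PP_nonneg by (simp add: ennreal_mult)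
  qed
  finally show ?thesis .
qed

section \<open>Mass of the composition and the flux bound\<close>

lemma U_ge: assumes "cmod w < b" shows "V (0, w) \<le> U x w"
  using V_mono[of 0 "Zf x w" w] Zf_pos[of x w] Zf_le[of x w] ab assms by (simp add: U_def)

text \<open>Monotonicity in |z| puts \<open>U\<close> above the slice at z = 0, and
  \<open>T_lower\<close> covers that slice as well.\<close>

lemma T_U_lower:
  assumes w: "cmod w \<le> dl" and s: "0 < s" "s \<le> s0"
  shows "- T s (U x) w \<le> L s"
proof -
  have "T s (\<lambda>w. V (0, w)) w \<le> T s (U x) w"
  proof (intro T_mono cont_slice Ck_cont[OF U_smooth] U_ge)
    fix \<zeta> assume "cmod \<zeta> < 1"
    then have "s * cmod \<zeta> \<le> s" using s by (simp add: mult_left_le)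
    moreover have "cmod (s *\<^sub>R \<zeta>) = s * cmod \<zeta>" using s by simp
    ultimately show "cmod (w + s *\<^sub>R \<zeta>) < b"
      using norm_triangle_ineq[of w "s *\<^sub>R \<zeta>"] w s dl_pos bd s0_def by linarith
  qed
  then show ?thesis using T_lower[of 0 w s] w s a0 ab by simp
qed

text \<open>If a exp(V/A) < tau then V(x, y) is so negative that the excess of its mean over V
  accounts for at least half of -V.\<close>

lemma U_bad:
  assumes x: "0 < x" "x < a" and \<tau>: "0 < \<tau>" "ln (a / \<tau>) \<ge> 1" "\<tau> < b" and s: "0 < s" "s \<le> s0" and LL: "2 * L s \<le> A * ln (a / \<tau>)"
    and y: "cmod y \<le> dl"
  shows "- U x y \<le> - V (complex_of_real \<tau>, y) + 2 * max 0 (T s (\<lambda>w. V (complex_of_real x, w)) y - V (complex_of_real x, y))"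
proof -
  let ?f = "\<lambda>w. V (complex_of_real x, w)"
  have yb: "cmod y < b" using y a0 dl_pos bd by simp
  show ?thesis
  proof (cases "Zf x y \<ge> \<tau>")
    case True
    have "V (complex_of_real \<tau>, y) \<le> U x y" unfolding U_def
      using True \<tau> Zf_le[of x y] ab yb by (intro V_mono) auto
    then show ?thesis by (smt (verit) max.cobounded1)
  next
    case False
    have lz: "ln (a / Zf x y) = - ?f y / A" using a0 by (simp add: Zf_def ln_div ln_mult)
    have "ln (a / \<tau>) < ln (a / Zf x y)" using False Zf_pos[of x y] a0 \<tau> by (simp add: divide_strict_left_mono)
    then have l1: "ln (a / \<tau>) < - ?f y / A" by (simp add: lz)
    \<comment> \<open>On the exceptional set, \<open>V_lower\<close> at the point
      \<open>Zf x y\<close>, whose logarithmic distance to \<open>a\<close> is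
      \<open>- ?f y / A\<close>, shows that \<open>U\<close> is nowhere more negative than
      \<open>V\<close> itself.\<close>
    have "- U x y \<le> A * ln (a / Zf x y)"
      using V_lower[of "Zf x y" y] Zf_pos[of x y] l1 lz \<tau> yb by (simp add: U_def)
    then have u: "- U x y \<le> - ?f y" using lz A_pos by simp
    have "A * ln (a / \<tau>) < - ?f y" using l1 A_pos by (simp add: field_simps)
    moreover have "- T s ?f y \<le> L s" using T_lower[of "complex_of_real x" y s] x ab y s by simp
    moreover have "q < - v \<Longrightarrow> - t \<le> l \<Longrightarrow> 2 * l \<le> q \<Longrightarrow> - v \<le> 2 * (t - v)" for q v t l :: real by argo
    ultimately have "- ?f y \<le> 2 * (T s ?f y - ?f y)" using LL by blast
    moreover have "T s ?f y - ?f y \<le> max 0 (T s ?f y - ?f y)" by simp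
    ultimately show ?thesis using u nonpos[of "(complex_of_real \<tau>, y)"] by argo
  qed
qed

text \<open>\<open>mass_lower\<close> from \<open>s\<close> to \<open>dl\<close> bounds the mass
  times the logarithm by the mean of \<open>- U\<close> at scale \<open>s\<close>, which
  \<open>U_bad\<close> splits in two. The mean of the slice at \<tau> is at least
  \<open>V (z, w)\<close>, by the sub-mean value property and |z| <= \<tau>; thus one value of
  \<open>V\<close> at one point suffices. The excess part is bounded by \<open>T_excess\<close> with
  both scales equal to \<open>s\<close>, independently of \<open>s\<close>.\<close>

lemma lap_mass_U:
  assumes x: "0 < x" "x < a" and z: "cmod z \<le> \<tau>" and \<tau>: "0 < \<tau>" "ln (a / \<tau>) \<ge> 1" "\<tau> < b"
    and s: "0 < s" "s < dl" and LL: "2 * L s \<le> A * ln (a / \<tau>)"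
    and w: "cmod w + s \<le> dl" and B: "\<And>z. beta z \<le> B"
  shows "lap_mass (U x) (ball w (sqrt (kap a b) * s)) \<le> ennreal ((- V (z, w) + 2 * (B * PP * m)) * cc / ln (dl / s))"
proof -
  let ?f = "\<lambda>w. V (complex_of_real x, w)" and ?g = "\<lambda>w. V (complex_of_real \<tau>, w)"
  let ?e = "\<lambda>y. max 0 (T s ?f y - ?f y)"
  have B0: "B \<ge> 0" using B[of 0] beta_nonneg[of 0] by linarith
  have ss0: "s \<le> s0" using s a0 dl_pos bd by (simp add: s0_def)
  have wb: "cmod w < dl" using w s by linarith
  have l: "ln (dl / s) / cc > 0" using s cc_pos by simp
  have [measurable]: "?f \<in> borel_measurable borel" "?g \<in> borel_measurable borel" "U x \<in> borel_measurable borel"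
    using cont_slice Ck_cont[OF U_smooth] by (simp_all add: borel_measurable_continuous_onI)
  have "(\<lambda>w. \<integral>\<zeta>. ?f (w + s *\<^sub>R \<zeta>) * beta \<zeta> \<partial>lborel) \<in> borel_measurable borel" by measurable
  then have [measurable]: "T s ?f \<in> borel_measurable borel" by (simp add: T_def[abs_def])
  have "lap_mass (U x) (ball w (sqrt (kap a b) * s)) * ennreal (ln (dl / s) / cc) \<le> ennreal (T dl (U x) w - T s (U x) w)"
  proof (rule mass_lower[OF U_smooth])
    fix y assume "dist w y < dl"
    then have "cmod y < b" using wb dl_pos bd a0 norm_triangle_ineq2[of y w] by (simp add: dist_norm norm_minus_commute)
    then show "0 \<le> lap (U x) y" using x ab by (intro U_lap_nonneg) auto
  qed (use s in auto)
  also have "\<dots> \<le> ennreal (\<integral>\<zeta>. - U x (w + s *\<^sub>R \<zeta>) * beta \<zeta> \<partial>lborel)"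
  proof (rule ennreal_leI)
    have "T dl (U x) w \<le> T dl (\<lambda>_. 0) w" by (intro T_mono Ck_cont[OF U_smooth] continuous_on_const U_nonpos)
    then show "T dl (U x) w - T s (U x) w \<le> (\<integral>\<zeta>. - U x (w + s *\<^sub>R \<zeta>) * beta \<zeta> \<partial>lborel)"
      by (simp add: T_const) (simp add: T_def)
  qed
  also have "\<dots> = (\<integral>\<^sup>+\<zeta>. ennreal (- U x (w + s *\<^sub>R \<zeta>) * beta \<zeta>) \<partial>lborel)"
  proof (rule nn_integral_eq_integral[symmetric])
    show "integrable lborel (\<lambda>\<zeta>. - U x (w + s *\<^sub>R \<zeta>) * beta \<zeta>)"
      by (rule T_integrable) (intro continuous_intros Ck_cont[OF U_smooth])
    show "AE \<zeta> in lborel. 0 \<le> - U x (w + s *\<^sub>R \<zeta>) * beta \<zeta>"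
      by (rule AE_I2) (use U_nonpos beta_nonneg in \<open>simp add: mult_nonpos_nonneg\<close>)
  qed
  also have "\<dots> \<le> (\<integral>\<^sup>+\<zeta>. ennreal (- ?g (w + s *\<^sub>R \<zeta>) * beta \<zeta>) + 2 * (ennreal (beta \<zeta>) * ennreal (T s ?f (w + s *\<^sub>R \<zeta>) - ?f (w + s *\<^sub>R \<zeta>))) \<partial>lborel)"
  proof (rule nn_integral_mono)
    fix \<zeta>
    let ?y = "w + s *\<^sub>R \<zeta>"
    show "ennreal (- U x ?y * beta \<zeta>) \<le> ennreal (- ?g ?y * beta \<zeta>) + 2 * (ennreal (beta \<zeta>) * ennreal (T s ?f ?y - ?f ?y))"
    proof (cases "cmod \<zeta> < 1")
      case True
      then have "s * cmod \<zeta> \<le> s" using s by (simp add: mult_left_le)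
      moreover have "cmod (s *\<^sub>R \<zeta>) = s * cmod \<zeta>" using s by simp
      ultimately have y: "cmod ?y \<le> dl" using norm_triangle_ineq[of w "s *\<^sub>R \<zeta>"] w by linarith
      have "- U x ?y * beta \<zeta> \<le> (- ?g ?y + 2 * ?e ?y) * beta \<zeta>"
        using U_bad[OF x \<tau> s(1) ss0 LL y] beta_nonneg by (rule mult_right_mono)
      then have "ennreal (- U x ?y * beta \<zeta>) \<le> ennreal (- ?g ?y * beta \<zeta> + 2 * (beta \<zeta> * ?e ?y))"
        by (intro ennreal_leI) (simp add: algebra_simps)
      also have "\<dots> = ennreal (- ?g ?y * beta \<zeta>) + 2 * (ennreal (beta \<zeta>) * ennreal (?e ?y))"
        using beta_nonneg[of \<zeta>] nonpos by (subst ennreal_plus) (auto simp: mult_nonpos_nonneg ennreal_mult)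
      also have "ennreal (?e ?y) = ennreal (T s ?f ?y - ?f ?y)" by (auto simp: max_def ennreal_neg)
      finally show ?thesis .
    qed (simp add: beta_zero)
  qed
  also have "\<dots> = (\<integral>\<^sup>+\<zeta>. ennreal (- ?g (w + s *\<^sub>R \<zeta>) * beta \<zeta>) \<partial>lborel) + 2 * (\<integral>\<^sup>+\<zeta>. ennreal (beta \<zeta>) * ennreal (T s ?f (w + s *\<^sub>R \<zeta>) - ?f (w + s *\<^sub>R \<zeta>)) \<partial>lborel)"
    by (subst nn_integral_add, measurable) (simp add: nn_integral_cmult)
  finally have K1: "lap_mass (U x) (ball w (sqrt (kap a b) * s)) * ennreal (ln (dl / s) / cc) \<le> (\<integral>\<^sup>+\<zeta>. ennreal (- ?g (w + s *\<^sub>R \<zeta>) * beta \<zeta>) \<partial>lborel) + 2 * (\<integral>\<^sup>+\<zeta>. ennreal (beta \<zeta>) * ennreal (T s ?f (w + s *\<^sub>R \<zeta>) - ?f (w + s *\<^sub>R \<zeta>)) \<partial>lborel)" .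
  have "(\<integral>\<^sup>+\<zeta>. ennreal (- ?g (w + s *\<^sub>R \<zeta>) * beta \<zeta>) \<partial>lborel) = ennreal (\<integral>\<zeta>. - ?g (w + s *\<^sub>R \<zeta>) * beta \<zeta> \<partial>lborel)"
  proof (rule nn_integral_eq_integral)
    show "integrable lborel (\<lambda>\<zeta>. - ?g (w + s *\<^sub>R \<zeta>) * beta \<zeta>)"
      by (rule T_integrable) (intro continuous_intros cont_slice)
    show "AE \<zeta> in lborel. 0 \<le> - ?g (w + s *\<^sub>R \<zeta>) * beta \<zeta>"
      by (rule AE_I2) (use nonpos beta_nonneg in \<open>simp add: mult_nonpos_nonneg\<close>)
  qed
  also have "\<dots> \<le> ennreal (- V (z, w))"
  proof (rule ennreal_leI)
    have wd: "cmod w < b" using wb a0 dl_pos bd by simp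
    have "V (z, w) \<le> ?g w" unfolding V_polar[of z w] using z \<tau> wd by (intro V_mono) auto
    also have "?g w = T 0 ?g w" by (simp add: T_0)
    also have "\<dots> \<le> T s ?g w"
    proof (rule T_nn(1)[OF slice_smooth])
      fix y assume "dist w y < s"
      then have "cmod y < b" using wb s dl_pos bd a0 norm_triangle_ineq2[of y w] by (simp add: dist_norm norm_minus_commute)
      then show "0 \<le> lap ?g y" using \<tau> by (intro slice_lap_nonneg) auto
    qed (use s in auto)
    finally show "(\<integral>\<zeta>. - ?g (w + s *\<^sub>R \<zeta>) * beta \<zeta> \<partial>lborel) \<le> - V (z, w)" by (simp add: T_def)
  qed
  finally have K2: "(\<integral>\<^sup>+\<zeta>. ennreal (- ?g (w + s *\<^sub>R \<zeta>) * beta \<zeta>) \<partial>lborel) \<le> ennreal (- V (z, w))" .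
  have "(\<integral>\<^sup>+\<zeta>. ennreal (beta \<zeta>) * ennreal (T s ?f (w + s *\<^sub>R \<zeta>) - ?f (w + s *\<^sub>R \<zeta>)) \<partial>lborel)
    \<le> ennreal (B * (s\<^sup>2 / s\<^sup>2) * PP) * lap_mass ?f (ball w (s + s))"
    unfolding PP_def
  proof (rule T_excess[OF slice_smooth])
    fix y assume "dist w y < s + s"
    then have "cmod y < b" using wb s dl_pos bd a0 norm_triangle_ineq2[of y w] by (simp add: dist_norm norm_minus_commute)
    then show "0 \<le> lap ?f y" using x ab by (intro slice_lap_nonneg) auto
  qed (use s B in auto)
  also have "\<dots> \<le> ennreal (B * (s\<^sup>2 / s\<^sup>2) * PP) * ennreal m"
    by (intro mult_left_mono lap_mass_slice_sub) (use x ab wb s dl_pos bd a0 in \<open>auto simp: ball_subset_ball_iff dist_norm\<close>)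
  also have "\<dots> = ennreal (B * PP * m)" using s B0 PP_nonneg m_nonneg by (simp add: ennreal_mult)
  finally have K3: "(\<integral>\<^sup>+\<zeta>. ennreal (beta \<zeta>) * ennreal (T s ?f (w + s *\<^sub>R \<zeta>) - ?f (w + s *\<^sub>R \<zeta>)) \<partial>lborel) \<le> ennreal (B * PP * m)" .
  have "lap_mass (U x) (ball w (sqrt (kap a b) * s)) * ennreal (ln (dl / s) / cc) \<le> ennreal (- V (z, w)) + 2 * ennreal (B * PP * m)"
    by (rule order_trans[OF K1]) (intro add_mono mult_left_mono K2 K3 zero_le)
  also have "ennreal (- V (z, w)) + 2 * ennreal (B * PP * m) = ennreal (- V (z, w) + 2 * (B * PP * m))"
    using nonpos[of "(z, w)"] B0 PP_nonneg m_nonneg by (subst ennreal_plus) (simp_all add: ennreal_mult)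
  also have "\<dots> = ennreal ((- V (z, w) + 2 * (B * PP * m)) * cc / ln (dl / s)) * ennreal (ln (dl / s) / cc)"
    using l nonpos[of "(z, w)"] mult_nonneg_nonneg[OF mult_nonneg_nonneg[OF B0 PP_nonneg] m_nonneg] cc_pos s
    by (subst ennreal_mult[symmetric]) (auto intro!: divide_nonneg_nonneg mult_nonneg_nonneg add_nonneg_nonneg)
  finally have "ennreal (ln (dl / s) / cc) * lap_mass (U x) (ball w (sqrt (kap a b) * s)) \<le> ennreal (ln (dl / s) / cc) * ennreal ((- V (z, w) + 2 * (B * PP * m)) * cc / ln (dl / s))"
    by (simp only: mult.commute)
  then show ?thesis using l by (subst (asm) ennreal_mult_le_mult_iff) auto
qed

text \<open>In t = ln x this integrates \<open>V_t\<close> against the Laplacian of the slice. The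
  sharp disc suffices, since \<open>flux_term\<close> bounds the cutoff \<open>chi r\<close> by its
  indicator.\<close>

definition "flux x r = (\<integral>\<^sup>+w. ennreal (E (complex_of_real x, w) * lap (\<lambda>w. V (complex_of_real x, w)) w) * indicator (ball 0 r) w \<partial>lborel)"

text \<open>Uses -f <= eta T + f^2 / (eta T) with T = ln (a / x), f^2 <= A T (-U), and the exchange of U and f
  in lemma symmetry_ineq.\<close>

lemma flux_bound:
  assumes x: "0 < x" "ln (a / x) \<ge> 1" and \<eta>: "\<eta> > 0" and rd: "0 < r" "0 < d" "r + 2 * d \<le> dl"
  shows "flux x r \<le> ennreal (\<eta> * m + A / (\<eta> * ln (a / x)) * (L d * m)) + ennreal (A\<^sup>2 / \<eta>) * lap_mass (U x) (ball 0 (r + d))"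
proof -
  let ?f = "\<lambda>w. V (complex_of_real x, w)" and ?T = "ln (a / x)"
  have xa: "x < a" using x a0 by (smt (verit) divide_le_eq_1_pos ln_le_zero_iff divide_pos_pos)
  have ds0: "d \<le> s0" using rd a0 dl_pos bd by (simp add: s0_def)
  have Ld: "L d \<ge> 0" unfolding L_def using C0 m_nonneg cc_pos rd ds0 by (intro add_nonneg_nonneg mult_nonneg_nonneg divide_nonneg_nonneg ln_ge_zero) auto
  note meas_lap[OF slice_smooth, measurable] meas_lap[OF U_smooth, measurable]
  have [measurable]: "?f \<in> borel_measurable borel" "U x \<in> borel_measurable borel"
    using cont_slice Ck_cont[OF U_smooth] by (simp_all add: borel_measurable_continuous_onI)
  have "(\<lambda>w. \<integral>\<zeta>. ?f (w + d *\<^sub>R \<zeta>) * beta \<zeta> \<partial>lborel) \<in> borel_measurable borel"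
    "(\<lambda>w. \<integral>\<zeta>. U x (w + d *\<^sub>R \<zeta>) * beta \<zeta> \<partial>lborel) \<in> borel_measurable borel" by measurable
  then have [measurable]: "T d ?f \<in> borel_measurable borel" "T d (U x) \<in> borel_measurable borel" by (simp_all add: T_def[abs_def])
  have pt: "E (complex_of_real x, w) * lap ?f w \<le> (\<eta> + A / (\<eta> * ?T) * (L d + max 0 (T d (U x) w - U x w))) * lap ?f w" if w: "cmod w < r" for w
  proof (rule mult_right_mono)
    have wb: "cmod w < b" and wd: "cmod w \<le> dl" using w rd a0 dl_pos bd by auto
    show "0 \<le> lap ?f w" using xa x ab wb by (intro slice_lap_nonneg) auto
    have "E (complex_of_real x, w) * ?T \<le> V (complex_of_real a, w) - ?f w" using x xa ab wb by (intro V_log) auto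
    also have "\<dots> \<le> - ?f w" using nonpos by simp
    finally have e: "E (complex_of_real x, w) \<le> - ?f w / ?T" using x by (simp add: field_simps)
    have fl: "- ?f w \<le> A * ?T" using V_lower[OF x wb] by simp
    have lz: "ln (a / Zf x w) = - ?f w / A" using a0 by (simp add: Zf_def ln_div ln_mult)
    \<comment> \<open>By \<open>V_lower\<close>, the point at which the composition evaluates
      \<open>V\<close> lies between \<open>x\<close> and \<open>a\<close>, as
      \<open>V_convex\<close> requires.\<close>
    have xz: "x \<le> Zf x w"
    proof -
      have "ln (a / Zf x w) \<le> ?T" unfolding lz using fl A_pos by (simp add: field_simps)
      then show ?thesis using x a0 Zf_pos[of x w] by (simp add: divide_le_cancel field_simps)
    qed
    have "U x w \<le> ln (a / Zf x w) / ?T * ?f w" unfolding U_def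
      using x xa xz Zf_le wb by (intro V_convex) auto
    then have u: "(?f w)\<^sup>2 / (A * ?T) \<le> - U x w" unfolding lz by (simp add: power2_eq_square)
    have "- ?f w \<le> \<eta> * ?T + (?f w)\<^sup>2 / (\<eta> * ?T)"
    proof -
      let ?h = "\<eta> * ?T"
      have h: "?h > 0" using \<eta> x by simp
      have "(- ?f w) * ?h \<le> ?h * ?h + (?f w)\<^sup>2"
      proof -
        have "0 \<le> (?f w + ?h / 2)\<^sup>2 + 3 / 4 * ?h\<^sup>2" by simp
        then show ?thesis by (simp add: power2_eq_square algebra_simps)
      qed
      then have "(- ?f w) * ?h / ?h \<le> (?h * ?h + (?f w)\<^sup>2) / ?h" using h by (intro divide_right_mono) auto
      then show ?thesis using \<eta> x by (simp add: add_divide_distrib)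
    qed
    also have "(?f w)\<^sup>2 / (\<eta> * ?T) = A / \<eta> * ((?f w)\<^sup>2 / (A * ?T))" using A_pos by simp
    also have "A / \<eta> * ((?f w)\<^sup>2 / (A * ?T)) \<le> A / \<eta> * (- U x w)" using u A_pos \<eta> by (intro mult_left_mono) auto
    finally have "- ?f w / ?T \<le> (\<eta> * ?T + A / \<eta> * (- U x w)) / ?T" using x by (intro divide_right_mono) auto
    also have "\<dots> = \<eta> + A / (\<eta> * ?T) * (- U x w)" using x \<eta> by (simp add: field_simps)
    also have "\<dots> \<le> \<eta> + A / (\<eta> * ?T) * (L d + max 0 (T d (U x) w - U x w))"
      using T_U_lower[OF wd rd(2) ds0, of x] A_pos \<eta> x by (intro add_left_mono mult_left_mono) auto
    finally show "E (complex_of_real x, w) \<le> \<eta> + A / (\<eta> * ?T) * (L d + max 0 (T d (U x) w - U x w))" using e by linarith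
  qed
  define c1 where "c1 = \<eta> + A / (\<eta> * ?T) * L d"
  define c2 where "c2 = A / (\<eta> * ?T)"
  have c: "c1 \<ge> 0" "c2 \<ge> 0" using \<eta> A_pos x Ld by (auto simp: c1_def c2_def intro!: add_nonneg_nonneg mult_nonneg_nonneg divide_nonneg_nonneg)
  have "flux x r \<le> (\<integral>\<^sup>+w. ennreal c1 * (ennreal (lap ?f w) * indicator (ball 0 r) w) + ennreal c2 * (ennreal (lap ?f w) * ennreal (T d (U x) w - U x w) * indicator (ball 0 r) w) \<partial>lborel)"
    unfolding flux_def
  proof (rule nn_integral_mono)
    fix w
    show "ennreal (E (complex_of_real x, w) * lap ?f w) * indicator (ball 0 r) w \<le> ennreal c1 * (ennreal (lap ?f w) * indicator (ball 0 r) w) + ennreal c2 * (ennreal (lap ?f w) * ennreal (T d (U x) w - U x w) * indicator (ball 0 r) w)"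
    proof (cases "cmod w < r")
      case True
      have wb: "cmod w < b" using True rd a0 dl_pos bd by auto
      have lf: "lap ?f w \<ge> 0" using xa x ab wb by (intro slice_lap_nonneg) auto
      have "ennreal (E (complex_of_real x, w) * lap ?f w) \<le> ennreal (c1 * lap ?f w + c2 * (lap ?f w * max 0 (T d (U x) w - U x w)))"
        using pt[OF True] by (intro ennreal_leI) (simp add: c1_def c2_def algebra_simps)
      also have "\<dots> = ennreal c1 * ennreal (lap ?f w) + ennreal c2 * (ennreal (lap ?f w) * ennreal (max 0 (T d (U x) w - U x w)))"
        using c lf by (subst ennreal_plus) (auto simp: ennreal_mult)
      also have "ennreal (max 0 (T d (U x) w - U x w)) = ennreal (T d (U x) w - U x w)" by (auto simp: max_def ennreal_neg)
      finally show ?thesis using True by simp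
    qed simp
  qed
  also have "\<dots> = ennreal c1 * lap_mass ?f (ball 0 r) + ennreal c2 * (\<integral>\<^sup>+w. ennreal (lap ?f w) * ennreal (T d (U x) w - U x w) * indicator (ball 0 r) w \<partial>lborel)"
    unfolding lap_mass_def by (subst nn_integral_add, measurable) (simp add: nn_integral_cmult)
  finally have J1: "flux x r \<le> ennreal c1 * lap_mass ?f (ball 0 r) + ennreal c2 * (\<integral>\<^sup>+w. ennreal (lap ?f w) * ennreal (T d (U x) w - U x w) * indicator (ball 0 r) w \<partial>lborel)" .
  \<comment> \<open>After the exchange the excess of \<open>?f\<close> is at most
    \<open>- ?f\<close>, hence at most \<open>A * ?T\<close>. This factor cancels the
    \<open>?T\<close> in the denominator of \<open>c2\<close>, so that the mass of \<open>U\<close>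
    enters with a coefficient independent of \<open>x\<close>.\<close>
  have "(\<integral>\<^sup>+w. ennreal (lap ?f w) * ennreal (T d (U x) w - U x w) * indicator (ball 0 r) w \<partial>lborel)
     \<le> (\<integral>\<^sup>+y. ennreal (lap (U x) y) * ennreal (T d ?f y - ?f y) * indicator (ball 0 (r + d)) y \<partial>lborel)"
    using rd x xa ab a0 dl_pos bd by (intro symmetry_ineq slice_smooth U_smooth slice_lap_nonneg U_lap_nonneg) auto
  also have "\<dots> \<le> (\<integral>\<^sup>+y. ennreal (A * ?T) * (ennreal (lap (U x) y) * indicator (ball 0 (r + d)) y) \<partial>lborel)"
  proof (rule nn_integral_mono)
    fix y
    have "ennreal (lap (U x) y) * ennreal (T d ?f y - ?f y) \<le> ennreal (lap (U x) y) * ennreal (A * ?T)" if "cmod y < r + d"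
      using T_slice_nonpos[of d "complex_of_real x" y] V_lower[OF x, of y] that rd a0 dl_pos bd
      by (intro mult_left_mono ennreal_leI) auto
    then show "ennreal (lap (U x) y) * ennreal (T d ?f y - ?f y) * indicator (ball 0 (r + d)) y \<le> ennreal (A * ?T) * (ennreal (lap (U x) y) * indicator (ball 0 (r + d)) y)"
      by (auto simp: indicator_def mult.commute)
  qed
  also have "\<dots> = ennreal (A * ?T) * lap_mass (U x) (ball 0 (r + d))"
    unfolding lap_mass_def by (rule nn_integral_cmult) measurable
  finally have J2: "(\<integral>\<^sup>+w. ennreal (lap ?f w) * ennreal (T d (U x) w - U x w) * indicator (ball 0 r) w \<partial>lborel) \<le> ennreal (A * ?T) * lap_mass (U x) (ball 0 (r + d))" .
  have J3: "lap_mass ?f (ball 0 r) \<le> ennreal m" using rd x xa ab a0 by (intro lap_mass_slice_sub) auto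
  have "flux x r \<le> ennreal c1 * ennreal m + ennreal c2 * (ennreal (A * ?T) * lap_mass (U x) (ball 0 (r + d)))"
    by (rule order_trans[OF J1]) (intro add_mono mult_left_mono J2 J3 zero_le)
  also have "ennreal c1 * ennreal m = ennreal (\<eta> * m + A / (\<eta> * ?T) * (L d * m))"
    using c m_nonneg by (subst ennreal_mult[symmetric]) (auto simp: c1_def algebra_simps)
  also have "ennreal c2 * (ennreal (A * ?T) * lap_mass (U x) (ball 0 (r + d))) = ennreal (A\<^sup>2 / \<eta>) * lap_mass (U x) (ball 0 (r + d))"
  proof -
    have "ennreal c2 * ennreal (A * ?T) = ennreal (A\<^sup>2 / \<eta>)"
      using c A_pos x \<eta> by (subst ennreal_mult[symmetric]) (auto simp: c2_def power2_eq_square)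
    then show ?thesis by (simp add: mult.assoc[symmetric])
  qed
  finally show ?thesis .
qed

end

section \<open>The Monge--Ampere integral\<close>

text \<open>V_aa V_bb - V_ab^2 = (V_a V_bb)_a - ((V_a)^2)_bb / 2.\<close>

lemma ibp_pair:
  fixes V \<phi> :: "'a::euclidean_space \<Rightarrow> real"
  assumes V: "\<And>n. Ck n V" and \<phi>: "\<And>n. Ck n \<phi>" and c: "csupp \<phi>"
  shows "(\<integral>x. \<phi> x * (dr a (dr a V) x * dr b (dr b V) x - (dr a (dr b V) x)\<^sup>2) \<partial>lborel)
    = - (\<integral>x. dr a \<phi> x * dr a V x * dr b (dr b V) x \<partial>lborel) - (\<integral>x. dr b (dr b \<phi>) x * (dr a V x)\<^sup>2 \<partial>lborel) / 2"
proof -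
  have V1: "Ck n (dr e V)" for n e using Ck_dr[OF V[of "Suc n"]] .
  have V2: "Ck n (dr e (dr e' V))" for n e e' using Ck_dr[OF V1[of "Suc n"]] .
  have V3: "Ck n (dr e (dr e' (dr e'' V)))" for n e e' e'' using Ck_dr[OF V2[of "Suc n"]] .
  have p1: "Ck n (dr e \<phi>)" for n e using Ck_dr[OF \<phi>[of "Suc n"]] .
  have p2: "Ck n (dr e (dr e' \<phi>))" for n e e' using Ck_dr[OF p1[of "Suc n"]] .
  note co = Ck_cont[OF V] Ck_cont[OF V1] Ck_cont[OF V2] Ck_cont[OF V3] Ck_cont[OF \<phi>] Ck_cont[OF p1] Ck_cont[OF p2]
  define W where "W = dr a V"
  have W: "Ck n W" for n unfolding W_def by (rule V1)
  have W1: "Ck n (dr e W)" for n e unfolding W_def by (rule V2)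
  have W2: "Ck n (dr e (dr e' W))" for n e e' unfolding W_def by (rule V3)
  have c1: "dr a (dr b V) = dr b W" unfolding W_def by (rule ext) (rule dr_commute[OF V[of "Suc (Suc 0)"]])
  have c2: "dr a (dr b (dr b V)) = dr b (dr b W)"
  proof
    fix x
    have "dr a (dr b (dr b V)) x = dr b (dr a (dr b V)) x" by (rule dr_commute[OF V1[of "Suc (Suc 0)"]])
    then show "dr a (dr b (dr b V)) x = dr b (dr b W) x" by (simp only: c1)
  qed
  have int: "integrable lborel (\<lambda>x. g x * h x)" if "continuous_on UNIV g" "continuous_on UNIV h" "csupp g" for g h :: "'a \<Rightarrow> real"
    using that by (intro csupp_integrable csupp_mult1 continuous_intros)
  have i1: "integrable lborel (\<lambda>x. \<phi> x * (dr b (dr b V) x * dr a W x))"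
    and i2: "integrable lborel (\<lambda>x. \<phi> x * (dr b W x * dr b W x))"
    and i3: "integrable lborel (\<lambda>x. dr a \<phi> x * (dr a V x * dr b (dr b V) x))"
    and i4: "integrable lborel (\<lambda>x. \<phi> x * (dr b (dr b W) x * W x))"
    and i5: "integrable lborel (\<lambda>x. dr b \<phi> x * (W x * dr b W x))"
    by (intro int continuous_intros co Ck_cont[OF W] Ck_cont[OF W1] Ck_cont[OF W2] c csupp_dr)+
  have A: "(\<integral>x. \<phi> x * (dr b (dr b V) x * dr a W x) \<partial>lborel) = - (\<integral>x. dr a \<phi> x * (dr a V x * dr b (dr b V) x) \<partial>lborel) - (\<integral>x. \<phi> x * (dr b (dr b W) x * W x) \<partial>lborel)"
  proof -
    have "(\<integral>x. (\<phi> x * dr b (dr b V) x) * dr a W x \<partial>lborel) = - (\<integral>x. dr a (\<lambda>x. \<phi> x * dr b (dr b V) x) x * W x \<partial>lborel)"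
      by (intro integral_by_parts Ck_mult \<phi> V2 W csupp_mult1 c)
    also have "(\<integral>x. dr a (\<lambda>x. \<phi> x * dr b (dr b V) x) x * W x \<partial>lborel) = (\<integral>x. \<phi> x * (dr b (dr b W) x * W x) + dr a \<phi> x * (dr a V x * dr b (dr b V) x) \<partial>lborel)"
      by (rule Bochner_Integration.integral_cong) (auto simp: dr_mult[OF \<phi>[of "Suc 0"] V2[of "Suc 0"]] c2 W_def[symmetric] algebra_simps)
    finally show ?thesis using i3 i4 by (simp add: mult.assoc)
  qed
  have B: "(\<integral>x. \<phi> x * (dr b W x * dr b W x) \<partial>lborel) = - (\<integral>x. dr b \<phi> x * (W x * dr b W x) \<partial>lborel) - (\<integral>x. \<phi> x * (dr b (dr b W) x * W x) \<partial>lborel)"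
  proof -
    have "(\<integral>x. (\<phi> x * dr b W x) * dr b W x \<partial>lborel) = - (\<integral>x. dr b (\<lambda>x. \<phi> x * dr b W x) x * W x \<partial>lborel)"
      by (intro integral_by_parts Ck_mult \<phi> W1 W csupp_mult1 c)
    also have "(\<integral>x. dr b (\<lambda>x. \<phi> x * dr b W x) x * W x \<partial>lborel) = (\<integral>x. \<phi> x * (dr b (dr b W) x * W x) + dr b \<phi> x * (W x * dr b W x) \<partial>lborel)"
      by (rule Bochner_Integration.integral_cong) (auto simp: dr_mult[OF \<phi>[of "Suc 0"] W1[of "Suc 0"]] algebra_simps)
    finally show ?thesis using i5 i4 by (simp add: mult.assoc)
  qed
  have D: "(\<integral>x. dr b \<phi> x * (W x * dr b W x) \<partial>lborel) = - (\<integral>x. dr b (dr b \<phi>) x * (W x)\<^sup>2 \<partial>lborel) / 2"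
  proof -
    have "(\<integral>x. dr b \<phi> x * dr b (\<lambda>x. W x * W x) x \<partial>lborel) = - (\<integral>x. dr b (dr b \<phi>) x * (W x * W x) \<partial>lborel)"
      by (intro integral_by_parts p1 Ck_mult W csupp_dr c)
    moreover have "dr b (\<lambda>x. W x * W x) x = 2 * (W x * dr b W x)" for x by (simp add: dr_mult[OF W[of "Suc 0"] W[of "Suc 0"]])
    ultimately show ?thesis by (simp add: power2_eq_square mult.left_commute[of _ 2])
  qed
  have "(\<integral>x. \<phi> x * (dr a (dr a V) x * dr b (dr b V) x - (dr a (dr b V) x)\<^sup>2) \<partial>lborel)
     = (\<integral>x. \<phi> x * (dr b (dr b V) x * dr a W x) - \<phi> x * (dr b W x * dr b W x) \<partial>lborel)"
    by (rule Bochner_Integration.integral_cong) (auto simp: c1 W_def[symmetric] algebra_simps power2_eq_square)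
  also have "\<dots> = (\<integral>x. \<phi> x * (dr b (dr b V) x * dr a W x) \<partial>lborel) - (\<integral>x. \<phi> x * (dr b W x * dr b W x) \<partial>lborel)"
    using i1 i2 by simp
  finally show ?thesis unfolding A B D by (simp add: mult.assoc W_def)
qed

section \<open>Radial bump functions as test functions\<close>

text \<open>The factor \<open>exp 1\<close> makes the bump equal to 1 at the origin.
  \<open>chi'\<close> is the radial factor in grad chi = - chi' z, so that pairing the gradients of
  the bump and of \<open>V\<close> in \<open>z\<close> produces \<open>E\<close>.\<close>

definition chi :: "real \<Rightarrow> complex \<Rightarrow> real" where "chi r z = exp 1 * flat_exp 0 (1 - sqn z / r\<^sup>2)"
definition chi' :: "real \<Rightarrow> complex \<Rightarrow> real" where "chi' r z = 2 * exp 1 / r\<^sup>2 * flat_exp 2 (1 - sqn z / r\<^sup>2)"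

lemma sqn_div: "Ck n (\<lambda>z. 1 - sqn z / r\<^sup>2)"
  using Ck_diff[OF Ck_const[of n 1] Ck_cmult[OF Ck_sqn, of n "1 / r\<^sup>2"]] by simp

lemma Ck_chi: "Ck n (chi r)" and Ck_chi': "Ck n (chi' r)"
  unfolding chi_def[abs_def] chi'_def[abs_def] by (intro Ck_cmult Ck_flat_exp sqn_div)+

lemma chi_nonneg: "chi r z \<ge> 0" and chi'_nonneg: "chi' r z \<ge> 0"
  unfolding chi_def chi'_def by (intro mult_nonneg_nonneg divide_nonneg_nonneg flat_exp_nonneg; simp)+

lemma sqn_nonneg: "sqn z \<ge> 0" by (simp add: sqn_def)

lemma chi_0: "chi r 0 = 1" by (simp add: chi_def flat_exp_def sqn_def exp_minus)

lemma chi_le: "chi r z \<le> 1"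
proof (cases "1 - sqn z / r\<^sup>2 > 0")
  case True
  have "sqn z / r\<^sup>2 \<ge> 0" by (simp add: sqn_nonneg)
  then have "inverse (1 - sqn z / r\<^sup>2) \<ge> 1" using True by (intro one_le_inverse) auto
  then have "exp 1 * exp (- inverse (1 - sqn z / r\<^sup>2)) \<le> 1" by (simp add: exp_add[symmetric])
  then show ?thesis using True by (simp add: chi_def flat_exp_def)
qed (simp add: chi_def flat_exp_0)

lemma chi_zero: "r > 0 \<Longrightarrow> cmod z \<ge> r \<Longrightarrow> chi r z = 0" and chi'_zero: "r > 0 \<Longrightarrow> cmod z \<ge> r \<Longrightarrow> chi' r z = 0"
proof -
  have "1 - sqn z / r\<^sup>2 \<le> 0" if "r > 0" "cmod z \<ge> r"
    using power_mono[OF that(2), of 2] that by (simp add: sqn_def)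
  then show "r > 0 \<Longrightarrow> cmod z \<ge> r \<Longrightarrow> chi r z = 0" "r > 0 \<Longrightarrow> cmod z \<ge> r \<Longrightarrow> chi' r z = 0"
    by (simp_all add: chi_def chi'_def flat_exp_0)
qed

lemma meas_chi[measurable]: "chi r \<in> borel_measurable borel" and meas_chi'[measurable]: "chi' r \<in> borel_measurable borel"
  by (simp_all add: borel_measurable_continuous_onI Ck_cont[OF Ck_chi] Ck_cont[OF Ck_chi'])

lemma csupp_chi: "r > 0 \<Longrightarrow> csupp (chi r)" and csupp_chi': "r > 0 \<Longrightarrow> csupp (chi' r)"
  unfolding csupp_def by (rule exI[of _ r], auto intro: chi_zero chi'_zero)+

lemma dr_chi: "dr e (chi r) z = - chi' r z * (Re e * Re z + Im e * Im z)"
proof -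
  have "((\<lambda>z. 1 - (1 / r\<^sup>2) * sqn z) has_derivative (\<lambda>e. 0 - (1 / r\<^sup>2) * (2 * (Re e * Re z + Im e * Im z)))) (at z)"
    by (intro has_derivative_diff has_derivative_const has_derivative_mult_right sqn_has_derivative)
  from has_derivative_mult_right[OF has_derivative_compose[OF this has_field_derivative_imp_has_derivative[OF flat_exp_deriv]], of "exp 1" 0]
  have "dr e (\<lambda>z. exp 1 * flat_exp 0 (1 - (1 / r\<^sup>2) * sqn z)) z = exp 1 * (flat_exp 2 (1 - (1 / r\<^sup>2) * sqn z) * (0 - (1 / r\<^sup>2) * (2 * (Re e * Re z + Im e * Im z))))"
    by (intro dr_eqI) (simp add: numeral_2_eq_2)
  then show ?thesis by (simp add: chi_def[abs_def] chi'_def)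
qed

text \<open>A bound for the integral of \<open>chi' r\<close> at every \<open>r\<close>: the
  pointwise bound scales like \<open>1 / r\<^sup>2\<close>, the area like \<open>r\<^sup>2\<close>.
  The number 48 is twice the factorial of 4 from \<open>flat_exp_le\<close>.\<close>

definition "K0 = 48 * exp 1 * measure lborel (ball (0::complex) 1)"

lemma K0_nonneg: "K0 \<ge> 0" by (simp add: K0_def)

lemma chi'_le: assumes "r > 0" shows "chi' r z \<le> 48 * exp 1 / r\<^sup>2"
proof -
  have "flat_exp 2 (1 - sqn z / r\<^sup>2) \<le> 24"
  proof (cases "1 - sqn z / r\<^sup>2 > 0")
    case True
    have "(1 - sqn z / r\<^sup>2)\<^sup>2 \<le> 1" using True sqn_nonneg[of z] by (intro power_le_one) auto
    then show ?thesis using flat_exp_le[OF True, of 2] by (simp add: fact_numeral)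
  qed (simp add: flat_exp_0)
  then have "2 * exp 1 / r\<^sup>2 * flat_exp 2 (1 - sqn z / r\<^sup>2) \<le> 2 * exp 1 / r\<^sup>2 * 24" by (intro mult_left_mono) auto
  then show ?thesis by (simp add: chi'_def)
qed

lemma nn_chi': assumes r: "r > 0" shows "(\<integral>\<^sup>+z. ennreal (chi' r z) \<partial>lborel) \<le> ennreal K0"
proof -
  have "(\<integral>\<^sup>+z. ennreal (chi' r z) \<partial>lborel) \<le> (\<integral>\<^sup>+z. ennreal (48 * exp 1 / r\<^sup>2) * indicator (ball (0::complex) r) z \<partial>lborel)"
    by (rule nn_integral_mono) (use chi'_le[OF r] chi'_zero[OF r] in \<open>auto simp: indicator_def ennreal_leI\<close>)
  also have "\<dots> = ennreal (48 * exp 1 / r\<^sup>2) * emeasure lborel (ball (0::complex) r)" by (simp add: nn_integral_cmult)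
  also have "emeasure lborel (ball (0::complex) r) = ennreal (measure lborel (ball (0::complex) r))"
    by (rule emeasure_eq_ennreal_measure) (use emeasure_lborel_ball_finite in \<open>auto simp: less_top[symmetric]\<close>)
  also have "measure lborel (ball (0::complex) r) = r\<^sup>2 * measure lborel (ball (0::complex) 1)"
    using content_ball_conv_unit_ball[of r "0::complex"] r by simp
  also have "ennreal (48 * exp 1 / r\<^sup>2) * ennreal (r\<^sup>2 * measure lborel (ball (0::complex) 1)) = ennreal K0"
    using r by (subst ennreal_mult[symmetric]) (auto simp: K0_def)
  finally show ?thesis .
qed

definition test2 :: "real \<Rightarrow> real \<Rightarrow> c2 \<Rightarrow> real" where "test2 q r p = chi q (fst p) * chi r (snd p)"

lemma Ck_fst: "Ck n f \<Longrightarrow> Ck n (\<lambda>p::c2. f (fst p))" and Ck_snd: "Ck n f \<Longrightarrow> Ck n (\<lambda>p::c2. f (snd p))"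
  using Ck_affine[OF bounded_linear_fst, of n f 0] Ck_affine[OF bounded_linear_snd, of n f 0] by simp_all

lemma dr_fst: "Ck (Suc n) f \<Longrightarrow> dr e (\<lambda>p::c2. f (fst p)) = (\<lambda>p. dr (fst e) f (fst p))"
  and dr_snd: "Ck (Suc n) f \<Longrightarrow> dr e (\<lambda>p::c2. f (snd p)) = (\<lambda>p. dr (snd e) f (snd p))"
  using dr_affine[OF bounded_linear_fst, of n f e 0] dr_affine[OF bounded_linear_snd, of n f e 0] by (auto simp: fun_eq_iff)

lemma Ck_test2: "Ck n (test2 q r)" unfolding test2_def[abs_def] by (intro Ck_mult Ck_fst Ck_snd Ck_chi)

lemma test2_zero: assumes "q > 0" "r > 0" "test2 q r p \<noteq> 0" shows "cmod (fst p) < q \<and> cmod (snd p) < r"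
  using assms chi_zero[of q "fst p"] chi_zero[of r "snd p"] by (auto simp: test2_def not_le[symmetric])

lemma csupp_test2: assumes "q > 0" "r > 0" shows "csupp (test2 q r)"
proof -
  have "test2 q r p = 0" if "norm p > q + r" for p
    using test2_zero[OF assms, of p] that norm_Pair_le[of "fst p" "snd p"] by force
  then show ?thesis by (auto simp: csupp_def)
qed

lemma dr_test2:
  shows "dr (e, 0) (test2 q r) p = dr e (chi q) (fst p) * chi r (snd p)"
    and "dr (0, e) (dr (0, e) (test2 q r)) p = chi q (fst p) * dr e (dr e (chi r)) (snd p)"
proof -
  have d: "dr x (test2 q r) p = chi q (fst p) * dr (snd x) (chi r) (snd p) + dr (fst x) (chi q) (fst p) * chi r (snd p)" for x p
    unfolding test2_def[abs_def]
    by (subst dr_mult[OF Ck_fst[OF Ck_chi, of "Suc 0"] Ck_snd[OF Ck_chi, of "Suc 0"]]) (simp add: dr_fst[OF Ck_chi[of "Suc 0"]] dr_snd[OF Ck_chi[of "Suc 0"]])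
  show "dr (e, 0) (test2 q r) p = dr e (chi q) (fst p) * chi r (snd p)"
    unfolding d by (simp add: dr_chi)
  have "dr (0, e) (test2 q r) = (\<lambda>p. chi q (fst p) * dr e (chi r) (snd p))"
    by (rule ext) (simp add: d dr_chi)
  moreover have ck: "Ck (Suc 0) (dr e (chi r))" by (rule Ck_dr[OF Ck_chi])
  moreover have "dr (0, e) (\<lambda>p. chi q (fst p) * dr e (chi r) (snd p)) p = chi q (fst p) * dr e (dr e (chi r)) (snd p)"
    by (subst dr_mult[OF Ck_fst[OF Ck_chi, of "Suc 0"] Ck_snd[OF ck]]) (simp add: dr_fst[OF Ck_chi[of "Suc 0"]] dr_snd[OF ck] dr_chi[of 0])
  ultimately show "dr (0, e) (dr (0, e) (test2 q r)) p = chi q (fst p) * dr e (dr e (chi r)) (snd p)" by simp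
qed

lemma pd_eq_dr: "Ck (Suc n) f \<Longrightarrow> pd e f = dr e f"
  by (rule ext) (use dr_line[of n f _ e 0] in \<open>auto simp: pd_def intro!: DERIV_imp_deriv\<close>)

section \<open>Monge-Ampere mass as flux plus a gradient error\<close>

context smooth_inv
begin

lemma X_zero: "X (0, w) = 0" "Y (0, w) = 0"
  using rot_id_deriv[of dy1 "(0, w)"] rot_id_deriv[of dx1 "(0, w)"] by (auto simp: dy1_def dx1_def)

text \<open>By \<open>rot_id\<close> the vector (X, Y) is a multiple of (Re z, Im z), and
  derivatives along \<open>w\<close> keep this ratio. The determinant is the cross term by which the
  squared modulus of the mixed complex derivative differs from the sum of the four squared real
  ones; its vanishing makes \<open>MA_density\<close> a sum of four real Hessian minors, each of the
  shape treated by \<open>ibp_pair\<close>.\<close>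

lemma mixed_zero: "dr dx2 X p * dr dy2 Y p - dr dy2 X p * dr dx2 Y p = 0"
proof -
  obtain z w where p: "p = (z, w)" by force
  have 1: "Im z * dr (0, e) X p = Re z * dr (0, e) Y p" for e using rot_id_deriv[of "(0, e)" p] by (simp add: p)
  consider "Re z \<noteq> 0" | "Im z \<noteq> 0" | "z = 0" by (auto simp: complex_eq_iff)
  then show ?thesis
  proof cases
    case 1
    have "Re z * (dr dx2 X p * dr dy2 Y p - dr dy2 X p * dr dx2 Y p) = dr dx2 X p * (Re z * dr dy2 Y p) - dr dy2 X p * (Re z * dr dx2 Y p)"
      by (simp add: algebra_simps)
    also have "\<dots> = 0" unfolding dx2_def dy2_def \<open>\<And>e. Im z * dr (0, e) X p = Re z * dr (0, e) Y p\<close>[symmetric] by simp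
    finally show ?thesis using 1 by simp
  next
    case 2
    have "Im z * (dr dx2 X p * dr dy2 Y p - dr dy2 X p * dr dx2 Y p) = (Im z * dr dx2 X p) * dr dy2 Y p - (Im z * dr dy2 X p) * dr dx2 Y p"
      by (simp add: algebra_simps)
    also have "\<dots> = 0" unfolding dx2_def dy2_def \<open>\<And>e. Im z * dr (0, e) X p = Re z * dr (0, e) Y p\<close> by simp
    finally show ?thesis using 2 by simp
  next
    case 3
    have "dr (0, e) X p = 0" for e using slice_dr[OF smX[of "Suc 0"], of e dx1 0 w] 3 p X_zero by (simp add: dr_def)
    then show ?thesis by (simp add: dx2_def dy2_def)
  qed
qed

definition "lapw p = dr dx2 (dr dx2 V) p + dr dy2 (dr dy2 V) p"

lemma MA_density_eq: "MA_density V p = (1 / (2 * pi\<^sup>2)) *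
   ((dr dx1 X p * dr dx2 (dr dx2 V) p - (dr dx1 (dr dx2 V) p)\<^sup>2) + (dr dx1 X p * dr dy2 (dr dy2 V) p - (dr dx1 (dr dy2 V) p)\<^sup>2)
   + (dr dy1 Y p * dr dx2 (dr dx2 V) p - (dr dy1 (dr dx2 V) p)\<^sup>2) + (dr dy1 Y p * dr dy2 (dr dy2 V) p - (dr dy1 (dr dy2 V) p)\<^sup>2))"
proof -
  have c: "dr dx1 (dr dx2 V) p = dr dx2 X p" "dr dx1 (dr dy2 V) p = dr dy2 X p" "dr dy1 (dr dx2 V) p = dr dx2 Y p" "dr dy1 (dr dy2 V) p = dr dy2 Y p"
    by (rule dr_commute[OF smooth[of "Suc (Suc 0)"]])+
  have "(8 / pi\<^sup>2) * (((A + B) / 4) * ((D + F) / 4) - (((a + d) / 4)\<^sup>2 + ((b - c) / 4)\<^sup>2))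
    = (1 / (2 * pi\<^sup>2)) * ((A * D - a\<^sup>2) + (A * F - b\<^sup>2) + (B * D - c\<^sup>2) + (B * F - d\<^sup>2))"
    if "a * d - b * c = 0" for A B D F a b c d :: real
  proof -
    have "8 * (((A + B) / 4) * ((D + F) / 4) - (((a + d) / 4)\<^sup>2 + ((b - c) / 4)\<^sup>2)) = (1 / 2) * ((A * D - a\<^sup>2) + (A * F - b\<^sup>2) + (B * D - c\<^sup>2) + (B * F - d\<^sup>2)) - (a * d - b * c)"
      by (simp add: power2_eq_square field_simps)
    then have e: "8 * (((A + B) / 4) * ((D + F) / 4) - (((a + d) / 4)\<^sup>2 + ((b - c) / 4)\<^sup>2)) = (1 / 2) * ((A * D - a\<^sup>2) + (A * F - b\<^sup>2) + (B * D - c\<^sup>2) + (B * F - d\<^sup>2))"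
      using that by simp
    have "(8 / pi\<^sup>2) * x = (1 / (2 * pi\<^sup>2)) * y" if "8 * x = (1 / 2) * y" for x y :: real
    proof -
      have "y = 16 * x" using that by simp
      then show ?thesis by simp
    qed
    from this[OF e] show ?thesis .
  qed
  from this[OF mixed_zero[of p]] show ?thesis
    unfolding MA_density_def Let_def by (simp only: pd_eq_dr[OF smooth[of "Suc 0"]] pd_eq_dr[OF smX[of "Suc 0"]] c)
qed

lemma grad_sq: "sqn (fst p) * ((X p)\<^sup>2 + (Y p)\<^sup>2) = (E p)\<^sup>2"
  using rot_id[of p] unfolding E_alt sqn_alt
  by algebra

text \<open>\<open>ibp_pair\<close> for the four pairs of one direction in \<open>z\<close> and one
  in \<open>w\<close>. The derivative of the test function in \<open>z\<close> meets that of
  \<open>V\<close> and gives \<open>chi' * E\<close>, the flux; the second derivatives in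
  \<open>w\<close> give the Laplacian of \<open>chi r\<close> against the squared gradient in
  \<open>z\<close>, the error.\<close>

lemma MA_integral:
  assumes q: "q > 0" and r: "r > 0"
  shows "(\<integral>p. test2 q r p * MA_density V p \<partial>lborel) = (1 / (2 * pi\<^sup>2)) *
    ((\<integral>p. chi' q (fst p) * chi r (snd p) * E p * lapw p \<partial>lborel)
     + (\<integral>p. chi q (fst p) * (- lap (chi r) (snd p)) * ((X p)\<^sup>2 + (Y p)\<^sup>2) \<partial>lborel) / 2)"
proof -
  let ?\<phi> = "test2 q r"
  note c\<phi> = csupp_test2[OF q r]
  note co = Ck_cont[OF smooth] Ck_cont[OF smX] Ck_cont[OF smXX] Ck_cont[OF Ck_test2]
  have p1: "Ck n (dr e ?\<phi>)" for n e using Ck_dr[OF Ck_test2[of "Suc n"]] .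
  have p2: "Ck n (dr e (dr e' ?\<phi>))" for n e e' using Ck_dr[OF p1[of "Suc n"]] .
  define G where "G a b p = ?\<phi> p * (dr a (dr a V) p * dr b (dr b V) p - (dr a (dr b V) p)\<^sup>2)" for a b p
  have iG: "integrable lborel (G a b)" for a b
    unfolding G_def by (intro csupp_integrable csupp_mult1 c\<phi> continuous_intros co)
  define H where "H a b p = dr a ?\<phi> p * dr a V p * dr b (dr b V) p" for a b p
  define I where "I a b p = dr b (dr b ?\<phi>) p * (dr a V p)\<^sup>2" for a b p
  have iH: "integrable lborel (H a b)" and iI: "integrable lborel (I a b)" for a b
    unfolding H_def I_def by (intro csupp_integrable csupp_mult1 csupp_dr c\<phi> continuous_intros co Ck_cont[OF p1] Ck_cont[OF p2])+
  have ibp: "(\<integral>p. G a b p \<partial>lborel) = - (\<integral>p. H a b p \<partial>lborel) - (\<integral>p. I a b p \<partial>lborel) / 2" for a b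
    unfolding G_def H_def I_def by (rule ibp_pair[OF smooth Ck_test2 c\<phi>])
  have "(\<integral>p. ?\<phi> p * MA_density V p \<partial>lborel) = (\<integral>p. (1 / (2 * pi\<^sup>2)) * (G dx1 dx2 p + G dx1 dy2 p + G dy1 dx2 p + G dy1 dy2 p) \<partial>lborel)"
    by (rule Bochner_Integration.integral_cong) (simp_all add: MA_density_eq G_def algebra_simps)
  also have "\<dots> = (1 / (2 * pi\<^sup>2)) * ((\<integral>p. G dx1 dx2 p \<partial>lborel) + (\<integral>p. G dx1 dy2 p \<partial>lborel) + (\<integral>p. G dy1 dx2 p \<partial>lborel) + (\<integral>p. G dy1 dy2 p \<partial>lborel))"
    by (simp add: iG)
  also have "\<dots> = (1 / (2 * pi\<^sup>2)) * (- ((\<integral>p. H dx1 dx2 p \<partial>lborel) + (\<integral>p. H dx1 dy2 p \<partial>lborel) + (\<integral>p. H dy1 dx2 p \<partial>lborel) + (\<integral>p. H dy1 dy2 p \<partial>lborel))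
      - ((\<integral>p. I dx1 dx2 p \<partial>lborel) + (\<integral>p. I dx1 dy2 p \<partial>lborel) + (\<integral>p. I dy1 dx2 p \<partial>lborel) + (\<integral>p. I dy1 dy2 p \<partial>lborel)) / 2)"
    unfolding ibp by (rule arg_cong[where f="\<lambda>t. (1 / (2 * pi\<^sup>2)) * t"]) argo
  also have "- ((\<integral>p. H dx1 dx2 p \<partial>lborel) + (\<integral>p. H dx1 dy2 p \<partial>lborel) + (\<integral>p. H dy1 dx2 p \<partial>lborel) + (\<integral>p. H dy1 dy2 p \<partial>lborel))
     = (\<integral>p. - (H dx1 dx2 p + H dx1 dy2 p + H dy1 dx2 p + H dy1 dy2 p) \<partial>lborel)"
    by (simp add: iH)
  also have "(\<lambda>p. - (H dx1 dx2 p + H dx1 dy2 p + H dy1 dx2 p + H dy1 dy2 p)) = (\<lambda>p. chi' q (fst p) * chi r (snd p) * E p * lapw p)"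
  proof
    fix p
    have "dr dx1 ?\<phi> p = - chi' q (fst p) * Re (fst p) * chi r (snd p)" "dr dy1 ?\<phi> p = - chi' q (fst p) * Im (fst p) * chi r (snd p)"
      unfolding dx1_def dy1_def dr_test2(1) dr_chi by auto
    then show "- (H dx1 dx2 p + H dx1 dy2 p + H dy1 dx2 p + H dy1 dy2 p) = chi' q (fst p) * chi r (snd p) * E p * lapw p"
      unfolding H_def lapw_def E_alt by (simp add: algebra_simps)
  qed
  also have "((\<integral>p. I dx1 dx2 p \<partial>lborel) + (\<integral>p. I dx1 dy2 p \<partial>lborel) + (\<integral>p. I dy1 dx2 p \<partial>lborel) + (\<integral>p. I dy1 dy2 p \<partial>lborel))
    = (\<integral>p. I dx1 dx2 p + I dx1 dy2 p + I dy1 dx2 p + I dy1 dy2 p \<partial>lborel)"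
    by (simp add: iI)
  also have "(\<lambda>p. I dx1 dx2 p + I dx1 dy2 p + I dy1 dx2 p + I dy1 dy2 p) = (\<lambda>p. - (chi q (fst p) * (- lap (chi r) (snd p)) * ((X p)\<^sup>2 + (Y p)\<^sup>2)))"
    unfolding I_def lap_def dx2_def dy2_def dr_test2(2) by (auto simp: algebra_simps)
  finally show ?thesis by simp
qed

lemma E_cont: "continuous_on UNIV E"
  unfolding E_alt[abs_def] by (intro continuous_intros Ck_cont[OF smX])

text \<open>\<open>E\<close> and \<open>lapw\<close> depend on \<open>z\<close> only through |z|, so
  the integral over \<open>w\<close> for fixed \<open>z\<close> is at most \<open>chi' q z\<close>
  times \<open>flux (cmod z) r\<close>; \<open>chi' q\<close> has total mass at most
  \<open>K0\<close>. The point z = 0, where the hypothesis says nothing, is a null set.\<close>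

lemma flux_term:
  assumes q: "0 < q" "q < a" and r: "0 < r" "r \<le> dl" and \<kappa>: "\<kappa> \<ge> 0" and J: "\<And>x. 0 < x \<Longrightarrow> x < q \<Longrightarrow> flux x r \<le> ennreal \<kappa>"
  shows "(\<integral>p. chi' q (fst p) * chi r (snd p) * E p * lapw p \<partial>lborel) \<le> K0 * \<kappa>"
proof -
  let ?F = "\<lambda>p. chi' q (fst p) * chi r (snd p) * E p * lapw p"
  have cl: "continuous_on UNIV lapw" unfolding lapw_def[abs_def] by (intro continuous_intros Ck_cont[OF smXX])
  have cF: "continuous_on UNIV ?F"
    by (intro continuous_intros E_cont cl Ck_cont[OF Ck_fst[OF Ck_chi']] Ck_cont[OF Ck_snd[OF Ck_chi]])
  have [measurable]: "?F \<in> borel_measurable borel" using cF by (rule borel_measurable_continuous_onI)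
  have mp: "case_prod (\<lambda>z w. ennreal (?F (z, w))) \<in> borel_measurable (lborel \<Otimes>\<^sub>M lborel)"
    unfolding lborel_prod by (simp add: case_prod_beta')
  have lw: "lapw (z, w) = lap (\<lambda>w. V (z, w)) w" for z w by (simp add: lapw_def slice_lap)
  have lwp: "lapw (z, w) = lapw (complex_of_real (cmod z), w)" for z w
    unfolding lw using V_polar by presburger
  have nn: "?F p \<ge> 0" for p
  proof (cases "cmod (fst p) < q \<and> cmod (snd p) < r")
    case True
    then have "cmod (fst p) < b" "cmod (snd p) < b" using q r ab dl_pos bd a0 by auto
    then have "E p \<ge> 0" "lapw p \<ge> 0" using E_nonneg[of "fst p" "snd p"] slice_lap_nonneg[of "fst p" "snd p"] lw[of "fst p" "snd p"] by auto
    then show ?thesis by (intro mult_nonneg_nonneg chi_nonneg chi'_nonneg)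
  qed (use chi_zero[OF r(1), of "snd p"] chi'_zero[OF q(1), of "fst p"] in auto)
  have "csupp ?F"
    unfolding csupp_def
  proof (intro exI[of _ "q + r"] allI impI)
    fix p :: c2 assume "norm p > q + r"
    then have "cmod (fst p) \<ge> q \<or> cmod (snd p) \<ge> r" using norm_Pair_le[of "fst p" "snd p"] by force
    then show "?F p = 0" using chi_zero[OF r(1), of "snd p"] chi'_zero[OF q(1), of "fst p"] by auto
  qed
  then have "ennreal (\<integral>p. ?F p \<partial>lborel) = (\<integral>\<^sup>+p. ennreal (?F p) \<partial>lborel)"
    using nn by (intro nn_integral_eq_integral[symmetric] csupp_integrable cF) auto
  also have "\<dots> = (\<integral>\<^sup>+p. (case p of (z, w) \<Rightarrow> ennreal (?F (z, w))) \<partial>(lborel \<Otimes>\<^sub>M lborel))"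
    unfolding lborel_prod by (simp add: case_prod_beta')
  also have "\<dots> = (\<integral>\<^sup>+z. (\<integral>\<^sup>+w. ennreal (?F (z, w)) \<partial>lborel) \<partial>lborel)"
    using lborel.nn_integral_fst[OF mp] by simp
  also have "\<dots> \<le> (\<integral>\<^sup>+z. ennreal (chi' q z) * ennreal \<kappa> \<partial>lborel)"
  proof (rule nn_integral_mono_AE)
    have "AE z in lborel. z \<noteq> (0::complex)" by (rule AE_lborel_singleton)
    then show "AE z in lborel. (\<integral>\<^sup>+w. ennreal (?F (z, w)) \<partial>lborel) \<le> ennreal (chi' q z) * ennreal \<kappa>"
    proof eventually_elim
      case (elim z)
      show ?case
      proof (cases "cmod z < q")
        case True
        have "(\<integral>\<^sup>+w. ennreal (?F (z, w)) \<partial>lborel) \<le> (\<integral>\<^sup>+w. ennreal (chi' q z) * (ennreal (E (complex_of_real (cmod z), w) * lap (\<lambda>w. V (complex_of_real (cmod z), w)) w) * indicator (ball 0 r) w) \<partial>lborel)"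
        proof (rule nn_integral_mono)
          fix w
          show "ennreal (?F (z, w)) \<le> ennreal (chi' q z) * (ennreal (E (complex_of_real (cmod z), w) * lap (\<lambda>w. V (complex_of_real (cmod z), w)) w) * indicator (ball 0 r) w)"
          proof (cases "cmod w < r")
            case wr: True
            then have "cmod z < b" "cmod w < b" using q r ab dl_pos bd a0 True by auto
            then have p: "E (z, w) \<ge> 0" "lapw (z, w) \<ge> 0" using E_nonneg[of z w] slice_lap_nonneg[of z w] lw[of z w] by auto
            have "?F (z, w) \<le> chi' q z * (E (z, w) * lapw (z, w))"
              using mult_left_mono[OF mult_right_mono[OF chi_le[of r w] mult_nonneg_nonneg[OF p]] chi'_nonneg[of q z]] by (simp add: mult.assoc)
            then have "ennreal (?F (z, w)) \<le> ennreal (chi' q z) * ennreal (E (z, w) * lapw (z, w))"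
              using chi'_nonneg by (subst ennreal_mult'[symmetric]) (auto intro: ennreal_leI)
            then show ?thesis using wr E_polar[of z w] lwp[of z w] lw[of "complex_of_real (cmod z)" w] by simp
          qed (use chi_zero[OF r(1), of w] in simp)
        qed
        also have "\<dots> = ennreal (chi' q z) * flux (cmod z) r"
        proof -
          note meas_lap[OF slice_smooth, measurable]
          have "continuous_on UNIV (\<lambda>w. E (complex_of_real (cmod z), w))"
            by (rule continuous_on_compose2[OF E_cont]) (auto intro!: continuous_intros)
          then have [measurable]: "(\<lambda>w. E (complex_of_real (cmod z), w)) \<in> borel_measurable borel" by (rule borel_measurable_continuous_onI)
          show ?thesis unfolding flux_def by (rule nn_integral_cmult) measurable
        qed
        also have "\<dots> \<le> ennreal (chi' q z) * ennreal \<kappa>" using True elim by (intro mult_left_mono J) auto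
        finally show ?thesis .
      qed (use chi'_zero[OF q(1), of z] in simp)
    qed
  qed
  also have "\<dots> = (\<integral>\<^sup>+z. ennreal (chi' q z) \<partial>lborel) * ennreal \<kappa>"
    by (rule nn_integral_multc) measurable
  also have "\<dots> \<le> ennreal K0 * ennreal \<kappa>" by (intro mult_right_mono nn_chi' q) auto
  also have "\<dots> = ennreal (K0 * \<kappa>)" using K0_nonneg by (simp add: ennreal_mult')
  finally show ?thesis using K0_nonneg \<kappa> by (subst (asm) ennreal_le_iff) auto
qed

lemma slice1_smooth: "Ck n (\<lambda>z. V (z, w))"
proof -
  have "bounded_linear (\<lambda>z::complex. (z, 0::complex))" by (intro bounded_linear_Pair bounded_linear_zero bounded_linear_ident)
  from Ck_affine[OF this smooth[of n], of "(0, w)"] show ?thesis by simp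
qed

lemma slice1_dr: "dr e (\<lambda>z. V (z, w)) z = dr (e, 0) V (z, w)"
proof -
  have "bounded_linear (\<lambda>z::complex. (z, 0::complex))" by (intro bounded_linear_Pair bounded_linear_zero bounded_linear_ident)
  from dr_affine[OF this smooth[of "Suc 0"], of e "(0, w)"] show ?thesis by simp
qed

text \<open>The field z / (|z|^2 + delta) regularises grad log |z| and has nonnegative divergence.\<close>

lemma radial_flux:
  assumes q: "0 < q" "q < b" and w: "cmod w < b" and \<delta>: "\<delta> > 0"
  shows "(\<integral>z. chi q z * E (z, w) * inverse (sqn z + \<delta>) \<partial>lborel) \<le> (\<integral>z. chi' q z * (V (z, w) - V (0, w)) \<partial>lborel)"
proof -
  define f where "f z = V (z, w) - V (0, w)" for z
  have f: "Ck n f" for n unfolding f_def by (intro Ck_diff slice1_smooth Ck_const)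
  have df: "dr e f z = dr (e, 0) V (z, w)" for e z
  proof -
    have "dr e f z = dr e (\<lambda>z. V (z, w)) z - 0" unfolding f_def
      by (rule dr_eqI) (intro has_derivative_diff has_derivative_const Ck_derivative[OF slice1_smooth])
    then show ?thesis by (simp add: slice1_dr)
  qed
  have f0: "0 \<le> f z" if "cmod z < b" for z
    using V_mono[of 0 "cmod z" w] V_polar[of z w] that w by (simp add: f_def)
  define I where "I z = inverse (sqn z + \<delta>)" for z
  have pos: "sqn z + \<delta> > 0" for z using sqn_nonneg[of z] \<delta> by simp
  have I: "Ck n I" for n unfolding I_def using pos by (intro Ck_inverse Ck_add Ck_sqn Ck_const) (simp add: less_imp_neq[symmetric])
  have Ipos: "I z > 0" for z using pos by (simp add: I_def)
  have dI: "(I has_derivative (\<lambda>e. - (I z * (2 * (Re e * Re z + Im e * Im z) + 0) * I z))) (at z)" for z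
    unfolding I_def using pos[of z] by (intro Deriv.has_derivative_inverse has_derivative_add sqn_has_derivative has_derivative_const) auto
  define F where "F e z = chi q z * ((Re e * Re z + Im e * Im z) * I z)" for e z
  have F: "Ck n (F e)" for n e
    unfolding F_def by (intro Ck_mult Ck_chi Ck_add Ck_const Ck_Re Ck_Im I)
  have cF: "csupp (F e)" for e unfolding F_def by (intro csupp_mult1 csupp_chi q)
  have dF: "dr e (F e) z = chi q z * ((Re e * Re z + Im e * Im z) * - (I z * (2 * (Re e * Re z + Im e * Im z) + 0) * I z) + ((Re e)\<^sup>2 + (Im e)\<^sup>2) * I z)
      + - chi' q z * (Re e * Re z + Im e * Im z) * ((Re e * Re z + Im e * Im z) * I z)" for e z
  proof -
    have l: "((\<lambda>z. Re e * Re z + Im e * Im z) has_derivative (\<lambda>h. Re e * Re h + Im e * Im h)) (at z)"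
      by (auto intro!: derivative_eq_intros)
    have "(F e has_derivative (\<lambda>h. chi q z * ((Re e * Re z + Im e * Im z) * - (I z * (2 * (Re h * Re z + Im h * Im z) + 0) * I z) + (Re e * Re h + Im e * Im h) * I z)
      + dr h (chi q) z * ((Re e * Re z + Im e * Im z) * I z))) (at z)"
      unfolding F_def by (intro has_derivative_mult l dI Ck_derivative[OF Ck_chi])
    from dr_eqI[OF this, of e] show ?thesis by (simp add: dr_chi power2_eq_square)
  qed
  \<comment> \<open>The divergence of the field times the cutoff: the \<delta>-term is the
    nonnegative divergence of the regularised field, and in the other the factor
    \<open>sqn z * I z\<close> is at most 1.\<close>
  have sum_dF: "dr 1 (F 1) z + dr \<i> (F \<i>) z = 2 * \<delta> * (chi q z * (I z)\<^sup>2) - chi' q z * (sqn z * I z)" for z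
  proof -
    have "sqn z * I z = 1 - \<delta> * I z" using pos[of z] by (simp add: I_def field_simps)
    then have *: "2 * I z - 2 * (sqn z * I z) * I z = 2 * \<delta> * (I z)\<^sup>2" by (simp only:) (simp add: algebra_simps power2_eq_square)
    have "dr 1 (F 1) z + dr \<i> (F \<i>) z = chi q z * (2 * I z - 2 * (sqn z * I z) * I z) - chi' q z * (sqn z * I z)"
      unfolding dF sqn_alt by (simp add: algebra_simps)
    then show ?thesis unfolding * by simp
  qed
  have i1: "integrable lborel (\<lambda>z. F e z * dr e f z)" and i2: "integrable lborel (\<lambda>z. dr e (F e) z * f z)" for e
    by (intro csupp_integrable csupp_mult1 csupp_dr cF continuous_intros Ck_cont[OF F] Ck_cont[OF f] Ck_cont[OF Ck_dr[OF F]] Ck_cont[OF Ck_dr[OF f]])+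
  have "(\<integral>z. chi q z * E (z, w) * inverse (sqn z + \<delta>) \<partial>lborel) = (\<integral>z. F 1 z * dr 1 f z + F \<i> z * dr \<i> f z \<partial>lborel)"
    by (rule Bochner_Integration.integral_cong) (simp_all add: F_def df E_alt I_def dx1_def dy1_def algebra_simps)
  also have "\<dots> = (\<integral>z. F 1 z * dr 1 f z \<partial>lborel) + (\<integral>z. F \<i> z * dr \<i> f z \<partial>lborel)"
    by (rule Bochner_Integration.integral_add[OF i1 i1])
  also have "\<dots> = - ((\<integral>z. dr 1 (F 1) z * f z \<partial>lborel) + (\<integral>z. dr \<i> (F \<i>) z * f z \<partial>lborel))"
    by (simp add: integral_by_parts[OF F f cF])
  also have "\<dots> = (\<integral>z. - (dr 1 (F 1) z * f z + dr \<i> (F \<i>) z * f z) \<partial>lborel)"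
    using i2 by simp
  also have "\<dots> \<le> (\<integral>z. chi' q z * f z \<partial>lborel)"
  proof (rule integral_mono)
    show "integrable lborel (\<lambda>z. - (dr 1 (F 1) z * f z + dr \<i> (F \<i>) z * f z))"
      using i2 by (intro Bochner_Integration.integrable_minus Bochner_Integration.integrable_add)
    show "integrable lborel (\<lambda>z. chi' q z * f z)"
      by (intro csupp_integrable csupp_mult1 csupp_chi' q continuous_intros Ck_cont[OF f] Ck_cont[OF Ck_chi'])
    fix z
    show "- (dr 1 (F 1) z * f z + dr \<i> (F \<i>) z * f z) \<le> chi' q z * f z"
    proof (cases "cmod z < q")
      case True
      then have fz: "f z \<ge> 0" using f0 q by simp
      have "sqn z * I z \<le> 1" using pos[of z] \<delta> by (simp add: I_def field_simps)
      then have "chi' q z * (sqn z * I z) \<le> chi' q z * 1" using chi'_nonneg by (intro mult_left_mono)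
      moreover have "0 \<le> 2 * \<delta> * (chi q z * (I z)\<^sup>2)" using \<delta> chi_nonneg by simp
      ultimately have "- (dr 1 (F 1) z + dr \<i> (F \<i>) z) \<le> chi' q z" unfolding sum_dF by linarith
      from mult_right_mono[OF this fz] show ?thesis by (simp add: algebra_simps)
    next
      case False
      then have "dr 1 (F 1) z + dr \<i> (F \<i>) z = 0" unfolding sum_dF using chi_zero[OF q(1), of z] chi'_zero[OF q(1), of z] by simp
      then have "(dr 1 (F 1) z + dr \<i> (F \<i>) z) * f z = 0" by simp
      then show ?thesis using False chi'_zero[OF q(1), of z] by (simp add: algebra_simps)
    qed
  qed
  finally show ?thesis by (simp add: f_def)
qed

text \<open>The gradient in \<open>z\<close> is radial, so its square is E^2 / |z|^2
  (\<open>grad_sq\<close>). One factor \<open>E\<close> is at most \<open>A0\<close>; the other,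
  regularised to E / (|z|^2 + \<delta>), is the left side of \<open>radial_flux\<close>. Fatou's
  lemma removes \<delta>.\<close>

lemma gradient_term_slice:
  assumes q: "0 < q" "q < a" and w: "cmod w < b"
  shows "(\<integral>\<^sup>+z. ennreal (chi q z * ((X (z, w))\<^sup>2 + (Y (z, w))\<^sup>2)) \<partial>lborel) \<le> ennreal (A0 * K0 * (V (complex_of_real q, w) - V (0, w)))"
proof -
  let ?G = "\<lambda>z. (X (z, w))\<^sup>2 + (Y (z, w))\<^sup>2"
  define \<delta> where "\<delta> n = 1 / real (Suc n)" for n
  have d0: "\<delta> \<longlonglongrightarrow> 0" unfolding \<delta>_def by (rule LIMSEQ_Suc[OF lim_const_over_n])
  have dp: "\<delta> n > 0" for n by (simp add: \<delta>_def)
  let ?h = "\<lambda>n z. chi q z * (E (z, w))\<^sup>2 * inverse (sqn z + \<delta> n)"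
  let ?M = "A0 * K0 * (V (complex_of_real q, w) - V (0, w))"
  have Vq: "V (complex_of_real q, w) - V (0, w) \<ge> 0" using V_mono[of 0 q w] q ab w by simp
  have cE: "continuous_on UNIV (\<lambda>z. E (z, w))" by (rule continuous_on_compose2[OF E_cont]) (auto intro!: continuous_intros)
  have spos: "sqn z + \<delta> n > 0" for z n using sqn_nonneg[of z] dp[of n] by simp
  have cI: "continuous_on UNIV (\<lambda>z. inverse (sqn z + \<delta> n))" for n
    using spos by (intro continuous_intros Ck_cont[OF Ck_sqn]) (auto simp: less_imp_neq[symmetric])
  have ch: "continuous_on UNIV (?h n)" for n
    by (intro continuous_intros cE cI Ck_cont[OF Ck_chi])
  have [measurable]: "?h n \<in> borel_measurable borel" for n using ch by (rule borel_measurable_continuous_onI)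
  have bound: "(\<integral>\<^sup>+z. ennreal (?h n z) \<partial>lborel) \<le> ennreal ?M" for n
  proof -
    have i1: "integrable lborel (\<lambda>z. chi q z * E (z, w) * inverse (sqn z + \<delta> n))"
      by (intro csupp_integrable csupp_mult1 csupp_chi q continuous_intros cE cI Ck_cont[OF Ck_chi])
    have i2: "integrable lborel (\<lambda>z. chi' q z * (V (z, w) - V (0, w)))"
      by (intro csupp_integrable csupp_mult1 csupp_chi' q continuous_intros Ck_cont[OF slice1_smooth] Ck_cont[OF Ck_chi'])
    have nn: "0 \<le> chi q z * E (z, w) * inverse (sqn z + \<delta> n)" for z
    proof (cases "cmod z < q")
      case True
      then have "E (z, w) \<ge> 0" using q ab w by (intro E_nonneg) auto
      then show ?thesis using chi_nonneg spos by (intro mult_nonneg_nonneg) (auto simp: less_imp_le)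
    qed (use chi_zero[OF q(1), of z] in simp)
    have "(\<integral>\<^sup>+z. ennreal (?h n z) \<partial>lborel) \<le> (\<integral>\<^sup>+z. ennreal A0 * ennreal (chi q z * E (z, w) * inverse (sqn z + \<delta> n)) \<partial>lborel)"
    proof (rule nn_integral_mono)
      fix z
      show "ennreal (?h n z) \<le> ennreal A0 * ennreal (chi q z * E (z, w) * inverse (sqn z + \<delta> n))"
      proof (cases "cmod z < q")
        case True
        have "E (z, w) \<le> A0" using True q w by (intro E_le) auto
        then have "E (z, w) * (chi q z * E (z, w) * inverse (sqn z + \<delta> n)) \<le> A0 * (chi q z * E (z, w) * inverse (sqn z + \<delta> n))"
          by (rule mult_right_mono) (rule nn)
        then show ?thesis unfolding ennreal_mult'[OF A0_nonneg, symmetric] by (intro ennreal_leI) (simp add: power2_eq_square algebra_simps)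
      qed (use chi_zero[OF q(1), of z] in simp)
    qed
    also have "\<dots> = ennreal A0 * ennreal (\<integral>z. chi q z * E (z, w) * inverse (sqn z + \<delta> n) \<partial>lborel)"
      using i1 nn by (subst nn_integral_cmult) (auto simp: nn_integral_eq_integral)
    also have "\<dots> \<le> ennreal A0 * ennreal (\<integral>z. chi' q z * (V (z, w) - V (0, w)) \<partial>lborel)"
      using q ab w dp by (intro mult_left_mono ennreal_leI radial_flux) auto
    also have "ennreal (\<integral>z. chi' q z * (V (z, w) - V (0, w)) \<partial>lborel) \<le> ennreal (K0 * (V (complex_of_real q, w) - V (0, w)))"
    proof -
      have "ennreal (\<integral>z. chi' q z * (V (z, w) - V (0, w)) \<partial>lborel) = (\<integral>\<^sup>+z. ennreal (chi' q z * (V (z, w) - V (0, w))) \<partial>lborel)"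
      proof (rule nn_integral_eq_integral[symmetric, OF i2], rule AE_I2)
        fix z show "0 \<le> chi' q z * (V (z, w) - V (0, w))"
          using V_mono[of 0 "cmod z" w] V_polar[of z w] q ab w chi'_nonneg[of q z] chi'_zero[OF q(1), of z]
          by (cases "cmod z < q") auto
      qed
      also have "\<dots> \<le> (\<integral>\<^sup>+z. ennreal (chi' q z) * ennreal (V (complex_of_real q, w) - V (0, w)) \<partial>lborel)"
      proof (rule nn_integral_mono)
        fix z show "ennreal (chi' q z * (V (z, w) - V (0, w))) \<le> ennreal (chi' q z) * ennreal (V (complex_of_real q, w) - V (0, w))"
          using V_mono[of "cmod z" q w] V_polar[of z w] q ab w chi'_nonneg[of q z] chi'_zero[OF q(1), of z]
          by (cases "cmod z < q") (auto simp: ennreal_mult'[symmetric] intro!: ennreal_leI mult_left_mono)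
      qed
      also have "\<dots> = (\<integral>\<^sup>+z. ennreal (chi' q z) \<partial>lborel) * ennreal (V (complex_of_real q, w) - V (0, w))"
        by (rule nn_integral_multc) measurable
      also have "\<dots> \<le> ennreal K0 * ennreal (V (complex_of_real q, w) - V (0, w))" by (intro mult_right_mono nn_chi' q) auto
      finally show ?thesis by (simp add: ennreal_mult'[OF K0_nonneg])
    qed
    finally have "(\<integral>\<^sup>+z. ennreal (?h n z) \<partial>lborel) \<le> ennreal A0 * ennreal (K0 * (V (complex_of_real q, w) - V (0, w)))"
      by (meson mult_left_mono order_trans zero_le)
    then show ?thesis by (simp add: ennreal_mult'[OF A0_nonneg, symmetric] mult.assoc)
  qed
  have "(\<integral>\<^sup>+z. ennreal (chi q z * ?G z) \<partial>lborel) \<le> (\<integral>\<^sup>+z. liminf (\<lambda>n. ennreal (?h n z)) \<partial>lborel)"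
  proof (rule nn_integral_mono_AE)
    have "AE z in lborel. z \<noteq> (0::complex)" by (rule AE_lborel_singleton)
    then show "AE z in lborel. ennreal (chi q z * ?G z) \<le> liminf (\<lambda>n. ennreal (?h n z))"
    proof eventually_elim
      case (elim z)
      then have s: "sqn z \<noteq> 0" by (simp add: sqn_def)
      have "(\<lambda>n. ?h n z) \<longlonglongrightarrow> chi q z * (E (z, w))\<^sup>2 * inverse (sqn z + 0)"
        using s by (intro tendsto_intros d0) auto
      also have "chi q z * (E (z, w))\<^sup>2 * inverse (sqn z + 0) = chi q z * ?G z"
        unfolding grad_sq[of "(z, w)", symmetric] using s by simp
      finally have "(\<lambda>n. ennreal (?h n z)) \<longlonglongrightarrow> ennreal (chi q z * ?G z)" by (intro tendsto_ennrealI)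
      then show ?case by (simp add: lim_imp_Liminf)
    qed
  qed
  also have "\<dots> \<le> liminf (\<lambda>n. \<integral>\<^sup>+z. ennreal (?h n z) \<partial>lborel)"
    by (rule nn_integral_liminf) measurable
  also have "\<dots> \<le> liminf (\<lambda>n. ennreal ?M)" by (intro Liminf_mono always_eventually allI bound)
  also have "\<dots> = ennreal ?M" by (rule Liminf_const) (rule trivial_limit_sequentially)
  finally show ?thesis .
qed

text \<open>The Laplacian of \<open>chi r\<close> has no sign, so the positive part is estimated by
  \<open>M\<close> times the slice bound. That Laplacian is shown to vanish for |w| >
  \<open>r\<close>; the open ball of radius \<open>2 * r\<close> contains the remaining closed
  disc.\<close>

lemma gradient_term:
  assumes q: "0 < q" "q < a" and r: "0 < r" "2 * r \<le> dl" and M: "M \<ge> 0" "\<And>w. \<bar>lap (chi r) w\<bar> \<le> M"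
  shows "(\<integral>p. chi q (fst p) * (- lap (chi r) (snd p)) * ((X p)\<^sup>2 + (Y p)\<^sup>2) \<partial>lborel)
    \<le> M * (A0 * K0) * (\<integral>w. indicator (ball 0 (2 * r)) w * (V (complex_of_real q, w) - V (0, w)) \<partial>lborel)"
proof -
  let ?G = "\<lambda>p. (X p)\<^sup>2 + (Y p)\<^sup>2"
  let ?F = "\<lambda>p. chi q (fst p) * (- lap (chi r) (snd p)) * ?G p"
  have cG: "continuous_on UNIV ?G" by (intro continuous_intros Ck_cont[OF smX])
  have cl: "continuous_on UNIV (lap (chi r))" by (rule Ck_lap_cont[OF Ck_chi])
  have cl': "continuous_on UNIV (\<lambda>p::c2. lap (chi r) (snd p))" by (rule continuous_on_compose2[OF cl]) (auto intro!: continuous_intros)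
  have lz: "lap (chi r) w = 0" if "cmod w > r" for w
  proof -
    have op: "open {x::complex. cmod x > r}" by (intro open_Collect_less continuous_intros)
    have z1: "dr e f w = 0" if "\<And>x. cmod x > r \<Longrightarrow> f x = 0" "cmod w > r" for e w and f :: "complex \<Rightarrow> real"
      by (rule dr_eqI[where D="\<lambda>_. 0"], rule has_derivative_transform_within_open[OF _ op, where f="\<lambda>x. 0"]) (use that in auto)
    show ?thesis unfolding lap_def using z1[of "dr 1 (chi r)" w 1] z1[of "dr \<i> (chi r)" w \<i>] z1[of "chi r"] chi_zero[OF r(1)] that by auto
  qed
  have cF: "continuous_on UNIV ?F" by (intro continuous_intros cl' cG Ck_cont[OF Ck_fst[OF Ck_chi]])
  have cs: "csupp ?F" unfolding csupp_def
  proof (intro exI[of _ "q + r"] allI impI)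
    fix p :: c2 assume "norm p > q + r"
    then have "cmod (fst p) \<ge> q \<or> cmod (snd p) > r" using norm_Pair_le[of "fst p" "snd p"] by force
    then show "?F p = 0" using lz[of "snd p"] chi_zero[OF q(1), of "fst p"] by auto
  qed
  let ?H = "\<lambda>z w. ennreal M * (indicator (ball 0 (2 * r)) w * ennreal (chi q z * ?G (z, w)))"
  have [measurable]: "?G \<in> borel_measurable borel" using cG by (rule borel_measurable_continuous_onI)
  have [measurable]: "(\<lambda>p. chi q (fst p) * ?G p) \<in> borel_measurable borel"
    by (intro borel_measurable_continuous_onI continuous_intros cG Ck_cont[OF Ck_fst[OF Ck_chi]])
  have "(\<lambda>p::c2. snd p) \<in> borel_measurable borel" by (intro borel_measurable_continuous_onI continuous_intros)
  from measurable_compose[OF this ball_indicator_borel]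
  have [measurable]: "(\<lambda>p::c2. indicator (ball 0 (2 * r)) (snd p) :: ennreal) \<in> borel_measurable borel" .
  have mH: "case_prod ?H \<in> borel_measurable (lborel \<Otimes>\<^sub>M lborel)"
    unfolding lborel_prod by (simp add: case_prod_beta')
  let ?W = "\<lambda>w. V (complex_of_real q, w) - V (0, w)"
  have Wnn: "?W w \<ge> 0" if "cmod w < 2 * r" for w using V_mono[of 0 q w] q ab that r dl_pos bd a0 by simp
  have iW: "integrable lborel (\<lambda>w. indicator (ball 0 (2 * r)) w * ?W w)"
  proof -
    have "integrable lborel (\<lambda>w. indicator (cball 0 (2 * r)) w *\<^sub>R ?W w)"
      by (intro borel_integrable_compact) (auto intro!: continuous_on_subset[OF continuous_on_diff[OF cont_slice cont_slice]])
    from integrable_mult_indicator[OF _ this, of "ball 0 (2 * r)"]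
    show ?thesis by (rule Bochner_Integration.integrable_cong[THEN iffD1, rotated 2]) (auto simp: indicator_def)
  qed
  have "(\<integral>p. ?F p \<partial>lborel) \<le> (\<integral>p. max 0 (?F p) \<partial>lborel)"
    using csupp_integrable[OF cF cs] by (intro integral_mono integrable_max) auto
  also have "ennreal \<dots> = (\<integral>\<^sup>+p. ennreal (max 0 (?F p)) \<partial>lborel)"
    using csupp_integrable[OF cF cs] by (intro nn_integral_eq_integral[symmetric] integrable_max) auto
  also have "\<dots> \<le> (\<integral>\<^sup>+p. case_prod ?H p \<partial>lborel)"
  proof (rule nn_integral_mono)
    fix p :: c2
    show "ennreal (max 0 (?F p)) \<le> case_prod ?H p"
    proof (cases "cmod (snd p) < 2 * r")
      case True
      have "chi q (fst p) * ?G p \<ge> 0" using chi_nonneg by simp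
      then have "(- lap (chi r) (snd p)) * (chi q (fst p) * ?G p) \<le> M * (chi q (fst p) * ?G p)"
        using M(2)[of "snd p"] by (intro mult_right_mono) auto
      then have "max 0 (?F p) \<le> M * (chi q (fst p) * ?G p)"
        using mult_nonneg_nonneg[OF M(1) \<open>chi q (fst p) * ?G p \<ge> 0\<close>] by (simp add: algebra_simps)
      then have "ennreal (max 0 (?F p)) \<le> ennreal M * ennreal (chi q (fst p) * ?G p)"
        unfolding ennreal_mult'[OF M(1), symmetric] by (rule ennreal_leI)
      then show ?thesis using True by (simp add: case_prod_beta')
    qed (use lz[of "snd p"] r in simp)
  qed
  also have "\<dots> = (\<integral>\<^sup>+w. (\<integral>\<^sup>+z. ?H z w \<partial>lborel) \<partial>lborel)"
    using lborel_pair.nn_integral_snd[OF mH] unfolding lborel_prod by simp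
  also have "\<dots> \<le> (\<integral>\<^sup>+w. ennreal (M * (A0 * K0)) * ennreal (indicator (ball 0 (2 * r)) w * ?W w) \<partial>lborel)"
  proof (rule nn_integral_mono)
    fix w
    show "(\<integral>\<^sup>+z. ?H z w \<partial>lborel) \<le> ennreal (M * (A0 * K0)) * ennreal (indicator (ball 0 (2 * r)) w * ?W w)"
    proof (cases "cmod w < 2 * r")
      case True
      have "(\<integral>\<^sup>+z. ?H z w \<partial>lborel) = ennreal M * (\<integral>\<^sup>+z. ennreal (chi q z * ?G (z, w)) \<partial>lborel)"
        using True by (simp add: nn_integral_cmult)
      also have "\<dots> \<le> ennreal M * ennreal (A0 * K0 * ?W w)"
        using True q r dl_pos bd a0 by (intro mult_left_mono gradient_term_slice) auto
      also have "\<dots> = ennreal (M * (A0 * K0)) * ennreal (?W w)"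
        using M A0_nonneg K0_nonneg Wnn[OF True] by (simp add: ennreal_mult'[symmetric] mult.assoc)
      finally show ?thesis using True by simp
    qed simp
  qed
  also have "\<dots> = ennreal (M * (A0 * K0)) * ennreal (\<integral>w. indicator (ball 0 (2 * r)) w * ?W w \<partial>lborel)"
  proof -
    have "(\<integral>\<^sup>+w. ennreal (indicator (ball 0 (2 * r)) w * ?W w) \<partial>lborel) = ennreal (\<integral>w. indicator (ball 0 (2 * r)) w * ?W w \<partial>lborel)"
      by (rule nn_integral_eq_integral[OF iW]) (use Wnn in \<open>auto simp: indicator_def\<close>)
    then show ?thesis using iW by (subst nn_integral_cmult) auto
  qed
  also have "\<dots> = ennreal (M * (A0 * K0) * (\<integral>w. indicator (ball 0 (2 * r)) w * ?W w \<partial>lborel))"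
    using M A0_nonneg K0_nonneg by (simp add: ennreal_mult')
  finally have "ennreal (\<integral>p. ?F p \<partial>lborel) \<le> ennreal (M * (A0 * K0) * (\<integral>w. indicator (ball 0 (2 * r)) w * ?W w \<partial>lborel))"
    by (simp add: ennreal_leI order_trans)
  moreover have "0 \<le> M * (A0 * K0) * (\<integral>w. indicator (ball 0 (2 * r)) w * ?W w \<partial>lborel)"
  proof (rule mult_nonneg_nonneg[OF mult_nonneg_nonneg[OF M(1) mult_nonneg_nonneg[OF A0_nonneg K0_nonneg]]], rule Bochner_Integration.integral_nonneg)
    show "0 \<le> indicator (ball 0 (2 * r)) w * ?W w" for w
      using Wnn[of w] by (cases "cmod w < 2 * r") auto
  qed
  ultimately show ?thesis by (subst (asm) ennreal_le_iff) auto
qed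

end

section \<open>Mollification\<close>

definition conv :: "('a::euclidean_space \<Rightarrow> real) \<Rightarrow> ('a \<Rightarrow> real) \<Rightarrow> 'a \<Rightarrow> real" where
  "conv k g x = (\<integral>y. g y * k (x - y) \<partial>lborel)"

lemma lipschitz_of_csupp:
  fixes k :: "'a::euclidean_space \<Rightarrow> real"
  assumes k: "Ck (Suc 0) k" and c: "csupp k"
  obtains M where "M \<ge> 0" "\<And>e x. \<bar>dr e k x\<bar> \<le> M * norm e" "\<And>x h. \<bar>k (x + h) - k x\<bar> \<le> M * norm h"
proof -
  have "\<exists>M\<ge>0. \<forall>x. \<bar>dr b k x\<bar> \<le> M" for b
    using csupp_bounded[OF Ck_cont[OF Ck_dr[OF k]] csupp_dr[OF c]] by metis
  then obtain N where N: "\<And>b. N b \<ge> 0" "\<And>b x. \<bar>dr b k x\<bar> \<le> N b" by metis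
  define M where "M = (\<Sum>b\<in>Basis. N b)"
  have M0: "M \<ge> 0" unfolding M_def by (intro sum_nonneg N)
  have b: "\<bar>dr e k x\<bar> \<le> M * norm e" for e x
  proof -
    have lin: "linear (\<lambda>e. dr e k x)" by (rule has_derivative_linear[OF Ck_derivative[OF k]])
    have "dr e k x = dr (\<Sum>b\<in>Basis. (e \<bullet> b) *\<^sub>R b) k x" by (simp add: euclidean_representation)
    also have "\<dots> = (\<Sum>b\<in>Basis. (e \<bullet> b) * dr b k x)" by (simp add: linear_sum[OF lin] linear_cmul[OF lin])
    finally have "\<bar>dr e k x\<bar> \<le> (\<Sum>b\<in>Basis. \<bar>(e \<bullet> b) * dr b k x\<bar>)" by (simp add: sum_abs)
    also have "\<dots> \<le> (\<Sum>b\<in>Basis. norm e * N b)"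
      by (intro sum_mono) (auto simp: abs_mult intro!: mult_mono N Basis_le_norm)
    finally show ?thesis by (simp add: M_def sum_distrib_left mult.commute)
  qed
  have "\<bar>k (x + h) - k x\<bar> \<le> M * norm h" for x h
  proof -
    obtain \<xi> where "k (x + 1 *\<^sub>R h) - k x = 1 * dr h k (x + \<xi> *\<^sub>R h)" using dr_mvt[OF k zero_less_one] by metis
    then show ?thesis using b[of h "x + \<xi> *\<^sub>R h"] by simp
  qed
  then show thesis using that M0 b by blast
qed

context
  fixes g :: "'a::euclidean_space \<Rightarrow> real" assumes g: "integrable lborel g"
begin

lemma conv_integrable:
  assumes "continuous_on UNIV k" "csupp k" shows "integrable lborel (\<lambda>y. g y * k (x - y))"
proof -
  obtain M where M: "M \<ge> 0" "\<And>x. \<bar>k x\<bar> \<le> M" using csupp_bounded[OF assms] by blast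
  have "continuous_on UNIV (\<lambda>y. k (x - y))" by (rule continuous_on_compose2[OF assms(1)]) (auto intro!: continuous_intros)
  then have [measurable]: "(\<lambda>y. k (x - y)) \<in> borel_measurable borel" by (rule borel_measurable_continuous_onI)
  have "\<bar>g y * k z\<bar> \<le> \<bar>M * g y\<bar>" for y z
    using mult_right_mono[OF M(2)[of z], of "\<bar>g y\<bar>"] M(1) by (simp add: abs_mult mult.commute)
  then show ?thesis
    by (rule_tac Bochner_Integration.integrable_bound[of _ "\<lambda>y. M * g y"]) (use g in auto)
qed

lemma conv_cont:
  assumes k: "continuous_on UNIV k" "csupp k" shows "continuous_on UNIV (conv k g)"
  unfolding continuous_on_sequentially
proof (intro ballI allI impI, elim conjE)
  fix X :: "nat \<Rightarrow> 'a" and x assume X: "X \<longlonglongrightarrow> x"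
  obtain M where M: "M \<ge> 0" "\<And>x. \<bar>k x\<bar> \<le> M" using csupp_bounded[OF k] by blast
  have ck: "isCont k z" for z using k(1) by (simp add: continuous_on_eq_continuous_at)
  show "(conv k g \<circ> X) \<longlonglongrightarrow> conv k g x"
    unfolding o_def conv_def
  proof (rule integral_dominated_convergence[where w="\<lambda>y. M * \<bar>g y\<bar>"])
    show "AE y in lborel. (\<lambda>i. g y * k (X i - y)) \<longlonglongrightarrow> g y * k (x - y)"
      by (intro AE_I2 tendsto_mult tendsto_const isCont_tendsto_compose[OF ck] tendsto_diff X)
    show "AE y in lborel. norm (g y * k (X i - y)) \<le> M * \<bar>g y\<bar>" for i
    proof (rule AE_I2)
      fix y show "norm (g y * k (X i - y)) \<le> M * \<bar>g y\<bar>"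
        using mult_right_mono[OF M(2)[of "X i - y"], of "\<bar>g y\<bar>"] by (simp add: abs_mult mult.commute)
    qed
  qed (use g conv_integrable[OF k] in \<open>auto intro: borel_measurable_integrable\<close>)
qed

text \<open>Derivatives fall on the kernel, so \<open>g\<close> need only be integrable: by the
  Lipschitz bound the remainder quotients of \<open>k\<close> are at most \<open>2 * M\<close>, and
  they tend to 0 pointwise, so dominated convergence applies with a multiple of
  \<open>\<bar>g\<bar>\<close>.\<close>

lemma conv_deriv:
  assumes k: "\<And>n. Ck n k" and c: "csupp k"
  shows "(conv k g has_derivative (\<lambda>e. conv (dr e k) g x)) (at x)"
proof -
  obtain M where M: "M \<ge> 0" "\<And>e x. \<bar>dr e k x\<bar> \<le> M * norm e" "\<And>x h. \<bar>k (x + h) - k x\<bar> \<le> M * norm h"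
    using lipschitz_of_csupp[OF k c] by blast
  note i0 = conv_integrable[OF Ck_cont[OF k] c]
  note i1 = conv_integrable[OF Ck_cont[OF Ck_dr[OF k]] csupp_dr[OF c]]
  have lin: "linear (\<lambda>e. conv (dr e k) g x)"
  proof (rule linearI)
    show "conv (dr (a + b) k) g x = conv (dr a k) g x + conv (dr b k) g x" for a b
      unfolding conv_def using i1[of a x] i1[of b x] by (simp add: dr_add_dir[OF k] distrib_left)
    show "conv (dr (r *\<^sub>R b) k) g x = r *\<^sub>R conv (dr b k) g x" for r b
      unfolding conv_def by (simp add: dr_scale_dir[OF k] mult.left_commute[of _ r])
  qed
  define q where "q h y = g y * ((k (x + h - y) - k (x - y) - dr h k (x - y)) / norm h)" for h y
  have eq: "(conv k g (x + h) - conv k g x - conv (dr h k) g x) / norm h = (\<integral>y. q h y \<partial>lborel)" for h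
  proof -
    have "conv k g (x + h) - conv k g x - conv (dr h k) g x = (\<integral>y. g y * k (x + h - y) - g y * k (x - y) - g y * dr h k (x - y) \<partial>lborel)"
      unfolding conv_def using i0[of "x + h"] i0[of x] i1[of h x] by simp
    also have "\<dots> = (\<integral>y. g y * (k (x + h - y) - k (x - y) - dr h k (x - y)) \<partial>lborel)"
      by (simp add: right_diff_distrib)
    finally have e: "conv k g (x + h) - conv k g x - conv (dr h k) g x = (\<integral>y. g y * (k (x + h - y) - k (x - y) - dr h k (x - y)) \<partial>lborel)" .
    have "q h y = (g y * (k (x + h - y) - k (x - y) - dr h k (x - y))) / norm h" for y by (simp add: q_def)
    then show ?thesis unfolding e by simp
  qed
  have "((\<lambda>h. (conv k g (x + h) - conv k g x - conv (dr h k) g x) / norm h) \<longlongrightarrow> 0) (at 0)"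
    unfolding eq tendsto_at_iff_sequentially
  proof (intro allI impI)
    fix H :: "nat \<Rightarrow> 'a" assume "\<forall>i. H i \<in> UNIV - {0}" and H: "H \<longlonglongrightarrow> 0"
    then have H0: "H i \<noteq> 0" for i by auto
    have Hat: "filterlim H (at 0) sequentially" using H H0 by (auto simp: filterlim_at)
    have "(\<lambda>i. \<integral>y. q (H i) y \<partial>lborel) \<longlonglongrightarrow> (\<integral>y. 0 \<partial>(lborel :: 'a measure))"
    proof (rule integral_dominated_convergence[where w="\<lambda>y. 2 * M * \<bar>g y\<bar>"])
      show "q (H i) \<in> borel_measurable lborel" for i
      proof -
        have m: "(\<lambda>y. g y * k (x + H i - y)) \<in> borel_measurable lborel" "(\<lambda>y. g y * k (x - y)) \<in> borel_measurable lborel"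
          "(\<lambda>y. g y * dr (H i) k (x - y)) \<in> borel_measurable lborel"
          using i0[of "x + H i"] i0[of x] i1[of "H i" x] by (auto intro: borel_measurable_integrable)
        have "q (H i) = (\<lambda>y. (g y * k (x + H i - y) - g y * k (x - y) - g y * dr (H i) k (x - y)) / norm (H i))"
          by (auto simp: q_def fun_eq_iff algebra_simps diff_divide_distrib)
        then show ?thesis using m by simp
      qed
      show "AE y in lborel. (\<lambda>i. q (H i) y) \<longlonglongrightarrow> 0"
      proof (rule AE_I2)
        fix y
        have "((\<lambda>h. norm (k (x - y + h) - k (x - y) - dr h k (x - y)) / norm h) \<longlongrightarrow> 0) (at 0)"
          using Ck_derivative[OF k[of "Suc 0"], of "x - y"] unfolding has_derivative_at by blast
        from filterlim_compose[OF this Hat]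
        have "(\<lambda>i. norm (k (x - y + H i) - k (x - y) - dr (H i) k (x - y)) / norm (H i)) \<longlonglongrightarrow> 0" .
        then have "(\<lambda>i. (k (x - y + H i) - k (x - y) - dr (H i) k (x - y)) / norm (H i)) \<longlonglongrightarrow> 0"
          by (rule_tac tendsto_norm_zero_cancel) simp
        from tendsto_mult[OF tendsto_const this, of "g y"] show "(\<lambda>i. q (H i) y) \<longlonglongrightarrow> 0"
          by (simp add: q_def algebra_simps)
      qed
      show "AE y in lborel. norm (q (H i) y) \<le> 2 * M * \<bar>g y\<bar>" for i
      proof (rule AE_I2)
        fix y
        have "\<bar>k (x - y + H i) - k (x - y) - dr (H i) k (x - y)\<bar> \<le> 2 * M * norm (H i)"
          using M(3)[of "x - y" "H i"] M(2)[of "H i" "x - y"] by linarith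
        then have "\<bar>k (x + H i - y) - k (x - y) - dr (H i) k (x - y)\<bar> / norm (H i) \<le> 2 * M"
          using H0[of i] by (simp add: divide_le_eq algebra_simps)
        then have "\<bar>g y\<bar> * (\<bar>k (x + H i - y) - k (x - y) - dr (H i) k (x - y)\<bar> / norm (H i)) \<le> \<bar>g y\<bar> * (2 * M)"
          by (intro mult_left_mono) auto
        then show "norm (q (H i) y) \<le> 2 * M * \<bar>g y\<bar>" by (simp add: q_def abs_mult mult.commute)
      qed
    qed (use g in \<open>auto intro!: integrable_mult_right\<close>)
    then show "((\<lambda>h. \<integral>y. q h y \<partial>lborel) \<circ> H) \<longlonglongrightarrow> 0" by (simp add: o_def)
  qed
  then have "((\<lambda>h. norm ((conv k g (x + h) - conv k g x - conv (dr h k) g x) / norm h)) \<longlongrightarrow> 0) (at 0)"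
    by (rule tendsto_norm_zero)
  then show ?thesis unfolding has_derivative_at using lin
    by (simp add: linear_conv_bounded_linear)
qed

lemma Ck_conv:
  assumes "\<And>n. Ck n k" and "csupp k"
  shows "Ck n (conv k g)"
  using assms
proof (induction n arbitrary: k)
  case 0 then show ?case using conv_cont[of k] Ck_cont[of 0 k] by simp
next
  case (Suc n)
  show ?case
    by (rule Ck_SucI[OF conv_deriv[OF Suc.prems]]) (intro Suc.IH Ck_dr[OF Suc.prems(1)] csupp_dr Suc.prems)
qed

end

lemma rho0_flat_exp: "rho0 = (\<lambda>p. flat_exp 0 (1 - (norm p)\<^sup>2))"
proof
  fix p :: c2
  have "norm p < 1 \<longleftrightarrow> (norm p)\<^sup>2 < 1" by (metis abs_norm_cancel abs_square_less_1)
  then show "rho0 p = flat_exp 0 (1 - (norm p)\<^sup>2)" by (simp add: rho0_def flat_exp_def divide_inverse)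
qed

lemma norm_c2: "(norm p)\<^sup>2 = sqn (fst p) + sqn (snd (p::c2))"
  by (simp add: norm_prod_def sqn_def)

lemma Ck_rho0: "Ck n rho0"
  unfolding rho0_flat_exp norm_c2
  by (intro Ck_flat_exp Ck_diff Ck_const Ck_add Ck_fst[OF Ck_sqn] Ck_snd[OF Ck_sqn])

lemma rho0_nonneg: "rho0 p \<ge> 0" by (simp add: rho0_flat_exp flat_exp_nonneg)
lemma rho0_zero: "norm p \<ge> 1 \<Longrightarrow> rho0 p = 0" by (simp add: rho0_def)
lemma csupp_rho0: "csupp rho0" unfolding csupp_def by (rule exI[of _ 1]) (simp add: rho0_zero)
lemma rho0_integrable: "integrable lborel rho0" by (rule csupp_integrable[OF Ck_cont[OF Ck_rho0] csupp_rho0])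

lemma rho0_int_pos: "(\<integral>q. rho0 q \<partial>lborel) > 0"
proof -
  have pos: "rho0 p \<ge> exp (- 4 / 3)" if "norm p < 1 / 2" for p
  proof -
    have "(norm p)\<^sup>2 \<le> (1 / 2)\<^sup>2" using that by (intro power_mono) auto
    then have "1 / (1 - (norm p)\<^sup>2) \<le> 4 / 3" by (simp add: field_simps power2_eq_square)
    then show ?thesis using that by (simp add: rho0_def)
  qed
  have "0 < exp (- 4 / 3) * measure lborel (ball (0::c2) (1 / 2))"
    using content_ball_pos[of "1/2" "0::c2"] by simp
  also have "\<dots> = (\<integral>z. exp (- 4 / 3) * indicator (ball (0::c2) (1/2)) z \<partial>lborel)" by simp
  also have "\<dots> \<le> (\<integral>q. rho0 q \<partial>lborel)"
  proof (rule integral_mono)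
    show "integrable lborel (\<lambda>z. exp (- 4 / 3) * indicator (ball (0::c2) (1/2)) z :: real)"
      using emeasure_lborel_ball_finite[of "0::c2" "1/2"] by (intro integrable_mult_right integrable_real_indicator) auto
    show "exp (- 4 / 3) * indicator (ball (0::c2) (1/2)) z \<le> rho0 z" for z
      using pos[of z] rho0_nonneg[of z] by (cases "norm z < 1/2") auto
  qed (rule rho0_integrable)
  finally show ?thesis .
qed

lemma Ck_rho: "Ck n rho"
  unfolding rho_def[abs_def] using Ck_cmult[OF Ck_rho0, of n "1 / (\<integral>q. rho0 q \<partial>lborel)"] by simp
lemma rho_nonneg: "rho p \<ge> 0" using rho0_nonneg rho0_int_pos by (simp add: rho_def)
lemma rho_zero: "norm p \<ge> 1 \<Longrightarrow> rho p = 0" by (simp add: rho_def rho0_zero)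
lemma csupp_rho: "csupp rho" unfolding csupp_def by (rule exI[of _ 1]) (simp add: rho_zero)
lemma rho_integrable: "integrable lborel rho" by (rule csupp_integrable[OF Ck_cont[OF Ck_rho] csupp_rho])
lemma rho_int: "(\<integral>q. rho q \<partial>lborel) = 1" using rho0_int_pos by (simp add: rho_def[abs_def])
lemma meas_rho[measurable]: "rho \<in> borel_measurable borel" by (simp add: borel_measurable_continuous_onI Ck_cont[OF Ck_rho])
lemma rho_radial: "norm p = norm q \<Longrightarrow> rho p = rho q" by (simp add: rho_def rho0_def)

lemma integral_affine:
  fixes f :: "'a::euclidean_space \<Rightarrow> real"
  assumes f: "f \<in> borel_measurable borel" and c: "c \<noteq> 0"
  shows "(\<integral>u. f u \<partial>lborel) = \<bar>c\<bar> ^ DIM('a) * (\<integral>y. f (t + c *\<^sub>R y) \<partial>lborel)"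
proof -
  note f[measurable]
  have "(\<integral>u. f u \<partial>lborel) = (\<integral>u. f u \<partial>density (distr lborel borel (\<lambda>x. t + c *\<^sub>R x)) (\<lambda>_. \<bar>c\<bar> ^ DIM('a)))"
    using lborel_affine[OF c, of t] by simp
  also have "\<dots> = (\<integral>u. \<bar>c\<bar> ^ DIM('a) *\<^sub>R f u \<partial>distr lborel borel (\<lambda>x. t + c *\<^sub>R x))"
    by (rule integral_density) auto
  also have "\<dots> = (\<integral>y. \<bar>c\<bar> ^ DIM('a) *\<^sub>R f (t + c *\<^sub>R y) \<partial>lborel)"
    by (rule integral_distr) auto
  finally show ?thesis by simp
qed

text \<open>The substitution u = x - \<epsilon> y; the exponent 4 is the real dimension of
  \<open>c2\<close>. It moves the dependence on \<open>x\<close> from \<open>g\<close> into the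
  smooth kernel.\<close>

lemma moll_conv:
  assumes g: "g \<in> borel_measurable borel" and \<epsilon>: "\<epsilon> > 0"
  shows "moll g \<epsilon> = conv (\<lambda>p. (1 / \<epsilon>) ^ 4 * rho ((1 / \<epsilon>) *\<^sub>R p)) g"
proof
  fix x
  have "(\<integral>u. g u * ((1 / \<epsilon>) ^ 4 * rho ((1 / \<epsilon>) *\<^sub>R (x - u))) \<partial>lborel)
    = \<bar>- \<epsilon>\<bar> ^ DIM(c2) * (\<integral>y. g (x + (- \<epsilon>) *\<^sub>R y) * ((1 / \<epsilon>) ^ 4 * rho ((1 / \<epsilon>) *\<^sub>R (x - (x + (- \<epsilon>) *\<^sub>R y)))) \<partial>lborel)"
    by (rule integral_affine) (use g \<epsilon> in auto)
  also have "\<dots> = \<epsilon> ^ 4 * (\<integral>y. (1 / \<epsilon>) ^ 4 * (g (x - \<epsilon> *\<^sub>R y) * rho y) \<partial>lborel)"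
    using \<epsilon> by (simp add: mult.left_commute)
  also have "\<dots> = moll g \<epsilon> x" using \<epsilon> by (simp add: moll_def power_one_over)
  finally show "moll g \<epsilon> x = conv (\<lambda>p. (1 / \<epsilon>) ^ 4 * rho ((1 / \<epsilon>) *\<^sub>R p)) g x" by (simp add: conv_def)
qed

lemma Ck_moll:
  assumes g: "integrable lborel g" and \<epsilon>: "\<epsilon> > 0"
  shows "Ck n (moll g \<epsilon>)"
proof -
  have m: "g \<in> borel_measurable borel" using borel_measurable_integrable[OF g] by simp
  show ?thesis unfolding moll_conv[OF m \<epsilon>]
  proof (rule Ck_conv[OF g])
    show "Ck n (\<lambda>p. (1 / \<epsilon>) ^ 4 * rho ((1 / \<epsilon>) *\<^sub>R p))" for n
      using Ck_cmult[OF Ck_affine[OF bounded_linear_scaleR_right Ck_rho], of n "(1 / \<epsilon>) ^ 4" 0 "1 / \<epsilon>"] by simp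
    show "csupp (\<lambda>p. (1 / \<epsilon>) ^ 4 * rho ((1 / \<epsilon>) *\<^sub>R p))"
      unfolding csupp_def
    proof (intro exI allI impI)
      fix p :: c2 assume "norm p > \<epsilon>"
      then have "norm ((1 / \<epsilon>) *\<^sub>R p) \<ge> 1" using \<epsilon> by (simp only: norm_scaleR) (simp add: field_simps)
      then show "(1 / \<epsilon>) ^ 4 * rho ((1 / \<epsilon>) *\<^sub>R p) = 0" by (simp add: rho_zero)
    qed
  qed
qed

section \<open>Mollified bounded plurisubharmonic functions\<close>

lemma bounded_integrable:
  fixes f :: "'a::euclidean_space \<Rightarrow> real"
  assumes "f \<in> borel_measurable borel" "\<And>x. \<bar>f x\<bar> \<le> K" "\<And>x. norm x > r \<Longrightarrow> f x = 0"
  shows "integrable lborel f"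
proof (rule Bochner_Integration.integrable_bound)
  show "integrable lborel (\<lambda>x. K * indicator (cball (0::'a) r) x)"
    using emeasure_bounded_finite[of "cball (0::'a) r"] by (intro integrable_mult_right integrable_real_indicator) auto
  show "AE x in lborel. norm (f x) \<le> norm (K * indicator (cball 0 r) x)"
  proof (rule AE_I2)
    fix x
    have "K \<ge> 0" using assms(2)[of x] by linarith
    then show "norm (f x) \<le> norm (K * indicator (cball 0 r) x)"
      using assms(2)[of x] assms(3)[of x] by (cases "norm x \<le> r") auto
  qed
qed (use assms in simp)

lemma cmul_cmul: "cmul a (cmul b p) = cmul (a * b) p" by (simp add: cmul_def)
lemma cmul_linear: "bounded_linear (\<lambda>\<zeta>. cmul \<zeta> B)"
  unfolding cmul_def by (intro bounded_linear_Pair bounded_linear_mult_const bounded_linear_ident bounded_linear_compose[OF bounded_linear_mult_left])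
lemma cmul_cont: "continuous_on UNIV (\<lambda>p. cmul (f p) (h p))" if "continuous_on UNIV f" "continuous_on UNIV h"
  unfolding cmul_def using that by (intro continuous_intros)
lemma norm_cmul: "norm (cmul c p) = cmod c * norm p"
proof -
  have "(norm (cmul c p))\<^sup>2 = (cmod c * norm p)\<^sup>2"
    by (simp add: norm_c2 sqn_def cmul_def norm_mult power_mult_distrib distrib_left)
  then show ?thesis by (simp add: power2_eq_iff_nonneg)
qed

lemma norm_Pair_cis: "norm (cis \<theta> * z, w) = norm (z, w)"
  by (simp add: norm_Pair norm_mult)

lemma (in kern) beta_cis: "beta (cis \<theta> * z) = beta z"
  by (simp add: beta_def beta0_def den_def sqn_def norm_mult)

text \<open>Extension by 0 makes \<open>g\<close> bounded and integrable on the whole space, so that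
  \<open>Ck_moll\<close> applies. It spoils the sub-mean value property across the boundary, hence
  the room conditions involving \<epsilon> in the lemmas below.\<close>

locale bnd_psh =
  fixes g :: "c2 \<Rightarrow> real" and c M :: real
  assumes c: "0 < c" and meas[measurable]: "g \<in> borel_measurable borel" and low: "\<And>p. - M \<le> g p" and up: "\<And>p. g p \<le> 0"
    and out: "\<And>p. \<not> (cmod (fst p) < c \<and> cmod (snd p) < c) \<Longrightarrow> g p = 0"
    and submean: "\<And>x B. (\<And>\<zeta>. cmod \<zeta> \<le> 1 \<Longrightarrow> cmod (fst (x + cmul \<zeta> B)) < c \<and> cmod (snd (x + cmul \<zeta> B)) < c) \<Longrightarrow>
       g x \<le> (1 / (2 * pi)) * (\<integral>\<theta>. indicator {0..2*pi} \<theta> * g (x + cmul (cis \<theta>) B) \<partial>lborel)"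
    and usc: "\<And>x t. cmod (fst x) < c \<Longrightarrow> cmod (snd x) < c \<Longrightarrow> g x < t \<Longrightarrow> \<forall>\<^sub>F y in nhds x. g y < t"
    and rotg: "\<And>\<theta> z w. g (cis \<theta> * z, w) = g (z, w)"
begin

lemma M0: "M \<ge> 0" using low[of 0] up[of 0] by linarith
lemma abs_g: "\<bar>g p\<bar> \<le> M" using low[of p] up[of p] by linarith

lemma g_integrable: "integrable lborel g"
proof (rule bounded_integrable[OF meas abs_g])
  fix x :: c2 assume "norm x > c + c"
  then show "g x = 0" using norm_Pair_le[of "fst x" "snd x"] by (intro out) auto
qed

text \<open>The weight \<open>k\<close> is invariant under \<open>R \<theta>\<close>, which acts on
  the image of \<open>P\<close> as multiplication by \<open>cis \<theta>\<close>. Averaging the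
  circle inequality for every \<open>y\<close> with weight \<open>k\<close> and exchanging the
  integrals gives the claim. It serves for balls of C^2 with \<open>rho\<close> in
  \<open>moll_ge\<close> and for discs with \<open>beta\<close> in \<open>moll_psh\<close>.\<close>

lemma average:
  fixes P :: "'y::euclidean_space \<Rightarrow> c2" and R :: "real \<Rightarrow> 'y \<Rightarrow> 'y" and k :: "'y \<Rightarrow> real"
  assumes P: "bounded_linear P" and R: "\<And>\<theta>. linear (R \<theta>)" "\<And>\<theta> y. norm (R \<theta> y) = norm y" "\<And>\<theta> y. P (R \<theta> y) = cmul (cis \<theta>) (P y)"
    and k: "continuous_on UNIV k" "\<And>y. k y \<ge> 0" "(\<integral>y. k y \<partial>lborel) = 1" "\<And>y. norm y \<ge> 1 \<Longrightarrow> k y = 0" "\<And>\<theta> y. k (R \<theta> y) = k y"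
    and room: "\<And>y \<zeta>. norm y \<le> 1 \<Longrightarrow> cmod \<zeta> \<le> 1 \<Longrightarrow> cmod (fst (x + cmul \<zeta> (P y))) < c \<and> cmod (snd (x + cmul \<zeta> (P y))) < c"
  shows "g x \<le> (\<integral>y. g (x + P y) * k y \<partial>lborel)"
proof -
  have ck: "csupp k" unfolding csupp_def using k(4) by (intro exI[of _ 1]) auto
  obtain K where K: "\<And>y. \<bar>k y\<bar> \<le> K" using csupp_bounded[OF k(1) ck] by blast
  have [measurable]: "k \<in> borel_measurable borel" using k(1) by (rule borel_measurable_continuous_onI)
  have [measurable]: "P \<in> borel_measurable borel" by (intro borel_measurable_continuous_onI linear_continuous_on P)
  have mc: "(\<lambda>p::real \<times> 'y. x + cmul (cis (fst p)) (P (snd p))) \<in> borel_measurable borel"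
    by (intro borel_measurable_continuous_onI continuous_intros cmul_cont continuous_on_compose2[OF linear_continuous_on[OF P]])
      (auto intro!: continuous_intros continuous_on_compose2[OF linear_continuous_on[OF P], of UNIV])
  define I where "I = (\<integral>y. g (x + P y) * k y \<partial>lborel)"
  let ?h = "\<lambda>\<theta> y. indicator {0..2*pi} \<theta> * (g (x + cmul (cis \<theta>) (P y)) * k y)"
  have intk: "integrable lborel (\<lambda>y. f y * k y)" if "f \<in> borel_measurable borel" "\<And>y. \<bar>f y\<bar> \<le> M" for f :: "'y \<Rightarrow> real"
  proof (rule bounded_integrable[where K="M * K" and r=1])
    show "\<bar>f y * k y\<bar> \<le> M * K" for y unfolding abs_mult by (intro mult_mono that K M0) auto
  qed (use that k in auto)
  have It: "(\<integral>y. g (x + cmul (cis \<theta>) (P y)) * k y \<partial>lborel) = I" for \<theta>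
  proof -
    have "(\<integral>y. (\<lambda>y. g (x + P y) * k y) (R \<theta> y) \<partial>lborel) = I" unfolding I_def
      by (rule integral_isometry[OF R(1,2)]) measurable
    then show ?thesis by (simp add: R k)
  qed
  have J: "integrable (lborel \<Otimes>\<^sub>M lborel) (\<lambda>(\<theta>, y). ?h \<theta> y)"
    unfolding lborel_prod case_prod_beta'
  proof (rule bounded_integrable[where K="M * K" and r="2 * pi + 1"])
    have "(\<lambda>p. g (x + cmul (cis (fst p)) (P (snd p)))) \<in> borel_measurable borel"
      using measurable_compose[OF mc meas] .
    moreover have "(\<lambda>p::real\<times>'y. indicator {0..2*pi} (fst p) :: real) \<in> borel_measurable borel" "(\<lambda>p::real\<times>'y. k (snd p)) \<in> borel_measurable borel"
      unfolding borel_prod[symmetric] by measurable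
    ultimately show "(\<lambda>p. ?h (fst p) (snd p)) \<in> borel_measurable borel" by measurable
    show "\<bar>?h (fst p) (snd p)\<bar> \<le> M * K" for p
    proof -
      have "\<bar>g (x + cmul (cis (fst p)) (P (snd p))) * k (snd p)\<bar> \<le> M * K" unfolding abs_mult by (intro mult_mono abs_g K M0) auto
      moreover have "0 \<le> M * K" using M0 K[of 0] by (intro mult_nonneg_nonneg) auto
      ultimately show ?thesis by (auto simp: indicator_def)
    qed
    fix p :: "real \<times> 'y" assume p: "norm p > 2 * pi + 1"
    have "\<not> (\<bar>fst p\<bar> \<le> 2 * pi \<and> norm (snd p) < 1)" using p norm_Pair_le[of "fst p" "snd p"] by auto
    then show "?h (fst p) (snd p) = 0" using k(4)[of "snd p"] by (auto simp: indicator_def not_le not_less)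
  qed
  have "2 * pi * g x = (\<integral>y. 2 * pi * g x * k y \<partial>lborel)" using k(3) by simp
  also have "\<dots> \<le> (\<integral>y. (\<integral>\<theta>. ?h \<theta> y \<partial>lborel) \<partial>lborel)"
  proof (rule integral_mono)
    show "integrable lborel (\<lambda>y. 2 * pi * g x * k y)" using csupp_integrable[OF k(1) ck] by (intro integrable_mult_right)
    show "integrable lborel (\<lambda>y. (\<integral>\<theta>. ?h \<theta> y \<partial>lborel))" using lborel_pair.integrable_snd[OF J] by simp
    fix y
    show "2 * pi * g x * k y \<le> (\<integral>\<theta>. ?h \<theta> y \<partial>lborel)"
    proof (cases "norm y < 1")
      case True
      have "g x \<le> (1 / (2 * pi)) * (\<integral>\<theta>. indicator {0..2*pi} \<theta> * g (x + cmul (cis \<theta>) (P y)) \<partial>lborel)"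
        by (rule submean) (rule room, use True in auto)
      then have "2 * pi * g x * k y \<le> (\<integral>\<theta>. indicator {0..2*pi} \<theta> * g (x + cmul (cis \<theta>) (P y)) \<partial>lborel) * k y"
        using k(2) by (intro mult_right_mono) (auto simp: field_simps)
      then show ?thesis by (simp add: mult.assoc[symmetric])
    qed (use k(4)[of y] in simp)
  qed
  also have "\<dots> = (\<integral>\<theta>. (\<integral>y. ?h \<theta> y \<partial>lborel) \<partial>lborel)" using lborel_pair.Fubini_integral[OF J] by simp
  also have "\<dots> = (\<integral>\<theta>. indicator {0..2*pi} \<theta> * I \<partial>lborel)" by (simp add: It)
  also have "\<dots> = 2 * pi * I" by simp
  finally show ?thesis by (simp add: I_def)
qed

lemma moll_smooth: "\<epsilon> > 0 \<Longrightarrow> Ck n (moll g \<epsilon>)" by (rule Ck_moll[OF g_integrable])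

lemma moll_int: "integrable lborel (\<lambda>y. g (x - \<epsilon> *\<^sub>R y) * rho y)"
proof -
  obtain K where K: "\<And>y. \<bar>rho y\<bar> \<le> K" using csupp_bounded[OF Ck_cont[OF Ck_rho] csupp_rho] by blast
  show ?thesis
  proof (rule bounded_integrable[where K="M * K" and r=1])
    show "\<bar>g (x - \<epsilon> *\<^sub>R y) * rho y\<bar> \<le> M * K" for y unfolding abs_mult by (intro mult_mono abs_g K M0) auto
  qed (auto simp: rho_zero)
qed

lemma moll_nonpos: "moll g \<epsilon> x \<le> 0"
proof -
  have "moll g \<epsilon> x \<le> (\<integral>y. 0 \<partial>(lborel::c2 measure))" unfolding moll_def
    by (rule integral_mono[OF moll_int]) (use up rho_nonneg in \<open>auto simp: mult_nonpos_nonneg\<close>)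
  then show ?thesis by simp
qed

lemma moll_ge_M: "moll g \<epsilon> x \<ge> - M"
proof -
  have "(\<integral>y. - M * rho y \<partial>lborel) \<le> moll g \<epsilon> x" unfolding moll_def
  proof (rule integral_mono[OF _ moll_int])
    show "integrable lborel (\<lambda>y. - M * rho y)" by (intro integrable_mult_right rho_integrable)
    show "- M * rho y \<le> g (x - \<epsilon> *\<^sub>R y) * rho y" for y using low rho_nonneg by (intro mult_right_mono)
  qed
  then show ?thesis by (simp add: rho_int)
qed

lemma moll_le: assumes \<epsilon>: "\<epsilon> > 0" and "\<And>y. dist x y < \<epsilon> \<Longrightarrow> g y \<le> t" shows "moll g \<epsilon> x \<le> t"
proof -
  have "moll g \<epsilon> x \<le> (\<integral>y. t * rho y \<partial>lborel)" unfolding moll_def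
  proof (rule integral_mono[OF moll_int])
    show "integrable lborel (\<lambda>y. t * rho y)" by (intro integrable_mult_right rho_integrable)
    show "g (x - \<epsilon> *\<^sub>R y) * rho y \<le> t * rho y" for y
      using assms(2)[of "x - \<epsilon> *\<^sub>R y"] rho_nonneg[of y] rho_zero[of y] \<epsilon>
      by (cases "norm y < 1") (auto simp: dist_norm intro!: mult_right_mono)
  qed
  then show ?thesis by (simp add: rho_int)
qed

text \<open>The lower bound on u off \<open>K\<close> is known almost everywhere only. The integral
  is therefore taken over the actual point \<open>y\<close> instead of the rescaled one, so that the
  null set can be discarded directly.\<close>

lemma moll_ge_AE: assumes \<epsilon>: "\<epsilon> > 0" and ae: "AE y in lborel. dist x y < \<epsilon> \<longrightarrow> t \<le> g y" shows "t \<le> moll g \<epsilon> x"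
proof -
  let ?k = "\<lambda>y. (1 / \<epsilon>) ^ 4 * rho ((1 / \<epsilon>) *\<^sub>R (x - y))"
  have eqc: "moll f \<epsilon> x = (\<integral>y. f y * ?k y \<partial>lborel)" if "f \<in> borel_measurable borel" for f
    unfolding moll_conv[OF that \<epsilon>] conv_def ..
  have k0: "?k y \<ge> 0" for y using \<epsilon> rho_nonneg by simp
  have kz: "?k y = 0" if "\<not> dist x y < \<epsilon>" for y
  proof -
    have "norm ((1 / \<epsilon>) *\<^sub>R (x - y)) \<ge> 1" using \<epsilon> that by (simp only: norm_scaleR dist_norm[symmetric]) (simp add: field_simps)
    then show ?thesis by (simp add: rho_zero)
  qed
  have csk: "csupp ?k" unfolding csupp_def
  proof (intro exI[of _ "norm x + \<epsilon>"] allI impI)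
    fix y :: c2 assume "norm y > norm x + \<epsilon>"
    then have "\<not> dist x y < \<epsilon>" using norm_triangle_ineq2[of y x] by (simp add: dist_norm norm_minus_commute)
    then show "?k y = 0" by (rule kz)
  qed
  have cok: "continuous_on UNIV ?k"
    by (intro continuous_intros continuous_on_compose2[OF Ck_cont[OF Ck_rho]]) auto
  have ik: "integrable lborel ?k" by (rule csupp_integrable[OF cok csk])
  have "t = moll (\<lambda>_. t) \<epsilon> x" by (simp add: moll_def rho_int)
  also have "\<dots> = (\<integral>y. t * ?k y \<partial>lborel)" by (rule eqc) simp
  also have "\<dots> \<le> (\<integral>y. g y * ?k y \<partial>lborel)"
  proof (rule integral_mono_AE)
    show "integrable lborel (\<lambda>y. t * ?k y)" by (rule integrable_mult_right) (rule ik)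
    obtain K where K: "\<And>y. \<bar>?k y\<bar> \<le> K" using csupp_bounded[OF cok csk] by blast
    have [measurable]: "?k \<in> borel_measurable borel" by (rule borel_measurable_continuous_onI[OF cok])
    show "integrable lborel (\<lambda>y. g y * ?k y)"
    proof (rule Bochner_Integration.integrable_bound[where f="\<lambda>y. K * g y"])
      show "AE y in lborel. norm (g y * ?k y) \<le> norm (K * g y)"
      proof (rule AE_I2)
        fix y
        have "K \<ge> 0" using K[of 0] by linarith
        then show "norm (g y * ?k y) \<le> norm (K * g y)"
          using mult_right_mono[OF K[of y], of "\<bar>g y\<bar>"] unfolding real_norm_def abs_mult[of "g y"] abs_mult[of K] by (simp only: abs_of_nonneg mult.commute abs_ge_zero)
      qed
    qed (use g_integrable in auto)
    show "AE y in lborel. t * ?k y \<le> g y * ?k y"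
      using ae
    proof eventually_elim
      case (elim y)
      show ?case
      proof (cases "dist x y < \<epsilon>")
        case True
        then show ?thesis using elim k0[of y] by (intro mult_right_mono) auto
      next
        case False
        show ?thesis by (simp only: kz[OF False] mult_zero_right order_refl)
      qed
    qed
  qed
  also have "\<dots> = moll g \<epsilon> x" by (rule eqc[symmetric]) measurable
  finally show ?thesis .
qed

lemma moll_rot: "moll g \<epsilon> (cis \<theta> * z, w) = moll g \<epsilon> (z, w)"
proof -
  let ?R = "\<lambda>y::c2. (cis \<theta> * fst y, snd y)"
  have "(\<integral>y. (\<lambda>y. g ((cis \<theta> * z, w) - \<epsilon> *\<^sub>R y) * rho y) (?R y) \<partial>lborel) = moll g \<epsilon> (cis \<theta> * z, w)"
    unfolding moll_def
  proof (rule integral_isometry)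
    show "linear ?R" by (rule linearI) (auto simp: algebra_simps)
    show "norm (?R x) = norm x" for x using norm_Pair_cis[of \<theta> "fst x" "snd x"] by simp
  qed measurable
  moreover have "g ((cis \<theta> * z, w) - \<epsilon> *\<^sub>R ?R y) * rho (?R y) = g ((z, w) - \<epsilon> *\<^sub>R y) * rho y" for y
  proof -
    have "(cis \<theta> * z, w) - \<epsilon> *\<^sub>R ?R y = (cis \<theta> * (z - \<epsilon> *\<^sub>R fst y), w - \<epsilon> *\<^sub>R snd y)" by (simp add: algebra_simps)
    moreover have "rho (?R y) = rho y" by (rule rho_radial) (metis norm_Pair_cis prod.collapse)
    ultimately show ?thesis using rotg[of \<theta> "z - \<epsilon> *\<^sub>R fst y" "w - \<epsilon> *\<^sub>R snd y"] by (simp add: minus_prod_def)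
  qed
  ultimately show ?thesis by (simp add: moll_def)
qed

lemma fst_snd_le: "cmod (fst p) \<le> norm p" "cmod (snd p) \<le> norm (p::c2)"
  by (metis norm_fst_le prod.collapse, metis norm_snd_le prod.collapse)

lemma moll_ge: assumes \<epsilon>: "\<epsilon> > 0" and r: "cmod (fst x) + \<epsilon> < c" "cmod (snd x) + \<epsilon> < c" shows "g x \<le> moll g \<epsilon> x"
proof -
  have "g x \<le> (\<integral>y. g (x + (- \<epsilon>) *\<^sub>R y) * rho y \<partial>lborel)"
  proof (rule average[where R="\<lambda>\<theta>. cmul (cis \<theta>)"])
    show "bounded_linear (\<lambda>y::c2. (- \<epsilon>) *\<^sub>R y)" by (rule bounded_linear_scaleR_right)
    show "linear (cmul (cis \<theta>))" for \<theta> by (rule linearI) (auto simp: cmul_def algebra_simps)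
    show "norm (cmul (cis \<theta>) y) = norm y" for \<theta> y by (simp add: norm_cmul)
    then show "rho (cmul (cis \<theta>) y) = rho y" for \<theta> y by (rule rho_radial)
    show "(- \<epsilon>) *\<^sub>R cmul (cis \<theta>) y = cmul (cis \<theta>) ((- \<epsilon>) *\<^sub>R y)" for \<theta> y by (simp add: cmul_def)
    fix y :: c2 and \<zeta> :: complex assume y: "norm y \<le> 1" "cmod \<zeta> \<le> 1"
    have "norm (cmul \<zeta> ((- \<epsilon>) *\<^sub>R y)) = \<epsilon> * (cmod \<zeta> * norm y)" using \<epsilon> by (simp only: norm_cmul norm_scaleR) simp
    also have "\<dots> \<le> \<epsilon> * 1" using y \<epsilon> by (intro mult_left_mono mult_le_one) auto
    finally have n: "norm (cmul \<zeta> ((- \<epsilon>) *\<^sub>R y)) \<le> \<epsilon>" by simp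
    show "cmod (fst (x + cmul \<zeta> ((- \<epsilon>) *\<^sub>R y))) < c \<and> cmod (snd (x + cmul \<zeta> ((- \<epsilon>) *\<^sub>R y))) < c"
      using r n fst_snd_le[of "cmul \<zeta> ((- \<epsilon>) *\<^sub>R y)"] norm_triangle_ineq[of "fst x" "fst (cmul \<zeta> ((- \<epsilon>) *\<^sub>R y))"] norm_triangle_ineq[of "snd x" "snd (cmul \<zeta> ((- \<epsilon>) *\<^sub>R y))"]
      unfolding fst_add snd_add by linarith
  qed (auto simp: rho_nonneg rho_int rho_zero Ck_cont[OF Ck_rho])
  then show ?thesis by (simp add: moll_def)
qed

text \<open>Convergence at every point, and not just almost everywhere: upper semicontinuity bounds
  the mollification from above, \<open>moll_ge\<close> from below. The slice at z = 0, a null set in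
  C^2, requires this.\<close>

lemma moll_tendsto: assumes x: "cmod (fst x) < c" "cmod (snd x) < c" shows "((\<lambda>\<epsilon>. moll g \<epsilon> x) \<longlongrightarrow> g x) (at_right 0)"
proof (rule tendstoI)
  fix e :: real assume e: "e > 0"
  have "\<forall>\<^sub>F y in nhds x. g y < g x + e / 2" using e by (intro usc x) auto
  then obtain d where d: "d > 0" "\<And>y. dist y x < d \<Longrightarrow> g y < g x + e / 2" unfolding eventually_nhds_metric by blast
  define d' where "d' = min d (min (c - cmod (fst x)) (c - cmod (snd x)))"
  have "d' > 0" using d x by (auto simp: d'_def)
  then have "\<forall>\<^sub>F \<epsilon> in at_right 0. \<epsilon> \<in> {0<..<d'}" by (rule eventually_at_right_real)
  then show "\<forall>\<^sub>F \<epsilon> in at_right 0. dist (moll g \<epsilon> x) (g x) < e"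
  proof eventually_elim
    case (elim \<epsilon>)
    then have "\<epsilon> > 0" "\<epsilon> < d" "\<epsilon> < c - cmod (fst x)" "\<epsilon> < c - cmod (snd x)" by (auto simp: d'_def)
    then have "g x \<le> moll g \<epsilon> x" "moll g \<epsilon> x \<le> g x + e / 2"
      by (auto intro!: moll_ge moll_le less_imp_le[OF d(2)] simp: dist_commute)
    then show ?case using e by (simp add: dist_real_def)
  qed
qed

text \<open>On each complex line the mollification inherits the sub-mean inequality from the
  translates of \<open>g\<close>, by \<open>average\<close> and Fubini;
  \<open>lap_nonneg_if_submean\<close> turns it into the second-order condition. Any value in (0, 1)
  would serve as parameter of \<open>kern\<close> here.\<close>

lemma moll_psh:
  assumes \<epsilon>: "\<epsilon> > 0" and p: "cmod (fst p) + \<epsilon> < c" "cmod (snd p) + \<epsilon> < c"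
  shows "dr B (dr B (moll g \<epsilon>)) p + dr (cmul \<i> B) (dr (cmul \<i> B) (moll g \<epsilon>)) p \<ge> 0"
proof -
  interpret kern "1 / 2" by standard auto
  let ?V = "moll g \<epsilon>"
  define F where "F \<zeta> = ?V (p + cmul \<zeta> B)" for \<zeta>
  have F: "Ck n F" for n unfolding F_def by (rule Ck_affine[OF cmul_linear moll_smooth[OF \<epsilon>]])
  have dF: "dr e F = (\<lambda>\<zeta>. dr (cmul e B) ?V (p + cmul \<zeta> B))" for e
    unfolding F_def by (rule ext) (rule dr_affine[OF cmul_linear moll_smooth[OF \<epsilon>, of "Suc 0"]])
  have ddF: "dr e (dr e F) 0 = dr (cmul e B) (dr (cmul e B) ?V) p" for e
  proof -
    have "dr e (\<lambda>\<zeta>. dr (cmul e B) ?V (p + cmul \<zeta> B)) 0 = dr (cmul e B) (dr (cmul e B) ?V) (p + cmul 0 B)"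
      by (rule dr_affine[OF cmul_linear Ck_dr[OF moll_smooth[OF \<epsilon>], of "Suc 0"]])
    then show ?thesis unfolding dF by (simp add: cmul_def zero_prod_def[symmetric])
  qed
  have lapF: "lap F 0 = dr B (dr B ?V) p + dr (cmul \<i> B) (dr (cmul \<i> B) ?V) p"
    unfolding lap_def ddF by (simp add: cmul_def)
  define d where "d = min (c - \<epsilon> - cmod (fst p)) (c - \<epsilon> - cmod (snd p)) / (norm B + 1)"
  have d0: "d > 0" unfolding d_def using p by (intro divide_pos_pos) (auto intro: add_nonneg_pos)
  obtain K where K: "\<And>y. \<bar>rho y\<bar> \<le> K" using csupp_bounded[OF Ck_cont[OF Ck_rho] csupp_rho] by blast
  obtain K' where K': "\<And>y. \<bar>beta y\<bar> \<le> K'" using csupp_bounded[OF cont_beta csupp_beta] by blast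
  have sm: "F 0 \<le> T s F 0" if s: "0 < s" "s < d" for s
  proof -
    have sB: "s * norm B < c - \<epsilon> - cmod (fst p)" "s * norm B < c - \<epsilon> - cmod (snd p)"
    proof -
      have "s * norm B \<le> s * (norm B + 1)" using s by simp
      also have "\<dots> < d * (norm B + 1)" using s by (intro mult_strict_right_mono) (auto intro: add_nonneg_pos)
      also have "\<dots> = min (c - \<epsilon> - cmod (fst p)) (c - \<epsilon> - cmod (snd p))"
      proof -
        have "norm B + 1 \<noteq> 0" using norm_ge_zero[of B] by linarith
        then show ?thesis unfolding d_def by simp
      qed
      finally show "s * norm B < c - \<epsilon> - cmod (fst p)" "s * norm B < c - \<epsilon> - cmod (snd p)" by auto
    qed
    let ?h = "\<lambda>\<zeta> y. (g (p - \<epsilon> *\<^sub>R y + cmul (s *\<^sub>R \<zeta>) B) * beta \<zeta>) * rho y"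
    have mc: "(\<lambda>q::complex \<times> c2. p - \<epsilon> *\<^sub>R snd q + cmul (s *\<^sub>R fst q) B) \<in> borel_measurable borel"
      by (intro borel_measurable_continuous_onI continuous_intros cmul_cont)
    have J: "integrable (lborel \<Otimes>\<^sub>M lborel) (\<lambda>(\<zeta>, y). ?h \<zeta> y)"
      unfolding lborel_prod case_prod_beta'
    proof (rule bounded_integrable[where K="M * K' * K" and r="1 + 1"])
      have "(\<lambda>q. g (p - \<epsilon> *\<^sub>R snd q + cmul (s *\<^sub>R fst q) B)) \<in> borel_measurable borel"
        using measurable_compose[OF mc meas] .
      moreover have "(\<lambda>q::complex\<times>c2. beta (fst q)) \<in> borel_measurable borel" "(\<lambda>q::complex\<times>c2. rho (snd q)) \<in> borel_measurable borel"
        by (intro borel_measurable_continuous_onI continuous_on_compose2[OF cont_beta] continuous_on_compose2[OF Ck_cont[OF Ck_rho]] continuous_intros; simp)+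
      ultimately show "(\<lambda>q. ?h (fst q) (snd q)) \<in> borel_measurable borel" by measurable
      show "\<bar>?h (fst q) (snd q)\<bar> \<le> M * K' * K" for q
        unfolding abs_mult using M0 K'[of 0] by (intro mult_mono abs_g K K' mult_nonneg_nonneg) auto
      fix q :: "complex \<times> c2" assume q: "norm q > 1 + 1"
      have "\<not> (cmod (fst q) < 1 \<and> norm (snd q) < 1)" using q norm_Pair_le[of "fst q" "snd q"] by auto
      then show "?h (fst q) (snd q) = 0" using beta_zero[of "fst q"] rho_zero[of "snd q"] by auto
    qed
    have "F 0 = (\<integral>y. g (p - \<epsilon> *\<^sub>R y) * rho y \<partial>lborel)" by (simp add: F_def moll_def cmul_def zero_prod_def[symmetric])
    also have "\<dots> \<le> (\<integral>y. (\<integral>\<zeta>. ?h \<zeta> y \<partial>lborel) \<partial>lborel)"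
    proof (rule integral_mono[OF moll_int])
      show "integrable lborel (\<lambda>y. (\<integral>\<zeta>. ?h \<zeta> y \<partial>lborel))" using lborel_pair.integrable_snd[OF J] by simp
      fix y :: c2
      show "g (p - \<epsilon> *\<^sub>R y) * rho y \<le> (\<integral>\<zeta>. ?h \<zeta> y \<partial>lborel)"
      proof (cases "norm y < 1")
        case True
        have "g (p - \<epsilon> *\<^sub>R y) \<le> (\<integral>\<zeta>. g (p - \<epsilon> *\<^sub>R y + cmul (s *\<^sub>R \<zeta>) B) * beta \<zeta> \<partial>lborel)"
        proof (rule average[where R="\<lambda>\<theta> z. cis \<theta> * z"])
          show "bounded_linear (\<lambda>\<zeta>. cmul (s *\<^sub>R \<zeta>) B)"
            by (rule bounded_linear_compose[OF cmul_linear bounded_linear_scaleR_right])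
          show "linear (\<lambda>z. cis \<theta> * z)" for \<theta> by (rule linearI) (auto simp: algebra_simps)
          show "cmod (cis \<theta> * y) = cmod y" for \<theta> y by (simp add: norm_mult)
          show "cmul (s *\<^sub>R (cis \<theta> * y)) B = cmul (cis \<theta>) (cmul (s *\<^sub>R y) B)" for \<theta> y by (simp add: cmul_cmul)
          show "continuous_on UNIV beta" by (rule cont_beta)
          show "beta z \<ge> 0" for z by (rule beta_nonneg)
          show "integral\<^sup>L lborel beta = 1" by (rule beta_int)
          show "cmod z \<ge> 1 \<Longrightarrow> beta z = 0" for z by (rule beta_zero)
          show "beta (cis \<theta> * z) = beta z" for \<theta> z by (rule beta_cis)
          fix z \<zeta> :: complex assume z: "cmod z \<le> 1" "cmod \<zeta> \<le> 1"
          let ?u = "p - \<epsilon> *\<^sub>R y" and ?v = "cmul \<zeta> (cmul (s *\<^sub>R z) B)"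
          have "norm ?v = (cmod \<zeta> * cmod z) * (s * norm B)" using s by (simp add: norm_cmul)
          also have "\<dots> \<le> 1 * (s * norm B)" using z s by (intro mult_right_mono mult_le_one) auto
          finally have v: "norm ?v \<le> s * norm B" by simp
          have "norm (\<epsilon> *\<^sub>R y) \<le> \<epsilon>" using True \<epsilon> by (simp add: mult_left_le)
          then have u: "cmod (fst (\<epsilon> *\<^sub>R y)) \<le> \<epsilon>" "cmod (snd (\<epsilon> *\<^sub>R y)) \<le> \<epsilon>" using fst_snd_le[of "\<epsilon> *\<^sub>R y"] by linarith+
          show "cmod (fst (?u + ?v)) < c \<and> cmod (snd (?u + ?v)) < c"
            using u v sB fst_snd_le[of ?v] norm_triangle_ineq[of "fst ?u" "fst ?v"] norm_triangle_ineq[of "snd ?u" "snd ?v"]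
              norm_triangle_ineq4[of "fst p" "fst (\<epsilon> *\<^sub>R y)"] norm_triangle_ineq4[of "snd p" "snd (\<epsilon> *\<^sub>R y)"]
            unfolding fst_add snd_add fst_diff snd_diff by linarith
        qed
        then have "g (p - \<epsilon> *\<^sub>R y) * rho y \<le> (\<integral>\<zeta>. g (p - \<epsilon> *\<^sub>R y + cmul (s *\<^sub>R \<zeta>) B) * beta \<zeta> \<partial>lborel) * rho y"
          using rho_nonneg by (intro mult_right_mono)
        then show ?thesis by simp
      qed (simp add: rho_zero)
    qed
    also have "\<dots> = (\<integral>\<zeta>. (\<integral>y. ?h \<zeta> y \<partial>lborel) \<partial>lborel)" using lborel_pair.Fubini_integral[OF J] by simp
    also have "\<dots> = (\<integral>\<zeta>. ?V (p + cmul (s *\<^sub>R \<zeta>) B) * beta \<zeta> \<partial>lborel)"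
    proof (rule Bochner_Integration.integral_cong[OF refl])
      fix \<zeta>
      have "(\<integral>y. ?h \<zeta> y \<partial>lborel) = (\<integral>y. (g (p + cmul (s *\<^sub>R \<zeta>) B - \<epsilon> *\<^sub>R y) * rho y) * beta \<zeta> \<partial>lborel)"
        by (simp add: algebra_simps)
      also have "\<dots> = ?V (p + cmul (s *\<^sub>R \<zeta>) B) * beta \<zeta>" unfolding moll_def by simp
      finally show "(\<integral>y. ?h \<zeta> y \<partial>lborel) = ?V (p + cmul (s *\<^sub>R \<zeta>) B) * beta \<zeta>" .
    qed
    also have "\<dots> = T s F 0" by (simp add: T_def F_def)
    finally show ?thesis .
  qed
  have "lap F 0 \<ge> 0" by (rule lap_nonneg_if_submean[OF F d0 sm])
  then show ?thesis unfolding lapF .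
qed

end

section \<open>Uniform smallness of the flux\<close>

text \<open>The constants of the locale do not depend on V; this instance makes their properties available.\<close>

lemma smooth_inv_zero: "0 < a \<Longrightarrow> a < b \<Longrightarrow> 0 \<le> C \<Longrightarrow> smooth_inv (\<lambda>_. 0) a b C"
proof unfold_locales
  have d: "dr e (\<lambda>_. 0) p = 0" for e p :: c2 by (rule dr_eqI) (rule has_derivative_const)
  then have d': "dr e (dr e' (\<lambda>_. 0)) p = 0" for e e' p :: c2
    using d[of e p] by (subst (2) dr_eqI'[where D="\<lambda>_ _. 0"]) auto
  show "0 \<le> dr B (dr B (\<lambda>_. 0)) p + dr (cmul \<i> B) (dr (cmul \<i> B) (\<lambda>_. 0)) p" for p B by (simp add: d')
qed (auto intro: Ck_const)

lemma exp_small: "0 < x \<Longrightarrow> - ln x \<le> y \<Longrightarrow> exp (- y) \<le> (x::real)"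
  by (metis exp_le_cancel_iff exp_ln minus_le_iff)

text \<open>The quantifiers carry the content: \<epsilon> and the bound \<open>t0\<close> come
  before the point \<open>p\<close>, then the radius, then \<open>x0\<close>, and \<open>V\<close>
  comes last. One value of \<open>V\<close> at \<open>p\<close> is the only information about the
  Lelong number, and truncation and mollification enter through \<open>V\<close> alone.\<close>

lemma flux_small:
  assumes a: "0 < a" and ab: "a < b" and C: "0 \<le> C" and \<kappa>: "0 < (\<kappa>::real)"
  shows "\<exists>\<epsilon>>0. \<exists>t0>0. \<forall>p::c2. p \<noteq> 0 \<longrightarrow> norm p < t0 \<longrightarrow>
     (\<exists>r>0. 2 * r \<le> smooth_inv.dl a b \<and> (\<exists>x0>0. x0 < a \<and>
        (\<forall>V. smooth_inv V a b C \<longrightarrow> \<epsilon> * ln (norm p) \<le> V p \<longrightarrow> (\<forall>x. 0 < x \<longrightarrow> x < x0 \<longrightarrow> smooth_inv.flux V x r \<le> ennreal \<kappa>))))"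
proof -
  interpret Z: smooth_inv "\<lambda>_. 0" a b C by (rule smooth_inv_zero[OF a ab C])
  define cc m A L PP dl s0 where "cc = Z.cc" and "m = Z.m" and "A = Z.A" and "L = Z.L" and "PP = Z.PP" and "dl = Z.dl" and "s0 = Z.s0"
  note defs = cc_def m_def A_def L_def PP_def dl_def s0_def
  have pos: "cc > 0" "m \<ge> 0" "A > 0" "PP \<ge> 0" "dl > 0" "s0 > 0" "dl < b" "dl \<le> s0"
    using Z.cc_pos Z.m_nonneg Z.A_pos Z.PP_nonneg Z.dl_pos Z.bd a unfolding defs Z.s0_def by auto
  have L: "L s = C + m / cc * ln (s0 / s)" for s unfolding defs Z.L_def ..
  obtain B where B: "B \<ge> 0" "\<And>z. \<bar>Z.beta z\<bar> \<le> B" using csupp_bounded[OF Z.cont_beta Z.csupp_beta] by blast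
  have Bb: "Z.beta z \<le> B" for z using B(2)[of z] by linarith
  define sk where "sk = sqrt (kap a b)"
  have sk: "0 < sk" "sk < 1" using Z.k0 Z.k1 by (auto simp: sk_def)
  \<comment> \<open>The three terms of \<open>flux_bound\<close> are each to be at most
    \<open>\<kappa> / 4\<close>: \<eta> takes care of the first, \<kappa>1 is the mass of
    \<open>U\<close> allowed by the last, and the middle one is made small later by taking
    \<open>x\<close> small.\<close>
  define \<eta> where "\<eta> = \<kappa> / (4 * (m + 1))"
  have \<eta>: "\<eta> > 0" "\<eta> * m \<le> \<kappa> / 4" using \<kappa> pos by (auto simp: \<eta>_def field_simps)
  define \<kappa>1 where "\<kappa>1 = \<eta> * \<kappa> / (4 * A\<^sup>2)"
  have \<kappa>1: "\<kappa>1 > 0" "A\<^sup>2 / \<eta> * \<kappa>1 = \<kappa> / 4" using \<eta> \<kappa> pos by (auto simp: \<kappa>1_def field_simps)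
  \<comment> \<open>The scale will be \<open>s\<close> = |p|^(1/N). Then \<open>L s\<close> grows
    like (m / cc) (l / N) with l = -ln |p|, and \<open>2 * L s\<close> must stay below
    \<open>A * ln (a / \<tau>)\<close>, which grows like A l. N >= 2 also keeps |p| small compared
    with \<open>s\<close>.\<close>
  define N where "N = 2 + 4 * m / (cc * A)"
  have N: "N \<ge> 2" "m / cc * (1 / N) \<le> A / 4"
  proof -
    show "N \<ge> 2" using pos by (simp add: N_def)
    then have "4 * m / (cc * A) \<le> N" "N > 0" by (auto simp: N_def)
    then have "4 * m \<le> N * (cc * A)" using pos by (subst (asm) pos_divide_le_eq) auto
    then show "m / cc * (1 / N) \<le> A / 4" using pos \<open>N > 0\<close> by (simp add: field_simps)
  qed
  define K where "K = 2 * (B * PP * m)"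
  have K: "K \<ge> 0" using B pos by (simp add: K_def)
  \<comment> \<open>In \<open>lap_mass_U\<close> the numerator is about \<epsilon> l cc and the
    logarithm in the denominator at least l / (2 N); this \<epsilon> makes their quotient half of
    \<kappa>1 and leaves the other half for \<open>K\<close>.\<close>
  define \<epsilon> where "\<epsilon> = \<kappa>1 / (4 * N * cc)"
  have \<epsilon>: "\<epsilon> > 0" using \<kappa>1 N pos by (simp add: \<epsilon>_def)
  \<comment> \<open>Thresholds for l = -ln |p|, in order: l >= 1; ln (a / \<tau>) >= 1; the
    condition on \<open>L s\<close>; s <= dl / 2; \<tau> <= dl / 2; ln (dl / s) >= l / (2 N);
    \<open>K\<close> dominated by the logarithm; exp (- l / 2) <= sk / 2, which gives \<tau> <= (sk
    / 2) s.\<close>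
  define l0 where "l0 = Max {1, 1 - ln a, (2 * C + 2 * (m / cc) * ln s0 - A * ln a) * (2 / A), - N * ln (dl / 2), - ln (dl / 2),
     - 2 * N * ln dl, 4 * N * cc * K / \<kappa>1, - 2 * ln (sk / 2)}"
  define t0 where "t0 = exp (- l0)"
  have t0: "t0 > 0" by (simp add: t0_def)
  show ?thesis
  proof (rule exI[of _ \<epsilon>], rule conjI[OF \<epsilon>], rule exI[of _ t0], rule conjI[OF t0], intro allI impI)
    fix p :: c2 assume p: "p \<noteq> 0" "norm p < t0"
    define l where "l = - ln (norm p)"
    have np: "norm p > 0" using p by simp
    have pe: "norm p = exp (- l)" using np by (simp add: l_def)
    have "l > l0" using p(2) unfolding t0_def pe by simp
    then have ge: "y \<le> l" if "y \<in> {1, 1 - ln a, (2 * C + 2 * (m / cc) * ln s0 - A * ln a) * (2 / A), - N * ln (dl / 2), - ln (dl / 2),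
     - 2 * N * ln dl, 4 * N * cc * K / \<kappa>1, - 2 * ln (sk / 2)}" for y
      using Max_ge[OF _ that] unfolding l0_def by (meson finite.emptyI finite.insertI le_less_trans less_imp_le)
    have l1: "1 \<le> l" "1 - ln a \<le> l" and l3: "(2 * C + 2 * (m / cc) * ln s0 - A * ln a) * (2 / A) \<le> l"
      and l4: "- N * ln (dl / 2) \<le> l" "- ln (dl / 2) \<le> l" and l6: "- 2 * N * ln dl \<le> l" and l7: "4 * N * cc * K / \<kappa>1 \<le> l"
      and l8: "- 2 * ln (sk / 2) \<le> l"
      by (rule ge, simp)+
    define \<tau> where "\<tau> = norm p"
    define s where "s = exp (- (l / N))"
    have s: "s > 0" by (simp add: s_def)
    have ln\<tau>: "ln (a / \<tau>) = ln a + l" using np a by (simp add: \<tau>_def ln_div l_def)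
    have c1: "ln (a / \<tau>) \<ge> 1" using l1 ln\<tau> by simp
    have \<tau>: "0 < \<tau>" "\<tau> < b"
    proof -
      show "0 < \<tau>" using np by (simp add: \<tau>_def)
      have "\<not> a / \<tau> \<le> 1" using c1 a \<open>0 < \<tau>\<close> by (metis divide_pos_pos ln_le_zero_iff not_one_le_zero order_trans)
      then show "\<tau> < b" using \<open>0 < \<tau>\<close> ab by (simp add: field_simps)
    qed
    have c2: "2 * L s \<le> A * ln (a / \<tau>)"
    proof -
      have "ln (s0 / s) = ln s0 + l * (1 / N)" using pos s by (simp add: ln_div s_def)
      then have "2 * L s = 2 * C + 2 * (m / cc) * ln s0 + 2 * (m / cc * (1 / N)) * l" unfolding L by (simp add: algebra_simps)
      also have "\<dots> \<le> 2 * C + 2 * (m / cc) * ln s0 + 2 * (A / 4) * l"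
        using N(2) l1 by (intro add_left_mono mult_right_mono mult_left_mono) auto
      also have "\<dots> \<le> A * ln a + A * l"
      proof -
        have "(2 * C + 2 * (m / cc) * ln s0 - A * ln a) * (2 / A) * (A / 2) \<le> l * (A / 2)"
          using l3 pos by (intro mult_right_mono) auto
        then have "2 * C + 2 * (m / cc) * ln s0 - A * ln a \<le> l * (A / 2)" using pos by simp
        moreover have "2 * (A / 4) * l = l * (A / 2)" "A * l = l * (A / 2) + l * (A / 2)" by (simp_all add: algebra_simps)
        ultimately show ?thesis by linarith
      qed
      finally show ?thesis unfolding ln\<tau> by (simp add: algebra_simps)
    qed
    have sd: "s \<le> dl / 2" unfolding s_def
    proof (rule exp_small)
      show "- ln (dl / 2) \<le> l / N" using l4(1) N by (simp add: field_simps)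
    qed (use pos in simp)
    have td: "\<tau> \<le> dl / 2" unfolding \<tau>_def pe by (rule exp_small) (use pos l4 in auto)
    have tsk: "\<tau> \<le> sk / 2 * s"
    proof -
      have "exp (- (l / 2)) \<le> sk / 2" by (rule exp_small) (use sk l8 in auto)
      moreover have "l / N \<le> l / 2" using N l1 by (intro divide_left_mono) auto
      then have "exp (- (l / 2)) \<le> s" by (simp add: s_def)
      ultimately have "exp (- (l / 2)) * exp (- (l / 2)) \<le> sk / 2 * s" using sk by (intro mult_mono) auto
      then show ?thesis by (simp add: \<tau>_def pe exp_add[symmetric])
    qed
    \<comment> \<open>A ball of radius \<open>2 * r\<close> around 0 is to fit into the one of
      radius \<open>sk * s\<close> around \<open>snd p\<close>, whose centre is at distance at most
      half that radius from 0.\<close>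
    define r where "r = sk * s / 4"
    have r: "r > 0" "r \<le> s / 4" using sk s by (auto simp: r_def mult_left_le_one_le)
    \<comment> \<open>The lower bound for ln (a / x) that makes the middle term of
      \<open>flux_bound\<close> at most \<open>\<kappa> / 4\<close>.\<close>
    define Tm where "Tm = max 1 (4 * A * (L r * m) / (\<eta> * \<kappa>))"
    define x0 where "x0 = a * exp (- Tm)"
    show "\<exists>r>0. 2 * r \<le> Z.dl \<and> (\<exists>x0>0. x0 < a \<and>
        (\<forall>V. smooth_inv V a b C \<longrightarrow> \<epsilon> * ln (norm p) \<le> V p \<longrightarrow> (\<forall>x. 0 < x \<longrightarrow> x < x0 \<longrightarrow> smooth_inv.flux V x r \<le> ennreal \<kappa>)))"
    proof (rule exI[of _ r], rule conjI[OF r(1)], rule conjI, goal_cases)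
      case 1
      show "2 * r \<le> Z.dl" using r sd pos s unfolding dl_def[symmetric] by linarith
    next
      case 2
      have "x0 > 0" using a by (simp add: x0_def)
      have "x0 < a" using a by (simp add: x0_def Tm_def)
      show ?case
      proof (rule exI[of _ x0], rule conjI[OF \<open>x0 > 0\<close>], rule conjI[OF \<open>x0 < a\<close>], intro allI impI)
      fix V x assume "smooth_inv V a b C" and Vp: "\<epsilon> * ln (norm p) \<le> V p" and x: "0 < x" "x < x0"
      then interpret W: smooth_inv V a b C by simp
      have T: "ln (a / x) > Tm"
      proof -
        have "ln x < ln x0" using x by simp
        also have "ln x0 = ln a - Tm" using a by (simp add: x0_def ln_mult)
        finally show ?thesis using a x by (simp add: ln_div)
      qed
      then have T1: "ln (a / x) \<ge> 1" by (simp add: Tm_def)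
      have xa: "x < a" using x \<open>x0 < a\<close> by simp
      have massU: "lap_mass (W.U x) (ball (snd p) (sk * s)) \<le> ennreal \<kappa>1"
      proof -
        have "lap_mass (W.U x) (ball (snd p) (sk * s)) \<le> ennreal ((- V (fst p, snd p) + 2 * (B * W.PP * W.m)) * Z.cc / ln (W.dl / s))"
          unfolding sk_def
        proof (rule W.lap_mass_U[OF x(1) xa _ \<tau>(1) c1 \<tau>(2) s])
          show "cmod (fst p) \<le> \<tau>" using norm_fst_le[of "fst p" "snd p"] by (simp add: \<tau>_def)
          show "s < W.dl" using sd pos s unfolding dl_def[symmetric] by linarith
          show "2 * W.L s \<le> W.A * ln (a / \<tau>)" using c2 unfolding L_def A_def .
          show "cmod (snd p) + s \<le> W.dl"
            using norm_snd_le[of "snd p" "fst p"] sd td unfolding dl_def[symmetric] by (simp add: \<tau>_def)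
          show "Z.beta z \<le> B" for z by (rule Bb)
        qed
        also have "\<dots> = ennreal ((- V p + K) * cc / ln (dl / s))" by (simp add: K_def defs)
        also have "\<dots> \<le> ennreal \<kappa>1"
        proof (rule ennreal_leI)
          have "ln (dl / s) = ln dl + l / N" using pos s by (simp add: ln_div s_def)
          moreover have "- 2 * N * ln dl / (2 * N) \<le> l / (2 * N)" using l6 N by (intro divide_right_mono) auto
          then have "- ln dl \<le> l / (2 * N)" using N by simp
          moreover have "l / N = l / (2 * N) + l / (2 * N)" using N by (simp add: field_simps)
          ultimately have ld: "l / (2 * N) \<le> ln (dl / s)" by linarith
          have lN: "l / (2 * N) > 0" using l1 N by simp
          have "- V p + K \<le> \<epsilon> * l + K" using Vp by (simp add: l_def)
          then have "(- V p + K) * cc \<le> (\<epsilon> * l + K) * cc" using pos by (intro mult_right_mono) auto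
          also have "\<dots> \<le> \<kappa>1 * (l / (2 * N))"
          proof -
            have "\<epsilon> * l * cc = \<kappa>1 * l / (4 * N)" using N pos by (simp add: \<epsilon>_def)
            moreover have "4 * N * cc * K \<le> l * \<kappa>1" using l7 \<kappa>1 by (simp add: pos_divide_le_eq)
            then have "4 * N * cc * K / (4 * N) \<le> l * \<kappa>1 / (4 * N)" using N by (intro divide_right_mono) auto
            then have "K * cc \<le> \<kappa>1 * l / (4 * N)" using N by (simp add: mult.commute)
            moreover have "\<kappa>1 * (l / (2 * N)) = \<kappa>1 * l / (4 * N) + \<kappa>1 * l / (4 * N)" using N by (simp add: field_simps)
            ultimately show ?thesis by (simp add: algebra_simps)
          qed
          also have "\<dots> \<le> \<kappa>1 * ln (dl / s)" using ld \<kappa>1 by (intro mult_left_mono) auto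
          finally show "(- V p + K) * cc / ln (dl / s) \<le> \<kappa>1" using ld lN by (subst pos_divide_le_eq) auto
        qed
        finally show ?thesis .
      qed
      have sub: "ball 0 (r + r) \<subseteq> ball (snd p) (sk * s)"
      proof -
        have "cmod (snd p) \<le> \<tau>" using norm_snd_le[of "snd p" "fst p"] by (simp add: \<tau>_def)
        then show ?thesis using tsk by (subst ball_subset_ball_iff) (auto simp: r_def dist_norm mult.commute)
      qed
      have "W.flux x r \<le> ennreal (\<eta> * W.m + W.A / (\<eta> * ln (a / x)) * (W.L r * W.m)) + ennreal (W.A\<^sup>2 / \<eta>) * lap_mass (W.U x) (ball 0 (r + r))"
        by (rule W.flux_bound[OF x(1) T1 \<eta>(1) r(1) r(1)]) (use r sd pos in \<open>auto simp: dl_def\<close>)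
      also have "\<dots> \<le> ennreal (\<kappa> / 4 + \<kappa> / 4) + ennreal (A\<^sup>2 / \<eta>) * ennreal \<kappa>1"
      proof (intro add_mono mult_mono ennreal_leI order_trans[OF lap_mass_mono[OF sub] massU])
        show "\<eta> * W.m \<le> \<kappa> / 4" using \<eta>(2) by (simp add: m_def)
        have "4 * A * (L r * m) / (\<eta> * \<kappa>) \<le> ln (a / x)" using T by (simp add: Tm_def)
        then have "4 * A * (L r * m) \<le> ln (a / x) * (\<eta> * \<kappa>)" using \<eta> \<kappa> by (simp add: pos_divide_le_eq)
        then have "A * (L r * m) \<le> \<kappa> / 4 * (\<eta> * ln (a / x))" by (simp add: algebra_simps)
        then show "W.A / (\<eta> * ln (a / x)) * (W.L r * W.m) \<le> \<kappa> / 4"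
          using \<eta> T1 by (simp add: pos_divide_le_eq A_def L_def m_def)
      qed (auto simp: A_def)
      also have "ennreal (A\<^sup>2 / \<eta>) * ennreal \<kappa>1 = ennreal (\<kappa> / 4)"
        using \<eta>(1) by (subst ennreal_mult'[symmetric]) (simp, simp only: \<kappa>1(2))
      also have "ennreal (\<kappa> / 4 + \<kappa> / 4) + ennreal (\<kappa> / 4) \<le> ennreal \<kappa>"
        using \<kappa> by (subst ennreal_plus[symmetric]) (auto intro!: ennreal_leI)
      finally show "W.flux x r \<le> ennreal \<kappa>" .
      qed
    qed
  qed
qed

section \<open>Truncations of the given function\<close>

definition pdisc :: "real \<Rightarrow> c2 set" where "pdisc c = {p. cmod (fst p) < c \<and> cmod (snd p) < c}"

lemma pdisc_iff: "p \<in> pdisc c \<longleftrightarrow> cmod (fst p) < c \<and> cmod (snd p) < c" by (simp add: pdisc_def)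

lemma bidisc_pdisc: "bidisc = pdisc 1" by (auto simp: bidisc_def pdisc_def dist_norm)

lemma open_pdisc: "open (pdisc c)"
  unfolding pdisc_def by (intro open_Collect_conj open_Collect_less continuous_intros)

locale psh_setup =
  fixes u :: "c2 \<Rightarrow> ereal" and C0 c :: real
  assumes psh: "psh bidisc u" and c: "0 < c" "c < 1" and C0: "0 \<le> C0"
    and ub: "\<And>p. p \<in> pdisc c \<Longrightarrow> u p \<le> ereal C0"
    and rot: "\<And>z w. (z, w) \<in> bidisc \<Longrightarrow> u (complex_of_real (cmod z), w) = u (z, w)"
begin

text \<open>\<open>h\<close> is the truncation occurring in \<open>is_MA\<close>. \<open>g\<close>
  lowers it by the constant \<open>C0\<close>, which changes no derivative, to make it nonpositive,
  and cuts it off outside the polydisc.\<close>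

definition h :: "nat \<Rightarrow> c2 \<Rightarrow> real" where "h j p = real_of_ereal (max (u p) (ereal (- real j)))"
definition g :: "nat \<Rightarrow> c2 \<Rightarrow> real" where "g j p = (if p \<in> pdisc c then h j p - C0 else 0)"

lemma pdisc_sub: "p \<in> pdisc c \<Longrightarrow> p \<in> bidisc" using c by (auto simp: bidisc_pdisc pdisc_def)

lemma usc_nhds: assumes "p \<in> bidisc" "u p < t" shows "\<forall>\<^sub>F y in nhds p. u y < t"
proof -
  have op: "open bidisc" and "usc_on bidisc u" using psh unfolding psh_def by blast+
  then have "\<forall>\<^sub>F y in at p within bidisc. u y < t" using assms unfolding usc_on_def by blast
  then have "\<forall>\<^sub>F y in at p. u y < t" by (simp only: at_within_open[OF assms(1) op])
  then show ?thesis using assms(2) unfolding eventually_nhds_conv_at by blast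
qed

lemma h_less: assumes "p \<in> pdisc c" shows "h j p < t \<longleftrightarrow> u p < ereal t \<and> - real j < t"
  using ub[OF assms] by (cases "u p") (auto simp: h_def max_def)

lemma h_bounds: assumes "p \<in> pdisc c" shows "- real j \<le> h j p" "h j p \<le> C0"
  using ub[OF assms] C0 by (cases "u p"; auto simp: h_def max_def)+

lemma h_ge: assumes "p \<in> pdisc c" "ereal t \<le> u p" shows "t \<le> h j p"
  using ub[OF assms(1)] assms(2) by (cases "u p") (auto simp: h_def max_def)

lemma h_mono: assumes "p \<in> pdisc c" "i \<le> j" shows "h j p \<le> h i p"
  using ub[OF assms(1)] assms(2) by (cases "u p") (auto simp: h_def max_def)

lemma u_open: "open {p \<in> pdisc c. u p < t}"
proof (subst open_subopen, intro ballI)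
  fix p assume "p \<in> {p \<in> pdisc c. u p < t}"
  then have p: "p \<in> pdisc c" "u p < t" by auto
  have "\<forall>\<^sub>F y in nhds p. y \<in> pdisc c" by (rule eventually_nhds_in_open[OF open_pdisc p(1)])
  moreover have "\<forall>\<^sub>F y in nhds p. u y < t" using p pdisc_sub by (intro usc_nhds)
  ultimately have "\<forall>\<^sub>F y in nhds p. y \<in> {p \<in> pdisc c. u p < t}" by eventually_elim auto
  then show "\<exists>T. open T \<and> p \<in> T \<and> T \<subseteq> {p \<in> pdisc c. u p < t}" unfolding eventually_nhds by blast
qed

lemma g_meas: "g j \<in> borel_measurable borel"
proof (rule borel_measurable_iff_less[THEN iffD2], intro allI)
  fix t
  show "{p \<in> space borel. g j p < t} \<in> sets borel"
  proof (cases "t > 0")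
    case True
    have "g j p < t" for p using h_bounds(2)[of p j] True by (auto simp: g_def)
    then have "{p \<in> space borel. g j p < t} = UNIV" by simp
    then show ?thesis by simp
  next
    case False
    then have "{p \<in> space borel. g j p < t} = (if - real j < t + C0 then {p \<in> pdisc c. u p < ereal (t + C0)} else {})"
      using h_less[of _ j "t + C0"] by (auto simp: g_def diff_less_eq split: if_splits)
    then show ?thesis using u_open by (simp add: borel_open)
  qed
qed

text \<open>Truncation leaves the positive part of u unchanged on the circle and can only diminish
  the negative part, so the extended mean of u, even when it is -infinity, is at most the real mean
  of the truncation. Where u <= -j at the centre, the constant -j is a trivial lower bound of that
  mean.\<close>

lemma g_submean:
  assumes disc: "\<And>\<zeta>. cmod \<zeta> \<le> 1 \<Longrightarrow> x + cmul \<zeta> B \<in> pdisc c"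
  shows "g j x \<le> (1 / (2 * pi)) * (\<integral>\<theta>. indicator {0..2*pi} \<theta> * g j (x + cmul (cis \<theta>) B) \<partial>lborel)"
proof -
  let ?y = "\<lambda>\<theta>. x + cmul (cis \<theta>) B"
  have y: "?y \<theta> \<in> pdisc c" for \<theta> by (rule disc) simp
  have x: "x \<in> pdisc c" using disc[of 0] by (simp add: cmul_def zero_prod_def[symmetric])
  have my: "?y \<in> borel_measurable borel" by (intro borel_measurable_continuous_onI continuous_intros cmul_cont)
  have mg: "(\<lambda>\<theta>. g j (?y \<theta>)) \<in> borel_measurable borel" using measurable_compose[OF my g_meas] .
  define H where "H \<theta> = h j (?y \<theta>)" for \<theta>
  have Hg: "g j (?y \<theta>) = H \<theta> - C0" for \<theta> using y by (simp add: g_def H_def)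
  have [measurable]: "H \<in> borel_measurable borel"
  proof -
    have "H = (\<lambda>\<theta>. g j (?y \<theta>) + C0)" by (simp add: Hg)
    then show ?thesis using mg by simp
  qed
  have Hb: "- real j \<le> H \<theta>" "H \<theta> \<le> C0" for \<theta> using h_bounds[OF y] by (auto simp: H_def)
  have int: "integrable lborel (\<lambda>\<theta>. indicator {0..2*pi} \<theta> * f (H \<theta>))" if "f \<in> borel_measurable borel" "\<And>t. \<bar>f t\<bar> \<le> \<bar>t\<bar>" for f :: "real \<Rightarrow> real"
  proof (rule bounded_integrable[where K="C0 + real j" and r="2 * pi"])
    show "(\<lambda>\<theta>. indicator {0..2*pi} \<theta> * f (H \<theta>)) \<in> borel_measurable borel" using that by measurable
    show "\<bar>indicator {0..2*pi} \<theta> * f (H \<theta>)\<bar> \<le> C0 + real j" for \<theta>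
      using that(2)[of "H \<theta>"] Hb[of \<theta>] C0 by (auto simp: indicator_def)
  qed (auto simp: indicator_def)
  define I where "I = (\<integral>\<theta>. indicator {0..2*pi} \<theta> * H \<theta> \<partial>lborel)"
  have main: "h j x \<le> (1 / (2 * pi)) * I"
  proof (cases "u x \<le> ereal (- real j)")
    case True
    then have "h j x = - real j" by (simp add: h_def max_def)
    also have "\<dots> = (1 / (2 * pi)) * (\<integral>\<theta>. indicator {0..2*pi} \<theta> * (- real j) \<partial>lborel)" by simp
    also have "\<dots> \<le> (1 / (2 * pi)) * I" unfolding I_def
    proof (intro mult_left_mono integral_mono)
      show "integrable lborel (\<lambda>\<theta>. indicator {0..2*pi} \<theta> * (- real j))" by (rule bounded_integrable[where K="real j" and r="2*pi"]) (auto simp: indicator_def)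
      show "integrable lborel (\<lambda>\<theta>. indicator {0..2*pi} \<theta> * H \<theta>)" using int[of "\<lambda>t. t"] by simp
    qed (use Hb in auto)
    finally show ?thesis .
  next
    case False
    define P where "P = (\<integral>\<theta>. indicator {0..2*pi} \<theta> * max 0 (H \<theta>) \<partial>lborel)"
    define Q where "Q = (\<integral>\<theta>. indicator {0..2*pi} \<theta> * max 0 (- H \<theta>) \<partial>lborel)"
    have iP: "integrable lborel (\<lambda>\<theta>. indicator {0..2*pi} \<theta> * max 0 (H \<theta>))" by (rule int) auto
    have iQ: "integrable lborel (\<lambda>\<theta>. indicator {0..2*pi} \<theta> * max 0 (- H \<theta>))" by (rule int) auto
    have PQ: "P - Q = I"
    proof -
      have "P - Q = (\<integral>\<theta>. indicator {0..2*pi} \<theta> * max 0 (H \<theta>) - indicator {0..2*pi} \<theta> * max 0 (- H \<theta>) \<partial>lborel)"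
        unfolding P_def Q_def using iP iQ by simp
      also have "\<dots> = I" unfolding I_def by (rule Bochner_Integration.integral_cong) (auto simp: indicator_def max_def)
      finally show ?thesis .
    qed
    have uH: "e2ennreal (u (?y \<theta>)) = ennreal (max 0 (H \<theta>))" for \<theta>
      unfolding H_def h_def using ub[OF y[of \<theta>]]
      by (cases "u (?y \<theta>)") (auto simp: max_def e2ennreal_neg ennreal_neg e2ennreal_ereal)
    have uH': "ennreal (max 0 (- H \<theta>)) \<le> e2ennreal (- u (?y \<theta>))" for \<theta>
    proof -
      have "ereal (max 0 (- H \<theta>)) \<le> max 0 (- u (?y \<theta>))"
        unfolding H_def h_def using ub[OF y[of \<theta>]] by (cases "u (?y \<theta>)") (auto simp: max_def)
      then have "e2ennreal (ereal (max 0 (- H \<theta>))) \<le> e2ennreal (max 0 (- u (?y \<theta>)))" by (rule e2ennreal_mono)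
      then show ?thesis by (simp add: e2ennreal_ereal max_def e2ennreal_neg split: if_splits)
    qed
    have nP: "(\<integral>\<^sup>+ \<theta>\<in>{0..2*pi}. e2ennreal (u (?y \<theta>)) \<partial>lborel) = ennreal P"
    proof -
      have "(\<integral>\<^sup>+ \<theta>\<in>{0..2*pi}. e2ennreal (u (?y \<theta>)) \<partial>lborel) = (\<integral>\<^sup>+ \<theta>. ennreal (indicator {0..2*pi} \<theta> * max 0 (H \<theta>)) \<partial>lborel)"
        by (rule nn_integral_cong) (simp add: uH indicator_def)
      also have "\<dots> = ennreal P" unfolding P_def by (rule nn_integral_eq_integral[OF iP]) (auto simp: indicator_def)
      finally show ?thesis .
    qed
    have nQ: "ennreal Q \<le> (\<integral>\<^sup>+ \<theta>\<in>{0..2*pi}. e2ennreal (- u (?y \<theta>)) \<partial>lborel)" (is "_ \<le> ?N")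
    proof -
      have "ennreal Q = (\<integral>\<^sup>+ \<theta>. ennreal (indicator {0..2*pi} \<theta> * max 0 (- H \<theta>)) \<partial>lborel)"
        unfolding Q_def by (rule nn_integral_eq_integral[OF iQ, symmetric]) (auto simp: indicator_def)
      also have "\<dots> \<le> ?N" by (rule nn_integral_mono) (use uH' in \<open>auto simp: indicator_def\<close>)
      finally show ?thesis .
    qed
    have P0: "P \<ge> 0" and Q0: "Q \<ge> 0" unfolding P_def Q_def by (rule Bochner_Integration.integral_nonneg, auto simp: indicator_def)+
    have "\<forall>\<zeta>. cmod \<zeta> \<le> 1 \<longrightarrow> x + cmul \<zeta> B \<in> bidisc" using disc pdisc_sub by blast
    then have "u x \<le> circ_mean (\<lambda>\<zeta>. u (x + cmul \<zeta> B))" using psh unfolding psh_def by blast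
    also have "\<dots> = ereal (1 / (2 * pi)) * (enn2ereal (ennreal P) - enn2ereal ?N)" unfolding circ_mean_def nP ..
    also have "\<dots> \<le> ereal (1 / (2 * pi)) * (ereal P - ereal Q)"
    proof (rule ereal_mult_left_mono)
      have "ereal Q \<le> enn2ereal ?N" using nQ Q0 by (metis enn2ereal_ennreal less_eq_ennreal.rep_eq)
      then show "enn2ereal (ennreal P) - enn2ereal ?N \<le> ereal P - ereal Q" using P0 by (intro ereal_minus_mono) auto
    qed simp
    also have "\<dots> = ereal ((1 / (2 * pi)) * I)" using PQ by simp
    finally have "u x \<le> ereal ((1 / (2 * pi)) * I)" .
    then show ?thesis using False by (cases "u x") (auto simp: h_def max_def)
  qed
  have "(\<integral>\<theta>. indicator {0..2*pi} \<theta> * g j (?y \<theta>) \<partial>lborel) = (\<integral>\<theta>. indicator {0..2*pi} \<theta> * H \<theta> - indicator {0..2*pi} \<theta> * C0 \<partial>lborel)"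
    by (simp add: Hg right_diff_distrib)
  also have "\<dots> = I - 2 * pi * C0"
  proof -
    have "integrable lborel (\<lambda>\<theta>. indicator {0..2*pi} \<theta> * C0)" by (rule bounded_integrable[where K="C0" and r="2*pi"]) (use C0 in \<open>auto simp: indicator_def\<close>)
    then show ?thesis unfolding I_def using int[of "\<lambda>t. t"] by simp
  qed
  finally show ?thesis using main x by (simp add: g_def field_simps)
qed

sublocale G: bnd_psh "g j" c "real j + C0" for j
proof
  show "g j \<in> borel_measurable borel" by (rule g_meas)
  show "- (real j + C0) \<le> g j p" for p using h_bounds(1)[of p j] C0 by (auto simp: g_def)
  show "g j p \<le> 0" for p using h_bounds(2)[of p j] by (auto simp: g_def)
  show "\<not> (cmod (fst p) < c \<and> cmod (snd p) < c) \<Longrightarrow> g j p = 0" for p by (auto simp: g_def pdisc_iff)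
  show "g j x \<le> (1 / (2 * pi)) * (\<integral>\<theta>. indicator {0..2*pi} \<theta> * g j (x + cmul (cis \<theta>) B) \<partial>lborel)"
    if "\<And>\<zeta>. cmod \<zeta> \<le> 1 \<Longrightarrow> cmod (fst (x + cmul \<zeta> B)) < c \<and> cmod (snd (x + cmul \<zeta> B)) < c" for x B
    by (rule g_submean) (use that in \<open>simp add: pdisc_iff\<close>)
  show "\<forall>\<^sub>F y in nhds x. g j y < t" if x: "cmod (fst x) < c" "cmod (snd x) < c" and t: "g j x < t" for x t
  proof -
    have xp: "x \<in> pdisc c" using x by (simp add: pdisc_iff)
    then have "u x < ereal (t + C0)" "- real j < t + C0" using t h_less[OF xp, of j "t + C0"] by (auto simp: g_def diff_less_eq)
    then have "\<forall>\<^sub>F y in nhds x. u y < ereal (t + C0)" using xp pdisc_sub by (intro usc_nhds)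
    moreover have "\<forall>\<^sub>F y in nhds x. y \<in> pdisc c" by (rule eventually_nhds_in_open[OF open_pdisc xp])
    ultimately show ?thesis
    proof eventually_elim
      case (elim y)
      then show ?case using h_less[of y j "t + C0"] \<open>- real j < t + C0\<close> by (simp add: g_def diff_less_eq)
    qed
  qed
  show "g j (cis \<theta> * z, w) = g j (z, w)" for \<theta> z w
  proof (cases "(z, w) \<in> pdisc c")
    case True
    then have T': "(cis \<theta> * z, w) \<in> pdisc c" by (simp add: pdisc_iff norm_mult)
    have "u (cis \<theta> * z, w) = u (z, w)"
      using rot[OF pdisc_sub[OF True]] rot[OF pdisc_sub[OF T']] by (simp add: norm_mult)
    then show ?thesis using True T' by (simp add: g_def h_def)
  qed (auto simp: g_def pdisc_iff norm_mult)
qed (use c in auto)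

lemma moll_h:
  assumes \<epsilon>: "\<epsilon> > 0" and x: "x \<in> pdisc (c - \<epsilon>)"
  shows "moll (h j) \<epsilon> x = moll (g j) \<epsilon> x + C0"
proof -
  have "moll (h j) \<epsilon> x = (\<integral>y. g j (x - \<epsilon> *\<^sub>R y) * rho y + C0 * rho y \<partial>lborel)"
    unfolding moll_def
  proof (rule Bochner_Integration.integral_cong[OF refl])
    fix y
    show "h j (x - \<epsilon> *\<^sub>R y) * rho y = g j (x - \<epsilon> *\<^sub>R y) * rho y + C0 * rho y"
    proof (cases "norm y < 1")
      case True
      have "norm (\<epsilon> *\<^sub>R y) \<le> \<epsilon>" using True \<epsilon> by (simp add: mult_left_le)
      then have "cmod (fst (\<epsilon> *\<^sub>R y)) \<le> \<epsilon>" "cmod (snd (\<epsilon> *\<^sub>R y)) \<le> \<epsilon>" using G.fst_snd_le[of "\<epsilon> *\<^sub>R y"] by linarith+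
      then have "x - \<epsilon> *\<^sub>R y \<in> pdisc c"
        using x norm_triangle_ineq4[of "fst x" "fst (\<epsilon> *\<^sub>R y)"] norm_triangle_ineq4[of "snd x" "snd (\<epsilon> *\<^sub>R y)"]
        unfolding pdisc_iff fst_diff snd_diff by linarith
      then show ?thesis by (simp add: g_def algebra_simps)
    qed (simp add: rho_zero)
  qed
  also have "\<dots> = moll (g j) \<epsilon> x + C0"
    unfolding moll_def using G.moll_int[of j x \<epsilon>] rho_integrable rho_int by simp
  finally show ?thesis .
qed

end

section \<open>Locality of the Monge-Ampere density\<close>

lemma pd_cong:
  assumes "open W" "x \<in> W" "\<And>y. y \<in> W \<Longrightarrow> f y = k y + t"
  shows "pd e f x = pd e k x"
proof -
  have cont: "isCont (\<lambda>s. x + s *\<^sub>R e) 0" by (intro continuous_intros)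
  then have "((\<lambda>s. x + s *\<^sub>R e) \<longlongrightarrow> x) (nhds 0)" by (simp add: isCont_def tendsto_nhds_iff)
  from topological_tendstoD[OF this assms(1,2)]
  have ev: "\<forall>\<^sub>F s in nhds 0. f (x + s *\<^sub>R e) = k (x + s *\<^sub>R e) + t" by (elim eventually_mono) (rule assms(3))
  have "pd e f x = deriv (\<lambda>s. k (x + s *\<^sub>R e) + t) 0" unfolding pd_def by (rule deriv_cong_ev[OF ev refl])
  also have "\<dots> = pd e k x"
  proof -
    \<comment> \<open>An equivalence for every candidate \<open>D\<close>: then \<open>deriv\<close>
      chooses the same value on both sides, also where neither function is differentiable.\<close>
    have "((\<lambda>s. k (x + s *\<^sub>R e) + t) has_field_derivative D) (at 0) \<longleftrightarrow> ((\<lambda>s. k (x + s *\<^sub>R e)) has_field_derivative D) (at 0)" for D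
      using DERIV_add[of "\<lambda>s. k (x + s *\<^sub>R e) + t" D 0 UNIV "\<lambda>_. - t" 0] DERIV_add[of "\<lambda>s. k (x + s *\<^sub>R e)" D 0 UNIV "\<lambda>_. t" 0] by auto
    then show ?thesis by (simp add: pd_def deriv_def)
  qed
  finally show ?thesis .
qed

text \<open>Needed because \<open>moll (h j) \<epsilon>\<close> is under control only where the
  mollifier stays inside the polydisc; there it equals \<open>moll (g j) \<epsilon>\<close> up to
  the constant \<open>C0\<close>.\<close>

lemma MA_cong:
  assumes W: "open W" "x \<in> W" "\<And>y. y \<in> W \<Longrightarrow> f y = k y + t"
  shows "MA_density f x = MA_density k x"
proof -
  have "pd e (pd e' f) x = pd e (pd e' k) x" for e e'
    by (rule pd_cong[OF W(1,2), where t=0]) (simp add: pd_cong[OF W(1) _ W(3)])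
  then show ?thesis by (simp add: MA_density_def)
qed

section \<open>Passage to the limit\<close>

context psh_setup
begin

text \<open>A ball of radius \<epsilon> around a point with |z| >= \<open>a\<close> or |w| >=
  \<open>a\<close> misses \<open>K\<close>, which lies in the polydisc of radius \<open>R0\<close>,
  so the bound on u off \<open>K\<close> passes to the average. The resulting constant depends
  neither on \<open>j\<close> nor on \<epsilon>.\<close>

lemma smooth_moll:
  assumes ab: "0 < a" "a < b" and \<epsilon>: "0 < \<epsilon>" "R0 + \<epsilon> \<le> a" "b + \<epsilon> \<le> c"
    and K: "\<And>p. p \<in> K \<Longrightarrow> cmod (fst p) \<le> R0 \<and> cmod (snd p) \<le> R0"
    and ae: "AE p in lborel. p \<in> bidisc - K \<longrightarrow> \<bar>u p\<bar> \<le> ereal C"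
  shows "smooth_inv (moll (g j) \<epsilon>) a b (\<bar>C\<bar> + C0)"
proof
  have low: "- (\<bar>C\<bar> + C0) \<le> moll (g j) \<epsilon> (z, w)" if zw: "cmod z < b" "cmod w < b" "a \<le> cmod z \<or> a \<le> cmod w" for z w
  proof (rule G.moll_ge_AE[OF \<epsilon>(1)])
    show "AE y in lborel. dist (z, w) y < \<epsilon> \<longrightarrow> - (\<bar>C\<bar> + C0) \<le> g j y"
      using ae
    proof eventually_elim
      case (elim y)
      show ?case
      proof
        assume d: "dist (z, w) y < \<epsilon>"
        have n: "cmod (z - fst y) < \<epsilon>" "cmod (w - snd y) < \<epsilon>"
          using d G.fst_snd_le[of "(z, w) - y"] by (auto simp: dist_norm)
        have y: "y \<in> pdisc c" using n zw \<epsilon> norm_triangle_ineq2[of "fst y" z] norm_triangle_ineq2[of "snd y" w]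
          by (auto simp: pdisc_iff norm_minus_commute)
        have "y \<notin> K"
        proof
          assume "y \<in> K"
          then have "cmod (fst y) \<le> R0" "cmod (snd y) \<le> R0" using K by auto
          then show False using n zw \<epsilon> norm_triangle_ineq2[of z "fst y"] norm_triangle_ineq2[of w "snd y"] by linarith
        qed
        then have "\<bar>u y\<bar> \<le> ereal C" using elim pdisc_sub[OF y] by blast
        then have "ereal (- C) \<le> u y" by (cases "u y") auto
        then have "- C \<le> h j y" by (rule h_ge[OF y])
        then show "- (\<bar>C\<bar> + C0) \<le> g j y" using y by (simp add: g_def)
      qed
    qed
  qed
  show "- (\<bar>C\<bar> + C0) \<le> moll (g j) \<epsilon> (z, w)" if "a \<le> cmod z" "cmod z < b" "cmod w < b" for z w using low that by blast
  show "- (\<bar>C\<bar> + C0) \<le> moll (g j) \<epsilon> (z, w)" if "a \<le> cmod w" "cmod w < b" "cmod z < b" for z w using low that by blast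
  show "0 \<le> dr B (dr B (moll (g j) \<epsilon>)) p + dr (cmul \<i> B) (dr (cmul \<i> B) (moll (g j) \<epsilon>)) p" if "cmod (fst p) < b" "cmod (snd p) < b" for p B
    using that \<epsilon> by (intro G.moll_psh) auto
qed (use ab C0 G.moll_smooth[OF \<epsilon>(1)] G.moll_rot G.moll_nonpos in auto)

lemma slice_meas: "(\<lambda>w. g j (z, w)) \<in> borel_measurable borel"
proof -
  have "(\<lambda>w::complex. (z, w)) \<in> borel_measurable borel" by (intro borel_measurable_continuous_onI continuous_intros)
  from measurable_compose[OF this g_meas] show ?thesis .
qed

lemma moll_slice_meas: assumes "\<epsilon> > 0" shows "(\<lambda>w. moll (g j) \<epsilon> (z, w)) \<in> borel_measurable borel"
proof -
  have "continuous_on UNIV (\<lambda>w. moll (g j) \<epsilon> (z, w))"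
    by (rule continuous_on_compose2[OF Ck_cont[OF G.moll_smooth[OF assms]]]) (auto intro!: continuous_intros)
  then show ?thesis by (rule borel_measurable_continuous_onI)
qed

lemma disc_integrable:
  fixes f :: "complex \<Rightarrow> real"
  assumes f: "f \<in> borel_measurable borel" "\<And>w. \<bar>f w\<bar> \<le> K"
  shows "integrable lborel (\<lambda>w. indicator (ball 0 q) w * f w)"
proof (rule bounded_integrable[where K=K and r=q])
  show "\<bar>indicator (ball 0 q) x * f x\<bar> \<le> K" for x using f(2)[of x] by (auto simp: indicator_def)
  show "(\<lambda>w. indicator (ball 0 q) w * f w) \<in> borel_measurable borel"
    using f(1) by (intro borel_measurable_times borel_measurable_indicator) auto
qed (auto simp: indicator_def)

lemma moll_abs: "\<bar>moll (g j) \<epsilon> p\<bar> \<le> real j + C0"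
  using G.moll_ge_M[of j \<epsilon> p] G.moll_nonpos[of j \<epsilon> p] by linarith

lemma moll_int_tendsto:
  assumes z: "cmod z < c" and q: "q < c"
  shows "((\<lambda>\<epsilon>. \<integral>w. indicator (ball 0 q) w * moll (g j) \<epsilon> (z, w) \<partial>lborel) \<longlongrightarrow> (\<integral>w. indicator (ball 0 q) w * g j (z, w) \<partial>lborel)) (at_right 0)"
  unfolding tendsto_at_iff_sequentially
proof (intro allI impI)
  fix S :: "nat \<Rightarrow> real" assume S0: "\<forall>i. S i \<in> {0<..} - {0}" and S: "S \<longlonglongrightarrow> 0"
  then have Sp: "S i > 0" for i by auto
  have Sat: "filterlim S (at_right 0) sequentially" using S Sp by (auto simp: filterlim_at less_imp_neq[symmetric])
  show "((\<lambda>\<epsilon>. \<integral>w. indicator (ball 0 q) w * moll (g j) \<epsilon> (z, w) \<partial>lborel) \<circ> S) \<longlonglongrightarrow> (\<integral>w. indicator (ball 0 q) w * g j (z, w) \<partial>lborel)"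
    unfolding o_def
  proof (rule integral_dominated_convergence[where w="\<lambda>w. indicator (ball 0 q) w * (real j + C0)"])
    show "(\<lambda>w. indicator (ball 0 q) w * g j (z, w)) \<in> borel_measurable lborel"
      using disc_integrable[OF slice_meas G.abs_g] by (rule borel_measurable_integrable)
    show "(\<lambda>w. indicator (ball 0 q) w * moll (g j) (S i) (z, w)) \<in> borel_measurable lborel" for i
      using disc_integrable[OF moll_slice_meas[OF Sp] moll_abs] by (rule borel_measurable_integrable)
    show "integrable lborel (\<lambda>w::complex. indicator (ball 0 q) w * (real j + C0))"
      by (rule disc_integrable[where K="real j + C0"]) (use C0 in auto)
    show "AE w in lborel. (\<lambda>i. indicator (ball 0 q) w * moll (g j) (S i) (z, w)) \<longlonglongrightarrow> indicator (ball 0 q) w * g j (z, w)"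
    proof (rule AE_I2)
      fix w
      show "(\<lambda>i. indicator (ball 0 q) w * moll (g j) (S i) (z, w)) \<longlonglongrightarrow> indicator (ball 0 q) w * g j (z, w)"
      proof (cases "cmod w < q")
        case True
        have "((\<lambda>\<epsilon>. moll (g j) \<epsilon> (z, w)) \<longlongrightarrow> g j (z, w)) (at_right 0)" using True z q by (intro G.moll_tendsto) auto
        from filterlim_compose[OF this Sat] show ?thesis by (intro tendsto_mult tendsto_const)
      qed simp
    qed
    show "AE w in lborel. norm (indicator (ball 0 q) w * moll (g j) (S i) (z, w)) \<le> indicator (ball 0 q) w * (real j + C0)" for i
      using moll_abs by (intro AE_I2) (auto simp: indicator_def)
  qed
qed

text \<open>The sub-mean inequality on the disc of radius \<open>x\<close> in the first variable,
  centred at \<open>(0, w)\<close>; on its boundary \<open>g\<close> is constant by rotation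
  invariance.\<close>

lemma g_radial_mono: assumes "0 \<le> x" "x < c" "cmod w < c" shows "g j (0, w) \<le> g j (complex_of_real x, w)"
proof -
  have "g j (0, w) \<le> (1 / (2 * pi)) * (\<integral>\<theta>. indicator {0..2*pi} \<theta> * g j ((0, w) + cmul (cis \<theta>) (complex_of_real x, 0)) \<partial>lborel)"
  proof (rule g_submean)
    fix \<zeta> assume \<zeta>: "cmod \<zeta> \<le> 1"
    have "cmod \<zeta> * x \<le> x" using \<zeta> assms by (simp add: mult_left_le_one_le)
    then show "(0, w) + cmul \<zeta> (complex_of_real x, 0) \<in> pdisc c" using assms by (simp add: pdisc_iff cmul_def norm_mult)
  qed
  also have "\<dots> = (1 / (2 * pi)) * (\<integral>\<theta>. indicator {0..2*pi} \<theta> * g j (complex_of_real x, w) \<partial>lborel)"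
    by (simp add: cmul_def G.rotg)
  also have "\<dots> = g j (complex_of_real x, w)" by simp
  finally show ?thesis .
qed

text \<open>Pointwise convergence on slices: \<open>g_radial_mono\<close> bounds the values from
  below and upper semicontinuity from above.\<close>

lemma g_int_tendsto:
  assumes q: "q < c"
  shows "((\<lambda>x. \<integral>w. indicator (ball 0 q) w * g j (complex_of_real x, w) \<partial>lborel) \<longlongrightarrow> (\<integral>w. indicator (ball 0 q) w * g j (0, w) \<partial>lborel)) (at_right 0)"
  unfolding tendsto_at_iff_sequentially
proof (intro allI impI)
  fix S :: "nat \<Rightarrow> real" assume S0: "\<forall>i. S i \<in> {0<..} - {0}" and S: "S \<longlonglongrightarrow> 0"
  then have Sp: "S i > 0" for i by auto
  show "((\<lambda>x. \<integral>w. indicator (ball 0 q) w * g j (complex_of_real x, w) \<partial>lborel) \<circ> S) \<longlonglongrightarrow> (\<integral>w. indicator (ball 0 q) w * g j (0, w) \<partial>lborel)"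
    unfolding o_def
  proof (rule integral_dominated_convergence[where w="\<lambda>w. indicator (ball 0 q) w * (real j + C0)"])
    show "(\<lambda>w. indicator (ball 0 q) w * g j (0, w)) \<in> borel_measurable lborel"
      "(\<lambda>w. indicator (ball 0 q) w * g j (complex_of_real (S i), w)) \<in> borel_measurable lborel" for i
      using disc_integrable[OF slice_meas G.abs_g] by (rule borel_measurable_integrable)+
    show "integrable lborel (\<lambda>w::complex. indicator (ball 0 q) w * (real j + C0))"
      by (rule disc_integrable[where K="real j + C0"]) (use C0 in auto)
    show "AE w in lborel. (\<lambda>i. indicator (ball 0 q) w * g j (complex_of_real (S i), w)) \<longlonglongrightarrow> indicator (ball 0 q) w * g j (0, w)"
    proof (rule AE_I2)
      fix w
      show "(\<lambda>i. indicator (ball 0 q) w * g j (complex_of_real (S i), w)) \<longlonglongrightarrow> indicator (ball 0 q) w * g j (0, w)"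
      proof (cases "cmod w < q")
        case True
        have "(\<lambda>i. g j (complex_of_real (S i), w)) \<longlonglongrightarrow> g j (0, w)"
        proof (rule order_tendstoI)
          fix t assume t: "t < g j (0, w)"
          have "\<forall>\<^sub>F i in sequentially. S i < c" using S c by (intro order_tendstoD) auto
          then show "\<forall>\<^sub>F i in sequentially. t < g j (complex_of_real (S i), w)"
          proof eventually_elim
            case (elim i)
            then show ?case using g_radial_mono[of "S i" w j] Sp[of i] True q t by simp
          qed
        next
          fix t assume t: "g j (0, w) < t"
          have "\<forall>\<^sub>F y in nhds (0, w). g j y < t" using True q c t by (intro G.usc) auto
          moreover have "(\<lambda>i. (complex_of_real (S i), w)) \<longlonglongrightarrow> (complex_of_real 0, w)" by (intro tendsto_intros S)
          ultimately show "\<forall>\<^sub>F i in sequentially. g j (complex_of_real (S i), w) < t"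
            unfolding of_real_0 by (rule eventually_compose_filterlim)
        qed
        then show ?thesis by (intro tendsto_mult tendsto_const)
      qed simp
    qed
    show "AE w in lborel. norm (indicator (ball 0 q) w * g j (complex_of_real (S i), w)) \<le> indicator (ball 0 q) w * (real j + C0)" for i
      using G.abs_g by (intro AE_I2) (auto simp: indicator_def)
  qed
qed

text \<open>The choice of \<open>x\<close> must not depend on \<open>j\<close>. The numbers
  \<open>- H j 0\<close> are bounded by \<open>C2\<close>, so some \<open>j1\<close> comes within
  \<open>\<delta> / 3\<close> of their supremum; \<open>x\<close> is then chosen for
  \<open>j1\<close> only. For \<open>j \<ge> j1\<close>, \<open>H j\<close> at \<open>x\<close> is
  at most \<open>H j1\<close> at \<open>x\<close>, while \<open>H j 0\<close> cannot fall below
  minus the supremum. Mollification costs the last third.\<close>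

lemma radial_increment_small:
  assumes q: "q < c" and C2: "\<And>j. - (\<integral>w. indicator (ball 0 q) w * g j (0, w) \<partial>lborel) \<le> C2"
    and \<delta>: "\<delta> > 0" and x1: "x1 > 0"
  obtains x j1 where "0 < x" "x < x1" "x < c"
    "\<And>j. j \<ge> j1 \<Longrightarrow> \<forall>\<^sub>F \<epsilon> in at_right 0. (\<integral>w. indicator (ball 0 q) w * (moll (g j) \<epsilon> (complex_of_real x, w) - moll (g j) \<epsilon> (0, w)) \<partial>lborel) \<le> \<delta>"
proof -
  define H where "H j z = (\<integral>w. indicator (ball 0 q) w * g j (z, w) \<partial>lborel)" for j z
  note ig = disc_integrable[OF slice_meas G.abs_g, of q]
  have mono: "H j z \<le> H i z" if "i \<le> j" "cmod z < c" for i j z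
    unfolding H_def
  proof (rule integral_mono[OF ig ig])
    show "indicator (ball 0 q) w * g j (z, w) \<le> indicator (ball 0 q) w * g i (z, w)" for w
    proof (cases "cmod w < q")
      case True
      then have "(z, w) \<in> pdisc c" using that q by (simp add: pdisc_iff)
      then show ?thesis using h_mono[of "(z, w)" i j] that True by (simp add: g_def)
    qed simp
  qed
  have bdd: "bdd_above (range (\<lambda>j. - H j 0))" using C2 unfolding H_def by (intro bdd_aboveI[where M=C2]) auto
  define S where "S = (SUP j. - H j 0)"
  have "S - \<delta> / 3 < S" using \<delta> by simp
  then obtain j1 where j1: "S - \<delta> / 3 < - H j1 0" unfolding S_def using less_cSUP_iff[OF _ bdd] by blast
  have Sj: "- H j 0 \<le> S" for j unfolding S_def by (rule cSUP_upper[OF _ bdd]) simp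
  have "((\<lambda>x. H j1 (complex_of_real x)) \<longlongrightarrow> H j1 0) (at_right 0)" unfolding H_def by (rule g_int_tendsto[OF q])
  then have "\<forall>\<^sub>F x in at_right 0. H j1 (complex_of_real x) < H j1 0 + \<delta> / 3" using \<delta> by (intro order_tendstoD) auto
  moreover have "\<forall>\<^sub>F x in at_right 0. x \<in> {0<..<min x1 c}" using x1 c by (intro eventually_at_right_real) auto
  ultimately have "\<forall>\<^sub>F x in at_right 0. H j1 (complex_of_real x) < H j1 0 + \<delta> / 3 \<and> x \<in> {0<..<min x1 c}" by (rule eventually_conj)
  then obtain x where x: "H j1 (complex_of_real x) < H j1 0 + \<delta> / 3" "x \<in> {0<..<min x1 c}"
    using eventually_happens[of _ "at_right (0::real)"] by auto
  have xc: "cmod (complex_of_real x) < c" using x by simp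
  show thesis
  proof (rule that[of x j1])
    fix j assume j: "j \<ge> j1"
    have "((\<lambda>\<epsilon>. \<integral>w. indicator (ball 0 q) w * moll (g j) \<epsilon> (complex_of_real x, w) \<partial>lborel) \<longlongrightarrow> H j (complex_of_real x)) (at_right 0)"
      unfolding H_def by (rule moll_int_tendsto[OF xc q])
    then have e1: "\<forall>\<^sub>F \<epsilon> in at_right 0. (\<integral>w. indicator (ball 0 q) w * moll (g j) \<epsilon> (complex_of_real x, w) \<partial>lborel) < H j (complex_of_real x) + \<delta> / 3"
      using \<delta> by (intro order_tendstoD) auto
    have e2: "\<forall>\<^sub>F \<epsilon> in at_right 0. \<epsilon> \<in> {0<..<c - max 0 q}" using q c by (intro eventually_at_right_real) auto
    show "\<forall>\<^sub>F \<epsilon> in at_right 0. (\<integral>w. indicator (ball 0 q) w * (moll (g j) \<epsilon> (complex_of_real x, w) - moll (g j) \<epsilon> (0, w)) \<partial>lborel) \<le> \<delta>"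
      using e1 e2
    proof eventually_elim
      case (elim \<epsilon>)
      then have \<epsilon>: "\<epsilon> > 0" by simp
      note im = disc_integrable[OF moll_slice_meas[OF \<epsilon>] moll_abs, of q]
      have "H j 0 \<le> (\<integral>w. indicator (ball 0 q) w * moll (g j) \<epsilon> (0, w) \<partial>lborel)"
        unfolding H_def
      proof (rule integral_mono[OF ig im])
        show "indicator (ball 0 q) w * g j (0, w) \<le> indicator (ball 0 q) w * moll (g j) \<epsilon> (0, w)" for w
        proof (cases "cmod w < q")
          case True
          then have "g j (0, w) \<le> moll (g j) \<epsilon> (0, w)" using elim \<epsilon> by (intro G.moll_ge) auto
          then show ?thesis using True by simp
        qed simp
      qed
      moreover have "(\<integral>w. indicator (ball 0 q) w * (moll (g j) \<epsilon> (complex_of_real x, w) - moll (g j) \<epsilon> (0, w)) \<partial>lborel)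
        = (\<integral>w. indicator (ball 0 q) w * moll (g j) \<epsilon> (complex_of_real x, w) \<partial>lborel) - (\<integral>w. indicator (ball 0 q) w * moll (g j) \<epsilon> (0, w) \<partial>lborel)"
        using im by (simp add: right_diff_distrib)
      moreover have "H j (complex_of_real x) \<le> H j1 (complex_of_real x)" by (rule mono[OF j xc])
      ultimately show ?case using elim(1) x(1) j1 Sj[of j] by linarith
    qed
  qed (use x in auto)
qed

text \<open>\<open>slice_L1\<close> at z = 0, after the mollification is removed; its constants
  depend on \<open>a\<close>, \<open>b\<close> and \<open>\<bar>C\<bar> + C0\<close> only, hence not
  on \<open>j\<close>.\<close>

lemma slice_L1_limit:
  assumes ab: "0 < a" "a < b" and R: "R0 < a" "b < c"
    and K: "\<And>p. p \<in> K \<Longrightarrow> cmod (fst p) \<le> R0 \<and> cmod (snd p) \<le> R0"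
    and ae: "AE p in lborel. p \<in> bidisc - K \<longrightarrow> \<bar>u p\<bar> \<le> ereal C"
    and q: "q \<le> smooth_inv.dl a b"
  shows "\<exists>C2. \<forall>j. - (\<integral>w. indicator (ball 0 q) w * g j (0, w) \<partial>lborel) \<le> C2"
proof -
  interpret Z: smooth_inv "\<lambda>_. 0" a b "\<bar>C\<bar> + C0" using ab C0 by (intro smooth_inv_zero) auto
  define C2 where "C2 = (\<bar>C\<bar> + C0) * measure lborel (ball (0::complex) Z.dl) + Z.m * (Z.s0\<^sup>2 * Z.PP)"
  have C20: "C2 \<ge> 0" unfolding C2_def using C0 Z.m_nonneg Z.PP_nonneg by simp
  have qc: "q < c" using q Z.bd Z.dl_pos ab R by linarith
  have "- (\<integral>w. indicator (ball 0 q) w * g j (0, w) \<partial>lborel) \<le> C2" for j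
  proof (rule tendsto_upperbound)
    show "((\<lambda>\<epsilon>. - (\<integral>w. indicator (ball 0 q) w * moll (g j) \<epsilon> (0, w) \<partial>lborel)) \<longlongrightarrow> - (\<integral>w. indicator (ball 0 q) w * g j (0, w) \<partial>lborel)) (at_right 0)"
      using c qc by (intro tendsto_minus moll_int_tendsto) auto
    have "\<forall>\<^sub>F \<epsilon> in at_right 0. \<epsilon> \<in> {0<..<min (a - R0) (c - b)}" using R by (intro eventually_at_right_real) auto
    then show "\<forall>\<^sub>F \<epsilon> in at_right 0. - (\<integral>w. indicator (ball 0 q) w * moll (g j) \<epsilon> (0, w) \<partial>lborel) \<le> C2"
    proof eventually_elim
      case (elim \<epsilon>)
      then have \<epsilon>: "0 < \<epsilon>" "R0 + \<epsilon> \<le> a" "b + \<epsilon> \<le> c" by auto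
      interpret W: smooth_inv "moll (g j) \<epsilon>" a b "\<bar>C\<bar> + C0" by (rule smooth_moll[OF ab \<epsilon> K ae])
      let ?f = "\<lambda>w. indicator (ball 0 q) w * - moll (g j) \<epsilon> (0, w)"
      have int: "integrable lborel ?f"
        by (rule disc_integrable[where K="real j + C0"]) (use moll_slice_meas[OF \<epsilon>(1)] moll_abs in auto)
      have "ennreal (\<integral>w. ?f w \<partial>lborel) = (\<integral>\<^sup>+w. ennreal (?f w) \<partial>lborel)"
        by (rule nn_integral_eq_integral[OF int, symmetric]) (use G.moll_nonpos in \<open>auto simp: indicator_def\<close>)
      also have "\<dots> \<le> (\<integral>\<^sup>+w. ennreal (- moll (g j) \<epsilon> (0, w)) * indicator (ball 0 Z.dl) w \<partial>lborel)"
        by (rule nn_integral_mono) (use q in \<open>auto simp: indicator_def\<close>)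
      also have "\<dots> \<le> ennreal C2" using W.slice_L1[of 0] ab by (simp add: C2_def)
      finally have "(\<integral>w. ?f w \<partial>lborel) \<le> C2" using C20 by (subst (asm) ennreal_le_iff) auto
      then show ?case by simp
    qed
  qed simp
  then show ?thesis by blast
qed

end

section \<open>Consequences of the Lelong number and of semicontinuity\<close>

text \<open>Otherwise u < \<epsilon> ln |p| + C on a punctured ball. For |p| below exp (- 2 C /
  \<epsilon>) half of the logarithm absorbs \<open>C\<close>, and division by the negative logarithm
  keeps the quotient at least \<open>\<epsilon> / 2\<close>, which contradicts the lower limit
  0.\<close>

lemma lelong_point:
  assumes "lelong u 0 = 0" and \<epsilon>: "\<epsilon> > 0" and t0: "t0 > 0" and C: "C \<ge> 0"
  shows "\<exists>p. p \<noteq> 0 \<and> norm p < t0 \<and> ereal (\<epsilon> * ln (norm p) + C) \<le> u p"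
proof (rule ccontr)
  assume neg: "\<not> ?thesis"
  define t1 where "t1 = min t0 (min 1 (exp (- 2 * C / \<epsilon>)))"
  have t1: "t1 > 0" "t1 \<le> 1" using t0 by (auto simp: t1_def)
  have "ereal (\<epsilon> / 2) \<le> u p / ereal (ln (norm (p - 0)))" if p: "p \<noteq> 0" "norm p < t1" for p
  proof -
    have np: "norm p > 0" using p by simp
    have l: "ln (norm p) < 0" using p np t1 by simp
    have "norm p < exp (- 2 * C / \<epsilon>)" using p by (simp add: t1_def)
    then have "ln (norm p) < ln (exp (- 2 * C / \<epsilon>))" using np by (subst ln_less_cancel_iff) auto
    then have "ln (norm p) * \<epsilon> \<le> - 2 * C" using \<epsilon> by (simp add: field_simps)
    then have le: "\<epsilon> * ln (norm p) + C \<le> (\<epsilon> / 2) * ln (norm p)" by (simp add: algebra_simps)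
    have "\<not> (p \<noteq> 0 \<and> norm p < t0 \<and> ereal (\<epsilon> * ln (norm p) + C) \<le> u p)" using neg by blast
    then have "u p < ereal (\<epsilon> * ln (norm p) + C)" using p by (simp add: t1_def not_le)
    then have "u p \<le> ereal ((\<epsilon> / 2) * ln (norm p))" using le by (meson ereal_less_eq(3) less_imp_le order_trans)
    then show ?thesis using l
    proof (cases "u p")
      case (real r)
      then have "r \<le> (\<epsilon> / 2) * ln (norm p)" using \<open>u p \<le> _\<close> by simp
      then have "\<epsilon> / 2 \<le> r / ln (norm p)" using l by (simp add: neg_le_divide_eq)
      then show ?thesis using real l by simp
    qed (use \<open>u p \<le> _\<close> in \<open>auto simp: divide_ereal_def\<close>)
  qed
  then have "\<forall>\<^sub>F p in at 0. ereal (\<epsilon> / 2) \<le> u p / ereal (ln (norm (p - 0)))"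
    unfolding eventually_at using t1(1) by (auto intro!: exI[of _ t1])
  then have "ereal (\<epsilon> / 2) \<le> lelong u 0" unfolding lelong_def by (rule Liminf_bounded)
  then show False using assms(1) \<epsilon> by simp
qed

lemma usc_bounded:
  assumes "psh bidisc u" and S: "compact S" "S \<subseteq> bidisc"
  obtains C where "C \<ge> 0" "\<And>p. p \<in> S \<Longrightarrow> u p \<le> ereal C"
proof -
  have op: "open bidisc" and us: "usc_on bidisc u" and fin: "\<And>p. p \<in> bidisc \<Longrightarrow> u p < \<infinity>"
    using assms(1) unfolding psh_def by blast+
  define W where "W n = {p \<in> bidisc. u p < ereal (real n)}" for n
  have opW: "open (W n)" for n
  proof (subst open_subopen, intro ballI)
    fix p assume p: "p \<in> W n"
    then have pb: "p \<in> bidisc" and up: "u p < ereal (real n)" by (auto simp: W_def)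
    have "\<forall>\<^sub>F y in at p within bidisc. u y < ereal (real n)" using us pb up unfolding usc_on_def by blast
    then have "\<forall>\<^sub>F y in at p. u y < ereal (real n)" by (simp only: at_within_open[OF pb op])
    then have "\<forall>\<^sub>F y in nhds p. u y < ereal (real n)" using up unfolding eventually_nhds_conv_at by blast
    moreover have "\<forall>\<^sub>F y in nhds p. y \<in> bidisc" by (rule eventually_nhds_in_open[OF op pb])
    ultimately have "\<forall>\<^sub>F y in nhds p. y \<in> W n" by eventually_elim (auto simp: W_def)
    then show "\<exists>T. open T \<and> p \<in> T \<and> T \<subseteq> W n" unfolding eventually_nhds by blast
  qed
  have "S \<subseteq> (\<Union>n\<in>UNIV. W n)"
  proof
    fix p assume "p \<in> S"
    then have "p \<in> bidisc" using S by auto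
    moreover obtain n where "u p < ereal (real n)" using fin[OF \<open>p \<in> bidisc\<close>] less_PInf_Ex_of_nat[of "u p"] by auto
    ultimately show "p \<in> (\<Union>n\<in>UNIV. W n)" by (auto simp: W_def)
  qed
  then obtain N where N: "finite N" "S \<subseteq> (\<Union>n\<in>N. W n)"
    by (rule compactE_image[OF S(1) opW])
  show thesis
  proof (rule that[of "real (Max (insert 0 N))"])
    fix p assume "p \<in> S"
    then obtain n where n: "n \<in> N" "p \<in> W n" using N by blast
    have "u p \<le> ereal (real n)" using n by (auto simp: W_def less_imp_le)
    also have "\<dots> \<le> ereal (real (Max (insert 0 N)))" using n N by (simp add: Max_ge_iff)
    finally show "u p \<le> ereal (real (Max (insert 0 N)))" .
  qed simp
qed

theorem mainTheorem19:
  fixes u :: "c2 \<Rightarrow> ereal" and K :: "c2 set" and \<mu> :: "c2 measure"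
  assumes "compact K" and "K \<subseteq> bidisc" and "0 \<in> K"
    and "psh bidisc u"
    and "\<exists>C::real. AE p in lborel. p \<in> bidisc - K \<longrightarrow> \<bar>u p\<bar> \<le> ereal C"
    and "\<forall>z w. (z, w) \<in> bidisc \<longrightarrow> u (complex_of_real (cmod z), w) = u (z, w)"
    and "lelong u 0 = 0"
    and "is_MA bidisc u \<mu>"
  shows "emeasure \<mu> {0} = 0"
proof -
  obtain C where ae: "AE p in lborel. p \<in> bidisc - K \<longrightarrow> \<bar>u p\<bar> \<le> ereal C" using assms(5) by blast
  have "continuous_on K (\<lambda>p. max (cmod (fst p)) (cmod (snd p)))" by (intro continuous_intros)
  then obtain p0 where p0: "p0 \<in> K" "\<And>p. p \<in> K \<Longrightarrow> max (cmod (fst p)) (cmod (snd p)) \<le> max (cmod (fst p0)) (cmod (snd p0))"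
    using continuous_attains_sup[OF assms(1)] assms(3) by blast
  define R0 where "R0 = max (cmod (fst p0)) (cmod (snd p0))"
  have R0: "0 \<le> R0" "R0 < 1" using p0(1) assms(2) by (auto simp: R0_def bidisc_pdisc pdisc_iff le_max_iff_disj)
  have KR: "\<And>p. p \<in> K \<Longrightarrow> cmod (fst p) \<le> R0 \<and> cmod (snd p) \<le> R0" using p0(2) unfolding R0_def by (meson max.bounded_iff)
  \<comment> \<open>Three radii between \<open>R0\<close> and 1: u is bounded almost everywhere in
    the shells from \<open>a\<close> to \<open>b\<close>, the gap from \<open>R0\<close> to
    \<open>a\<close> keeps mollifiers away from \<open>K\<close>, and the gap from \<open>b\<close>
    to \<open>c\<close> keeps them inside the polydisc where u <= \<open>C0\<close>.\<close>
  define a where "a = R0 + (1 - R0) / 4"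
  define b where "b = R0 + (1 - R0) / 2"
  define c where "c = R0 + 3 * (1 - R0) / 4"
  have abc: "0 < a" "a < b" "b < c" "c < 1" "R0 < a" "0 < c" using R0 unfolding a_def b_def c_def by (simp_all add: field_simps)
  have "compact (cball (0::complex) c \<times> cball (0::complex) c)" by (intro compact_Times compact_cball)
  moreover have "cball (0::complex) c \<times> cball (0::complex) c \<subseteq> bidisc" using abc by (auto simp: bidisc_def)
  ultimately obtain C0 where C0: "C0 \<ge> 0" "\<And>p. p \<in> cball (0::complex) c \<times> cball (0::complex) c \<Longrightarrow> u p \<le> ereal C0"
    using usc_bounded[OF assms(4)] by blast
  interpret psh_setup u C0 c
  proof
    show "u p \<le> ereal C0" if "p \<in> pdisc c" for p using that by (intro C0(2)) (auto simp: pdisc_iff mem_Times_iff)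
  qed (use assms abc C0 in auto)
  define C1 where "C1 = \<bar>C\<bar> + C0"
  have C1: "C1 \<ge> 0" using C0 by (simp add: C1_def)
  interpret Z: smooth_inv "\<lambda>_. 0" a b C1 using abc C1 by (intro smooth_inv_zero) auto
  obtain \<mu>s where \<mu>s: "\<And>j::nat. is_MA_bdd bidisc (h j) (\<mu>s j)"
    and lim: "\<And>\<phi>. test_fun bidisc \<phi> \<Longrightarrow> (\<lambda>j. \<integral>x. \<phi> x \<partial>(\<mu>s j)) \<longlonglongrightarrow> (\<integral>x. \<phi> x \<partial>\<mu>)"
    using assms(8) unfolding is_MA_def h_def[abs_def] by blast
  have \<mu>: "sets \<mu> = sets borel" "\<And>S. compact S \<Longrightarrow> S \<subseteq> bidisc \<Longrightarrow> emeasure \<mu> S < \<infinity>"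
    using assms(8) unfolding is_MA_def radon_on_def by blast+
  have bound: "emeasure \<mu> {0} \<le> ennreal tol" if tol: "tol > 0" for tol
  proof -
    \<comment> \<open>Half of the tolerance goes to the flux term; \<delta> below is chosen so that
      the gradient term, which carries a factor 1/2, takes the other half.\<close>
    define \<kappa> where "\<kappa> = tol / (2 * (K0 + 1))"
    have \<kappa>: "\<kappa> > 0" "K0 * \<kappa> \<le> tol / 2"
      using tol K0_nonneg by (auto simp: \<kappa>_def field_simps intro!: divide_pos_pos add_nonneg_pos)
    obtain \<epsilon>' t0 where e': "\<epsilon>' > 0" "t0 > 0" and fl: "\<And>p::c2. p \<noteq> 0 \<Longrightarrow> norm p < t0 \<Longrightarrow>
      \<exists>r>0. 2 * r \<le> Z.dl \<and> (\<exists>x0>0. x0 < a \<and>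
        (\<forall>V. smooth_inv V a b C1 \<longrightarrow> \<epsilon>' * ln (norm p) \<le> V p \<longrightarrow> (\<forall>x. 0 < x \<longrightarrow> x < x0 \<longrightarrow> smooth_inv.flux V x r \<le> ennreal \<kappa>)))"
      using flux_small[OF abc(1,2) C1 \<kappa>(1)] by metis
    \<comment> \<open>The extra \<open>C0\<close> compensates the shift in \<open>g\<close>, so that
      \<open>g j p\<close> is at least \<open>\<epsilon>' * ln (norm p)\<close> for every
      \<open>j\<close>; \<open>moll_ge\<close> passes this to the mollifications.\<close>
    obtain p where p: "p \<noteq> 0" "norm p < min t0 c" "ereal (\<epsilon>' * ln (norm p) + C0) \<le> u p"
      using lelong_point[OF assms(7) e'(1) _ C0(1), of "min t0 c"] e'(2) abc by auto
    obtain r x0 where r: "r > 0" "2 * r \<le> Z.dl" and x0: "x0 > 0" "x0 < a"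
      and J: "\<And>V x. smooth_inv V a b C1 \<Longrightarrow> \<epsilon>' * ln (norm p) \<le> V p \<Longrightarrow> 0 < x \<Longrightarrow> x < x0 \<Longrightarrow> smooth_inv.flux V x r \<le> ennreal \<kappa>"
      using fl[OF p(1)] p(2) by auto
    have pc: "cmod (fst p) < c" "cmod (snd p) < c" using p(2) G.fst_snd_le[of p] by auto
    have gp: "\<epsilon>' * ln (norm p) \<le> g j p" for j
    proof -
      have "p \<in> pdisc c" using pc by (simp add: pdisc_iff)
      then show ?thesis using h_ge[OF _ p(3), of j] by (simp add: g_def)
    qed
    have clap: "continuous_on UNIV (lap (chi r))" by (rule Ck_lap_cont[OF Ck_chi])
    have "csupp (lap (chi r))" unfolding lap_def[abs_def] by (intro csupp_add csupp_dr csupp_chi r)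
    from csupp_bounded[OF clap this] obtain M where M: "M \<ge> 0" "\<And>w. \<bar>lap (chi r) w\<bar> \<le> M" by blast
    define MA where "MA = M * (Z.A0 * K0)"
    have MA0: "MA \<ge> 0" unfolding MA_def using M Z.A0_nonneg K0_nonneg by simp
    define \<delta> where "\<delta> = tol / (MA + 1)"
    have \<delta>: "\<delta> > 0" "MA * \<delta> \<le> tol" using tol MA0 by (auto simp: \<delta>_def field_simps intro!: divide_pos_pos add_nonneg_pos)
    have qc: "2 * r < c" using r Z.bd Z.dl_pos abc by linarith
    obtain C2 where C2: "\<And>j. - (\<integral>w. indicator (ball 0 (2 * r)) w * g j (0, w) \<partial>lborel) \<le> C2"
      using slice_L1_limit[OF abc(1,2) abc(5,3) KR ae r(2)] by blast
    \<comment> \<open>\<open>x\<close> is the cutoff radius in the first variable. The flux must be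
      small for all radii below \<open>x\<close>, hence \<open>x < x0\<close>; the increment from 0
      to \<open>x\<close> controls the gradient term for all large \<open>j\<close>.\<close>
    obtain x j1 where x: "0 < x" "x < x0" "x < c"
      and lims: "\<And>j. j \<ge> j1 \<Longrightarrow> \<forall>\<^sub>F \<epsilon> in at_right 0. (\<integral>w. indicator (ball 0 (2 * r)) w * (moll (g j) \<epsilon> (complex_of_real x, w) - moll (g j) \<epsilon> (0, w)) \<partial>lborel) \<le> \<delta>"
      using radial_increment_small[OF qc C2 \<delta>(1) x0(1)] by blast
    let ?\<phi> = "test2 x r"
    have \<phi>0: "?\<phi> q \<ge> 0" for q by (simp add: test2_def chi_nonneg)
    have c\<phi>: "continuous_on UNIV ?\<phi>" by (rule Ck_cont[OF Ck_test2])
    have rb: "r < b" "x < b" using r(2) Z.dl_pos Z.bd abc x x0 r(1) by auto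
    let ?Q = "cball (0::complex) x \<times> cball (0::complex) r"
    have sup: "closure {q. ?\<phi> q \<noteq> 0} \<subseteq> ?Q"
    proof (rule closure_minimal)
      show "{q. ?\<phi> q \<noteq> 0} \<subseteq> ?Q"
      proof
        fix q assume "q \<in> {q. ?\<phi> q \<noteq> 0}"
        then have "cmod (fst q) < x \<and> cmod (snd q) < r" using test2_zero[OF x(1) r(1)] by blast
        then show "q \<in> ?Q" by (simp add: mem_Times_iff)
      qed
    qed (intro closed_Times closed_cball)
    have Qb: "?Q \<subseteq> bidisc" using rb abc by (auto simp: bidisc_def)
    have test: "test_fun bidisc ?\<phi>"
      unfolding test_fun_def
    proof (intro conjI c\<phi>)
      show "compact (closure {q. ?\<phi> q \<noteq> 0})"
        by (rule compact_Int_closed[OF compact_Times[OF compact_cball compact_cball], of "closure {q. ?\<phi> q \<noteq> 0}" 0 x 0 r, unfolded inf_absorb2[OF sup]]) simp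
      show "closure {q. ?\<phi> q \<noteq> 0} \<subseteq> bidisc" using sup Qb by blast
    qed
    have small: "(\<integral>q. ?\<phi> q \<partial>\<mu>s j) \<le> tol" if j: "j \<ge> j1" for j
    proof (rule tendsto_upperbound)
      show "((\<lambda>\<epsilon>. \<integral>q. ?\<phi> q * MA_density (moll (h j) \<epsilon>) q \<partial>lborel) \<longlongrightarrow> (\<integral>q. ?\<phi> q \<partial>\<mu>s j)) (at_right 0)"
        using \<mu>s[of j] test unfolding is_MA_bdd_def by blast
      have "\<forall>\<^sub>F \<epsilon> in at_right 0. \<epsilon> \<in> {0<..<min (min (a - R0) (c - b)) (min (c - cmod (fst p)) (c - cmod (snd p)))}"
        using abc pc by (intro eventually_at_right_real) auto
      then show "\<forall>\<^sub>F \<epsilon> in at_right 0. (\<integral>q. ?\<phi> q * MA_density (moll (h j) \<epsilon>) q \<partial>lborel) \<le> tol"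
        using lims[OF j]
      proof eventually_elim
        case (elim \<epsilon>)
        then have \<epsilon>: "0 < \<epsilon>" "R0 + \<epsilon> \<le> a" "b + \<epsilon> \<le> c" and \<epsilon>p: "cmod (fst p) + \<epsilon> < c" "cmod (snd p) + \<epsilon> < c" by auto
        define V where "V = moll (g j) \<epsilon>"
        interpret W: smooth_inv V a b C1 unfolding V_def C1_def by (rule smooth_moll[OF abc(1,2) \<epsilon> KR ae])
        have "\<epsilon>' * ln (norm p) \<le> V p" using gp[of j] G.moll_ge[OF \<epsilon>(1) \<epsilon>p, of j] unfolding V_def by linarith
        then have flux: "W.flux y r \<le> ennreal \<kappa>" if "0 < y" "y < x" for y
          using that x by (intro J[OF W.smooth_inv_axioms]) auto
        \<comment> \<open>The support of the test function lies where mollifying \<open>h j\<close>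
          or \<open>g j\<close> differs by a constant, so the densities agree there and elsewhere
          the factor is 0.\<close>
        have eq: "?\<phi> q * MA_density (moll (h j) \<epsilon>) q = ?\<phi> q * MA_density V q" for q
        proof (cases "?\<phi> q = 0")
          case False
          then have "cmod (fst q) < x \<and> cmod (snd q) < r" by (rule test2_zero[OF x(1) r(1)])
          then have q: "q \<in> pdisc (c - \<epsilon>)" using rb \<epsilon> by (auto simp: pdisc_iff)
          have "MA_density (moll (h j) \<epsilon>) q = MA_density V q" unfolding V_def
            by (rule MA_cong[OF open_pdisc q]) (rule moll_h[OF \<epsilon>(1)])
          then show ?thesis by simp
        qed simp
        have "(\<integral>q. ?\<phi> q * MA_density (moll (h j) \<epsilon>) q \<partial>lborel) = (\<integral>q. ?\<phi> q * MA_density V q \<partial>lborel)" by (simp only: eq)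
        also have "\<dots> = (1 / (2 * pi\<^sup>2)) *
          ((\<integral>p. chi' x (fst p) * chi r (snd p) * W.E p * W.lapw p \<partial>lborel)
          + (\<integral>p. chi x (fst p) * (- lap (chi r) (snd p)) * ((W.X p)\<^sup>2 + (W.Y p)\<^sup>2) \<partial>lborel) / 2)"
          by (rule W.MA_integral[OF x(1) r(1)])
        also have "\<dots> \<le> (1 / (2 * pi\<^sup>2)) * tol"
        proof (rule mult_left_mono)
          have xa: "x < a" using x x0 by simp
          have r2: "r \<le> Z.dl" using r by simp
          have t1: "(\<integral>p. chi' x (fst p) * chi r (snd p) * W.E p * W.lapw p \<partial>lborel) \<le> K0 * \<kappa>"
            by (rule W.flux_term[OF x(1) xa r(1) r2 less_imp_le[OF \<kappa>(1)] flux])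
          have "(\<integral>p. chi x (fst p) * (- lap (chi r) (snd p)) * ((W.X p)\<^sup>2 + (W.Y p)\<^sup>2) \<partial>lborel)
             \<le> MA * (\<integral>w. indicator (ball 0 (2 * r)) w * (V (complex_of_real x, w) - V (0, w)) \<partial>lborel)"
            unfolding MA_def by (rule W.gradient_term[OF x(1) xa r M])
          also have "\<dots> \<le> MA * \<delta>" using elim(2) unfolding V_def by (intro mult_left_mono MA0)
          finally show "(\<integral>p. chi' x (fst p) * chi r (snd p) * W.E p * W.lapw p \<partial>lborel)
            + (\<integral>p. chi x (fst p) * (- lap (chi r) (snd p)) * ((W.X p)\<^sup>2 + (W.Y p)\<^sup>2) \<partial>lborel) / 2 \<le> tol"
            using t1 \<kappa>(2) \<delta>(2) by linarith
        qed simp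
        also have "\<dots> \<le> 1 * tol"
        proof (rule mult_right_mono)
          have "1 \<le> pi\<^sup>2" using pi_gt3 by (intro one_le_power) auto
          then show "1 / (2 * pi\<^sup>2) \<le> 1" by simp
        qed (use tol in simp)
        finally show ?case by simp
      qed
    qed simp
    have "(\<integral>q. ?\<phi> q \<partial>\<mu>) \<le> tol"
      by (rule tendsto_upperbound[OF lim[OF test]]) (use small in \<open>auto simp: eventually_sequentially\<close>)
    have m\<phi>: "?\<phi> \<in> borel_measurable \<mu>" using \<mu>(1) borel_measurable_continuous_onI[OF c\<phi>] by (simp cong: measurable_cong_sets)
    have fQ: "emeasure \<mu> ?Q < \<infinity>" by (rule \<mu>(2)) (auto intro!: compact_Times Qb)
    have sQ: "?Q \<in> sets \<mu>" unfolding \<mu>(1) by (intro borel_closed closed_Times closed_cball)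
    have int: "integrable \<mu> ?\<phi>"
    proof (rule Bochner_Integration.integrable_bound)
      show "integrable \<mu> (indicator ?Q :: c2 \<Rightarrow> real)" using fQ sQ by (intro integrable_real_indicator)
      show "AE q in \<mu>. norm (?\<phi> q) \<le> norm (indicator ?Q q :: real)"
      proof (rule AE_I2)
        fix q
        have "chi x (fst q) * chi r (snd q) \<le> 1" by (intro mult_le_one chi_le chi_nonneg)
        moreover have "?\<phi> q = 0" if "q \<notin> ?Q" using test2_zero[OF x(1) r(1), of q] that by (force simp: mem_Times_iff)
        ultimately show "norm (?\<phi> q) \<le> norm (indicator ?Q q :: real)" using \<phi>0[of q] by (cases "q \<in> ?Q") (auto simp: test2_def)
      qed
    qed (rule m\<phi>)
    have s0: "{0} \<in> sets \<mu>" unfolding \<mu>(1) by simp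
    have "emeasure \<mu> {0} = (\<integral>\<^sup>+q. indicator {0} q \<partial>\<mu>)" using s0 by simp
    also have "\<dots> \<le> (\<integral>\<^sup>+q. ennreal (?\<phi> q) \<partial>\<mu>)"
      by (rule nn_integral_mono) (auto simp: indicator_def test2_def chi_0)
    also have "\<dots> = ennreal (\<integral>q. ?\<phi> q \<partial>\<mu>)" by (rule nn_integral_eq_integral[OF int]) (simp add: \<phi>0)
    also have "\<dots> \<le> ennreal tol" using \<open>(\<integral>q. ?\<phi> q \<partial>\<mu>) \<le> tol\<close> by (rule ennreal_leI)
    finally show ?thesis .
  qed
  have "emeasure \<mu> {0} \<le> 0"
  proof (rule ennreal_le_epsilon)
    show "emeasure \<mu> {0} \<le> 0 + ennreal e" if "0 < e" for e using bound[OF that] by simp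
  qed
  then show ?thesis by simp
qed

end
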